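(* Let $\Omega\subset\mathbb{R}^N$ ($N>1$) be a bounded domain with $C^2$ boundary. For $i=1,2$ let $p_i\in C^1(\overline{\Omega})$ with $1<p_i^-\le p_i^+<N$, let $r_i,q_i,s_i\in L^\infty(\Omega)$ with essential infimum $\ge1$, let $\alpha_i,\gamma_i,\eta_i\in L^\infty(\Omega)$ be nonnegative a.e., and let $\beta_i\in L^\infty(\Omega)$ be nonnegative with $0<\alpha_i^-+\beta_i^-\le\alpha_i^++\beta_i^+<p_i^--1$. Let $\mathcal{A}:\overline{\Omega}\times[0,\infty)\to\mathbb{R}$ be continuous and let $a_0,b_0>0$. For $\lambda,\theta>0$ consider $$-\mathcal{A}(x,|v|_{L^{r_1(x)}})\Delta_{p_1(x)}u=\lambda|u|^{\beta_1(x)-1}u|v|_{L^{q_1(x)}}^{\alpha_1(x)}+\theta|v|^{\eta_1(x)-1}v|v|_{L^{s_1(x)}}^{\gamma_1(x)}\ \text{in }\Omega,$$ $$-\mathcal{A}(x,|u|_{L^{r_2(x)}})\Delta_{p_2(x)}v=\lambda|v|^{\beta_2(x)-1}v|u|_{L^{q_2(x)}}^{\alpha_2(x)}+\theta|u|^{\eta_2(x)-1}u|u|_{L^{s_2(x)}}^{\gamma_2(x)}\ \text{in }\Omega,\qquad u=v=0\ \text{on }\partial\Omega. \quad (S)_{\lambda,\theta}$$ (A1) If $p_2^+-1<\eta_1^-+\gamma_1^-$, $p_1^+-1<\eta_2^-+\gamma_2^-$ and $\mathcal{A}(x,t)\ge a_0$ in $\overline{\Omega}\times[0,b_0]$, then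 for each $\theta>0$ there exists $\lambda_0>0$ such that for each $\lambda\in(0,\lambda_0)$ the problem $(S)_{\lambda,\theta}$ has a positive weak solution. (A2) If $p_2^+-1<\eta_1^-+\gamma_1^-$, $p_1^+-1<\eta_2^-+\gamma_2^-$, $\frac{\beta_1^+}{p_1^--1}+\frac{\alpha_1^+}{p_2^--1}<1$, $\frac{\beta_2^+}{p_2^--1}+\frac{\alpha_2^+}{p_1^--1}<1$, $0<\mathcal{A}(x,t)\le a_0$ in $\overline{\Omega}\times(0,\infty)$ and $\lim_{t\to\infty}\mathcal{A}(x,t)=b_0$ uniformly in $\overline{\Omega}$, then for each $\lambda>0$ there exists $\theta_0>0$ such that for each $\theta\in(0,\theta_0)$ the problem $(S)_{\lambda,\theta}$ has a positive weak solution.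
   Context: For $m\in L^\infty(\Omega)$, $m^+=\operatorname{ess\,sup}_\Omega m$, $m^-=\operatorname{ess\,inf}_\Omega m$. $|\cdot|_{L^{m(x)}}$ is the Luxemburg norm of the variable exponent Lebesgue space $L^{m(x)}(\Omega)$: $|u|_{L^{m(x)}}=\inf\{\lambda>0:\int_\Omega|u/\lambda|^{m(x)}\le1\}$. $W_0^{1,p(x)}(\Omega)$ is the closure of $C_0^\infty(\Omega)$ in the variable exponent Sobolev space $W^{1,p(x)}(\Omega)$, and $\Delta_{p(x)}u=\operatorname{div}(|\nabla u|^{p(x)-2}\nabla u)$. A positive weak solution is a pair $(u,v)$ with $u\in W_0^{1,p_1(x)}(\Omega)\cap L^\infty(\Omega)$, $v\in W_0^{1,p_2(x)}(\Omega)\cap L^\infty(\Omega)$, $u,v>0$ in $\Omega$, such that for all $\varphi$ in the respective spaces $\int_\Omega|\nabla u|^{p_1(x)-2}\nabla u\nabla\varphi=\int_\Omega\frac{R_1}{\mathcal{A}(x,|v|_{L^{r_1(x)}})}\varphi$ and $\int_\Omega|\nabla v|^{p_2(x)-2}\nabla v\nabla\varphi=\int_\Omega\frac{R_2}{\mathcal{A}(x,|u|_{L^{r_2(x)}})}\varphi$, where $R_1,R_2$ are the right-hand sides of the first and second equations of $(S)_{\lambda,\theta}$. *)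

theory Defs
  imports "HOL-Analysis.Analysis" "HOL-Probability.Essential_Supremum"
begin

definition partial_deriv :: "'n::finite \<Rightarrow> (real^'n \<Rightarrow> real) \<Rightarrow> real^'n \<Rightarrow> real" where
  "partial_deriv i g x = frechet_derivative g (at x) (axis i 1)"

text \<open>C^infinity on an open set U: all iterated partial derivatives exist (Frechet) and are
  continuous; equivalently f lies in a family of continuously differentiable functions on U
  closed under taking partial derivatives.\<close>
definition smooth_on :: "(real^'n::finite) set \<Rightarrow> (real^'n \<Rightarrow> real) \<Rightarrow> bool" where
  "smooth_on U f \<longleftrightarrow> (\<exists>F. f \<in> F \<and>
     (\<forall>g\<in>F. continuous_on U g \<and> (\<forall>x\<in>U. g differentiable (at x)) \<and>
             (\<forall>i. partial_deriv i g \<in> F)))"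

definition C1_on :: "'a::euclidean_space set \<Rightarrow> ('a \<Rightarrow> 'b::real_normed_vector) \<Rightarrow> bool" where
  "C1_on U f \<longleftrightarrow> (\<exists>Df. (\<forall>x\<in>U. (f has_derivative blinfun_apply (Df x)) (at x)) \<and> continuous_on U Df)"

definition C2_on :: "'a::euclidean_space set \<Rightarrow> ('a \<Rightarrow> real) \<Rightarrow> bool" where
  "C2_on U f \<longleftrightarrow> (\<exists>Df. (\<forall>x\<in>U. (f has_derivative blinfun_apply (Df x)) (at x)) \<and> C1_on U Df)"

definition C1_closure :: "'a::euclidean_space set \<Rightarrow> ('a \<Rightarrow> real) \<Rightarrow> bool" where
  "C1_closure \<Omega> p \<longleftrightarrow> continuous_on (closure \<Omega>) p \<and>
     (\<exists>Dp. (\<forall>x\<in>\<Omega>. (p has_derivative blinfun_apply (Dp x)) (at x)) \<and> continuous_on (closure \<Omega>) Dp)"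

definition C2_boundary :: "'a::euclidean_space set \<Rightarrow> bool" where
  "C2_boundary \<Omega> \<longleftrightarrow> (\<forall>x0\<in>frontier \<Omega>. \<exists>U \<phi>. open U \<and> x0 \<in> U \<and> C2_on U \<phi> \<and>
      (\<forall>x\<in>U. \<phi> x = 0 \<longrightarrow> frechet_derivative \<phi> (at x) \<noteq> (\<lambda>h. 0)) \<and>
      \<Omega> \<inter> U = {x\<in>U. \<phi> x < 0})"

definition bounded_domain :: "'a::euclidean_space set \<Rightarrow> bool" where
  "bounded_domain \<Omega> \<longleftrightarrow> open \<Omega> \<and> connected \<Omega> \<and> bounded \<Omega> \<and> \<Omega> \<noteq> {}"

definition Linfty :: "'a::euclidean_space set \<Rightarrow> ('a \<Rightarrow> real) \<Rightarrow> bool" where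
  "Linfty \<Omega> m \<longleftrightarrow> m \<in> borel_measurable (lebesgue_on \<Omega>) \<and>
     (\<exists>C. AE x in lebesgue_on \<Omega>. \<bar>m x\<bar> \<le> C)"

definition ess_sup :: "'a::euclidean_space set \<Rightarrow> ('a \<Rightarrow> real) \<Rightarrow> real" where
  "ess_sup \<Omega> m = real_of_ereal (esssup (lebesgue_on \<Omega>) (\<lambda>x. ereal (m x)))"

definition ess_inf :: "'a::euclidean_space set \<Rightarrow> ('a \<Rightarrow> real) \<Rightarrow> real" where
  "ess_inf \<Omega> m = - ess_sup \<Omega> (\<lambda>x. - m x)"

definition modular :: "'a::euclidean_space set \<Rightarrow> ('a \<Rightarrow> real) \<Rightarrow> ('a \<Rightarrow> real) \<Rightarrow> ennreal" where
  "modular \<Omega> m u = (\<integral>\<^sup>+ x. ennreal (\<bar>u x\<bar> powr m x) \<partial>lebesgue_on \<Omega>)"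

definition Lvar :: "'a::euclidean_space set \<Rightarrow> ('a \<Rightarrow> real) \<Rightarrow> ('a \<Rightarrow> real) \<Rightarrow> bool" where
  "Lvar \<Omega> m u \<longleftrightarrow> u \<in> borel_measurable (lebesgue_on \<Omega>) \<and>
     (\<exists>l>0. modular \<Omega> m (\<lambda>x. u x / l) < \<infinity>)"

definition lux_norm :: "'a::euclidean_space set \<Rightarrow> ('a \<Rightarrow> real) \<Rightarrow> ('a \<Rightarrow> real) \<Rightarrow> real" where
  "lux_norm \<Omega> m u = Inf {l. l > 0 \<and> modular \<Omega> m (\<lambda>x. u x / l) \<le> 1}"

definition test_fun :: "(real^'n::finite) set \<Rightarrow> (real^'n \<Rightarrow> real) \<Rightarrow> bool" where
  "test_fun \<Omega> \<phi> \<longleftrightarrow> smooth_on UNIV \<phi> \<and>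
     compact (closure {x. \<phi> x \<noteq> 0}) \<and> closure {x. \<phi> x \<noteq> 0} \<subseteq> \<Omega>"

definition weak_grad :: "(real^'n::finite) set \<Rightarrow> (real^'n \<Rightarrow> real) \<Rightarrow> (real^'n \<Rightarrow> real^'n) \<Rightarrow> bool" where
  "weak_grad \<Omega> u g \<longleftrightarrow>
     (\<forall>K. compact K \<and> K \<subseteq> \<Omega> \<longrightarrow> set_integrable lebesgue K u \<and> (\<forall>i. set_integrable lebesgue K (\<lambda>x. g x $ i))) \<and>
     (\<forall>\<phi>. test_fun \<Omega> \<phi> \<longrightarrow> (\<forall>i.
        (\<integral>x. u x * partial_deriv i \<phi> x \<partial>lebesgue_on \<Omega>) = - (\<integral>x. g x $ i * \<phi> x \<partial>lebesgue_on \<Omega>)))"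

definition grad :: "(real^'n::finite \<Rightarrow> real) \<Rightarrow> real^'n \<Rightarrow> real^'n" where
  "grad \<phi> x = (\<chi> i. partial_deriv i \<phi> x)"

definition W1p_grad :: "(real^'n::finite) set \<Rightarrow> (real^'n \<Rightarrow> real) \<Rightarrow> (real^'n \<Rightarrow> real) \<Rightarrow> (real^'n \<Rightarrow> real^'n) \<Rightarrow> bool" where
  "W1p_grad \<Omega> p u g \<longleftrightarrow> Lvar \<Omega> p u \<and> weak_grad \<Omega> u g \<and> Lvar \<Omega> p (\<lambda>x. norm (g x))"

definition W1p_norm :: "(real^'n::finite) set \<Rightarrow> (real^'n \<Rightarrow> real) \<Rightarrow> (real^'n \<Rightarrow> real) \<Rightarrow> (real^'n \<Rightarrow> real^'n) \<Rightarrow> real" where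
  "W1p_norm \<Omega> p u g = lux_norm \<Omega> p u + lux_norm \<Omega> p (\<lambda>x. norm (g x))"

definition W01p :: "(real^'n::finite) set \<Rightarrow> (real^'n \<Rightarrow> real) \<Rightarrow> (real^'n \<Rightarrow> real) \<Rightarrow> bool" where
  "W01p \<Omega> p u \<longleftrightarrow> (\<exists>g. W1p_grad \<Omega> p u g \<and>
     (\<exists>\<phi>::nat \<Rightarrow> real^'n \<Rightarrow> real. (\<forall>k. test_fun \<Omega> (\<phi> k)) \<and>
        (\<lambda>k. W1p_norm \<Omega> p (\<lambda>x. \<phi> k x - u x) (\<lambda>x. grad (\<phi> k) x - g x)) \<longlonglongrightarrow> 0))"

definition rhs :: "(real^'n::finite) set \<Rightarrow> real \<Rightarrow> real \<Rightarrow>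
    (real^'n \<Rightarrow> real) \<Rightarrow> (real^'n \<Rightarrow> real) \<Rightarrow> (real^'n \<Rightarrow> real) \<Rightarrow> (real^'n \<Rightarrow> real) \<Rightarrow>
    (real^'n \<Rightarrow> real) \<Rightarrow> (real^'n \<Rightarrow> real) \<Rightarrow> (real^'n \<Rightarrow> real) \<Rightarrow> (real^'n \<Rightarrow> real) \<Rightarrow> real^'n \<Rightarrow> real" where
  "rhs \<Omega> lam th \<alpha> \<beta> \<gamma> \<eta> q s u v x =
     lam * \<bar>u x\<bar> powr (\<beta> x - 1) * u x * lux_norm \<Omega> q v powr \<alpha> x
     + th * \<bar>v x\<bar> powr (\<eta> x - 1) * v x * lux_norm \<Omega> s v powr \<gamma> x"

definition weak_eq :: "(real^'n::finite) set \<Rightarrow> (real^'n \<Rightarrow> real) \<Rightarrow> (real^'n \<Rightarrow> real^'n) \<Rightarrow>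
    (real^'n \<Rightarrow> real) \<Rightarrow> bool" where
  "weak_eq \<Omega> p gu F \<longleftrightarrow> (\<forall>\<phi> g\<phi>. W01p \<Omega> p \<phi> \<and> weak_grad \<Omega> \<phi> g\<phi> \<longrightarrow>
      integrable (lebesgue_on \<Omega>) (\<lambda>x. norm (gu x) powr (p x - 2) * (gu x \<bullet> g\<phi> x)) \<and>
      integrable (lebesgue_on \<Omega>) (\<lambda>x. F x * \<phi> x) \<and>
      (\<integral>x. norm (gu x) powr (p x - 2) * (gu x \<bullet> g\<phi> x) \<partial>lebesgue_on \<Omega>) =
      (\<integral>x. F x * \<phi> x \<partial>lebesgue_on \<Omega>))"

definition pos_weak_solution :: "(real^'n::finite) set \<Rightarrow>
    (real^'n \<Rightarrow> real \<Rightarrow> real) \<Rightarrow> real \<Rightarrow> real \<Rightarrow>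
    (real^'n \<Rightarrow> real) \<Rightarrow> (real^'n \<Rightarrow> real) \<Rightarrow> (real^'n \<Rightarrow> real) \<Rightarrow> (real^'n \<Rightarrow> real) \<Rightarrow> (real^'n \<Rightarrow> real) \<Rightarrow> (real^'n \<Rightarrow> real) \<Rightarrow> (real^'n \<Rightarrow> real) \<Rightarrow> (real^'n \<Rightarrow> real) \<Rightarrow> (real^'n \<Rightarrow> real) \<Rightarrow> (real^'n \<Rightarrow> real) \<Rightarrow> (real^'n \<Rightarrow> real) \<Rightarrow> (real^'n \<Rightarrow> real) \<Rightarrow> (real^'n \<Rightarrow> real) \<Rightarrow> (real^'n \<Rightarrow> real) \<Rightarrow> (real^'n \<Rightarrow> real) \<Rightarrow> (real^'n \<Rightarrow> real) \<Rightarrow> (real^'n \<Rightarrow> real) \<Rightarrow> (real^'n \<Rightarrow> real) \<Rightarrow> bool" where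
  "pos_weak_solution \<Omega> A lam th p1 p2 r1 r2 q1 q2 s1 s2 \<alpha>1 \<alpha>2 \<beta>1 \<beta>2 \<gamma>1 \<gamma>2 \<eta>1 \<eta>2 u v \<longleftrightarrow>
     W01p \<Omega> p1 u \<and> Linfty \<Omega> u \<and> W01p \<Omega> p2 v \<and> Linfty \<Omega> v \<and>
     (AE x in lebesgue_on \<Omega>. u x > 0) \<and> (AE x in lebesgue_on \<Omega>. v x > 0) \<and>
     (\<exists>gu gv. weak_grad \<Omega> u gu \<and> weak_grad \<Omega> v gv \<and>
        weak_eq \<Omega> p1 gu (\<lambda>x. rhs \<Omega> lam th \<alpha>1 \<beta>1 \<gamma>1 \<eta>1 q1 s1 u v x / A x (lux_norm \<Omega> r1 v)) \<and>
        weak_eq \<Omega> p2 gv (\<lambda>x. rhs \<Omega> lam th \<alpha>2 \<beta>2 \<gamma>2 \<eta>2 q2 s2 v u x / A x (lux_norm \<Omega> r2 u)))"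

end

theory Submission
  imports Defs "HOL-Library.Diagonal_Subsequence"
begin

text \<open>For a bounded right-hand side $h \ge 0$ the equation $-\Delta_{p(x)} u = h$ is solved by minimising the
energy; uniform convexity of $\xi \mapsto |\xi|^{p(x)}$ makes minimising sequences converge strongly, and
Stampacchia truncation gives an explicit sup bound in terms of $h$. A suitable bump $f$ supported in a ball satisfies
$-\Delta_{p(x)}(\epsilon f) \le C (\epsilon f)^{\kappa}$ weakly for $0 < \epsilon \le 1$ and a given $\kappa < p^- - 1$,
by a computation with the radial field. The supremum of multiples $\epsilon_n f_n$ over countably many balls covering
the domain is a positive lower barrier $w_i$, so no regularity theory or maximum principle is needed. Replacing $u, v$ on
the right-hand sides by their truncations between $w_i$ and constants $M_i$ makes the solution map continuous and
compact in $L^1$; after averaging over small cells it has a fixed point by Brouwer's theorem, and a subsequence converges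
to a fixed point of the solution map itself. The truncation is inactive as soon as the right-hand sides for $u \le M_1$,
$v \le M_2$ are small enough for the sup bound to give back $M_1$ and $M_2$. In (A1) the $M_i$ are chosen small, so that the
superlinear $\theta$-terms are harmless, and then $\lambda$ small; in (A2) the $M_i$ are chosen large, so that the
sublinear $\lambda$-terms are harmless, and then $\theta$ small.\<close>

section \<open>Smooth functions and gradients\<close>

text \<open>What shapes the proof is a circular dependence of constants. A barrier scaled by
  \<epsilon> also lowers the guaranteed Luxemburg norms to c0, a multiple of \<epsilon>, so it has
  to satisfy C \<epsilon>^\<kappa> <= D c0^ap \<epsilon>^bp; this closes because some \<kappa> fits
  between ap + bp and pm - 1. The slack below pm - 1 also absorbs the logarithm that appears when
  the variable exponent is differentiated. In (A1) the upper constants are fixed first, since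
  \<open>A\<close> is controlled only for small norms, and the barrier is placed below them. In (A2)
  the order is reversed: \<open>A\<close> may degenerate as t tends to 0, so the barrier comes
  first, its c0 yields a positive lower bound for \<open>A\<close>, and only then are the upper
  constants enlarged. In both cases one parameter \<tau> measures the source, and powers of it give
  the scale of the sup bound, which is linear in that scale. A second obstacle is that the Luxemburg
  norm suits neither truncation nor compactness; the work is done with values in L1 and gradients in
  the modular, and the Sobolev space reappears only at the end.\<close>

inductive_set fun_alg :: "('a => real) set => ('a => real) set" for B where
 base: "f \<in> B ==> f \<in> fun_alg B"
| add: "f \<in> fun_alg B ==> g \<in> fun_alg B ==> (%x. f x + g x) \<in> fun_alg B"
| mult: "f \<in> fun_alg B ==> g \<in> fun_alg B ==> (%x. f x * g x) \<in> fun_alg B"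

lemma partial_deriv_eqI: "(f has_derivative D) (at x) ==> partial_deriv i f x = D (axis i 1)"
 unfolding partial_deriv_def by (metis frechet_derivative_at)

lemma partial_deriv_add:
 assumes "f differentiable at x" "g differentiable at x"
 shows "partial_deriv i (%x. f x + g x) x = partial_deriv i f x + partial_deriv i g x"
proof -
 have "((%x. f x + g x) has_derivative (%h. frechet_derivative f (at x) h + frechet_derivative g (at x) h)) (at x)"
  using assms by (intro has_derivative_add) (auto simp: frechet_derivative_works[symmetric])
 from partial_deriv_eqI[OF this] show ?thesis by (simp add: partial_deriv_def)
qed

lemma partial_deriv_mult:
 assumes "f differentiable at x" "g differentiable at x"
 shows "partial_deriv i (%x. f x * g x) x = f x * partial_deriv i g x + partial_deriv i f x * g x"
proof -
 have "((%x. f x * g x) has_derivative (%h. f x * frechet_derivative g (at x) h + frechet_derivative f (at x) h * g x)) (at x)"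
  using assms by (intro has_derivative_mult) (auto simp: frechet_derivative_works[symmetric])
 from partial_deriv_eqI[OF this] show ?thesis by (simp add: partial_deriv_def)
qed

lemma partial_deriv_compose:
 assumes "f differentiable at x" "(G has_real_derivative d) (at (f x))"
 shows "partial_deriv i (%x. G (f x)) x = d * partial_deriv i f x"
proof -
 have "((%x. G (f x)) has_derivative (%h. d * frechet_derivative f (at x) h)) (at x)"
  using has_derivative_compose[of f "frechet_derivative f (at x)" x UNIV G "(*) d"] assms
  by (auto simp: has_field_derivative_def frechet_derivative_works[symmetric])
 from partial_deriv_eqI[OF this] show ?thesis by (simp add: partial_deriv_def)
qed

text \<open>The sum and product rules carry closure under partial derivatives from \<open>B\<close>
  to the algebra it generates, so \<open>fun_alg B\<close> is itself the family that
  \<open>smooth_on\<close> asks for. Afterwards only generators have to be checked.\<close>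

lemma smooth_on_fun_alg:
 fixes B :: "(real^'n::finite => real) set"
 assumes B: "\<And>f x. f \<in> B ==> f differentiable at x"
  and D: "\<And>f i. f \<in> B ==> partial_deriv i f \<in> fun_alg B"
  and f: "f \<in> fun_alg B"
 shows "smooth_on UNIV f"
proof -
 have diff: "f differentiable at x" if "f \<in> fun_alg B" for f x
  using that by induction (auto simp: B)
 have pd: "partial_deriv i f \<in> fun_alg B" if "f \<in> fun_alg B" for f i
  using that
 proof induction
  case (base f)
  then show ?case by (rule D)
 next
  case (add f g)
  have "partial_deriv i (%x. f x + g x) = (%x. partial_deriv i f x + partial_deriv i g x)"
   using add diff by (auto simp: partial_deriv_add)
  then show ?case using add by (simp add: fun_alg.add)
 next
  case (mult f g)
  have "partial_deriv i (%x. f x * g x) = (%x. f x * partial_deriv i g x + partial_deriv i f x * g x)"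
   using mult diff by (auto simp: partial_deriv_mult)
  then show ?case using mult by (simp add: fun_alg.add fun_alg.mult)
 qed
 have "continuous_on UNIV g" if "g \<in> fun_alg B" for g
  using diff[OF that] by (auto intro!: differentiable_imp_continuous_on simp: differentiable_on_def)
 then show ?thesis unfolding smooth_on_def using f diff pd
  by (intro exI[of _ "fun_alg B"] conjI ballI allI) simp_all
qed

lemma smooth_on_diff:
 assumes "smooth_on UNIV f" shows "f differentiable at x"
proof -
 from assms obtain F where F: "f \<in> F" "ALL g:F. continuous_on UNIV g & (ALL x:UNIV. g differentiable (at x)) & (ALL i. partial_deriv i g \<in> F)"
  unfolding smooth_on_def by (elim exE conjE)
 from bspec[OF F(2,1)] show ?thesis by simp
qed

lemma smooth_on_cont:
 assumes "smooth_on UNIV f" shows "continuous_on UNIV f"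
 using smooth_on_diff[OF assms] by (auto intro!: differentiable_imp_continuous_on simp: differentiable_on_def)

lemma smooth_on_partial:
 assumes "smooth_on UNIV f" shows "smooth_on UNIV (partial_deriv i f)"
proof -
 from assms obtain F where F: "f \<in> F" "ALL g:F. continuous_on UNIV g & (ALL x:UNIV. g differentiable (at x)) & (ALL i. partial_deriv i g \<in> F)"
  unfolding smooth_on_def by (elim exE conjE)
 from bspec[OF F(2,1)] have "partial_deriv i f \<in> F" by simp
 with F(2) show ?thesis unfolding smooth_on_def by (intro exI[of _ F] conjI)
qed

lemma smooth_on_ops:
 assumes "smooth_on UNIV f" "smooth_on UNIV g"
 shows smooth_on_add: "smooth_on UNIV (%x. f x + g x)" and smooth_on_mult: "smooth_on UNIV (%x. f x * g x)"
proof -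
 from assms obtain F1 F2 where F: "f \<in> F1" "g \<in> F2"
   "\<And>g. g \<in> F1 \<union> F2 ==> continuous_on UNIV g & (ALL x:UNIV. g differentiable (at x)) &
       (ALL i. partial_deriv i g \<in> F1 \<union> F2)" unfolding smooth_on_def by (elim exE conjE) (simp add: Ball_def, metis)
 have "smooth_on UNIV h" if "h \<in> fun_alg (F1 \<union> F2)" for h
  by (rule smooth_on_fun_alg[OF _ _ that]) (use F in \<open>auto intro: fun_alg.base\<close>)
 moreover have "(%x. f x + g x) \<in> fun_alg (F1 \<union> F2)" "(%x. f x * g x) \<in> fun_alg (F1 \<union> F2)"
  using F by (auto intro: fun_alg.intros)
 ultimately show "smooth_on UNIV (%x. f x + g x)" "smooth_on UNIV (%x. f x * g x)" by auto
qed

lemma smooth_on_const: "smooth_on UNIV (%x::real^'n::finite. c)"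
proof (rule smooth_on_fun_alg)
 show "(%x::real^'n. c) \<in> fun_alg (range (%c x. c))" by (rule fun_alg.base) auto
next
 fix f :: "real^'n => real" and i
 assume "f \<in> range (%c x. c)"
 then have "partial_deriv i f = (%x. 0)" unfolding partial_deriv_def by auto
 then show "partial_deriv i f \<in> fun_alg (range (%c x. c))" by (auto intro!: fun_alg.base)
qed auto

lemma smooth_on_coord: "smooth_on UNIV (%x::real^'n::finite. x $ j)"
proof (rule smooth_on_fun_alg)
 let ?B = "insert (%x::real^'n. x $ j) (range (%c x. c))"
 show "(%x::real^'n. x $ j) \<in> fun_alg ?B" by (rule fun_alg.base) auto
 have cd: "((%x::real^'n. x $ j) has_derivative (%x. x $ j)) (at x)" for x
  by (rule bounded_linear_imp_has_derivative[OF bounded_linear_vec_nth])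
 fix f :: "real^'n => real" and i
 assume f: "f \<in> ?B"
 then show "f differentiable at x" for x using cd by (auto intro: differentiableI)
 have "partial_deriv i (%x::real^'n. x $ j) = (%x. axis i 1 $ j)"
  using partial_deriv_eqI[OF cd] by auto
 moreover have "partial_deriv i (%x::real^'n. c) = (%x. 0)" for c
  unfolding partial_deriv_def by auto
 ultimately show "partial_deriv i f \<in> fun_alg ?B" using f by (auto intro!: fun_alg.base)
qed

section \<open>Smooth functions of one variable and the flat function exp(-1/t)\<close>

definition smooth1 :: "(real => real) => bool" where
 "smooth1 G \<longleftrightarrow> (EX F. G \<in> F & (ALL f:F. EX f':F. ALL t. (f has_real_derivative f' t) (at t)))"

lemma smooth1_fun_alg:
 assumes D: "\<And>f. f \<in> B ==> EX f':fun_alg B. ALL t. (f has_real_derivative f' t) (at t)"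
  and G: "G \<in> fun_alg B"
 shows "smooth1 G"
 unfolding smooth1_def
proof (intro exI[of _ "fun_alg B"] conjI ballI G)
 fix f assume "f \<in> fun_alg B"
 then show "EX f':fun_alg B. ALL t. (f has_real_derivative f' t) (at t)"
 proof induction
  case (add f g)
  then obtain f' g' where "f' \<in> fun_alg B" "g' \<in> fun_alg B" "ALL t. (f has_real_derivative f' t) (at t)"
   "ALL t. (g has_real_derivative g' t) (at t)" by blast
  then show ?case by (intro bexI[of _ "%t. f' t + g' t"]) (auto intro!: derivative_eq_intros fun_alg.add)
 next
  case (mult f g)
  then obtain f' g' where fg: "f' \<in> fun_alg B" "g' \<in> fun_alg B" "\<And>t. (f has_real_derivative f' t) (at t)"
   "\<And>t. (g has_real_derivative g' t) (at t)" by blast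
  show ?case
  proof (intro bexI[of _ "%t. f' t * g t + g' t * f t"] allI)
   show "((%x. f x * g x) has_real_derivative f' t * g t + g' t * f t) (at t)" for t
    using DERIV_mult[OF fg(3,4)] by simp
  qed (use fg mult.hyps in \<open>intro fun_alg.intros(2,3)\<close>)
 qed (rule D)
qed

lemma smooth_on_compose:
 assumes "smooth_on UNIV f" "smooth1 G"
 shows "smooth_on UNIV (%x. G (f x))"
proof -
 from assms(1) obtain F1 where F: "f \<in> F1"
   "\<And>g. g \<in> F1 ==> continuous_on UNIV g & (ALL x:UNIV. g differentiable (at x)) &
       (ALL i. partial_deriv i g \<in> F1)" unfolding smooth_on_def by (elim exE conjE) simp
 from assms(2) obtain F2 where F2: "G \<in> F2" "\<And>f. f \<in> F2 ==> EX f':F2. ALL t. (f has_real_derivative f' t) (at t)"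
  unfolding smooth1_def by blast
 let ?B = "F1 \<union> (%g x. g (f x)) ` F2"
 show ?thesis
 proof (rule smooth_on_fun_alg)
  show "(%x. G (f x)) \<in> fun_alg ?B" using F2 by (auto intro: fun_alg.base)
  fix h i assume h: "h \<in> ?B"
  have f: "f differentiable at x" for x using F by auto
  show "h differentiable at x" for x
  proof (cases "h \<in> F1")
   case False
   with h obtain g where "g \<in> F2" "h = (%x. g (f x))" by auto
   moreover obtain g' where "ALL t. (g has_real_derivative g' t) (at t)" using F2 \<open>g \<in> F2\<close> by blast
   ultimately have "g differentiable at (f x)" using real_differentiable_def by blast
   then show ?thesis using f[of x] \<open>h = _\<close> by (auto intro!: differentiable_compose[of g f])
  qed (use F in auto)
  show "partial_deriv i h \<in> fun_alg ?B"
  proof (cases "h \<in> F1")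
   case False
   with h obtain g where g: "g \<in> F2" "h = (%x. g (f x))" by auto
   obtain g' where g': "g' \<in> F2" "\<And>t. (g has_real_derivative g' t) (at t)" using F2 \<open>g \<in> F2\<close> by blast
   have "partial_deriv i h = (%x. g' (f x) * partial_deriv i f x)"
    using f g' g by (auto simp: partial_deriv_compose)
   also have "... \<in> fun_alg ?B" using F g' by (intro fun_alg.mult fun_alg.base) auto
   finally show ?thesis .
  qed (use F in \<open>auto intro: fun_alg.base\<close>)
 qed
qed

text \<open>For large \<open>j\<close> this is a bounded, 1-Lipschitz substitute for the identity;
  it later cuts an unbounded approximating sequence down to a bounded one.\<close>

lemma smooth1_sin:
 assumes "j ~= 0"
 shows "smooth1 (%t. j * sin (t / j))"
proof (rule smooth1_fun_alg)
 let ?B = "{%t. sin (t / j), %t. cos (t / j)} \<union> range (%c t. c)"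
 have [simp]: "sin \<circ> g = (%t. sin (g t))" for g :: "real => real" by auto
 show "(%t. j * sin (t / j)) \<in> fun_alg ?B"
  by (intro fun_alg.mult fun_alg.base) auto
 have A: "(%t. 1 / j * cos (t / j)) \<in> fun_alg ?B" "(%t. - 1 / j * sin (t / j)) \<in> fun_alg ?B" "(%t. 0) \<in> fun_alg ?B"
  by (intro fun_alg.mult fun_alg.base; auto)+
 fix f assume "f \<in> ?B"
 then consider "f = (%t. sin (t / j))" | "f = (%t. cos (t / j))" | c where "f = (%t. c)" by auto
 then show "EX f':fun_alg ?B. ALL t. (f has_real_derivative f' t) (at t)"
 proof cases
  case 1
  show ?thesis by (rule bexI[OF _ A(1)]) (use assms in \<open>auto simp: 1 intro!: derivative_eq_intros\<close>)
 next
  case 2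
  show ?thesis by (rule bexI[OF _ A(2)]) (use assms in \<open>auto simp: 2 intro!: derivative_eq_intros\<close>)
 next
  case 3
  show ?thesis by (rule bexI[OF _ A(3)]) (auto simp: 3 intro!: derivative_eq_intros)
 qed
qed

text \<open>\<open>bmp 0\<close> is the classical flat function exp(-1/t); the powers of 1/t are
  included so that the family is closed under differentiation up to linear combinations. Throughout,
  \<open>bmp 0\<close> replaces the positive part, and \<open>bmp 2\<close> is its
  derivative.\<close>

definition bmp :: "nat => real => real" where
 "bmp n t = (if t > 0 then (1 / t) ^ n * exp (- (1 / t)) else 0)"

lemma bmp_lim: "((%t. (1 / t) ^ n * exp (- (1 / t))) \<longlongrightarrow> (0::real)) (at_right 0)"
proof -
 have "((%s::real. s ^ n / exp s) \<longlongrightarrow> 0) at_top" by (rule tendsto_power_div_exp_0)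
 then have "((%t. inverse t ^ n / exp (inverse t)) \<longlongrightarrow> (0::real)) (at_right 0)"
  by (rule filterlim_compose) (rule filterlim_inverse_at_top_right)
 then show ?thesis by (simp add: exp_minus divide_simps)
qed

lemma bmp_deriv: "(bmp n has_real_derivative bmp (n + 2) t - real n * bmp (n + 1) t) (at t)"
proof -
 consider "t > 0" | "t < 0" | "t = 0" by linarith
 then show ?thesis
 proof cases
  case 1
  have "((%t. (1 / t) ^ n * exp (- (1 / t))) has_real_derivative bmp (n + 2) t - real n * bmp (n + 1) t) (at t)"
  proof (cases n)
   case 0
   then show ?thesis using 1 by (auto intro!: derivative_eq_intros simp: bmp_def field_simps power2_eq_square)
  next
   case (Suc m)
   have "((%t. (1 / t) ^ n * exp (- (1 / t))) has_real_derivative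
     real n * (1 / t) ^ m * (- 1 / t^2) * exp (-(1/t)) + (1/t)^n * (exp (-(1/t)) * (1 / t^2))) (at t)"
   proof -
    have "((%t. 1 / t) has_real_derivative - 1 / t^2) (at t)"
     using 1 by (auto intro!: derivative_eq_intros simp: power2_eq_square)
    from DERIV_power[OF this, of n] have a: "((%t. (1 / t)^n) has_real_derivative real n * (1 / t) ^ m * (- 1 / t^2)) (at t)"
     using Suc by (simp add: mult_ac)
    have "((%t. exp (-(1/t))) has_real_derivative exp (-(1/t)) * (1 / t^2)) (at t)"
     using 1 by (auto intro!: derivative_eq_intros simp: power2_eq_square)
    from DERIV_mult[OF a this] show ?thesis by (simp add: algebra_simps)
   qed
   moreover have "real n * (1 / t) ^ m * (- 1 / t^2) * exp (-(1/t)) + (1/t)^n * (exp (-(1/t)) * (1 / t^2))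
     = bmp (n + 2) t - real n * bmp (n + 1) t"
    using 1 Suc by (simp add: bmp_def power_add power2_eq_square field_simps)
   ultimately show ?thesis by simp
  qed
  then show ?thesis
   by (rule DERIV_cong_ev[THEN iffD1, rotated -1, OF _ refl _ refl])
     (use 1 in \<open>auto simp: bmp_def eventually_nhds intro!: exI[of _ "{0<..}"]\<close>)
 next
  case 2
  have "((%t. 0) has_real_derivative 0) (at t)" by simp
  then have "(bmp n has_real_derivative 0) (at t)"
   by (rule DERIV_cong_ev[THEN iffD1, rotated -1, OF _ refl _ refl])
     (use 2 in \<open>auto simp: bmp_def eventually_nhds intro!: exI[of _ "{..<0}"]\<close>)
  then show ?thesis using 2 by (simp add: bmp_def)
 next
  case 3
  \<comment> \<open>The right difference quotient at 0 is the expression of \<open>bmp_lim\<close>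
    with exponent \<open>n + 1\<close>.\<close>
  have R: "((%h. bmp n h / h) \<longlongrightarrow> 0) (at_right 0)"
  proof (rule Lim_transform_eventually[OF bmp_lim[of "n+1"]])
   show "\<forall>\<^sub>F t in at_right 0. (1 / t) ^ (n + 1) * exp (- (1 / t)) = bmp n t / t"
    by (auto simp: eventually_at bmp_def intro!: exI[of _ 1])
  qed
  have L: "((%h. bmp n h / h) \<longlongrightarrow> 0) (at_left 0)"
   by (rule Lim_transform_eventually[OF tendsto_const]) (auto simp: eventually_at bmp_def intro!: exI[of _ 1])
  have "(bmp n has_real_derivative 0) (at 0)"
   unfolding has_field_derivative_iff using filterlim_split_at[OF L R] by (simp add: bmp_def)
  then show ?thesis using 3 by (simp add: bmp_def)
 qed
qed

lemma bmp0_deriv: "(bmp 0 has_real_derivative bmp 2 t) (at t)"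
 using bmp_deriv[of 0 t] by (simp add: numeral_2_eq_2)

lemma bmp_nonneg: "0 <= bmp n t" and bmp_le0: "t <= 0 ==> bmp n t = 0" and bmp_pos: "t > 0 ==> bmp n t > 0"
 by (auto simp: bmp_def)

lemma bmp0_le1: "bmp 0 t <= 1"
 by (auto simp: bmp_def)

text \<open>With s = 1/t the claim is s^2 <= exp s, which follows from s/2 <= exp(s/2 - 1) and
  exp(-1) <= 1/2. It makes \<open>bmp 0\<close> a 1-Lipschitz truncation, so that composing with it
  never increases a gradient.\<close>

lemma bmp2_le1: "bmp 2 t <= 1"
proof (cases "t > 0")
 case True
 define s where "s = 1 / t"
 have "s > 0" using True s_def by auto
 have "s / 2 <= exp (s / 2) * exp (-1)" using exp_ge_add_one_self[of "s/2 - 1"] by (simp add: mult_exp_exp)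
 moreover have "exp (-1::real) <= 1 / 2" using exp_ge_add_one_self[of 1] by (simp add: exp_minus field_simps)
 ultimately have "s / 2 <= exp (s/2) * (1 / 2)"
  by (smt (verit) exp_gt_zero mult_left_mono)
 then have "s <= exp (s/2)" by simp
 then have "s^2 <= exp (s/2)^2" using \<open>s > 0\<close> by (intro power_mono) auto
 also have "... = exp s" by (simp add: exp_double[symmetric])
 finally show ?thesis using True by (simp add: bmp_def s_def exp_minus field_simps)
qed (simp add: bmp_def)

lemma smooth1_bmp0: "smooth1 (%t. c * bmp 0 ((t - b) / c'))"
proof (rule smooth1_fun_alg)
 let ?B = "range (%n t. bmp n ((t - b) / c')) \<union> range (%c t. c)"
 show "(%t. c * bmp 0 ((t - b) / c')) \<in> fun_alg ?B"
  by (intro fun_alg.mult fun_alg.base) auto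
 fix f assume "f \<in> ?B"
 then consider n where "f = (%t. bmp n ((t - b) / c'))" | c where "f = (%t. c)" by auto
 then show "EX f':fun_alg ?B. ALL t. (f has_real_derivative f' t) (at t)"
 proof cases
  case 1
  show ?thesis
  proof (intro bexI allI)
   show "(%t. 1 / c' * (bmp (n+2) ((t - b)/c') + (- real n) * bmp (n+1) ((t - b) / c'))) \<in> fun_alg ?B"
    by (intro fun_alg.add fun_alg.mult fun_alg.base) auto
   have "((%t. (t - b) / c') has_real_derivative 1 / c') (at t)" for t
    by (auto intro!: derivative_eq_intros simp: divide_inverse)
   from DERIV_chain2[OF bmp_deriv this]
   show "(f has_real_derivative 1 / c' * (bmp (n+2) ((t - b)/c') + (- real n) * bmp (n+1) ((t - b) / c'))) (at t)" for t
    using 1 by (simp add: mult.commute)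
  qed
 next
  case 2
  then show ?thesis by (intro bexI[of _ "%t. 0"]) (auto intro!: fun_alg.base)
 qed
qed

section \<open>Gradients and test functions\<close>

lemma has_derivative_grad:
 assumes "f differentiable at x"
 shows "(f has_derivative (%h. grad f x \<bullet> h)) (at x)"
proof -
 define D where "D = frechet_derivative f (at x)"
 have D: "(f has_derivative D) (at x)" using assms unfolding D_def by (simp add: frechet_derivative_works)
 then have lin: "linear D" by (simp add: has_derivative_linear)
 have Dg: "D h = grad f x \<bullet> h" for h
 proof -
  have "D h = D (\<Sum>i\<in>UNIV. h $ i *\<^sub>R axis i 1)" by (subst basis_expansion[symmetric]) (simp add: scalar_mult_eq_scaleR)
  also have "... = (\<Sum>i\<in>UNIV. h $ i * D (axis i 1))" using lin by (simp add: linear_sum linear_cmul)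
  also have "... = grad f x \<bullet> h" by (simp add: grad_def partial_deriv_def D_def inner_vec_def mult.commute)
  finally show ?thesis .
 qed
 have "D = (%h. grad f x \<bullet> h)" by (rule ext) (rule Dg)
 then show ?thesis using D by simp
qed

lemma grad_eqI:
 assumes "(f has_derivative (%h. g \<bullet> h)) (at x)"
 shows "grad f x = g"
 using partial_deriv_eqI[OF assms] by (simp add: grad_def vec_eq_iff inner_axis)

lemma test_fun_smooth: "test_fun \<Omega> \<phi> ==> smooth_on UNIV \<phi>" by (simp add: test_fun_def)
lemma test_fun_diff: "test_fun \<Omega> \<phi> ==> \<phi> differentiable at x" by (simp add: test_fun_def smooth_on_diff)
lemma test_fun_cont: "test_fun \<Omega> \<phi> ==> continuous_on UNIV \<phi>" by (simp add: test_fun_def smooth_on_cont)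
lemma test_fun_grad_cont: "test_fun \<Omega> \<phi> ==> continuous_on UNIV (grad \<phi>)"
 unfolding grad_def by (intro continuous_intros continuous_on_vec_lambda smooth_on_cont smooth_on_partial test_fun_smooth)

lemma test_funI:
 assumes "smooth_on UNIV \<phi>" "compact K" "K \<subseteq> \<Omega>" "\<And>x. x \<notin> K ==> \<phi> x = 0"
 shows "test_fun \<Omega> \<phi>"
proof -
 have "closure {x. \<phi> x ~= 0} \<subseteq> K" using assms by (intro closure_minimal) (auto simp: compact_imp_closed)
 moreover have "compact (closure {x. \<phi> x ~= 0})"
  using calculation assms(2) by (metis bounded_subset closed_closure compact_eq_bounded_closed)
 ultimately show ?thesis using assms unfolding test_fun_def by auto
qed

lemma test_funE:
 assumes "test_fun \<Omega> \<phi>"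
 obtains K where "compact K" "K \<subseteq> \<Omega>" "\<And>x. x \<notin> K ==> \<phi> x = 0" "\<And>x. x \<notin> K ==> grad \<phi> x = 0"
proof
 let ?K = "closure {x. \<phi> x ~= 0}"
 show "compact ?K" "?K \<subseteq> \<Omega>" using assms by (auto simp: test_fun_def)
 show "\<phi> x = 0" if "x \<notin> ?K" for x using that closure_subset[of "{x. \<phi> x ~= 0}"] by auto
 show "grad \<phi> x = 0" if "x \<notin> ?K" for x
 proof (rule grad_eqI)
  have "((%x. 0::real) has_derivative (%h. 0 \<bullet> h)) (at x)" by auto
  then show "(\<phi> has_derivative (%h. 0 \<bullet> h)) (at x)"
   by (rule has_derivative_transform_within_open[of _ _ _ _ "- ?K"])
     (use that closure_subset[of "{x. \<phi> x ~= 0}"] in auto)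
 qed
qed

lemma test_fun_add:
 assumes "test_fun \<Omega> f" "test_fun \<Omega> g" shows "test_fun \<Omega> (%x. f x + g x)"
proof -
 obtain K where K: "compact K" "K \<subseteq> \<Omega>" "\<And>x. x \<notin> K ==> f x = 0" using test_funE[OF assms(1)] by metis
 obtain L where L: "compact L" "L \<subseteq> \<Omega>" "\<And>x. x \<notin> L ==> g x = 0" using test_funE[OF assms(2)] by metis
 show ?thesis by (rule test_funI[of _ "K \<union> L"]) (use K L assms in \<open>auto intro: smooth_on_add test_fun_smooth\<close>)
qed

lemma test_fun_mult_smooth:
 assumes "smooth_on UNIV f" "test_fun \<Omega> g" shows "test_fun \<Omega> (%x. f x * g x)"
proof -
 obtain L where L: "compact L" "L \<subseteq> \<Omega>" "\<And>x. x \<notin> L ==> g x = 0" using test_funE[OF assms(2)] by metis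
 show ?thesis by (rule test_funI[of _ "L"]) (use L assms in \<open>auto intro: smooth_on_mult test_fun_smooth\<close>)
qed

lemma test_fun_scale: "test_fun \<Omega> g ==> test_fun \<Omega> (%x. c * g x)"
 by (rule test_fun_mult_smooth[OF smooth_on_const])

lemma test_fun_compose:
 assumes "test_fun \<Omega> f" "smooth1 G" "G 0 = 0" shows "test_fun \<Omega> (%x. G (f x))"
proof -
 obtain K where K: "compact K" "K \<subseteq> \<Omega>" "\<And>x. x \<notin> K ==> f x = 0" using test_funE[OF assms(1)] by metis
 show ?thesis by (rule test_funI[of _ K]) (use K assms in \<open>auto intro: smooth_on_compose test_fun_smooth\<close>)
qed

lemma grad_add: "f differentiable at x ==> g differentiable at x ==> grad (%x. f x + g x) x = grad f x + grad g x"
 by (simp add: grad_def vec_eq_iff partial_deriv_add)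

lemma grad_scale:
 assumes "f differentiable at x" shows "grad (%x. c * f x) x = c *\<^sub>R grad f x"
proof -
 have "((%x. c * f x) has_derivative (%h. (c *\<^sub>R grad f x) \<bullet> h)) (at x)"
  using has_derivative_grad[OF assms] by (auto intro!: derivative_eq_intros)
 then show ?thesis by (rule grad_eqI)
qed

lemma grad_compose:
 "f differentiable at x ==> (G has_real_derivative d) (at (f x)) ==> grad (%x. G (f x)) x = d *\<^sub>R grad f x"
 by (simp add: grad_def vec_eq_iff partial_deriv_compose)

section \<open>Inequalities for the p-Laplacian flux\<close>

text \<open>With y = (t/s)^p the claim becomes the weighted arithmetic-geometric inequality y^(1/p)
  < 1 + (y - 1)/p, obtained from ln z <= z - 1 at y/c and at 1/c. Strictness comes from the second
  point, as c differs from 1 when t differs from s.\<close>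

lemma powr_tangent:
 assumes "1 < p" "0 < s" "0 <= (t::real)"
 shows "s powr p + p * s powr (p - 1) * (t - s) <= t powr p"
  and "t ~= s ==> s powr p + p * s powr (p - 1) * (t - s) < t powr p"
proof -
 have sp: "s powr p = s powr (p - 1) * s" using assms by (simp add: powr_mult_base mult.commute)
 have *: "s powr p + p * s powr (p - 1) * (t - s) < t powr p" if "t ~= s"
 proof (cases "t = 0")
  case True
  have "s powr p * (1 - p) < 0" using assms by (intro mult_pos_neg) auto
  then show ?thesis using True assms sp by (simp add: algebra_simps)
 next
  case False
  define y where "y = (t / s) powr p"
  define \<theta> where "\<theta> = 1 / p"
  define c where "c = 1 + (y - 1) * \<theta>"
  have t: "t > 0" "t / s > 0" using False assms by auto
  have y: "y > 0" using t assms by (auto simp: y_def)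
  have \<theta>: "0 < \<theta>" "\<theta> < 1" using assms by (auto simp: \<theta>_def)
  have c: "c = \<theta> * y + (1 - \<theta>)" by (simp add: c_def algebra_simps)
  then have c0: "c > 0" using \<theta> y by (simp add: add_pos_pos)
  have y1: "y ~= 1" using t that assms unfolding y_def
   by (metis divide_eq_1_iff less_irrefl powr_eq_one_iff_gen less_numeral_extra(1) not_one_less_zero order_less_trans)
  have c1: "c ~= 1" using y1 \<theta> by (simp add: c_def)
  have "ln (y / c) <= y / c - 1" using y c0 by (intro ln_le_minus_one) auto
  moreover have "ln (1 / c) < 1 / c - 1"
   using ln_le_minus_one[of "1/c"] ln_eq_minus_one[of "1/c"] c0 c1 by (auto simp: less_le)
  ultimately have "\<theta> * ln (y / c) + (1 - \<theta>) * ln (1 / c) < \<theta> * (y / c - 1) + (1 - \<theta>) * (1 / c - 1)"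
   using \<theta> by (intro add_le_less_mono mult_left_mono mult_strict_left_mono) auto
  also have "... = 0" using c0 c by (simp add: field_simps)
  finally have "\<theta> * ln y < ln c" using y c0 by (simp add: ln_div algebra_simps)
  moreover have "\<theta> * ln y = ln (t / s)" using t assms by (simp add: y_def ln_powr \<theta>_def)
  ultimately have "t / s < c" using t c0 by simp
  then have "p * (t / s) < p * c" using assms by (intro mult_strict_left_mono) auto
  also have "p * c = p + y - 1" using assms by (simp add: c_def \<theta>_def field_simps)
  finally have "1 + p * (t / s - 1) < y" by (simp add: algebra_simps)
  then have "s powr p * (1 + p * (t / s - 1)) < s powr p * y" using assms by simp
  also have "s powr p * y = t powr p" using assms t by (simp add: y_def powr_divide)
  also have "s powr p * (1 + p * (t / s - 1)) = s powr p + p * s powr (p - 1) * (t - s)"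
   using assms sp by (simp add: field_simps)
  finally show ?thesis .
 qed
 then show "t ~= s ==> s powr p + p * s powr (p - 1) * (t - s) < t powr p" .
 show "s powr p + p * s powr (p - 1) * (t - s) <= t powr p"
  using * by (cases "t = s") auto
qed

lemma norm_powr_tangent:
 fixes a b :: "'a::real_inner"
 assumes "1 < p"
 shows "norm a powr p + p * (norm a powr (p - 2) * (a \<bullet> (b - a))) <= norm b powr p"
proof (cases "a = 0")
 case False
 have "a \<bullet> (b - a) <= norm a * (norm b - norm a)"
  using norm_cauchy_schwarz[of a b] by (simp add: inner_diff_right dot_square_norm power2_eq_square algebra_simps)
 then have "p * (norm a powr (p - 2) * (a \<bullet> (b - a))) <= p * (norm a powr (p - 2) * (norm a * (norm b - norm a)))"
  using assms by (intro mult_left_mono) auto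
 also have "... = p * norm a powr (p - 1) * (norm b - norm a)"
  using False powr_mult_base[of "norm a" "p - 2"] by (simp add: algebra_simps)
 also have "... <= norm b powr p - norm a powr p" using powr_tangent(1)[of p "norm a" "norm b"] assms False by auto
 finally show ?thesis by simp
qed auto

lemma powr_midpoint:
 fixes s t p :: real
 assumes "1 < p" "0 <= s" "0 <= t"
 shows "((s + t) / 2) powr p <= (s powr p + t powr p) / 2"
  and "s ~= t ==> ((s + t) / 2) powr p < (s powr p + t powr p) / 2"
proof -
 let ?m = "(s + t) / 2"
 have *: "((s + t) / 2) powr p < (s powr p + t powr p) / 2" if "s ~= t"
 proof -
  have m: "?m > 0" using assms that by auto
  have "?m powr p + p * ?m powr (p - 1) * (s - ?m) < s powr p"
   using assms that m by (intro powr_tangent(2)) auto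
  moreover have "?m powr p + p * ?m powr (p - 1) * (t - ?m) < t powr p"
   using assms that m by (intro powr_tangent(2)) auto
  moreover have "t - ?m = - (s - ?m)" by (simp add: field_simps)
  ultimately have "2 * ?m powr p < s powr p + t powr p" by (simp only: mult_minus_right)
  then show ?thesis by (simp add: field_simps)
 qed
 then show "s ~= t ==> ((s + t) / 2) powr p < (s powr p + t powr p) / 2" .
 show "((s + t) / 2) powr p <= (s powr p + t powr p) / 2" using * by (cases "s = t") auto
qed

text \<open>The midpoint defect in the convexity of the p-th power of the norm. It is the common
  currency of the proof: the monotonicity of the flux and the energy excess of a minimising sequence
  both dominate it.\<close>

definition cvx_gap :: "real => 'a::real_inner => 'a => real" where
 "cvx_gap p a b = (norm a powr p + norm b powr p) / 2 - norm ((1/2) *\<^sub>R (a + b)) powr p"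

lemma cvx_gap_nonneg:
 assumes "1 < p" shows "0 <= cvx_gap p a b"
proof -
 have "norm ((1/2) *\<^sub>R (a + b)) <= (norm a + norm b) / 2" using norm_triangle_ineq[of a b] by simp
 then have "norm ((1/2) *\<^sub>R (a + b)) powr p <= ((norm a + norm b) / 2) powr p" using assms by (intro powr_mono2) auto
 then show ?thesis using powr_midpoint(1)[OF assms, of "norm a" "norm b"] by (auto simp: cvx_gap_def)
qed

text \<open>Norms that differ are handled by strict convexity of the scalar power; equal norms by
  the parallelogram identity, which makes the midpoint strictly shorter.\<close>

lemma cvx_gap_pos:
 fixes a b :: "'a::real_inner"
 assumes "1 < p" "a ~= b" shows "0 < cvx_gap p a b"
proof (cases "norm a = norm b")
 case False
 have "norm ((1/2) *\<^sub>R (a + b)) <= (norm a + norm b) / 2" using norm_triangle_ineq[of a b] by simp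
 then have "norm ((1/2) *\<^sub>R (a + b)) powr p <= ((norm a + norm b) / 2) powr p" using assms by (intro powr_mono2) auto
 then show ?thesis using powr_midpoint(2)[OF assms(1), of "norm a" "norm b"] False by (auto simp: cvx_gap_def)
next
 case True
 have "norm (a + b) ^ 2 + norm (a - b) ^ 2 = 2 * (norm a)^2 + 2 * (norm b)^2"
  by (simp add: power2_norm_eq_inner inner_simps inner_commute)
 moreover have "norm (a - b)^2 > 0" using assms by simp
 ultimately have "norm (a + b) ^ 2 < (2 * norm a)^2" using True by (simp add: power_mult_distrib) (smt (verit) zero_less_power2 right_minus_eq norm_eq_zero assms(2))
 then have "norm (a + b) < 2 * norm a" by (rule power_less_imp_less_base) simp
 then have "norm ((1/2) *\<^sub>R (a + b)) < norm a" by simp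
 then have "norm ((1/2) *\<^sub>R (a + b)) powr p < norm a powr p" using assms by (intro powr_less_mono2) auto
 then show ?thesis using True by (auto simp: cvx_gap_def)
qed

lemma cvx_gap_scale:
 assumes "s > 0" shows "cvx_gap p (s *\<^sub>R a) (s *\<^sub>R b) = s powr p * cvx_gap p a b"
proof -
 have "norm ((1/2) *\<^sub>R (s *\<^sub>R a + s *\<^sub>R b)) = s * norm ((1/2) *\<^sub>R (a + b))"
  using assms by (simp flip: scaleR_add_right)
 then show ?thesis using assms by (simp add: cvx_gap_def powr_mult algebra_simps add_divide_distrib)
qed

lemma powr_add_le:
 fixes s t p :: real
 assumes "0 <= s" "0 <= t" "0 <= p"
 shows "(s + t) powr p <= 2 powr p * (s powr p + t powr p)"
proof -
 have "(s + t) powr p <= (2 * max s t) powr p" using assms by (intro powr_mono2) auto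
 also have "... = 2 powr p * max s t powr p" using assms by (simp add: powr_mult)
 also have "... <= 2 powr p * (s powr p + t powr p)" by (intro mult_left_mono) (auto simp: max_def)
 finally show ?thesis .
qed

lemma norm_add_powr_le:
 fixes a b :: "'a::real_normed_vector"
 assumes "0 <= p" "p <= q"
 shows "norm (a + b) powr p <= 2 powr q * (norm a powr p + norm b powr p)"
proof -
 have "norm (a + b) powr p <= (norm a + norm b) powr p" using assms by (intro powr_mono2 norm_triangle_ineq) auto
 also have "... <= 2 powr p * (norm a powr p + norm b powr p)" using assms by (intro powr_add_le) auto
 also have "... <= 2 powr q * (norm a powr p + norm b powr p)" using assms by (intro mult_right_mono powr_mono) auto
 finally show ?thesis .
qed

text \<open>Homogeneity reduces the claim to vectors whose norms add up to 1. With the exponent in a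
  compact interval the remaining parameters form a compact set, on which the continuous positive gap
  has a positive minimum.\<close>

lemma uniform_convexity_powr:
 fixes dummy :: "'a::euclidean_space"
 assumes "1 < pm" "0 < \<epsilon>"
 shows "EX \<delta>>0. ALL p (a::'a) b. pm <= p --> p <= pp --> \<epsilon> * (norm a + norm b) <= norm (a - b)
   --> \<delta> * (norm a powr p + norm b powr p) <= cvx_gap p a b"
proof -
 define K where "K = {(p, a::'a, b). p \<in> {pm..pp} & norm a + norm b = 1 & \<epsilon> <= norm (a - b)}"
 have "K = ({pm..pp} \<times> cball 0 1 \<times> cball 0 1) \<inter> {z. norm (fst (snd z)) + norm (snd (snd z)) = 1}
   \<inter> {z. \<epsilon> <= norm (fst (snd z) - snd (snd z))}"
  by (auto simp: K_def) (smt (verit) norm_ge_zero)+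
 moreover have "closed {z::real\<times>'a\<times>'a. norm (fst (snd z)) + norm (snd (snd z)) = 1}"
  by (intro closed_Collect_eq continuous_intros)
 moreover have "closed {z::real\<times>'a\<times>'a. \<epsilon> <= norm (fst (snd z) - snd (snd z))}"
  by (intro closed_Collect_le continuous_intros)
 ultimately have "compact K" by (auto intro!: compact_Int_closed compact_Times)
 moreover have "continuous_on K (%z. cvx_gap (fst z) (fst (snd z)) (snd (snd z)))"
  unfolding cvx_gap_def
  by (intro continuous_intros continuous_on_powr') (use assms in \<open>auto simp: K_def\<close>)
 moreover have pos: "0 < cvx_gap (fst z) (fst (snd z)) (snd (snd z))" if "z \<in> K" for z
  using that assms by (intro cvx_gap_pos) (auto simp: K_def)
 ultimately obtain \<delta> where \<delta>: "\<delta> > 0" "\<And>z. z \<in> K ==> \<delta> <= cvx_gap (fst z) (fst (snd z)) (snd (snd z))"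
 proof (cases "K = {}")
  case True
  then show ?thesis using that[of 1] by auto
 next
  case False
  from continuous_attains_inf[OF \<open>compact K\<close> False \<open>continuous_on K _\<close>] pos that show ?thesis by metis
 qed
 show ?thesis
 proof (intro exI[of _ "\<delta> / 2"] conjI allI impI)
  fix p :: real and a b :: 'a
  assume p: "pm <= p" "p <= pp" and e: "\<epsilon> * (norm a + norm b) <= norm (a - b)"
  define s where "s = norm a + norm b"
  show "\<delta> / 2 * (norm a powr p + norm b powr p) <= cvx_gap p a b"
  proof (cases "s = 0")
   case True
   then have "a = 0" "b = 0" unfolding s_def by (auto simp: add_nonneg_eq_0_iff)
   then show ?thesis by (simp add: cvx_gap_def)
  next
   case False
   then have s: "s > 0" unfolding s_def by (simp add: order_less_le)
   define a' b' where "a' = (1/s) *\<^sub>R a" "b' = (1/s) *\<^sub>R b"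
   have ab: "a = s *\<^sub>R a'" "b = s *\<^sub>R b'" using s by (auto simp: a'_b'_def)
   have "norm a' + norm b' = 1" using s by (simp add: a'_b'_def s_def flip: add_divide_distrib)
   moreover have "\<epsilon> <= norm (a' - b')"
   proof -
    have "a' - b' = (1/s) *\<^sub>R (a - b)" by (simp add: a'_b'_def scaleR_diff_right)
    then have "norm (a' - b') = norm (a - b) / s" using s by simp
    moreover have "\<epsilon> * s <= norm (a - b)" using e by (simp add: s_def)
    ultimately show ?thesis using s by (simp add: pos_le_divide_eq)
   qed
   ultimately have "(p, a', b') \<in> K" using p by (auto simp: K_def)
   then have "\<delta> <= cvx_gap p a' b'" using \<delta>(2) by fastforce
   then have "s powr p * \<delta> <= cvx_gap p a b" using s unfolding ab by (simp add: cvx_gap_scale)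
   moreover have "norm a powr p <= s powr p" "norm b powr p <= s powr p"
    using p assms by (auto simp: s_def intro!: powr_mono2)
   then have "\<delta> / 2 * (norm a powr p + norm b powr p) <= \<delta> / 2 * (2 * s powr p)"
    using \<delta> by (intro mult_left_mono) auto
   ultimately show ?thesis by (simp add: mult.commute)
  qed
 qed (use \<delta> in auto)
qed

text \<open>Two cases. If a and b are far apart relative to their size, uniform convexity bounds
  everything by the gap. Otherwise the p-th power of the distance is at most (2e)^p times the two
  powers, and \<open>2 * e <= 1\<close> with p >= 1 turns this factor into \<epsilon>.\<close>

lemma powr_diff_le_gap:
 fixes dummy :: "'a::euclidean_space"
 assumes "1 < pm" "0 < \<epsilon>"
 shows "EX C>=0. ALL p (a::'a) b. pm <= p --> p <= pp
   --> norm (a - b) powr p <= \<epsilon> * (norm a powr p + norm b powr p) + C * cvx_gap p a b"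
proof -
 define e where "e = min (1/2) (\<epsilon> / 2)"
 have e: "e > 0" "2 * e <= 1" "2 * e <= \<epsilon>" using assms by (auto simp: e_def min_def)
 obtain \<delta> where \<delta>: "\<delta> > 0" "\<And>p (a::'a) b. pm <= p ==> p <= pp ==> e * (norm a + norm b) <= norm (a - b)
   ==> \<delta> * (norm a powr p + norm b powr p) <= cvx_gap p a b"
  using uniform_convexity_powr[OF assms(1) e(1), of pp] by blast
 show ?thesis
 proof (intro exI[of _ "2 powr pp / \<delta>"] conjI allI impI)
  fix p :: real and a b :: 'a
  assume p: "pm <= p" "p <= pp"
  have g0: "0 <= cvx_gap p a b" using p assms by (intro cvx_gap_nonneg) auto
  show "norm (a - b) powr p <= \<epsilon> * (norm a powr p + norm b powr p) + 2 powr pp / \<delta> * cvx_gap p a b"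
  proof (cases "e * (norm a + norm b) <= norm (a - b)")
   case True
   have "norm (a - b) powr p <= 2 powr pp * (norm a powr p + norm b powr p)"
    using norm_add_powr_le[of p pp a "-b"] p assms by auto
   also have "... = 2 powr pp / \<delta> * (\<delta> * (norm a powr p + norm b powr p))" using \<delta> by simp
   also have "... <= 2 powr pp / \<delta> * cvx_gap p a b" using \<delta> True p by (intro mult_left_mono) auto
   also have "... <= \<epsilon> * (norm a powr p + norm b powr p) + 2 powr pp / \<delta> * cvx_gap p a b"
    using assms by simp
   finally show ?thesis .
  next
   case False
   then have "norm (a - b) powr p <= (e * (norm a + norm b)) powr p" using p assms by (intro powr_mono2) auto
   also have "... = e powr p * (norm a + norm b) powr p" using e by (simp add: powr_mult)
   also have "... <= e powr p * (2 powr p * (norm a powr p + norm b powr p))"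
    using p assms by (intro mult_left_mono powr_add_le) auto
   also have "... = (2 * e) powr p * (norm a powr p + norm b powr p)" using e by (simp add: powr_mult mult_ac)
   also have "... <= \<epsilon> * (norm a powr p + norm b powr p)"
   proof (intro mult_right_mono)
    have "(2 * e) powr p <= (2 * e) powr 1" using e p assms by (intro powr_mono') auto
    then show "(2 * e) powr p <= \<epsilon>" using e by auto
   qed auto
   also have "... <= \<epsilon> * (norm a powr p + norm b powr p) + 2 powr pp / \<delta> * cvx_gap p a b" using \<delta> g0 by auto
   finally show ?thesis .
  qed
 qed (use \<delta> in auto)
qed

definition pflux :: "real => 'a::real_inner => 'a" where
 "pflux p a = norm a powr (p - 2) *\<^sub>R a"

lemma norm_pflux: "norm (pflux p a) = norm a powr (p - 1)"
proof (cases "a = 0")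
 case False
 then show ?thesis using powr_mult_base[of "norm a" "p - 2"] by (simp add: pflux_def mult.commute algebra_simps)
qed (simp add: pflux_def)

lemma pflux_inner_self: "1 < p ==> pflux p a \<bullet> a = norm a powr p"
proof (cases "a = 0")
 case False
 then show ?thesis using powr_mult_base[of "norm a" "p - 2"] powr_mult_base[of "norm a" "p - 1"]
  by (simp add: pflux_def dot_square_norm power2_eq_square algebra_simps)
qed (simp add: pflux_def)

lemma pflux_tangent:
 assumes "1 < p"
 shows "norm a powr p + p * (pflux p a \<bullet> (b - a)) <= norm b powr p"
 using norm_powr_tangent[OF assms, of a b] by (simp add: pflux_def)

text \<open>The tangent inequalities at \<open>a\<close> and at \<open>b\<close> are both evaluated
  at the midpoint and added; the linear terms combine to -p/2 times the monotonicity
  pairing.\<close>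

lemma pflux_mono_gap:
 assumes "1 < p"
 shows "4 / p * cvx_gap p a b <= (pflux p a - pflux p b) \<bullet> (a - b)"
proof -
 let ?m = "(1/2) *\<^sub>R (a + b)"
 have "norm a powr p + p * (pflux p a \<bullet> (?m - a)) <= norm ?m powr p"
    "norm b powr p + p * (pflux p b \<bullet> (?m - b)) <= norm ?m powr p"
  by (rule pflux_tangent[OF assms])+
 then have "norm a powr p + norm b powr p + p * (pflux p a \<bullet> (?m - a)) + p * (pflux p b \<bullet> (?m - b)) <= 2 * norm ?m powr p"
  by linarith
 moreover have "p * (pflux p a \<bullet> (?m - a)) + p * (pflux p b \<bullet> (?m - b)) = - p / 2 * ((pflux p a - pflux p b) \<bullet> (a - b))"
  by (simp add: inner_simps field_simps)
 ultimately have "4 * cvx_gap p a b <= p * ((pflux p a - pflux p b) \<bullet> (a - b))"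
  unfolding cvx_gap_def by argo
 then show ?thesis using assms by (simp add: field_simps)
qed

lemma pflux_mono:
 assumes "1 < p" shows "0 <= (pflux p a - pflux p b) \<bullet> (a - b)"
 using pflux_mono_gap[OF assms, of a b] cvx_gap_nonneg[OF assms, of a b] assms
 by (smt (verit) divide_nonneg_nonneg mult_nonneg_nonneg)

lemma pflux_strict_mono:
 assumes "1 < p" "(pflux p a - pflux p b) \<bullet> (a - b) <= 0" shows "a = b"
proof (rule ccontr)
 assume "a ~= b"
 then have "0 < 4 / p * cvx_gap p a b" using cvx_gap_pos[OF assms(1), of a b] assms(1) by (intro mult_pos_pos) auto
 then show False using pflux_mono_gap[OF assms(1), of a b] assms(2) by linarith
qed

text \<open>A cut at \<open>t <= \<epsilon> * s\<close> replaces conjugate exponents, so that one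
  constant serves all p in the range; the two summands of the constant cover \<epsilon> > 1 and
  \<epsilon> <= 1.\<close>

lemma powr_young:
 fixes pm pp \<epsilon> :: real
 assumes "1 < pm" "0 < \<epsilon>"
 shows "EX C>=0. ALL p s t. pm <= p --> p <= pp --> 0 <= s --> 0 <= t -->
   s powr (p - 1) * t <= \<epsilon> * s powr p + C * t powr p"
proof (intro exI[of _ "\<epsilon> powr (1 - pm) + \<epsilon> powr (1 - pp)"] conjI allI impI)
 fix p s t :: real
 assume p: "pm <= p" "p <= pp" and st: "0 <= s" "0 <= t"
 let ?C = "\<epsilon> powr (1 - pm) + \<epsilon> powr (1 - pp)"
 show "s powr (p - 1) * t <= \<epsilon> * s powr p + ?C * t powr p"
 proof (cases "t <= \<epsilon> * s")
  case True
  then have "s powr (p - 1) * t <= s powr (p - 1) * (\<epsilon> * s)" by (intro mult_left_mono) auto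
  also have "... = \<epsilon> * s powr p" using st powr_mult_base[of s "p - 1"] by (cases "s = 0") (auto simp: mult_ac)
  also have "... <= \<epsilon> * s powr p + ?C * t powr p" by simp
  finally show ?thesis .
 next
  case False
  then have t: "t > 0" using st assms by (smt (verit) mult_nonneg_nonneg)
  have "s <= t / \<epsilon>" using False assms by (simp add: field_simps)
  then have "s powr (p - 1) * t <= (t / \<epsilon>) powr (p - 1) * t" using st p assms by (intro mult_right_mono powr_mono2) auto
  also have "... = \<epsilon> powr (1 - p) * t powr p"
   using t assms powr_mult_base[of t "p - 1"] by (simp add: powr_divide powr_diff field_simps)
  also have "... <= ?C * t powr p"
  proof (intro mult_right_mono)
   show "\<epsilon> powr (1 - p) <= ?C"
   proof (cases "\<epsilon> <= 1")
    case True
    then have "\<epsilon> powr (1 - p) <= \<epsilon> powr (1 - pp)" using p assms by (intro powr_mono') auto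
    then show ?thesis by (smt (verit) powr_ge_zero)
   next
    case False
    then have "\<epsilon> powr (1 - p) <= \<epsilon> powr (1 - pm)" using p assms by (intro powr_mono) auto
    then show ?thesis by (smt (verit) powr_ge_zero)
   qed
  qed auto
  also have "... <= \<epsilon> * s powr p + ?C * t powr p" using assms by simp
  finally show ?thesis .
 qed
qed auto

text \<open>The scale \<open>s\<close> stays explicit because both the sup bound and the coercivity
  of the energy are tuned through it.\<close>

lemma le_add_powr:
 assumes "1 < p" "0 < s" "0 <= (t::real)"
 shows "t <= s + s powr (1 - p) * t powr p"
proof (cases "t <= s")
 case True
 then show ?thesis by (smt (verit) mult_nonneg_nonneg powr_ge_zero)
next
 case False
 then have t: "t > 0" using assms by auto
 have "t = t powr (1 - p) * t powr p" using t by (simp add: powr_add[symmetric])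
 also have "... <= s powr (1 - p) * t powr p" using False assms by (intro mult_right_mono powr_mono2') auto
 finally show ?thesis using assms by simp
qed

lemma le_add_powr_uniform:
 fixes pm pp \<epsilon> :: real
 assumes "1 < pm" "0 < \<epsilon>"
 shows "EX C>=0. ALL p t. pm <= p --> p <= pp --> 0 <= t --> t <= \<epsilon> + C * t powr p"
proof -
 obtain C where C: "C >= 0" "\<And>p s t. pm <= p ==> p <= pp ==> 0 <= s ==> 0 <= t ==>
   s powr (p - 1) * t <= \<epsilon> * s powr p + C * t powr p" using powr_young[OF assms, of pp] by blast
 show ?thesis
 proof (intro exI[of _ C] conjI allI impI C(1))
  fix p t :: real assume "pm <= p" "p <= pp" "0 <= t"
  then show "t <= \<epsilon> + C * t powr p" using C(2)[of p 1 t] by simp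
 qed
qed

section \<open>Convergence in the mean\<close>

lemma tendsto_0_if_le:
 fixes X :: "nat => ennreal"
 assumes "\<And>e::real. e > 0 ==> \<forall>\<^sub>F k in sequentially. X k <= ennreal e"
 shows "X \<longlonglongrightarrow> 0"
proof (rule order_tendstoI)
 fix a :: ennreal assume "0 < a"
 then obtain e where e: "0 < e" "e < a" using dense by blast
 then obtain r where r: "e = ennreal r" "r >= 0" by (cases e) (auto simp: top_unique)
 then have "r > 0" using e by (cases "r = 0") auto
 from assms[OF this] show "\<forall>\<^sub>F k in sequentially. X k < a" using e r by (auto elim!: eventually_mono)
qed auto

text \<open>A subsequence with increments below 2^-n converges almost everywhere, since the sum of
  its increments has finite integral, and Fatou's lemma identifies the limit in the mean. Formulated
  through differences only.\<close>

lemma L1_Cauchy_limit: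
 fixes f :: "nat => 'a => 'b::euclidean_space"
 assumes meas[measurable]: "\<And>k. f k \<in> borel_measurable M"
  and cauchy: "\<And>e::real. e > 0 ==> EX N. ALL k>=N. ALL l>=N. (\<integral>\<^sup>+x. ennreal (norm (f k x - f l x)) \<partial>M) < ennreal e"
 obtains g r where "strict_mono (r::nat=>nat)" "g \<in> borel_measurable M" "AE x in M. (%k. f (r k) x) \<longlonglongrightarrow> g x"
  "(%k. \<integral>\<^sup>+x. ennreal (norm (f k x - g x)) \<partial>M) \<longlonglongrightarrow> 0"
proof -
 have "EX r. ALL n. (ALL k>=r n. ALL l>=r n. (\<integral>\<^sup>+x. ennreal (norm (f k x - f l x)) \<partial>M) < ennreal ((1/2)^n)) & r n < r (Suc n)"
 proof (rule dependent_nat_choice)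
  show "EX x. ALL k>=x. ALL l>=x. (\<integral>\<^sup>+xa. ennreal (norm (f k xa - f l xa)) \<partial>M) < ennreal ((1 / 2) ^ 0)"
   using cauchy[of 1] by auto
  fix y n
  obtain N where "ALL k>=N. ALL l>=N. (\<integral>\<^sup>+x. ennreal (norm (f k x - f l x)) \<partial>M) < ennreal ((1/2)^Suc n)"
   using cauchy[of "(1/2)^Suc n"] by auto
  then show "EX ya. (ALL k>=ya. ALL l>=ya. (\<integral>\<^sup>+x. ennreal (norm (f k x - f l x)) \<partial>M) < ennreal ((1 / 2) ^ Suc n)) & y < ya"
   by (intro exI[of _ "max N (Suc y)"]) auto
 qed
 then obtain r where r: "\<And>n k l. r n <= k ==> r n <= l ==> (\<integral>\<^sup>+x. ennreal (norm (f k x - f l x)) \<partial>M) < ennreal ((1/2)^n)"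
  "\<And>n. r n < r (Suc n)" by blast
 have mono: "strict_mono r" using r(2) by (simp add: strict_mono_Suc_iff)
 define D where "D n x = norm (f (r (Suc n)) x - f (r n) x)" for n x
 have [measurable]: "D n \<in> borel_measurable M" for n unfolding D_def by measurable
 have "(\<integral>\<^sup>+x. (\<Sum>n. ennreal (D n x)) \<partial>M) = (\<Sum>n. \<integral>\<^sup>+x. ennreal (D n x) \<partial>M)"
  by (rule nn_integral_suminf) auto
 also have "... <= (\<Sum>n. ennreal ((1/2)^n))"
 proof (rule suminf_le)
  show "(\<integral>\<^sup>+x. ennreal (D n x) \<partial>M) <= ennreal ((1/2)^n)" for n
   unfolding D_def using r(1)[of n "r (Suc n)" "r n"] r(2)[of n] by (simp add: less_imp_le)
 qed auto
 also have "... = ennreal (\<Sum>n. (1/2)^n)" by (intro suminf_ennreal2) auto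
 also have "... < \<infinity>" by simp
 finally have "(\<integral>\<^sup>+x. (\<Sum>n. ennreal (D n x)) \<partial>M) ~= \<infinity>" by simp
 then have AE: "AE x in M. (\<Sum>n. ennreal (D n x)) ~= \<infinity>"
  by (intro nn_integral_noteq_infinite) auto
 have conv: "AE x in M. convergent (%k. f (r k) x)"
  using AE
 proof eventually_elim
  fix x assume "(\<Sum>n. ennreal (D n x)) ~= \<infinity>"
  then have "summable (%n. D n x)" by (intro summable_suminf_not_top) (auto simp: D_def)
  then have "summable (%n. f (r (Suc n)) x - f (r n) x)" unfolding D_def by (rule summable_norm_cancel)
  then have "convergent (%n. \<Sum>i<n. f (r (Suc i)) x - f (r i) x)" by (simp add: summable_iff_convergent)
  moreover have "(\<Sum>i<n. f (r (Suc i)) x - f (r i) x) = f (r n) x - f (r 0) x" for n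
   by (rule sum_lessThan_telescope)
  ultimately have "convergent (%n. f (r n) x - f (r 0) x)" by simp
  from convergent_add[OF this convergent_const[of "f (r 0) x"]] show "convergent (%k. f (r k) x)" by simp
 qed
 define g where "g x = lim (%k. f (r k) x)" for x
 have [measurable]: "g \<in> borel_measurable M" unfolding g_def by (rule borel_measurable_lim_metric) auto
 have lim: "AE x in M. (%k. f (r k) x) \<longlonglongrightarrow> g x"
  using conv by eventually_elim (simp add: g_def convergent_LIMSEQ_iff)
 have "(%k. \<integral>\<^sup>+x. ennreal (norm (f k x - g x)) \<partial>M) \<longlonglongrightarrow> 0"
 proof (rule tendsto_0_if_le)
  fix e :: real assume "e > 0"
  then obtain N where N: "\<And>k l. N <= k ==> N <= l ==> (\<integral>\<^sup>+x. ennreal (norm (f k x - f l x)) \<partial>M) < ennreal e"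
   using cauchy by blast
  have "(\<integral>\<^sup>+x. ennreal (norm (f k x - g x)) \<partial>M) <= ennreal e" if k: "k >= N" for k
  proof -
   have "(\<integral>\<^sup>+x. ennreal (norm (f k x - g x)) \<partial>M) = (\<integral>\<^sup>+x. liminf (%l. ennreal (norm (f k x - f (r l) x))) \<partial>M)"
   proof (rule nn_integral_cong_AE)
    show "AE x in M. ennreal (norm (f k x - g x)) = liminf (%l. ennreal (norm (f k x - f (r l) x)))"
     using lim
    proof eventually_elim
     case (elim x)
     then have "(%l. ennreal (norm (f k x - f (r l) x))) \<longlonglongrightarrow> ennreal (norm (f k x - g x))"
      by (intro tendsto_ennrealI tendsto_intros)
     then show ?case
      by (intro lim_imp_Liminf[symmetric]) auto
    qed
   qed
   also have "... <= liminf (%l. \<integral>\<^sup>+x. ennreal (norm (f k x - f (r l) x)) \<partial>M)"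
    by (rule nn_integral_liminf) auto
   also have "... <= ennreal e"
   proof (rule Liminf_le)
    have "\<forall>\<^sub>F l in sequentially. N <= l" by (rule eventually_ge_at_top)
    then show "\<forall>\<^sub>F l in sequentially. (\<integral>\<^sup>+x. ennreal (norm (f k x - f (r l) x)) \<partial>M) <= ennreal e"
    proof eventually_elim
     case (elim l)
     then have "N <= r l" using seq_suble[OF mono, of l] by simp
     then show ?case using N[OF k, of "r l"] by simp
    qed
   qed auto
   finally show ?thesis .
  qed
  then show "\<forall>\<^sub>F k in sequentially. (\<integral>\<^sup>+x. ennreal (norm (f k x - g x)) \<partial>M) <= ennreal e"
   unfolding eventually_sequentially by blast
 qed
 from that[OF mono \<open>g \<in> borel_measurable M\<close> lim this] show ?thesis .
qed


lemma L1_null_AE_subseq: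
 fixes f :: "nat => 'a => 'b::euclidean_space"
 assumes meas[measurable]: "\<And>k. f k \<in> borel_measurable M" "g \<in> borel_measurable M"
  and lim: "(%k. \<integral>\<^sup>+x. ennreal (norm (f k x - g x)) \<partial>M) \<longlonglongrightarrow> 0"
 obtains r where "strict_mono (r::nat=>nat)" "AE x in M. (%k. f (r k) x) \<longlonglongrightarrow> g x"
proof -
 have "\<forall>\<^sub>F k in sequentially. (\<integral>\<^sup>+x. ennreal (norm (f k x - g x)) \<partial>M) < \<infinity>" using lim by (intro order_tendstoD) auto
 then obtain N where N: "\<And>k. (\<integral>\<^sup>+x. ennreal (norm (f (k + N) x - g x)) \<partial>M) < \<infinity>"
  unfolding eventually_sequentially by (metis le_add2)
 have i: "integrable M (%x. f (k + N) x - g x)" for k using N[of k] by (auto simp: integrable_iff_bounded)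
 have "(%k. ennreal (LINT x|M. norm (f (k + N) x - g x))) \<longlonglongrightarrow> ennreal 0"
  using LIMSEQ_ignore_initial_segment[OF lim, of N] nn_integral_eq_integral[OF integrable_norm[OF i]] by simp
 then have "(%k. \<integral>x. norm (f (k + N) x - g x) \<partial>M) \<longlonglongrightarrow> 0" by (subst (asm) tendsto_ennreal_iff) auto
 from tendsto_L1_AE_subseq[OF i this] obtain r where r: "strict_mono r" "AE x in M. (%k. f (r k + N) x - g x) \<longlonglongrightarrow> 0" by blast
 have "strict_mono (%k. r k + N)" using r(1) by (simp add: strict_mono_def)
 moreover have "AE x in M. (%k. f (r k + N) x) \<longlonglongrightarrow> g x" using r(2) by eventually_elim (rule LIM_zero_cancel)
 ultimately show ?thesis by (rule that)
qed

section \<open>Translations and mean oscillation\<close>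

lemma nn_integral_lebesgue_on:
 fixes f :: "'a::euclidean_space => ennreal"
 assumes "f \<in> borel_measurable borel" "S \<in> sets borel"
 shows "(\<integral>\<^sup>+x. f x \<partial>lebesgue_on S) = (\<integral>\<^sup>+x. f x * indicator S x \<partial>lborel)"
 using assms by (simp add: nn_integral_restrict_space nn_integral_completion)

lemma nn_integral_translate:
 fixes f :: "'a::euclidean_space => ennreal"
 assumes [measurable]: "f \<in> borel_measurable borel"
 shows "(\<integral>\<^sup>+x. f (x + c) \<partial>lborel) = (\<integral>\<^sup>+x. f x \<partial>lborel)"
proof -
 have "(\<integral>\<^sup>+x. f x \<partial>lborel) = (\<integral>\<^sup>+x. f x \<partial>distr lborel borel ((+) c))" by (simp add: lborel_distr_plus)
 also have "... = (\<integral>\<^sup>+x. f (c + x) \<partial>lborel)" by (rule nn_integral_distr) auto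
 finally show ?thesis by (simp add: add.commute)
qed

text \<open>The increment is the integral of the directional derivative along the segment; Tonelli
  and translation invariance of Lebesgue measure remove the dependence on the position along
  it.\<close>

lemma translation_estimate:
 fixes \<phi> :: "real^'n::finite => real"
 assumes \<phi>: "\<And>x. \<phi> differentiable at x" "continuous_on UNIV (grad \<phi>)"
 shows "(\<integral>\<^sup>+x. ennreal \<bar>\<phi> (x + h) - \<phi> x\<bar> \<partial>lborel) <= ennreal (norm h) * (\<integral>\<^sup>+x. ennreal (norm (grad \<phi> x)) \<partial>lborel)"
proof -
 let ?f = "%x s. ennreal (norm (grad \<phi> (x + s *\<^sub>R h))) * indicator {0..1::real} s"
 have [measurable]: "grad \<phi> \<in> borel_measurable borel" using \<phi>(2) by (rule borel_measurable_continuous_onI)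
 have "continuous_on UNIV (%z. grad \<phi> (fst z + snd z *\<^sub>R h))"
  by (rule continuous_on_compose2[OF \<phi>(2)]) (auto intro!: continuous_intros)
 then have [measurable]: "(%z. grad \<phi> (fst z + snd z *\<^sub>R h)) \<in> borel_measurable (borel \<Otimes>\<^sub>M borel)"
  unfolding borel_prod by (rule borel_measurable_continuous_onI)
 have pt: "ennreal \<bar>\<phi> (x + h) - \<phi> x\<bar> <= ennreal (norm h) * (\<integral>\<^sup>+s. ?f x s \<partial>lborel)" for x
 proof -
  let ?F = "%s. grad \<phi> (x + s *\<^sub>R h) \<bullet> h"
  have der: "((%s. \<phi> (x + s *\<^sub>R h)) has_real_derivative ?F s) (at s)" for s
  proof -
   have "((%s. x + s *\<^sub>R h) has_derivative (%t. t *\<^sub>R h)) (at s)" by (auto intro!: derivative_eq_intros)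
   from has_derivative_compose[OF this has_derivative_grad[OF \<phi>(1)]]
   show ?thesis by (simp add: has_field_derivative_def mult.commute[of _ "grad \<phi> _ \<bullet> _"])
  qed
  have cont: "continuous_on UNIV ?F"
   by (intro continuous_intros continuous_on_compose2[OF \<phi>(2)]) auto
  then have cont1: "isCont ?F s" for s by (simp add: continuous_on_eq_continuous_at)
  have B: "has_bochner_integral lborel (%s. ?F s * indicator {0..1} s) (\<phi> (x + 1 *\<^sub>R h) - \<phi> (x + 0 *\<^sub>R h))"
   by (rule has_bochner_integral_FTC_Icc_real[OF _ der cont1]) auto
  then have "ennreal \<bar>\<phi> (x + h) - \<phi> x\<bar> <= (\<integral>\<^sup>+s. ennreal (norm (?F s * indicator {0..1} s)) \<partial>lborel)"
   using integral_norm_bound_ennreal[of lborel "%s. ?F s * indicator {0..1} s"]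
   by (simp add: has_bochner_integral_iff)
  also have "... <= (\<integral>\<^sup>+s. ennreal (norm h) * ?f x s \<partial>lborel)"
  proof (intro nn_integral_mono)
   fix s
   have "\<bar>?F s\<bar> <= norm h * norm (grad \<phi> (x + s *\<^sub>R h))" using Cauchy_Schwarz_ineq2 by (metis mult.commute)
   then show "ennreal (norm (?F s * indicator {0..1} s)) <= ennreal (norm h) * ?f x s"
    by (auto simp: indicator_def ennreal_mult[symmetric] split: if_splits)
  qed
  also have "... = ennreal (norm h) * (\<integral>\<^sup>+s. ?f x s \<partial>lborel)"
  proof (rule nn_integral_cmult)
   have "continuous_on UNIV (%s. grad \<phi> (x + s *\<^sub>R h))"
    by (rule continuous_on_compose2[OF \<phi>(2)]) (auto intro!: continuous_intros)
   then have [measurable]: "(%s. grad \<phi> (x + s *\<^sub>R h)) \<in> borel_measurable borel" by (rule borel_measurable_continuous_onI)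
   show "?f x \<in> borel_measurable lborel" by simp
  qed
  finally show ?thesis .
 qed
 have "(\<integral>\<^sup>+x. ennreal \<bar>\<phi> (x + h) - \<phi> x\<bar> \<partial>lborel) <= (\<integral>\<^sup>+x. ennreal (norm h) * (\<integral>\<^sup>+s. ?f x s \<partial>lborel) \<partial>lborel)"
  using pt by (rule nn_integral_mono)
 also have "... = ennreal (norm h) * (\<integral>\<^sup>+x. (\<integral>\<^sup>+s. ?f x s \<partial>lborel) \<partial>lborel)"
  by (rule nn_integral_cmult) (simp add: case_prod_beta)
 also have "(\<integral>\<^sup>+x. (\<integral>\<^sup>+s. ?f x s \<partial>lborel) \<partial>lborel) = (\<integral>\<^sup>+s. (\<integral>\<^sup>+x. ?f x s \<partial>lborel) \<partial>lborel)"
  by (rule lborel_pair.Fubini'[symmetric]) (simp add: case_prod_beta)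
 also have "... = (\<integral>\<^sup>+s. (\<integral>\<^sup>+x. ennreal (norm (grad \<phi> x)) \<partial>lborel) * indicator {0..1::real} s \<partial>lborel)"
 proof (intro nn_integral_cong)
  fix s :: real
  have "(\<integral>\<^sup>+x. ?f x s \<partial>lborel) = (\<integral>\<^sup>+x. ennreal (norm (grad \<phi> (x + s *\<^sub>R h))) \<partial>lborel) * indicator {0..1} s"
   by (rule nn_integral_multc) simp
  then show "(\<integral>\<^sup>+x. ?f x s \<partial>lborel) = (\<integral>\<^sup>+x. ennreal (norm (grad \<phi> x)) \<partial>lborel) * indicator {0..1} s"
   by (subst (asm) nn_integral_translate[of "%x. ennreal (norm (grad \<phi> x))"]) auto
 qed
 also have "... = (\<integral>\<^sup>+x. ennreal (norm (grad \<phi> x)) \<partial>lborel)"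
  by (subst nn_integral_cmult) auto
 finally show ?thesis .
qed

definition cube :: "real => (real^'n::finite) set" where "cube \<rho> = cbox (- (\<chi> i. \<rho>)) (\<chi> i. \<rho>)"

lemma cube_iff: "h \<in> cube \<rho> \<longleftrightarrow> (ALL i. \<bar>h $ i\<bar> <= \<rho>)"
 by (auto simp: cube_def mem_box_cart abs_le_iff) (metis minus_le_iff)+

lemma cube_borel[measurable]: "cube \<rho> \<in> sets borel" by (simp add: cube_def)

lemma emeasure_cube:
 assumes "\<rho> >= 0" shows "emeasure lborel (cube \<rho> :: (real^'n::finite) set) = ennreal ((2 * \<rho>) ^ CARD('n))"
proof -
 have "emeasure lborel (cube \<rho> :: (real^'n::finite) set) = ennreal (\<Prod>b\<in>Basis. ((\<chi> i. \<rho>) - (- (\<chi> i. \<rho>)) :: real^'n) \<bullet> b)"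
  unfolding cube_def using assms by (intro emeasure_lborel_cbox) (auto simp: Basis_vec_def inner_axis)
 also have "(\<Prod>b\<in>Basis. ((\<chi> i. \<rho>) - (- (\<chi> i. \<rho>)) :: real^'n) \<bullet> b) = (\<Prod>b\<in>(Basis::(real^'n) set). 2 * \<rho>)"
  by (intro prod.cong) (auto simp: Basis_vec_def inner_axis)
 finally show ?thesis by simp
qed

lemma norm_cube: "h \<in> cube \<rho> ==> norm (h::real^'n::finite) <= real CARD('n) * \<rho>"
 using norm_le_l1_cart[of h] sum_bounded_above[of UNIV "%i. \<bar>h $ i\<bar>" \<rho>] by (auto simp: cube_iff)

text \<open>Left unnormalised; each use divides by the volume that suits it, that of a cube or that
  of a grid cell.\<close>

definition osc :: "real => (real^'n::finite => real) => real^'n => ennreal" where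
 "osc \<rho> \<phi> x = (\<integral>\<^sup>+h. ennreal \<bar>\<phi> (x + h) - \<phi> x\<bar> * indicator (cube \<rho>) h \<partial>lborel)"

lemma osc_measurable[measurable]:
 assumes "continuous_on UNIV \<phi>" shows "osc \<rho> \<phi> \<in> borel_measurable borel"
proof -
 have "continuous_on UNIV (%z. \<phi> (fst z + snd z) - \<phi> (fst z))"
  by (intro continuous_intros continuous_on_compose2[OF assms]) auto
 then have [measurable]: "(%z. \<phi> (fst z + snd z) - \<phi> (fst z)) \<in> borel_measurable (borel \<Otimes>\<^sub>M borel)"
  unfolding borel_prod by (rule borel_measurable_continuous_onI)
 show ?thesis unfolding osc_def by (simp add: case_prod_beta)
qed

lemma osc_estimate:
 fixes \<phi> :: "real^'n::finite => real"
 assumes \<phi>: "\<And>x. \<phi> differentiable at x" "continuous_on UNIV (grad \<phi>)" and \<rho>: "\<rho> >= 0"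
 shows "(\<integral>\<^sup>+x. osc \<rho> \<phi> x \<partial>lborel) <= ennreal ((2 * \<rho>) ^ CARD('n) * (real CARD('n) * \<rho>)) * (\<integral>\<^sup>+x. ennreal (norm (grad \<phi> x)) \<partial>lborel)"
proof -
 let ?G = "\<integral>\<^sup>+x. ennreal (norm (grad \<phi> x)) \<partial>lborel"
 have c: "continuous_on UNIV \<phi>"
  using \<phi>(1) by (auto intro!: differentiable_imp_continuous_on simp: differentiable_on_def)
 then have [measurable]: "\<phi> \<in> borel_measurable borel" by (rule borel_measurable_continuous_onI)
 have "continuous_on UNIV (%z. \<phi> (fst z + snd z) - \<phi> (fst z))"
  by (intro continuous_intros continuous_on_compose2[OF c]) auto
 then have [measurable]: "(%z. \<phi> (fst z + snd z) - \<phi> (fst z)) \<in> borel_measurable (borel \<Otimes>\<^sub>M borel)"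
  unfolding borel_prod by (rule borel_measurable_continuous_onI)
 have "(\<integral>\<^sup>+x. osc \<rho> \<phi> x \<partial>lborel) = (\<integral>\<^sup>+h. (\<integral>\<^sup>+x. ennreal \<bar>\<phi> (x + h) - \<phi> x\<bar> * indicator (cube \<rho>) h \<partial>lborel) \<partial>lborel)"
  unfolding osc_def by (rule lborel_pair.Fubini'[symmetric]) (simp add: case_prod_beta)
 also have "... <= (\<integral>\<^sup>+h. ennreal (real CARD('n) * \<rho>) * ?G * indicator (cube \<rho> :: (real^'n) set) h \<partial>lborel)"
 proof (intro nn_integral_mono)
  fix h :: "real^'n"
  have "(\<integral>\<^sup>+x. ennreal \<bar>\<phi> (x + h) - \<phi> x\<bar> \<partial>lborel) <= ennreal (real CARD('n) * \<rho>) * ?G" if "h \<in> cube \<rho>"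
   using translation_estimate[OF \<phi>, of h] norm_cube[OF that]
   by (meson order_trans mult_right_mono ennreal_leI zero_le)
  then show "(\<integral>\<^sup>+x. ennreal \<bar>\<phi> (x + h) - \<phi> x\<bar> * indicator (cube \<rho>) h \<partial>lborel)
    <= ennreal (real CARD('n) * \<rho>) * ?G * indicator (cube \<rho>) h"
   by (cases "h \<in> cube \<rho>") auto
 qed
 also have "... = ennreal (real CARD('n) * \<rho>) * ?G * emeasure lborel (cube \<rho> :: (real^'n) set)"
  by (rule nn_integral_cmult_indicator) simp
 also have "... = ennreal ((2 * \<rho>) ^ CARD('n) * (real CARD('n) * \<rho>)) * ?G"
  using \<rho> by (simp add: emeasure_cube ennreal_mult mult_ac)
 finally show ?thesis .
qed

section \<open>Cell averages on a bounded open set\<close>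

lemma tendsto_0_bound:
 fixes X Y :: "nat => ennreal"
 assumes "Y \<longlonglongrightarrow> 0" "\<And>k. X k <= Y k" shows "X \<longlonglongrightarrow> 0"
 using assms by (intro tendsto_sandwich[of "%_. 0" X sequentially Y 0]) auto

lemma tendsto_0_add:
 fixes X Y :: "nat => ennreal"
 assumes "X \<longlonglongrightarrow> 0" "Y \<longlonglongrightarrow> 0" shows "(%k. X k + Y k) \<longlonglongrightarrow> 0"
 using tendsto_add[OF assms] by simp

lemma tendsto_0_cmult:
 fixes X :: "nat => ennreal"
 assumes "X \<longlonglongrightarrow> 0" shows "(%k. ennreal c * X k) \<longlonglongrightarrow> 0"
 using ennreal_tendsto_cmult[of "ennreal c" X 0] assms by simp

lemma integral_inner_tendsto:
 fixes f :: "nat => 'a => 'b::euclidean_space"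
 assumes f: "\<And>k. integrable N (f k)" "integrable N f0" and lim: "(%k. \<integral>\<^sup>+x. ennreal (norm (f k x - f0 x)) \<partial>N) \<longlonglongrightarrow> 0"
  and w[measurable]: "w \<in> borel_measurable N" and B: "AE x in N. norm (w x) <= B"
 shows "integrable N (%x. w x \<bullet> f0 x)" "(%k. \<integral>x. w x \<bullet> f k x \<partial>N) \<longlonglongrightarrow> (LINT x|N. w x \<bullet> f0 x)"
proof -
 have [measurable]: "f k \<in> borel_measurable N" "f0 \<in> borel_measurable N" for k using f by auto
 have le: "AE x in N. norm (w x \<bullet> h x) <= \<bar>B\<bar> * norm (h x)" for h
  using B
 proof eventually_elim
  case (elim x)
  then have "norm (w x) * norm (h x) <= \<bar>B\<bar> * norm (h x)" by (intro mult_right_mono) auto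
  then show ?case using Cauchy_Schwarz_ineq2[of "w x" "h x"] by simp
 qed
 have i: "integrable N (%x. w x \<bullet> h x)" if h: "integrable N h" for h
 proof (rule Bochner_Integration.integrable_bound)
  show "integrable N (%x. \<bar>B\<bar> * norm (h x))" using h by simp
  show "AE x in N. norm (w x \<bullet> h x) <= norm (\<bar>B\<bar> * norm (h x))" using le[of h] by eventually_elim (simp add: abs_mult)
 qed (use h in simp)
 then show "integrable N (%x. w x \<bullet> f0 x)" using f by blast
 show "(%k. \<integral>x. w x \<bullet> f k x \<partial>N) \<longlonglongrightarrow> (LINT x|N. w x \<bullet> f0 x)"
 proof (rule tendsto_L1_int[OF i[OF f(1)] i[OF f(2)] tendsto_0_bound[OF tendsto_0_cmult[OF lim, of "\<bar>B\<bar>"]]])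
  show "(\<integral>\<^sup>+x. ennreal (norm (w x \<bullet> f k x - w x \<bullet> f0 x)) \<partial>N) <= ennreal \<bar>B\<bar> * (\<integral>\<^sup>+x. ennreal (norm (f k x - f0 x)) \<partial>N)" for k
   unfolding inner_diff_right[symmetric]
   by (subst nn_integral_cmult[symmetric], simp, rule nn_integral_mono_AE, use le[of "%x. f k x - f0 x"] in eventually_elim)
     (simp add: ennreal_mult[symmetric] ennreal_leI)
 qed
qed

locale bounded_open =
 fixes \<Omega> :: "(real^'n::finite) set"
 assumes open_\<Omega>: "open \<Omega>" and bounded_\<Omega>: "bounded \<Omega>"
begin

abbreviation M :: "(real^'n) measure" where "M == lebesgue_on \<Omega>"

abbreviation meas :: "(real^'n => 'b::topological_space) => bool" where
 "meas f == f \<in> borel_measurable M"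

abbreviation eint :: "(real^'n => ennreal) => ennreal" where "eint == nn_integral M"

abbreviation L1n :: "(real^'n => 'b::real_normed_vector) => ennreal" where
 "L1n g == eint (%x. ennreal (norm (g x)))"

definition vol :: real where "vol = measure lebesgue \<Omega>"

lemma \<Omega>_borel[measurable, simp]: "\<Omega> \<in> sets borel" using open_\<Omega> by auto
lemma \<Omega>_lebesgue[simp]: "\<Omega> \<in> sets lebesgue" using open_\<Omega> by (simp add: borel_open)
lemma space_M[simp]: "space M = \<Omega>" by simp

lemma vol_nonneg: "0 <= vol" by (simp add: vol_def)

lemma emeasure_M: "emeasure M \<Omega> = ennreal vol"
proof -
 have "\<Omega> \<in> lmeasurable" using open_\<Omega> bounded_\<Omega> by (simp add: bounded_set_imp_lmeasurable)
 then have "emeasure lebesgue \<Omega> = ennreal vol" by (simp add: vol_def emeasure_eq_measure2)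
 then show ?thesis by (simp add: emeasure_restrict_space)
qed

lemma finite_M: "finite_measure M"
 by (rule finite_measureI) (use emeasure_M in auto)

lemma borel_M: "f \<in> borel_measurable borel ==> meas f"
 by (intro measurable_restrict_space1 measurable_completion) simp

lemma cont_M: "continuous_on UNIV f ==> meas f"
 by (intro borel_M borel_measurable_continuous_onI)

lemma test_M[measurable]: "test_fun \<Omega> \<phi> ==> meas \<phi>"
 and grad_M[measurable]: "test_fun \<Omega> \<phi> ==> meas (grad \<phi>)"
 by (auto intro!: cont_M test_fun_cont test_fun_grad_cont)

lemma nn_M_le:
 assumes "f \<in> borel_measurable borel" shows "eint (%x. f x) <= (\<integral>\<^sup>+x. f x \<partial>lborel)"
 by (subst nn_integral_lebesgue_on) (use assms in \<open>auto intro!: nn_integral_mono split: split_indicator\<close>)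

lemma nn_M_eq:
 assumes "f \<in> borel_measurable borel" "\<And>x. x \<notin> \<Omega> ==> f x = 0" shows "eint (%x. f x) = (\<integral>\<^sup>+x. f x \<partial>lborel)"
 by (subst nn_integral_lebesgue_on) (use assms in \<open>auto intro!: nn_integral_cong split: split_indicator\<close>)

lemma test_fun_outside: "test_fun \<Omega> \<phi> ==> x \<notin> \<Omega> ==> \<phi> x = 0"
 and grad_outside: "test_fun \<Omega> \<phi> ==> x \<notin> \<Omega> ==> grad \<phi> x = 0"
 by (erule test_funE; blast)+

lemma test_bounded:
 assumes "test_fun \<Omega> \<phi>"
 obtains B where "B >= 0" "\<And>x. \<bar>\<phi> x\<bar> <= B" "\<And>x. norm (grad \<phi> x) <= B"
proof -
 obtain K where K: "compact K" "\<And>x. x \<notin> K ==> \<phi> x = 0" "\<And>x. x \<notin> K ==> grad \<phi> x = 0" using test_funE[OF assms] by metis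
 have "compact (\<phi> ` K)" "compact (grad \<phi> ` K)"
  using K(1) test_fun_cont[OF assms] test_fun_grad_cont[OF assms] by (auto intro!: compact_continuous_image continuous_on_subset[where s=UNIV])
 then obtain B1 B2 where B: "\<And>x. x \<in> K ==> \<bar>\<phi> x\<bar> <= B1" "\<And>x. x \<in> K ==> norm (grad \<phi> x) <= B2"
  by (metis bounded_iff compact_imp_bounded image_eqI real_norm_def)
 show ?thesis
 proof (rule that[of "\<bar>B1\<bar> + \<bar>B2\<bar>"])
  fix x
  show "\<bar>\<phi> x\<bar> <= \<bar>B1\<bar> + \<bar>B2\<bar>" "norm (grad \<phi> x) <= \<bar>B1\<bar> + \<bar>B2\<bar>"
   using K B by (cases "x \<in> K"; force)+
 qed auto
qed

lemma osc_le:
 assumes \<phi>: "test_fun \<Omega> \<phi>" and \<rho>: "0 <= \<rho>"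
 shows "eint (%x. osc \<rho> \<phi> x) <= ennreal ((2 * \<rho>) ^ CARD('n) * (real CARD('n) * \<rho>)) * L1n (%x. grad \<phi> x)"
proof -
 have [measurable]: "osc \<rho> \<phi> \<in> borel_measurable borel" using test_fun_cont[OF \<phi>] by (rule osc_measurable)
 have [measurable]: "grad \<phi> \<in> borel_measurable borel"
  using test_fun_grad_cont[OF \<phi>] by (rule borel_measurable_continuous_onI)
 have "eint (%x. osc \<rho> \<phi> x) <= (\<integral>\<^sup>+x. osc \<rho> \<phi> x \<partial>lborel)" by (rule nn_M_le) simp
 also have "... <= ennreal ((2 * \<rho>) ^ CARD('n) * (real CARD('n) * \<rho>)) * (\<integral>\<^sup>+x. ennreal (norm (grad \<phi> x)) \<partial>lborel)"
  using \<phi> \<rho> by (intro osc_estimate test_fun_grad_cont) (auto intro: test_fun_diff)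
 also have "(\<integral>\<^sup>+x. ennreal (norm (grad \<phi> x)) \<partial>lborel) = L1n (%x. grad \<phi> x)"
  by (rule nn_M_eq[symmetric]) (use grad_outside[OF \<phi>] in auto)
 finally show ?thesis .
qed

text \<open>The value at x is compared with all values at x + h, h in a cube: the difference costs
  the oscillation, the shifted values at most the full integral. For small \<open>E\<close> the last
  term can later be absorbed.\<close>

lemma test_local_poincare:
 assumes \<phi>: "test_fun \<Omega> \<phi>" and \<rho>: "0 < \<rho>" and E: "E \<in> sets M"
 shows "eint (%x. ennreal \<bar>\<phi> x\<bar> * indicator E x) <= ennreal (real CARD('n) * \<rho>) * L1n (%x. grad \<phi> x)
   + ennreal (1 / (2 * \<rho>) ^ CARD('n)) * (emeasure M E * eint (%x. ennreal \<bar>\<phi> x\<bar>))"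
proof -
 let ?q = "(2 * \<rho>) ^ CARD('n)"
 let ?U = "\<integral>\<^sup>+x. ennreal \<bar>\<phi> x\<bar> \<partial>M" and ?G = "\<integral>\<^sup>+x. ennreal (norm (grad \<phi> x)) \<partial>M"
 have q: "?q > 0" using \<rho> by simp
 have cp: "continuous_on UNIV \<phi>" using \<phi> by (rule test_fun_cont)
 have [measurable]: "\<phi> \<in> borel_measurable borel" "osc \<rho> \<phi> \<in> borel_measurable borel"
  using cp by (auto intro!: osc_measurable borel_measurable_continuous_onI)
 have [measurable]: "meas (osc \<rho> \<phi>)" "E \<in> sets M" "meas \<phi>"
  using E by (auto intro: borel_M)
 have U: "?U = (\<integral>\<^sup>+x. ennreal \<bar>\<phi> x\<bar> \<partial>lborel)" by (rule nn_M_eq) (use test_fun_outside[OF \<phi>] in auto)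
 have pt: "ennreal ?q * ennreal \<bar>\<phi> x\<bar> <= osc \<rho> \<phi> x + ?U" for x
 proof -
  have [measurable]: "(%h. \<phi> (x + h)) \<in> borel_measurable borel"
   by (intro borel_measurable_continuous_onI continuous_on_compose2[OF cp]) (auto intro!: continuous_intros)
  have "ennreal ?q * ennreal \<bar>\<phi> x\<bar> = (\<integral>\<^sup>+h. ennreal \<bar>\<phi> x\<bar> * indicator (cube \<rho>) h \<partial>(lborel :: (real^'n) measure))"
   using \<rho> by (subst nn_integral_cmult_indicator) (auto simp: emeasure_cube mult.commute)
  also have "... <= (\<integral>\<^sup>+h. ennreal \<bar>\<phi> (x + h) - \<phi> x\<bar> * indicator (cube \<rho>) h + ennreal \<bar>\<phi> (x + h)\<bar> \<partial>lborel)"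
   by (intro nn_integral_mono) (auto simp flip: ennreal_plus split: split_indicator)
  also have "... = osc \<rho> \<phi> x + (\<integral>\<^sup>+h. ennreal \<bar>\<phi> (x + h)\<bar> \<partial>lborel)"
   unfolding osc_def by (rule nn_integral_add) auto
  also have "(\<integral>\<^sup>+h. ennreal \<bar>\<phi> (x + h)\<bar> \<partial>lborel) = ?U"
   unfolding U using nn_integral_translate[of "%h. ennreal \<bar>\<phi> h\<bar>" x] by (simp add: add.commute)
  finally show ?thesis .
 qed
 have "ennreal ?q * eint (%x. ennreal \<bar>\<phi> x\<bar> * indicator E x) = eint (%x. ennreal ?q * ennreal \<bar>\<phi> x\<bar> * indicator E x)"
  by (subst nn_integral_cmult[symmetric]) (auto simp: mult.assoc)
 also have "... <= eint (%x. osc \<rho> \<phi> x + ?U * indicator E x)"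
  using pt by (intro nn_integral_mono) (auto split: split_indicator)
 also have "... = eint (%x. osc \<rho> \<phi> x) + ?U * emeasure M E"
  by (subst nn_integral_add) (auto simp: nn_integral_cmult_indicator)
 also have "... <= ennreal (?q * (real CARD('n) * \<rho>)) * ?G + ?U * emeasure M E"
  using osc_le[OF \<phi>, of \<rho>] \<rho> by (intro add_right_mono) auto
 finally have "ennreal (1 / ?q) * (ennreal ?q * eint (%x. ennreal \<bar>\<phi> x\<bar> * indicator E x))
   <= ennreal (1 / ?q) * (ennreal (?q * (real CARD('n) * \<rho>)) * ?G + ?U * emeasure M E)"
  by (rule mult_left_mono) simp
 also have "... = ennreal (1 / ?q) * ennreal (?q * (real CARD('n) * \<rho>)) * ?G + ennreal (1 / ?q) * (emeasure M E * ?U)"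
  by (simp add: distrib_left mult_ac)
 also have "ennreal (1 / ?q) * ennreal (?q * (real CARD('n) * \<rho>)) = ennreal (real CARD('n) * \<rho>)"
  using q by (subst ennreal_mult''[symmetric]) (use \<rho> in \<open>simp_all\<close>)
 also have "ennreal (1 / ?q) * (ennreal ?q * eint (%x. ennreal \<bar>\<phi> x\<bar> * indicator E x)) = eint (%x. ennreal \<bar>\<phi> x\<bar> * indicator E x)"
  using q \<rho> by (simp add: mult.assoc[symmetric] flip: ennreal_mult'')
 finally show ?thesis .
qed

section \<open>The grid of cells and averages over it\<close>

definition cellof :: "real => real^'n => 'n => int" where "cellof l x = (%i. \<lfloor>x $ i / l\<rfloor>)"
definition cell :: "real => ('n => int) => (real^'n) set" where "cell l z = {y. cellof l y = z}"
text \<open>The divisor is the volume of the whole cell also where the cell crosses the boundary,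
  which amounts to extending \<open>u\<close> by zero.\<close>

definition cavg :: "real => (real^'n => real) => ('n => int) => real" where
 "cavg l u z = (LINT y|M. u y * indicator (cell l z) y) / l ^ CARD('n)"

lemma cell_borel[measurable]: "cell l z \<in> sets borel"
proof -
 have "cell l z = {y. ALL i:UNIV. \<lfloor>y $ i / l\<rfloor> = z i}" by (auto simp: cell_def cellof_def)
 also have "... \<in> sets borel" by measurable
 finally show ?thesis .
qed

lemma emeasure_cell:
 assumes "l > 0" shows "emeasure lborel (cell l z) = ennreal (l ^ CARD('n))"
proof -
 let ?a = "\<chi> i. l * real_of_int (z i)" and ?b = "\<chi> i. l * (real_of_int (z i) + 1)"
 have c: "y \<in> cell l z \<longleftrightarrow> (ALL i. l * real_of_int (z i) <= y $ i & y $ i < l * (real_of_int (z i) + 1))" for y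
  using assms by (auto simp: cell_def cellof_def fun_eq_iff floor_eq_iff field_simps)
 have s: "box ?a ?b \<subseteq> cell l z" "cell l z \<subseteq> cbox ?a ?b"
  by (auto simp: c mem_box_cart less_imp_le)
 have e: "(\<Prod>b\<in>Basis. (?b - ?a) \<bullet> b) = l ^ CARD('n)"
 proof -
  have "(\<Prod>b\<in>Basis. (?b - ?a) \<bullet> b) = (\<Prod>b\<in>(Basis::(real^'n) set). l)"
   by (intro prod.cong) (auto simp: Basis_vec_def inner_axis algebra_simps)
  then show ?thesis by simp
 qed
 have le: "?a \<bullet> b <= ?b \<bullet> b" if "b \<in> Basis" for b using that assms by (auto simp: Basis_vec_def inner_axis)
 have "emeasure lborel (box ?a ?b) = ennreal (l ^ CARD('n))" using emeasure_lborel_box[of ?a ?b] le e by auto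
 moreover have "emeasure lborel (cbox ?a ?b) = ennreal (l ^ CARD('n))" using emeasure_lborel_cbox[of ?a ?b] le e by auto
 ultimately show ?thesis
  using emeasure_mono[OF s(1), of lborel] emeasure_mono[OF s(2), of lborel] by (simp add: antisym)
qed

text \<open>Two points of a cell differ by a vector of \<open>cube l\<close>, so the deviation from
  the average is at most the oscillation divided by the cell volume. The factor 2^N is the ratio of
  the volumes of \<open>cube l\<close> and of a cell.\<close>

lemma test_cavg:
 assumes \<phi>: "test_fun \<Omega> \<phi>" and l: "0 < l"
 shows "eint (%x. ennreal \<bar>\<phi> x - cavg l \<phi> (cellof l x)\<bar>) <= ennreal (2 ^ CARD('n) * real CARD('n) * l) * L1n (%x. grad \<phi> x)"
proof -
 let ?q = "l ^ CARD('n)"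
 have q: "?q > 0" using l by simp
 have cp: "continuous_on UNIV \<phi>" using \<phi> by (rule test_fun_cont)
 have [measurable]: "\<phi> \<in> borel_measurable borel" "osc l \<phi> \<in> borel_measurable borel"
  using cp by (auto intro!: osc_measurable borel_measurable_continuous_onI)
 then have oM[measurable]: "meas (osc l \<phi>)" by (auto intro: borel_M)
 obtain B where B: "\<And>x. \<bar>\<phi> x\<bar> <= B" using test_bounded[OF \<phi>] by metis
 have pt: "ennreal \<bar>\<phi> x - cavg l \<phi> (cellof l x)\<bar> <= ennreal (1 / ?q) * osc l \<phi> x" for x
 proof -
  let ?Q = "cell l (cellof l x)"
  have [measurable]: "(%h. \<phi> (x + h)) \<in> borel_measurable borel"
   by (intro borel_measurable_continuous_onI continuous_on_compose2[OF cp]) (auto intro!: continuous_intros)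
  have eq: "emeasure lborel ?Q = ennreal ?q" using l by (rule emeasure_cell)
  have i1: "integrable lborel (%y. indicator ?Q y *\<^sub>R \<phi> x)"
   using eq by (intro integrable_scaleR_left integrable_real_indicator) auto
  have i2: "integrable lborel (%y. indicator ?Q y *\<^sub>R \<phi> y)"
  proof (rule Bochner_Integration.integrable_bound)
   show "integrable lborel (%y. indicator ?Q y *\<^sub>R B)"
    using eq by (intro integrable_scaleR_left integrable_real_indicator) auto
   show "AE y in lborel. norm (indicator ?Q y *\<^sub>R \<phi> y) <= norm (indicator ?Q y *\<^sub>R B)"
    using B by (intro AE_I2) (auto split: split_indicator intro: order_trans[OF _ abs_ge_self])
  qed simp
  have "(LINT y|M. \<phi> y * indicator ?Q y) = (LINT y|lborel. indicator \<Omega> y *\<^sub>R (\<phi> y * indicator ?Q y))"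
   by (subst integral_restrict_space) (auto simp: integral_completion)
  also have "... = (LINT y|lborel. indicator ?Q y *\<^sub>R \<phi> y)"
   using test_fun_outside[OF \<phi>] by (intro Bochner_Integration.integral_cong) (auto split: split_indicator)
  finally have cv: "cavg l \<phi> (cellof l x) = (LINT y|lborel. indicator ?Q y *\<^sub>R \<phi> y) / ?q" by (simp add: cavg_def)
  have "(LINT y|lborel. indicator ?Q y *\<^sub>R \<phi> x) = ?q * \<phi> x" using eq q by (simp add: measure_def)
  then have "\<phi> x - cavg l \<phi> (cellof l x) = (LINT y|lborel. indicator ?Q y *\<^sub>R \<phi> x - indicator ?Q y *\<^sub>R \<phi> y) / ?q"
   using l q i1 i2 by (subst Bochner_Integration.integral_diff) (auto simp: cv diff_divide_distrib)
  also have "(%y. indicator ?Q y *\<^sub>R \<phi> x - indicator ?Q y *\<^sub>R \<phi> y) = (%y. indicator ?Q y * (\<phi> x - \<phi> y))"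
   by (auto simp: algebra_simps)
  finally have d: "\<phi> x - cavg l \<phi> (cellof l x) = (LINT y|lborel. indicator ?Q y * (\<phi> x - \<phi> y)) / ?q" .
  have "ennreal \<bar>\<integral>y. indicator ?Q y * (\<phi> x - \<phi> y) \<partial>lborel\<bar> <= (\<integral>\<^sup>+y. ennreal (norm (indicator ?Q y * (\<phi> x - \<phi> y))) \<partial>lborel)"
   using i1 i2 integral_norm_bound_ennreal[of lborel "%y. indicator ?Q y * (\<phi> x - \<phi> y)"]
   by (simp add: right_diff_distrib)
  also have "... = (\<integral>\<^sup>+h. ennreal (norm (indicator ?Q (h + x) * (\<phi> x - \<phi> (h + x)))) \<partial>lborel)"
   by (rule nn_integral_translate[symmetric]) simp
  also have "... <= osc l \<phi> x"
   unfolding osc_def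
  proof (intro nn_integral_mono)
   fix h
   have "h \<in> cube l" if "h + x \<in> ?Q"
    unfolding cube_iff
   proof
    fix i
    have "\<lfloor>(h + x) $ i / l\<rfloor> = \<lfloor>x $ i / l\<rfloor>" using that by (simp add: cell_def cellof_def fun_eq_iff)
    then have "\<bar>(h + x) $ i / l - x $ i / l\<bar> < 1" by linarith
    then have "\<bar>h $ i / l\<bar> < 1" by (simp add: add_divide_distrib)
    then show "\<bar>h $ i\<bar> <= l" using l by (simp add: field_simps)
   qed
   then show "ennreal (norm (indicator ?Q (h + x) * (\<phi> x - \<phi> (h + x)))) <= ennreal \<bar>\<phi> (x + h) - \<phi> x\<bar> * indicator (cube l) h"
    by (auto split: split_indicator simp: add.commute abs_minus_commute)
  qed
  finally have "ennreal (1 / ?q) * ennreal \<bar>\<integral>y. indicator ?Q y * (\<phi> x - \<phi> y) \<partial>lborel\<bar> <= ennreal (1 / ?q) * osc l \<phi> x"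
   by (rule mult_left_mono) simp
  then show ?thesis unfolding d using q by (simp add: abs_divide flip: ennreal_mult'')
 qed
 have "eint (%x. ennreal \<bar>\<phi> x - cavg l \<phi> (cellof l x)\<bar>) <= eint (%x. ennreal (1 / ?q) * osc l \<phi> x)"
  using pt by (intro nn_integral_mono)
 also have "... = ennreal (1 / ?q) * eint (%x. osc l \<phi> x)" by (rule nn_integral_cmult) simp
 also have "... <= ennreal (1 / ?q) * (ennreal ((2 * l) ^ CARD('n) * (real CARD('n) * l)) * L1n (%x. grad \<phi> x))"
  using osc_le[OF \<phi>] l by (intro mult_left_mono) auto
 also have "... = ennreal (1 / ?q * ((2 * l) ^ CARD('n) * (real CARD('n) * l))) * L1n (%x. grad \<phi> x)"
  using q l by (simp add: mult.assoc[symmetric] flip: ennreal_mult'')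
 also have "1 / ?q * ((2 * l) ^ CARD('n) * (real CARD('n) * l)) = 2 ^ CARD('n) * real CARD('n) * l"
  using l by (simp add: power_mult_distrib)
 finally show ?thesis .
qed

end

section \<open>Limits of test functions\<close>

lemma smooth1_deriv_cont:
 assumes "smooth1 G" "\<And>t. (G has_real_derivative G' t) (at t)"
 shows "continuous_on UNIV G'"
proof -
 from assms(1) obtain F where F: "G \<in> F" "ALL f:F. EX f':F. ALL t. (f has_real_derivative f' t) (at t)"
  unfolding smooth1_def by blast
 then obtain f' where f': "f' \<in> F" "ALL t. (G has_real_derivative f' t) (at t)" by blast
 then obtain f'' where "ALL t. (f' has_real_derivative f'' t) (at t)" using F by blast
 then have "continuous_on UNIV f'" using DERIV_isCont by (auto simp: continuous_on_eq_continuous_at)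
 moreover have "G' = f'" using DERIV_unique[OF assms(2)] f'(2) by auto
 ultimately show ?thesis by simp
qed

context bounded_open
begin

lemma L1n_add:
 fixes f g :: "real^'n => 'b::euclidean_space"
 assumes [measurable]: "meas f" "meas g"
 shows "L1n (%x. f x + g x) <= L1n f + L1n g"
proof -
 have "L1n (%x. f x + g x) <= eint (%x. ennreal (norm (f x)) + ennreal (norm (g x)))"
  by (intro nn_integral_mono) (simp flip: ennreal_plus add: norm_triangle_ineq)
 then show ?thesis by (subst (asm) nn_integral_add) auto
qed

lemma L1n_triangle:
 fixes f g h :: "real^'n => 'b::euclidean_space"
 assumes "meas f" "meas g" "meas h"
 shows "L1n (%x. f x - h x) <= L1n (%x. f x - g x) + L1n (%x. g x - h x)"
 using L1n_add[of "%x. f x - g x" "%x. g x - h x"] assms by simp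

lemma L1n_minus_commute: "L1n (%x. f x - g x) = L1n (%x. g x - f x)" by (simp add: norm_minus_commute)

text \<open>L1 continuity of a single average, used both for the limit in \<open>W0_cavg\<close> and
  for the continuity of the finite-dimensional map in \<open>schauder_cells\<close>.\<close>

lemma cavg_diff_le:
 assumes [measurable]: "integrable M u" "integrable M v" and l: "0 < l"
 shows "ennreal \<bar>cavg l u z - cavg l v z\<bar> <= ennreal (1 / l ^ CARD('n)) * L1n (%x. u x - v x)"
proof -
 have [measurable]: "cell l z \<in> sets lebesgue" using cell_borel by auto
 have c: "meas (%y. indicator (cell l z) y :: real)"
  by (intro borel_M borel_measurable_indicator cell_borel)
 have "integrable M (%y. w y * indicator (cell l z) y)" if "integrable M w" for w :: "real^'n => real"
  by (rule Bochner_Integration.integrable_bound[OF that]) (use c that in \<open>auto split: split_indicator\<close>)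
 then have i: "integrable M (%y. u y * indicator (cell l z) y)" "integrable M (%y. v y * indicator (cell l z) y)"
  using assms by auto
 have "cavg l u z - cavg l v z = (LINT y|M. u y * indicator (cell l z) y - v y * indicator (cell l z) y) / l ^ CARD('n)"
  using i by (simp add: cavg_def diff_divide_distrib)
 then have "ennreal \<bar>cavg l u z - cavg l v z\<bar> = ennreal (1 / l ^ CARD('n)) * ennreal \<bar>\<integral>y. u y * indicator (cell l z) y - v y * indicator (cell l z) y \<partial>M\<bar>"
  using l by (simp add: abs_divide flip: ennreal_mult'')
 also have "... <= ennreal (1 / l ^ CARD('n)) * eint (%y. ennreal (norm (u y * indicator (cell l z) y - v y * indicator (cell l z) y)))"
  using i integral_norm_bound_ennreal[of M "%y. u y * indicator (cell l z) y - v y * indicator (cell l z) y"]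
  by (intro mult_left_mono) auto
 also have "... <= ennreal (1 / l ^ CARD('n)) * L1n (%x. u x - v x)"
  by (intro mult_left_mono nn_integral_mono) (auto split: split_indicator)
 finally show ?thesis .
qed

lemma step_M: "meas (%x. a (cellof l x) :: real)"
proof -
 have "(%x. cellof l x) \<in> measurable borel (count_space UNIV)"
 proof (rule measurable_count_space_eq_countable[THEN iffD2])
  show "countable (UNIV :: ('n => int) set)" by simp
  have "cellof l -` {a} \<inter> space borel = cell l a" for a by (auto simp: cell_def)
  then show "cellof l \<in> space borel \<rightarrow> UNIV & (ALL a:UNIV. cellof l -` {a} \<inter> space borel \<in> sets borel)" by simp
 qed
 then have "(%x. a (cellof l x)) \<in> borel_measurable borel"
  by (rule measurable_compose) simp
 then show ?thesis by (rule borel_M)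
qed

lemmas cavg_M[measurable] = step_M[of "cavg l u" l for l u]

lemma cavg_bounds:
 assumes u: "integrable M u" "AE x in M. 0 <= u x & u x <= B" and l: "0 < l" and B: "0 <= B"
 shows "0 <= cavg l u z" "cavg l u z <= B"
proof -
 show "0 <= cavg l u z" unfolding cavg_def
  using u(2) l by (intro divide_nonneg_pos integral_nonneg_AE) (auto elim!: eventually_mono split: split_indicator)
 have "integrable lborel (%y. B * indicator (cell l z) y)"
  using emeasure_cell[OF l, of z] by (intro integrable_mult_right integrable_real_indicator) auto
 have "eint (%y. ennreal (u y * indicator (cell l z) y)) <= eint (%y. ennreal B * indicator (cell l z) y)"
  by (intro nn_integral_mono_AE, use u(2) in eventually_elim) (auto intro!: ennreal_leI split: split_indicator)
 also have "... <= (\<integral>\<^sup>+y. ennreal B * indicator (cell l z) y \<partial>lborel)" by (rule nn_M_le) simp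
 also have "... = ennreal (B * l ^ CARD('n))" using emeasure_cell[OF l, of z] B l by (simp add: nn_integral_cmult_indicator ennreal_mult)
 finally have "(LINT y|M. u y * indicator (cell l z) y) <= B * l ^ CARD('n)"
  using u(2) B l by (intro integral_real_bounded) auto
 then show "cavg l u z <= B" unfolding cavg_def using l by (simp add: field_simps)
qed

end

locale var_exponent = bounded_open \<Omega> for \<Omega> :: "(real^'n::finite) set" +
 fixes p :: "real^'n => real" and pm pp :: real
 assumes p_cont: "continuous_on \<Omega> p" and pm: "1 < pm"
  and p_lower: "\<And>x. x \<in> \<Omega> ==> pm <= p x" and p_upper: "\<And>x. x \<in> \<Omega> ==> p x <= pp"
begin

lemma p_M[measurable]: "meas p"
 using p_cont by (rule continuous_imp_measurable_on_sets_lebesgue) simp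

lemma p_gt1: "x \<in> \<Omega> ==> 1 < p x" using p_lower[of x] pm by simp

text \<open>The modular, for scalar and vector valued functions alike. Convergence is expressed by
  it instead of by the Luxemburg norm; for functions of finite modular the two agree by
  \<open>luxset_tendsto_0\<close>.\<close>

definition pmod :: "(real^'n => 'b::real_normed_vector) => ennreal" where
 "pmod g = eint (%x. ennreal (norm (g x) powr p x))"

lemma pmod_add:
 fixes f g :: "real^'n => 'b::euclidean_space"
 assumes [measurable]: "meas f" "meas g"
 shows "pmod (%x. f x + g x) <= ennreal (2 powr pp) * (pmod f + pmod g)"
proof -
 have "pmod (%x. f x + g x) <= eint (%x. ennreal (2 powr pp) * (ennreal (norm (f x) powr p x) + ennreal (norm (g x) powr p x)))"
  unfolding pmod_def
 proof (intro nn_integral_mono)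
  fix x assume "x \<in> space M"
  then have "norm (f x + g x) powr p x <= 2 powr pp * (norm (f x) powr p x + norm (g x) powr p x)"
   using p_lower[of x] p_upper[of x] pm by (intro norm_add_powr_le) auto
  then show "ennreal (norm (f x + g x) powr p x) <= ennreal (2 powr pp) * (ennreal (norm (f x) powr p x) + ennreal (norm (g x) powr p x))"
   by (simp flip: ennreal_mult'' ennreal_plus)
 qed
 also have "... = ennreal (2 powr pp) * (pmod f + pmod g)"
  unfolding pmod_def by (subst nn_integral_cmult, simp) (subst nn_integral_add, auto)
 finally show ?thesis .
qed

lemma pmod_uminus: "pmod (%x. - f x) = pmod f" by (simp add: pmod_def)

lemma pmod_diff:
 fixes f g :: "real^'n => 'b::euclidean_space"
 assumes [measurable]: "meas f" "meas g"
 shows "pmod (%x. f x - g x) <= ennreal (2 powr pp) * (pmod f + pmod g)"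
 using pmod_add[of f "%x. - g x"] by (simp add: pmod_uminus)

lemma pmod_mult_le:
 fixes g :: "real^'n => 'b::euclidean_space" and c :: "real^'n => real"
 assumes [measurable]: "meas g" and c: "\<And>x. x \<in> \<Omega> ==> \<bar>c x\<bar> <= B"
 shows "pmod (%x. c x *\<^sub>R g x) <= ennreal (max 1 B powr pp) * pmod g"
proof -
 have "pmod (%x. c x *\<^sub>R g x) <= eint (%x. ennreal (max 1 B powr pp) * ennreal (norm (g x) powr p x))"
  unfolding pmod_def
 proof (intro nn_integral_mono)
  fix x assume x: "x \<in> space M"
  have "norm (c x *\<^sub>R g x) powr p x = \<bar>c x\<bar> powr p x * norm (g x) powr p x" by (simp add: powr_mult)
  also have "\<bar>c x\<bar> powr p x <= max 1 B powr p x" using c[of x] x p_lower[of x] pm by (intro powr_mono2) auto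
  also have "... <= max 1 B powr pp" using p_upper[of x] x by (intro powr_mono) auto
  finally show "ennreal (norm (c x *\<^sub>R g x) powr p x) <= ennreal (max 1 B powr pp) * ennreal (norm (g x) powr p x)"
   by (simp flip: ennreal_mult'' add: mult_right_mono)
 qed
 also have "... = ennreal (max 1 B powr pp) * pmod g"
  unfolding pmod_def by (rule nn_integral_cmult) simp
 finally show ?thesis .
qed

lemma pmod_bounded_finite:
 assumes "\<And>x. x \<in> \<Omega> ==> norm (g x) <= B" shows "pmod g < \<infinity>"
proof -
 have "pmod g <= eint (%x. ennreal (max 1 B powr pp))"
  unfolding pmod_def
 proof (intro nn_integral_mono ennreal_leI)
  fix x assume x: "x \<in> space M"
  have "norm (g x) powr p x <= max 1 B powr p x" using assms[of x] x p_lower[of x] pm by (intro powr_mono2) auto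
  also have "... <= max 1 B powr pp" using p_upper[of x] x by (intro powr_mono) auto
  finally show "norm (g x) powr p x <= max 1 B powr pp" .
 qed
 also have "... = ennreal (max 1 B powr pp) * ennreal vol" by (simp add: emeasure_M)
 also have "... < \<infinity>" by (simp add: ennreal_mult_less_top)
 finally show ?thesis .
qed

text \<open>The additive \<epsilon> makes up for the missing homogeneity of the modular; convergence
  to zero in the modular still forces convergence in the mean.\<close>

lemma L1n_le_pmod:
 assumes "0 < \<epsilon>"
 shows "EX C>=0. ALL g :: real^'n => 'b::euclidean_space. meas g --> L1n g <= ennreal \<epsilon> + ennreal C * pmod g"
proof -
 define e where "e = \<epsilon> / (vol + 1)"
 have e: "e > 0" "e * vol <= \<epsilon>" using assms vol_nonneg by (auto simp: e_def field_simps)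
 obtain C where C: "C >= 0" "\<And>q t. pm <= q ==> q <= pp ==> 0 <= t ==> t <= e + C * t powr q"
  using le_add_powr_uniform[OF pm e(1), of pp] by blast
 show ?thesis
 proof (intro exI[of _ C] conjI allI impI C)
  fix g :: "real^'n => 'b" assume [measurable]: "meas g"
  have "L1n g <= eint (%x. ennreal e + ennreal C * ennreal (norm (g x) powr p x))"
   using C p_lower p_upper e by (intro nn_integral_mono) (simp flip: ennreal_mult'' ennreal_plus)
  also have "... = ennreal e * ennreal vol + ennreal C * pmod g"
   unfolding pmod_def by (subst nn_integral_add, simp, simp) (subst nn_integral_cmult, auto simp: emeasure_M)
  also have "ennreal e * ennreal vol <= ennreal \<epsilon>" using e vol_nonneg by (simp flip: ennreal_mult'' add: ennreal_leI)
  finally show "L1n g <= ennreal \<epsilon> + ennreal C * pmod g" by (simp add: add_right_mono)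
 qed
qed

lemma L1n_finite:
 fixes g :: "real^'n => 'b::euclidean_space"
 assumes "meas g" "pmod g < \<infinity>" shows "L1n g < \<infinity>"
proof -
 obtain C where "L1n g <= ennreal 1 + ennreal C * pmod g" using L1n_le_pmod[of 1] assms(1) by (metis zero_less_one)
 also have "... < \<infinity>" using assms(2) by (simp add: ennreal_mult_less_top)
 finally show ?thesis .
qed

lemma L1n_tendsto:
 fixes g :: "nat => real^'n => 'b::euclidean_space"
 assumes g: "\<And>k. meas (g k)" and lim: "(%k. pmod (g k)) \<longlonglongrightarrow> 0"
 shows "(%k. L1n (g k)) \<longlonglongrightarrow> 0"
proof (rule tendsto_0_if_le)
 fix e :: real assume "e > 0"
 then have "e / 2 > 0" by simp
 from L1n_le_pmod[OF this] obtain C where C: "\<And>g :: real^'n => 'b. meas g ==> L1n g <= ennreal (e/2) + ennreal C * pmod g"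
  by blast
 have "(%k. ennreal C * pmod (g k)) \<longlonglongrightarrow> 0" by (rule tendsto_0_cmult[OF lim])
 then have "\<forall>\<^sub>F k in sequentially. ennreal C * pmod (g k) < ennreal (e / 2)" using \<open>e > 0\<close> by (intro order_tendstoD) auto
 then show "\<forall>\<^sub>F k in sequentially. L1n (g k) <= ennreal e"
 proof eventually_elim
  fix k assume *: "ennreal C * pmod (g k) < ennreal (e / 2)"
  have "L1n (g k) <= ennreal (e/2) + ennreal C * pmod (g k)" using C[OF g] .
  also have "... <= ennreal (e/2) + ennreal (e/2)" using * by (intro add_left_mono) auto
  also have "... = ennreal e" using \<open>e > 0\<close> by (simp flip: ennreal_plus)
  finally show "L1n (g k) <= ennreal e" .
 qed
qed

text \<open>Values converge only in the mean, gradients in the modular. This mixed notion is stable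
  under smooth truncation and comes with an L1 Poincare inequality; for bounded functions
  \<open>W0_bounded_imp_W01p\<close> returns to the Sobolev space. The gradient is carried along as
  a second component.\<close>

definition W0_via :: "(nat => real^'n => real) => (real^'n => real) => (real^'n => real^'n) => bool" where
 "W0_via \<phi> u g \<longleftrightarrow> meas u & meas g & (ALL k. test_fun \<Omega> (\<phi> k)) &
   (%k. L1n (%x. \<phi> k x - u x)) \<longlonglongrightarrow> 0 & (%k. pmod (%x. grad (\<phi> k) x - g x)) \<longlonglongrightarrow> 0"

definition W0 :: "(real^'n => real) => (real^'n => real^'n) => bool" where
 "W0 u g \<longleftrightarrow> (EX \<phi>. W0_via \<phi> u g)"

lemma W0_M: "W0 u g ==> meas u" "W0 u g ==> meas g"
 by (auto simp: W0_def W0_via_def)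

lemma W0_test:
 assumes "test_fun \<Omega> \<phi>" shows "W0 \<phi> (grad \<phi>)"
proof -
 have "W0_via (%_. \<phi>) \<phi> (grad \<phi>)"
  unfolding W0_via_def using assms test_M grad_M by (simp add: pmod_def)
 then show ?thesis unfolding W0_def by blast
qed

lemma W0_cong:
 assumes "W0 u g" "AE x in M. u x = v x" "AE x in M. g x = h x" "meas v" "meas h"
 shows "W0 v h"
proof -
 obtain \<phi> where \<phi>: "W0_via \<phi> u g" using assms unfolding W0_def by blast
 have "L1n (%x. \<phi> k x - u x) = L1n (%x. \<phi> k x - v x)" for k
  by (rule nn_integral_cong_AE) (use assms(2) in \<open>eventually_elim, simp\<close>)
 moreover have "pmod (%x. grad (\<phi> k) x - g x) = pmod (%x. grad (\<phi> k) x - h x)" for k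
  unfolding pmod_def by (rule nn_integral_cong_AE) (use assms(3) in \<open>eventually_elim, simp\<close>)
 ultimately have "W0_via \<phi> v h" using \<phi> assms(4,5) unfolding W0_via_def by simp
 then show ?thesis unfolding W0_def by blast
qed

lemma pmod_test: "test_fun \<Omega> \<phi> ==> pmod (grad \<phi>) < \<infinity>"
 by (metis pmod_bounded_finite test_bounded)

lemma L1n_test:
 assumes "test_fun \<Omega> \<phi>" shows "L1n \<phi> < \<infinity>"
proof -
 obtain B where B: "\<And>x. \<bar>\<phi> x\<bar> <= B" using test_bounded[OF assms] by metis
 have "L1n \<phi> <= eint (%x. ennreal B)" using B by (intro nn_integral_mono ennreal_leI) auto
 also have "... < \<infinity>" by (simp add: emeasure_M ennreal_mult_less_top)
 finally show ?thesis .
qed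

lemma W0_pmod:
 assumes "W0 u g" shows "pmod g < \<infinity>"
proof -
 obtain \<phi> where \<phi>: "W0_via \<phi> u g" using assms unfolding W0_def by blast
 then have "\<forall>\<^sub>F k in sequentially. pmod (%x. grad (\<phi> k) x - g x) < 1"
  unfolding W0_via_def by (intro order_tendstoD) auto
 then obtain k where k: "pmod (%x. grad (\<phi> k) x - g x) < 1" unfolding eventually_sequentially by blast
 have m: "meas (grad (\<phi> k))" "meas g" and t: "test_fun \<Omega> (\<phi> k)"
  using \<phi> grad_M unfolding W0_via_def by auto
 have "pmod g = pmod (%x. grad (\<phi> k) x - (grad (\<phi> k) x - g x))" by simp
 also have "... <= ennreal (2 powr pp) * (pmod (grad (\<phi> k)) + pmod (%x. grad (\<phi> k) x - g x))"
  using m by (intro pmod_diff) auto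
 also have "... < \<infinity>" using k pmod_test[OF t] by (auto simp: ennreal_mult_less_top intro: less_trans)
 finally show ?thesis .
qed

lemma W0_L1n_grad: "W0 u g ==> L1n g < \<infinity>"
 using L1n_finite W0_pmod W0_M by blast

lemma W0_L1n:
 assumes "W0 u g" shows "L1n u < \<infinity>"
proof -
 obtain \<phi> where \<phi>: "W0_via \<phi> u g" using assms unfolding W0_def by blast
 then have "\<forall>\<^sub>F k in sequentially. L1n (%x. \<phi> k x - u x) < 1"
  unfolding W0_via_def by (intro order_tendstoD) auto
 then obtain k where k: "L1n (%x. \<phi> k x - u x) < 1" unfolding eventually_sequentially by blast
 have m: "meas (\<phi> k)" "meas u" and t: "test_fun \<Omega> (\<phi> k)"
  using \<phi> test_M unfolding W0_via_def by auto
 have "L1n u = L1n (%x. \<phi> k x + (u x - \<phi> k x))" by simp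
 also have "... <= L1n (\<phi> k) + L1n (%x. u x - \<phi> k x)"
  using m by (intro L1n_add) auto
 also have "... < \<infinity>" using k L1n_test[OF t] by (subst L1n_minus_commute) (auto intro: less_trans)
 finally show ?thesis .
qed

lemma W0_integrable: "W0 u g ==> integrable M u" "W0 u g ==> integrable M g"
 using W0_L1n W0_L1n_grad W0_M by (auto simp: integrable_iff_bounded)

lemma W0_lincomb:
 assumes "W0 u g" "W0 v h" shows "W0 (%x. u x + c * v x) (%x. g x + c *\<^sub>R h x)"
proof -
 obtain \<phi> \<psi> where \<phi>: "W0_via \<phi> u g" and \<psi>: "W0_via \<psi> v h" using assms unfolding W0_def by blast
 note [measurable] = W0_M[OF assms(1)] W0_M[OF assms(2)]
 have t: "test_fun \<Omega> (\<phi> k)" "test_fun \<Omega> (\<psi> k)" for k using \<phi> \<psi> unfolding W0_via_def by auto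
 then have [measurable]: "meas (\<phi> k)" "meas (\<psi> k)" "meas (grad (\<phi> k))" "meas (grad (\<psi> k))" for k
  by auto
 have gr: "grad (%x. \<phi> k x + c * \<psi> k x) x = grad (\<phi> k) x + c *\<^sub>R grad (\<psi> k) x" for k x
  using grad_add[OF test_fun_diff[OF t(1)] test_fun_diff[OF test_fun_scale[OF t(2)]]] grad_scale[OF test_fun_diff[OF t(2)]]
  by simp
 have "W0_via (%k x. \<phi> k x + c * \<psi> k x) (%x. u x + c * v x) (%x. g x + c *\<^sub>R h x)"
  unfolding W0_via_def
 proof (intro conjI allI)
  show "test_fun \<Omega> (%x. \<phi> k x + c * \<psi> k x)" for k using t by (intro test_fun_add test_fun_scale)
  show "(%k. L1n (%x. \<phi> k x + c * \<psi> k x - (u x + c * v x))) \<longlonglongrightarrow> 0"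
  proof (rule tendsto_0_bound)
   show "(%k. L1n (%x. \<phi> k x - u x) + ennreal \<bar>c\<bar> * L1n (%x. \<psi> k x - v x)) \<longlonglongrightarrow> 0"
    using \<phi> \<psi> unfolding W0_via_def by (intro tendsto_0_add tendsto_0_cmult) auto
   fix k
   have "L1n (%x. \<phi> k x + c * \<psi> k x - (u x + c * v x)) = L1n (%x. (\<phi> k x - u x) + c * (\<psi> k x - v x))"
    by (simp add: algebra_simps)
   also have "... <= L1n (%x. \<phi> k x - u x) + L1n (%x. c * (\<psi> k x - v x))" by (rule L1n_add) auto
   also have "L1n (%x. c * (\<psi> k x - v x)) = ennreal \<bar>c\<bar> * L1n (%x. \<psi> k x - v x)"
    by (subst nn_integral_cmult[symmetric]) (auto simp: abs_mult ennreal_mult)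
   finally show "L1n (%x. \<phi> k x + c * \<psi> k x - (u x + c * v x)) <= L1n (%x. \<phi> k x - u x) + ennreal \<bar>c\<bar> * L1n (%x. \<psi> k x - v x)" .
  qed
  show "(%k. pmod (%x. grad (%x. \<phi> k x + c * \<psi> k x) x - (g x + c *\<^sub>R h x))) \<longlonglongrightarrow> 0"
  proof (rule tendsto_0_bound)
   show "(%k. ennreal (2 powr pp) * (pmod (%x. grad (\<phi> k) x - g x) + ennreal (max 1 \<bar>c\<bar> powr pp) * pmod (%x. grad (\<psi> k) x - h x))) \<longlonglongrightarrow> 0"
    using \<phi> \<psi> unfolding W0_via_def by (intro tendsto_0_add tendsto_0_cmult) auto
   fix k
   have "pmod (%x. grad (%x. \<phi> k x + c * \<psi> k x) x - (g x + c *\<^sub>R h x)) = pmod (%x. (grad (\<phi> k) x - g x) + c *\<^sub>R (grad (\<psi> k) x - h x))"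
    unfolding gr by (simp add: algebra_simps)
   also have "... <= ennreal (2 powr pp) * (pmod (%x. grad (\<phi> k) x - g x) + pmod (%x. c *\<^sub>R (grad (\<psi> k) x - h x)))" by (rule pmod_add) auto
   also have "... <= ennreal (2 powr pp) * (pmod (%x. grad (\<phi> k) x - g x) + ennreal (max 1 \<bar>c\<bar> powr pp) * pmod (%x. grad (\<psi> k) x - h x))"
    by (intro mult_left_mono add_left_mono pmod_mult_le) auto
   finally show "pmod (%x. grad (%x. \<phi> k x + c * \<psi> k x) x - (g x + c *\<^sub>R h x)) <=
     ennreal (2 powr pp) * (pmod (%x. grad (\<phi> k) x - g x) + ennreal (max 1 \<bar>c\<bar> powr pp) * pmod (%x. grad (\<psi> k) x - h x))" .
  qed
 qed auto
 then show ?thesis unfolding W0_def by blast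
qed

lemma W0_diff: "W0 u g ==> W0 v h ==> W0 (%x. u x - v x) (%x. g x - h x)"
 using W0_lincomb[of u g v h "-1"] by simp

lemma W0_scale:
 assumes "W0 u g" shows "W0 (%x. c * u x) (%x. c *\<^sub>R g x)"
 using W0_lincomb[OF W0_diff[OF assms assms] assms, of c] by simp

lemma pmod_dominated:
 fixes f :: "nat => real^'n => 'b::euclidean_space"
 assumes [measurable]: "\<And>k. meas (f k)" "meas G"
  and dom: "\<And>k. AE x in M. norm (f k x) <= norm (G x :: real)" "pmod G < \<infinity>" and lim: "AE x in M. (%k. f k x) \<longlonglongrightarrow> 0"
 shows "(%k. pmod (f k)) \<longlonglongrightarrow> 0"
proof -
 have "(%k. pmod (f k)) \<longlonglongrightarrow> eint (%x. 0)"
  unfolding pmod_def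
 proof (rule nn_integral_dominated_convergence)
  show "AE x in M. ennreal (norm (f k x) powr p x) <= ennreal (norm (G x) powr p x)" for k
   using dom(1)[of k] AE_space
  proof eventually_elim
   case (elim x)
   then show ?case
    using p_gt1[of x] by (intro ennreal_leI powr_mono2) auto
  qed
  show "AE x in M. (%k. ennreal (norm (f k x) powr p x)) \<longlonglongrightarrow> 0"
   using lim AE_space
  proof eventually_elim
   fix x assume l: "(%k. f k x) \<longlonglongrightarrow> 0" and x: "x \<in> space M"
   have "(%k. norm (f k x) powr p x) \<longlonglongrightarrow> 0"
    by (rule tendsto_zero_powrI[OF tendsto_norm_zero[OF l] tendsto_const]) (use p_gt1[of x] x in auto)
   from tendsto_ennrealI[OF this] show "(%k. ennreal (norm (f k x) powr p x)) \<longlonglongrightarrow> 0" by simp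
  qed
  show "eint (%x. ennreal (norm (G x) powr p x)) < \<infinity>" using dom(2) by (simp add: pmod_def)
 qed auto
 then show ?thesis by simp
qed

text \<open>The difference of gradients splits into G'(\<phi>) (grad \<phi> - g) and (G'(\<phi>) -
  G'(u)) g. The first is small in the modular because G' is bounded, the second by dominated
  convergence, for which an almost everywhere convergent subsequence is extracted.\<close>

lemma W0_via_compose:
 assumes \<phi>: "W0_via \<phi> u g" and G: "smooth1 G" "G 0 = 0" "\<And>t. (G has_real_derivative G' t) (at t)" "\<And>t. \<bar>G' t\<bar> <= L"
 shows "EX r. W0_via (%k x. G (\<phi> (r k) x)) (%x. G (u x)) (%x. G' (u x) *\<^sub>R g x)"
proof -
 have W: "W0 u g" using assms unfolding W0_def by blast
 note [measurable] = W0_M[OF W]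
 have t: "test_fun \<Omega> (\<phi> k)" for k using \<phi> unfolding W0_via_def by auto
 then have [measurable]: "meas (\<phi> k)" "meas (grad (\<phi> k))" for k by auto
 have l1: "(%k. L1n (%x. \<phi> k x - u x)) \<longlonglongrightarrow> 0" and l2: "(%k. pmod (%x. grad (\<phi> k) x - g x)) \<longlonglongrightarrow> 0"
  using \<phi> unfolding W0_via_def by auto
 obtain r :: "nat => nat" where r: "strict_mono r" "AE x in M. (%k. \<phi> (r k) x) \<longlonglongrightarrow> u x"
  using L1_null_AE_subseq[OF _ _ l1] by auto
 have G'c: "continuous_on UNIV G'" using smooth1_deriv_cont G by blast
 have Gc: "continuous_on UNIV G" using G(3) DERIV_isCont by (auto simp: continuous_on_eq_continuous_at)
 note [measurable] = borel_measurable_continuous_onI[OF G'c] borel_measurable_continuous_onI[OF Gc]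
 have L: "0 <= L" using G(4)[of 0] by linarith
 have lip: "\<bar>G s - G t\<bar> <= L * \<bar>s - t\<bar>" for s t
 proof -
  have "norm (G s - G t) <= L * norm (s - t)"
   by (rule field_differentiable_bound[of UNIV G G']) (use G(3,4) in \<open>auto simp: has_field_derivative_at_within\<close>)
  then show ?thesis by simp
 qed
 have gr: "grad (%x. G (\<phi> k x)) x = G' (\<phi> k x) *\<^sub>R grad (\<phi> k) x" for k x
  by (rule grad_compose[OF test_fun_diff[OF t] G(3)])
 have dom: "(%k. pmod (%x. (G' (\<phi> (r k) x) - G' (u x)) *\<^sub>R g x)) \<longlonglongrightarrow> 0"
 proof (rule pmod_dominated[of _ "%x. 2 * L * norm (g x)"])
  have "\<bar>G' s - G' t\<bar> <= 2 * L" for s t using G(4)[of s] G(4)[of t] by linarith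
  then show "AE x in M. norm ((G' (\<phi> (r k) x) - G' (u x)) *\<^sub>R g x) <= norm (2 * L * norm (g x))" for k
   using L by (intro AE_I2) (simp add: abs_mult mult_right_mono)
  have "pmod (%x. 2 * L * norm (g x)) <= ennreal (max 1 (2 * L) powr pp) * pmod (%x. norm (g x))"
   using pmod_mult_le[of "%x. norm (g x)" "%x. 2 * L" "2 * L"] L by simp
  also have "... < \<infinity>" using W0_pmod[OF W] by (simp add: pmod_def ennreal_mult_less_top)
  finally show "pmod (%x. 2 * L * norm (g x)) < \<infinity>" .
  show "AE x in M. (%k. (G' (\<phi> (r k) x) - G' (u x)) *\<^sub>R g x) \<longlonglongrightarrow> 0" using r(2)
  proof eventually_elim
   case (elim x)
   have "(%k. (G' (\<phi> (r k) x) - G' (u x)) *\<^sub>R g x) \<longlonglongrightarrow> (G' (u x) - G' (u x)) *\<^sub>R g x"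
    by (intro tendsto_intros continuous_on_tendsto_compose[OF G'c elim]) auto
   then show ?case by simp
  qed
 qed auto
 have "W0_via (%k x. G (\<phi> (r k) x)) (%x. G (u x)) (%x. G' (u x) *\<^sub>R g x)"
  unfolding W0_via_def
 proof (intro conjI allI)
  show "test_fun \<Omega> (%x. G (\<phi> (r k) x))" for k by (rule test_fun_compose[OF t G(1,2)])
  show "(%k. L1n (%x. G (\<phi> (r k) x) - G (u x))) \<longlonglongrightarrow> 0"
  proof (rule tendsto_0_bound)
   show "(%k. ennreal L * L1n (%x. \<phi> (r k) x - u x)) \<longlonglongrightarrow> 0"
    using LIMSEQ_subseq_LIMSEQ[OF l1 r(1)] by (intro tendsto_0_cmult) (simp add: o_def)
   fix k
   have "L1n (%x. G (\<phi> (r k) x) - G (u x)) <= eint (%x. ennreal L * ennreal (norm (\<phi> (r k) x - u x)))"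
    using lip L by (intro nn_integral_mono) (simp flip: ennreal_mult'')
   then show "L1n (%x. G (\<phi> (r k) x) - G (u x)) <= ennreal L * L1n (%x. \<phi> (r k) x - u x)"
    by (subst (asm) nn_integral_cmult) auto
  qed
  show "(%k. pmod (%x. grad (%x. G (\<phi> (r k) x)) x - G' (u x) *\<^sub>R g x)) \<longlonglongrightarrow> 0"
  proof (rule tendsto_0_bound)
   show "(%k. ennreal (2 powr pp) * (ennreal (max 1 L powr pp) * pmod (%x. grad (\<phi> (r k)) x - g x) + pmod (%x. (G' (\<phi> (r k) x) - G' (u x)) *\<^sub>R g x))) \<longlonglongrightarrow> 0"
    using LIMSEQ_subseq_LIMSEQ[OF l2 r(1)] dom by (intro tendsto_0_add tendsto_0_cmult) (auto simp: o_def)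
   fix k
   have "pmod (%x. grad (%x. G (\<phi> (r k) x)) x - G' (u x) *\<^sub>R g x) =
    pmod (%x. G' (\<phi> (r k) x) *\<^sub>R (grad (\<phi> (r k)) x - g x) + (G' (\<phi> (r k) x) - G' (u x)) *\<^sub>R g x)"
    unfolding gr by (simp add: algebra_simps)
   also have "... <= ennreal (2 powr pp) * (pmod (%x. G' (\<phi> (r k) x) *\<^sub>R (grad (\<phi> (r k)) x - g x)) + pmod (%x. (G' (\<phi> (r k) x) - G' (u x)) *\<^sub>R g x))"
    by (rule pmod_add) auto
   also have "... <= ennreal (2 powr pp) * (ennreal (max 1 L powr pp) * pmod (%x. grad (\<phi> (r k)) x - g x) + pmod (%x. (G' (\<phi> (r k) x) - G' (u x)) *\<^sub>R g x))"
    using G(4) by (intro mult_left_mono add_right_mono pmod_mult_le) auto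
   finally show "pmod (%x. grad (%x. G (\<phi> (r k) x)) x - G' (u x) *\<^sub>R g x) <=
     ennreal (2 powr pp) * (ennreal (max 1 L powr pp) * pmod (%x. grad (\<phi> (r k)) x - g x) + pmod (%x. (G' (\<phi> (r k) x) - G' (u x)) *\<^sub>R g x))" .
  qed
 qed auto
 then show ?thesis by blast
qed

lemma W0_compose:
 assumes "W0 u g" "smooth1 G" "G 0 = 0" "\<And>t. (G has_real_derivative G' t) (at t)" "\<And>t. \<bar>G' t\<bar> <= L"
 shows "W0 (%x. G (u x)) (%x. G' (u x) *\<^sub>R g x)"
 using assms(1) W0_via_compose[OF _ assms(2-5)] unfolding W0_def by blast

text \<open>Carries an L1 inequality from test functions to \<open>W0\<close>; the term with
  \<open>c3\<close> collects the error of replacing \<open>u\<close> by its approximation and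
  disappears in the limit.\<close>

lemma W0_limit_le:
 assumes W: "W0_via \<phi> u g" and a: "\<And>k. a <= ennreal c1 * L1n (grad (\<phi> k)) + ennreal c2 * L1n (\<phi> k) + ennreal c3 * L1n (%x. \<phi> k x - u x)"
 shows "a <= ennreal c1 * L1n g + ennreal c2 * L1n u"
proof -
 have W0: "W0 u g" using W unfolding W0_def by blast
 note [measurable] = W0_M[OF W0]
 have t: "test_fun \<Omega> (\<phi> k)" for k using W unfolding W0_via_def by auto
 then have [measurable]: "meas (\<phi> k)" "meas (grad (\<phi> k))" for k by auto
 have l1: "(%k. L1n (%x. \<phi> k x - u x)) \<longlonglongrightarrow> 0" and l2: "(%k. L1n (%x. grad (\<phi> k) x - g x)) \<longlonglongrightarrow> 0"
  using W unfolding W0_via_def by (auto intro!: L1n_tendsto)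
 have b: "a <= ennreal c1 * (L1n g + L1n (%x. grad (\<phi> k) x - g x)) + ennreal c2 * (L1n u + L1n (%x. \<phi> k x - u x)) + ennreal c3 * L1n (%x. \<phi> k x - u x)" for k
 proof -
  have "L1n (grad (\<phi> k)) <= L1n g + L1n (%x. grad (\<phi> k) x - g x)"
   using L1n_add[of g "%x. grad (\<phi> k) x - g x"] by simp
  moreover have "L1n (\<phi> k) <= L1n u + L1n (%x. \<phi> k x - u x)"
   using L1n_add[of u "%x. \<phi> k x - u x"] by simp
  ultimately show ?thesis by (intro order_trans[OF a] add_mono mult_left_mono) auto
 qed
 have "(%k. ennreal c1 * (L1n g + L1n (%x. grad (\<phi> k) x - g x)) + ennreal c2 * (L1n u + L1n (%x. \<phi> k x - u x)) + ennreal c3 * L1n (%x. \<phi> k x - u x))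
  \<longlonglongrightarrow> ennreal c1 * (L1n g + 0) + ennreal c2 * (L1n u + 0) + ennreal c3 * 0"
  by (intro tendsto_add ennreal_tendsto_cmult tendsto_const l1 l2) auto
 then have "a <= ennreal c1 * (L1n g + 0) + ennreal c2 * (L1n u + 0) + ennreal c3 * 0"
  by (rule LIMSEQ_le_const) (use b in blast)
 then show ?thesis by simp
qed

section \<open>Poincare inequalities and cell averages in \<open>W0\<close>\<close>

lemma W0_local_poincare:
 assumes W: "W0 u g" and \<rho>: "0 < \<rho>" and E: "E \<in> sets M"
 shows "eint (%x. ennreal \<bar>u x\<bar> * indicator E x) <= ennreal (real CARD('n) * \<rho>) * L1n g
   + ennreal (measure M E / (2 * \<rho>) ^ CARD('n)) * L1n u"
proof -
 obtain \<phi> where \<phi>: "W0_via \<phi> u g" using assms unfolding W0_def by blast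
 note [measurable] = W0_M[OF W] E
 have t: "test_fun \<Omega> (\<phi> k)" for k using \<phi> unfolding W0_via_def by auto
 then have [measurable]: "meas (\<phi> k)" "meas (grad (\<phi> k))" for k by auto
 interpret finite_measure M by (rule finite_M)
 show ?thesis
 proof (rule W0_limit_le[OF \<phi>, of _ _ _ 1])
  fix k
  have "eint (%x. ennreal \<bar>u x\<bar> * indicator E x) <= eint (%x. ennreal \<bar>\<phi> k x\<bar> * indicator E x + ennreal \<bar>\<phi> k x - u x\<bar>)"
   by (intro nn_integral_mono) (auto simp flip: ennreal_plus split: split_indicator)
  also have "... = eint (%x. ennreal \<bar>\<phi> k x\<bar> * indicator E x) + L1n (%x. \<phi> k x - u x)"
   by (subst nn_integral_add) auto
  also have "... <= ennreal (real CARD('n) * \<rho>) * L1n (grad (\<phi> k))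
   + ennreal (measure M E / (2 * \<rho>) ^ CARD('n)) * L1n (\<phi> k) + L1n (%x. \<phi> k x - u x)"
  proof (intro add_right_mono)
   have "ennreal (1 / (2 * \<rho>) ^ CARD('n)) * (emeasure M E * L1n (\<phi> k)) = ennreal (measure M E / (2 * \<rho>) ^ CARD('n)) * L1n (\<phi> k)"
    using \<rho> by (simp add: emeasure_eq_measure mult.assoc[symmetric] flip: ennreal_mult'')
   then show "eint (%x. ennreal \<bar>\<phi> k x\<bar> * indicator E x) <= ennreal (real CARD('n) * \<rho>) * L1n (grad (\<phi> k))
     + ennreal (measure M E / (2 * \<rho>) ^ CARD('n)) * L1n (\<phi> k)"
    using test_local_poincare[OF t \<rho> E, of k] by simp
  qed
  finally show "eint (%x. ennreal \<bar>u x\<bar> * indicator E x) <= ennreal (real CARD('n) * \<rho>) * L1n (grad (\<phi> k))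
   + ennreal (measure M E / (2 * \<rho>) ^ CARD('n)) * L1n (\<phi> k) + ennreal 1 * L1n (%x. \<phi> k x - u x)" by simp
 qed
qed

text \<open>The side of the cube is chosen so that the averaging term is absorbed on the left.\<close>

lemma W0_poincare_support:
 assumes W: "W0 u g" and E: "E \<in> sets M" "AE x in M. x \<notin> E --> u x = 0" and m: "measure M E <= m" "0 < m"
 shows "L1n u <= ennreal (2 * real CARD('n) * m powr (1 / real CARD('n))) * L1n g"
proof -
 define \<rho> where "\<rho> = m powr (1 / real CARD('n))"
 have \<rho>: "\<rho> > 0" using m by (simp add: \<rho>_def)
 have "\<rho> ^ CARD('n) = m" using m by (simp add: \<rho>_def powr_realpow[symmetric] powr_powr)
 then have "(2 * \<rho>) ^ CARD('n) = 2 ^ CARD('n) * m" by (simp add: power_mult_distrib)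
 moreover have "(2::real) ^ 1 <= 2 ^ CARD('n)" by (intro power_increasing) (auto simp: Suc_leI)
 ultimately have q: "2 * m <= (2 * \<rho>) ^ CARD('n)" using m by simp
 have half: "measure M E / (2 * \<rho>) ^ CARD('n) <= 1 / 2"
  using q m \<rho> by (simp add: field_simps)
 have "L1n u = eint (%x. ennreal \<bar>u x\<bar> * indicator E x)"
  by (rule nn_integral_cong_AE) (use E(2) in \<open>eventually_elim, auto split: split_indicator\<close>)
 also have "... <= ennreal (real CARD('n) * \<rho>) * L1n g + ennreal (measure M E / (2 * \<rho>) ^ CARD('n)) * L1n u"
  by (rule W0_local_poincare[OF W \<rho> E(1)])
 also have "... <= ennreal (real CARD('n) * \<rho>) * L1n g + ennreal (1/2) * L1n u"
  by (intro add_left_mono mult_right_mono ennreal_leI half) auto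
 finally have *: "L1n u <= ennreal (real CARD('n) * \<rho>) * L1n g + ennreal (1/2) * L1n u" .
 obtain U where U: "L1n u = ennreal U" "U >= 0" using W0_L1n[OF W] by (cases "L1n u") auto
 obtain H where H: "L1n g = ennreal H" "H >= 0" using W0_L1n_grad[OF W] by (cases "L1n g") auto
 have "U <= real CARD('n) * \<rho> * H + 1/2 * U"
 proof -
  have "ennreal (real CARD('n) * \<rho> * H + 1/2 * U) = ennreal (real CARD('n) * \<rho>) * ennreal H + ennreal (1/2) * ennreal U"
   using U H \<rho> by (subst ennreal_plus, simp, simp, subst ennreal_mult, simp, simp, subst ennreal_mult, simp, simp) (rule refl)
  then have "ennreal U <= ennreal (real CARD('n) * \<rho> * H + 1/2 * U)" using * U H by (simp only:)
  then show ?thesis using U H \<rho> by (subst (asm) ennreal_le_iff) auto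
 qed
 then have "U <= 2 * real CARD('n) * \<rho> * H" by simp
 then show ?thesis using U H \<rho> by (simp flip: ennreal_mult'' add: \<rho>_def ennreal_leI)
qed

text \<open>The constant of \<open>W0_poincare_support\<close> for the whole domain; the added 1
  keeps it positive also when the volume is zero.\<close>

definition cP :: real where "cP = 2 * real CARD('n) * (vol + 1) powr (1 / real CARD('n))"

lemma cP_pos: "cP > 0" using vol_nonneg by (simp add: cP_def)

lemma W0_poincare:
 assumes "W0 u g" shows "L1n u <= ennreal cP * L1n g"
proof -
 have "measure M \<Omega> = vol" using emeasure_M vol_nonneg by (simp add: measure_def)
 then show ?thesis unfolding cP_def using vol_nonneg
  by (intro W0_poincare_support[OF assms, of \<Omega>] AE_I2) (auto simp: sets_restrict_space_iff)
qed

lemma W0_cavg: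
 assumes W: "W0 u g" and l: "0 < l"
 shows "eint (%x. ennreal \<bar>u x - cavg l u (cellof l x)\<bar>) <= ennreal (2 ^ CARD('n) * real CARD('n) * l) * L1n g"
proof -
 obtain \<phi> where \<phi>: "W0_via \<phi> u g" using assms unfolding W0_def by blast
 note [measurable] = W0_M[OF W]
 have t: "test_fun \<Omega> (\<phi> k)" for k using \<phi> unfolding W0_via_def by auto
 then have [measurable]: "meas (\<phi> k)" "meas (grad (\<phi> k))" for k by auto
 have "eint (%x. ennreal \<bar>u x - cavg l u (cellof l x)\<bar>) <= ennreal (2 ^ CARD('n) * real CARD('n) * l) * L1n g + ennreal 0 * L1n u"
 \<comment> \<open>Replacing \<open>u\<close> by a test function costs the L1 distance once directly
   and once through the averages, where it is divided by the cell volume and integrated over the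
   domain.\<close>
 proof (rule W0_limit_le[OF \<phi>, of _ _ _ "1 + vol / l ^ CARD('n)"])
  fix k
  let ?d = "L1n (%x. \<phi> k x - u x)" and ?q = "l ^ CARD('n)"
  have "eint (%x. ennreal \<bar>u x - cavg l u (cellof l x)\<bar>) <=
   eint (%x. ennreal \<bar>\<phi> k x - cavg l (\<phi> k) (cellof l x)\<bar> + (ennreal (norm (\<phi> k x - u x)) + ennreal (1 / ?q) * ?d))"
  proof (intro nn_integral_mono)
   fix x
   have "ennreal \<bar>u x - cavg l u (cellof l x)\<bar> <= ennreal (\<bar>\<phi> k x - cavg l (\<phi> k) (cellof l x)\<bar> + (norm (\<phi> k x - u x) + \<bar>cavg l (\<phi> k) (cellof l x) - cavg l u (cellof l x)\<bar>))"
    by (intro ennreal_leI) auto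
   also have "... = ennreal \<bar>\<phi> k x - cavg l (\<phi> k) (cellof l x)\<bar> + (ennreal (norm (\<phi> k x - u x)) + ennreal \<bar>cavg l (\<phi> k) (cellof l x) - cavg l u (cellof l x)\<bar>)"
    by (simp add: ennreal_plus)
   also have "... <= ennreal \<bar>\<phi> k x - cavg l (\<phi> k) (cellof l x)\<bar> + (ennreal (norm (\<phi> k x - u x)) + ennreal (1 / ?q) * ?d)"
    using cavg_diff_le[OF W0_integrable(1)[OF W0_test[OF t]] W0_integrable(1)[OF W] l] by (intro add_left_mono)
   finally show "ennreal \<bar>u x - cavg l u (cellof l x)\<bar> <= ennreal \<bar>\<phi> k x - cavg l (\<phi> k) (cellof l x)\<bar> + (ennreal (norm (\<phi> k x - u x)) + ennreal (1 / ?q) * ?d)" .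
  qed
  also have "... = eint (%x. ennreal \<bar>\<phi> k x - cavg l (\<phi> k) (cellof l x)\<bar>) + (?d + ennreal (1 / ?q) * ?d * ennreal vol)"
   by (subst nn_integral_add, simp, simp, subst nn_integral_add, simp, simp) (simp add: emeasure_M)
  also have "?d + ennreal (1 / ?q) * ?d * ennreal vol = (1 + ennreal (1 / ?q) * ennreal vol) * ?d"
   by (simp add: distrib_right mult_ac)
  also have "1 + ennreal (1 / ?q) * ennreal vol = ennreal (1 + vol / ?q)"
   using l vol_nonneg by (simp flip: ennreal_mult'' ennreal_plus ennreal_1)
  finally show "eint (%x. ennreal \<bar>u x - cavg l u (cellof l x)\<bar>) <= ennreal (2 ^ CARD('n) * real CARD('n) * l) * L1n (grad (\<phi> k))
   + ennreal 0 * L1n (\<phi> k) + ennreal (1 + vol / ?q) * ?d"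
   using test_cavg[OF t l, of k] by (simp add: order_trans[OF _ add_right_mono])
 qed
 then show ?thesis by simp
qed

end

section \<open>Comparison and sup bounds for the p(x)-Laplacian\<close>

lemma tendsto_pflux:
 fixes a :: "'b::euclidean_space"
 assumes "1 < q" "(f \<longlongrightarrow> a) F"
 shows "((%n. pflux q (f n)) \<longlongrightarrow> pflux q a) F"
proof (cases "a = 0")
 case True
 have "((%n. norm (f n)) \<longlongrightarrow> 0) F" using assms(2) True by (intro tendsto_norm_zero) simp
 then have "((%n. norm (f n) powr (q - 1)) \<longlongrightarrow> 0) F"
  by (rule tendsto_zero_powrI[OF _ tendsto_const]) (use assms(1) in auto)
 then have "((%n. norm (pflux q (f n))) \<longlongrightarrow> 0) F" by (simp add: norm_pflux)
 then have "((%n. pflux q (f n)) \<longlongrightarrow> 0) F" by (rule tendsto_norm_zero_cancel)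
 then show ?thesis using True by (simp add: pflux_def)
next
 case False
 then show ?thesis unfolding pflux_def
  by (intro tendsto_intros assms) auto
qed

text \<open>Stampacchia's iteration: along the levels d (1 - 2^-n) the quantity \<open>A\<close>
  decays like V 2^(-n/\<delta>), and \<open>d\<close> is exactly the value for which the induction
  step closes.\<close>

lemma stampacchia_vanish:
 fixes A :: "real => real"
 assumes nonneg: "\<And>k. 0 <= A k" and mono: "\<And>k l. k <= l ==> A l <= A k"
  and A0: "A 0 <= V" "0 < V" and \<delta>: "0 < \<delta>" and B: "0 < B"
  and step: "\<And>k l. 0 <= k ==> k < l ==> (l - k) * A l <= B * A k powr (1 + \<delta>)"
 shows "A (2 * 2 powr (1 / \<delta>) * B * V powr \<delta>) = 0"
proof -
 define d where "d = 2 * 2 powr (1 / \<delta>) * B * V powr \<delta>"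
 have d: "d > 0" using A0 B by (simp add: d_def)
 define k where "k n = d * (1 - (1/2) ^ n)" for n :: nat
 have kd: "k (Suc n) - k n = d * (1/2) ^ Suc n" for n by (simp add: k_def algebra_simps)
 have k0: "0 <= k n" for n using d by (simp add: k_def power_le_one)
 have bound: "A (k n) <= V * 2 powr (- real n / \<delta>)" for n
 proof (induction n)
  case 0
  then show ?case using A0 by (simp add: k_def)
 next
  case (Suc n)
  have "(k (Suc n) - k n) * A (k (Suc n)) <= B * A (k n) powr (1 + \<delta>)"
  proof (rule step[OF k0])
   have "0 < k (Suc n) - k n" unfolding kd using d by simp
   then show "k n < k (Suc n)" by simp
  qed
  also have "... <= B * (V * 2 powr (- real n / \<delta>)) powr (1 + \<delta>)"
   using Suc nonneg B \<delta> by (intro mult_left_mono powr_mono2) auto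
  also have "(V * 2 powr (- real n / \<delta>)) powr (1 + \<delta>) = V * V powr \<delta> * 2 powr (- real n / \<delta> - real n)"
  proof -
   have "- real n / \<delta> * (1 + \<delta>) = - real n / \<delta> - real n" using \<delta> by (simp add: field_simps)
   then have "(2 powr (- real n / \<delta>)) powr (1 + \<delta>) = 2 powr (- real n / \<delta> - real n)" by (simp only: powr_powr)
   moreover have "V powr (1 + \<delta>) = V * V powr \<delta>" using A0 by (simp add: powr_add)
   ultimately show ?thesis using A0 by (simp only: powr_mult)
  qed
  finally have "d * (1/2) ^ Suc n * A (k (Suc n)) <= B * (V * V powr \<delta> * 2 powr (- real n / \<delta> - real n))"
   unfolding kd .
  moreover have "B * (V * V powr \<delta> * 2 powr (- real n / \<delta> - real n)) = d * (1/2) ^ Suc n * (V * 2 powr (- real (Suc n) / \<delta>))"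
  proof -
   have "2 powr (- real n / \<delta> - real n) = 2 powr (- real n / \<delta>) * (1/2)^n"
    by (simp add: powr_diff powr_realpow power_one_over)
   moreover have "2 powr (- real (Suc n) / \<delta>) = 2 powr (- real n / \<delta>) / 2 powr (1 / \<delta>)"
   proof -
    have "- real (Suc n) / \<delta> = (- real n - 1) / \<delta>" by simp
    also have "... = - real n / \<delta> - 1 / \<delta>" by (rule diff_divide_distrib)
    finally have "- real (Suc n) / \<delta> = - real n / \<delta> - 1 / \<delta>" .
    then show ?thesis by (simp only: powr_diff)
   qed
   ultimately show ?thesis by (simp add: d_def)
  qed
  ultimately have "d * (1/2) ^ Suc n * A (k (Suc n)) <= d * (1/2) ^ Suc n * (V * 2 powr (- real (Suc n) / \<delta>))" by (simp only:)
  then show ?case using d by (subst (asm) mult_le_cancel_left_pos) auto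
 qed
 have "(%n. V * 2 powr (- real n / \<delta>)) \<longlonglongrightarrow> V * 0"
 proof (intro tendsto_mult tendsto_const)
  have "(%n. (2 powr (- 1 / \<delta>)) ^ n) \<longlonglongrightarrow> 0"
   using \<delta> by (intro LIMSEQ_realpow_zero) (auto intro: powr_less_one)
  moreover have "(2 powr (- 1 / \<delta>)) ^ n = 2 powr (- real n / \<delta>)" for n
   by (simp add: powr_realpow[symmetric] powr_powr)
  ultimately show "(%n. 2 powr (- real n / \<delta>)) \<longlonglongrightarrow> 0" by simp
 qed
 moreover have "A d <= V * 2 powr (- real n / \<delta>)" for n
  using mono[of "k n" d] bound[of n] d by (auto simp: k_def mult_le_cancel_left1)
 ultimately have "A d <= V * 0" by (intro LIMSEQ_le_const) auto
 then show ?thesis using nonneg[of d] by (simp add: d_def)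
qed

context bounded_open
begin

definition source :: "real => (real^'n => real) => bool" where
 "source \<mu> h \<longleftrightarrow> meas h & (AE x in M. 0 <= h x & h x <= \<mu>)"

lemma source_M: "source \<mu> h ==> meas h" by (simp add: source_def)

lemma source_integrable:
 assumes h: "source \<mu> h" and u: "integrable M u" shows "integrable M (%x. h x * u x)"
proof (rule Bochner_Integration.integrable_bound)
 show "integrable M (%x. \<mu> * u x)" using u by simp
 show "meas (%x. h x * u x)" using h u by (auto simp: source_def)
 have "AE x in M. 0 <= h x & h x <= \<mu>" using h by (simp add: source_def)
 then show "AE x in M. norm (h x * u x) <= norm (\<mu> * u x)"
  by eventually_elim (auto simp: abs_mult intro!: mult_right_mono)
qed

end

context var_exponent
begin

lemma pmod_integrable:
 fixes g :: "real^'n => 'b::euclidean_space"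
 assumes [measurable]: "meas g" and fin: "pmod g < \<infinity>"
 shows "integrable M (%x. norm (g x) powr p x)" and "pmod g = ennreal (LINT x|M. norm (g x) powr p x)"
proof -
 show i: "integrable M (%x. norm (g x) powr p x)"
  using fin by (intro integrableI_bounded) (auto simp: pmod_def)
 show "pmod g = ennreal (LINT x|M. norm (g x) powr p x)"
  unfolding pmod_def using i by (intro nn_integral_eq_integral) auto
qed

lemma pflux_M[measurable]:
 fixes g :: "real^'n => 'b::euclidean_space"
 assumes [measurable]: "meas g" shows "meas (%x. pflux (p x) (g x))"
 unfolding pflux_def by measurable

text \<open>Plays the role of Hoelder's inequality between the flux of one field and another
  field.\<close>

lemma flux_pair_le:
 assumes "0 < \<epsilon>"
 shows "EX C>=0. ALL (\<xi> :: real^'n => 'b::euclidean_space) (\<eta> :: real^'n => 'b). meas \<xi> --> meas \<eta> -->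
   eint (%x. ennreal (norm (\<xi> x) powr (p x - 1) * norm (\<eta> x))) <= ennreal \<epsilon> * pmod \<xi> + ennreal C * pmod \<eta>"
proof -
 obtain C where C: "C >= 0" "\<And>q s t. pm <= q ==> q <= pp ==> 0 <= s ==> 0 <= t ==> s powr (q - 1) * t <= \<epsilon> * s powr q + C * t powr q"
  using powr_young[OF pm assms, of pp] by blast
 show ?thesis
 proof (intro exI[of _ C] conjI allI impI C(1))
  fix \<xi> \<eta> :: "real^'n => 'b" assume [measurable]: "meas \<xi>" "meas \<eta>"
  have "eint (%x. ennreal (norm (\<xi> x) powr (p x - 1) * norm (\<eta> x))) <=
    eint (%x. ennreal \<epsilon> * ennreal (norm (\<xi> x) powr p x) + ennreal C * ennreal (norm (\<eta> x) powr p x))"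
   using C p_lower p_upper assms by (intro nn_integral_mono) (simp flip: ennreal_mult'' ennreal_plus)
  also have "... = ennreal \<epsilon> * pmod \<xi> + ennreal C * pmod \<eta>"
   unfolding pmod_def by (subst nn_integral_add, simp, simp, subst nn_integral_cmult, simp, subst nn_integral_cmult, simp) simp
  finally show "eint (%x. ennreal (norm (\<xi> x) powr (p x - 1) * norm (\<eta> x))) <= ennreal \<epsilon> * pmod \<xi> + ennreal C * pmod \<eta>" .
 qed
qed

lemma norm_pflux_inner_le: "norm (pflux q a \<bullet> b) <= norm a powr (q - 1) * norm b"
 using Cauchy_Schwarz_ineq2[of "pflux q a" b] by (simp add: norm_pflux)

lemma flux_integrable:
 fixes \<xi> \<eta> :: "real^'n => 'b::euclidean_space"
 assumes [measurable]: "meas \<xi>" "meas \<eta>" and fin: "pmod \<xi> < \<infinity>" "pmod \<eta> < \<infinity>"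
 shows "integrable M (%x. pflux (p x) (\<xi> x) \<bullet> \<eta> x)"
proof (rule integrableI_bounded)
 have "(0::real) < 1" by simp
 from flux_pair_le[OF this] obtain C where C: "\<And>(\<xi> :: real^'n => 'b) (\<eta> :: real^'n => 'b). meas \<xi> ==> meas \<eta> ==>
   eint (%x. ennreal (norm (\<xi> x) powr (p x - 1) * norm (\<eta> x))) <= ennreal 1 * pmod \<xi> + ennreal C * pmod \<eta>"
  by blast
 have "eint (%x. ennreal (norm (\<xi> x) powr (p x - 1) * norm (\<eta> x))) <= ennreal 1 * pmod \<xi> + ennreal C * pmod \<eta>"
  by (rule C) fact+
 also have "... < \<infinity>" using fin by (simp add: ennreal_mult_less_top)
 finally have "eint (%x. ennreal (norm (\<xi> x) powr (p x - 1) * norm (\<eta> x))) < \<infinity>" .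
 moreover have "L1n (%x. pflux (p x) (\<xi> x) \<bullet> \<eta> x) <= eint (%x. ennreal (norm (\<xi> x) powr (p x - 1) * norm (\<eta> x)))"
  by (intro nn_integral_mono ennreal_leI norm_pflux_inner_le)
 ultimately show "L1n (%x. pflux (p x) (\<xi> x) \<bullet> \<eta> x) < \<infinity>" by (rule le_less_trans[rotated])
qed simp

definition weak_sol :: "(real^'n => real) => (real^'n => real) => (real^'n => real^'n) => bool" where
 "weak_sol h u g \<longleftrightarrow> W0 u g &
   (ALL \<phi> \<zeta>. W0 \<phi> \<zeta> --> (LINT x|M. pflux (p x) (g x) \<bullet> \<zeta> x) = (LINT x|M. h x * \<phi> x))"

lemma weak_solD:
 assumes "weak_sol h u g"
 shows "W0 u g" "W0 \<phi> \<zeta> ==> (LINT x|M. pflux (p x) (g x) \<bullet> \<zeta> x) = (LINT x|M. h x * \<phi> x)"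
 using assms by (simp_all add: weak_sol_def)

lemma W0_flux_integrable: "W0 u g ==> W0 v h ==> integrable M (%x. pflux (p x) (g x) \<bullet> h x)"
 by (intro flux_integrable W0_M W0_pmod)

lemma W0_zero: "W0 (%x. 0) (%x. 0)"
proof -
 have t: "test_fun \<Omega> (%x. 0)" by (rule test_funI[of _ "{}"]) (auto intro: smooth_on_const)
 have "grad (%x::real^'n. 0::real) = (%x. 0)" by (intro ext grad_eqI) auto
 then show ?thesis using W0_test[OF t] by simp
qed

text \<open>A smooth stand-in for the positive part of u - k, truncated at height \<tau>: it
  vanishes for u <= k, is at most \<tau>, and has slope between 0 and 1. The sign of the level makes
  the outer function vanish at 0, so that zero boundary values survive.\<close>

lemma W0_bmp:
 assumes "W0 u g" "0 < \<tau>" "0 <= k"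
 shows "W0 (%x. \<tau> * bmp 0 ((u x - k) / \<tau>)) (%x. bmp 2 ((u x - k) / \<tau>) *\<^sub>R g x)"
proof (rule W0_compose[OF assms(1), of "%t. \<tau> * bmp 0 ((t - k) / \<tau>)" "%t. bmp 2 ((t - k) / \<tau>)" 1])
 show "smooth1 (%t. \<tau> * bmp 0 ((t - k) / \<tau>))" by (rule smooth1_bmp0)
 show "\<tau> * bmp 0 ((0 - k) / \<tau>) = 0" using assms by (simp add: bmp_le0)
 show "\<bar>bmp 2 ((t - k) / \<tau>)\<bar> <= 1" for t using bmp2_le1 bmp_nonneg by (simp add: abs_le_iff)
 show "((%t. \<tau> * bmp 0 ((t - k) / \<tau>)) has_real_derivative bmp 2 ((t - k) / \<tau>)) (at t)" for t
 proof -
  have "((%t. (t - k) / \<tau>) has_real_derivative 1 / \<tau>) (at t)" by (auto intro!: derivative_eq_intros simp: divide_inverse)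
  from DERIV_cmult[OF DERIV_chain2[OF bmp0_deriv this], of \<tau>] show ?thesis using assms by simp
 qed
qed

text \<open>Testing with \<open>bmp 0 (w x - u x)\<close> leaves a nonnegative integrand with
  nonpositive integral; strict monotonicity of the flux then makes the gradient of the test function
  vanish, and the Poincare inequality the test function itself. The inequality between the fluxes is
  demanded only for test functions living where \<open>w\<close> exceeds \<open>u\<close>.\<close>

lemma comparison:
 assumes w: "W0 w \<gamma>" and u: "W0 u g"
  and le: "\<And>\<phi> \<zeta>. W0 \<phi> \<zeta> ==> (AE x in M. 0 <= \<phi> x & (w x <= u x --> \<phi> x = 0)) ==>
    (LINT x|M. pflux (p x) (\<gamma> x) \<bullet> \<zeta> x) <= (LINT x|M. pflux (p x) (g x) \<bullet> \<zeta> x)"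
 shows "AE x in M. w x <= u x"
proof -
 note [measurable] = W0_M[OF w] W0_M[OF u]
 define \<phi> where "\<phi> x = bmp 0 (w x - u x)" for x
 define \<zeta> where "\<zeta> x = bmp 2 (w x - u x) *\<^sub>R (\<gamma> x - g x)" for x
 have W: "W0 \<phi> \<zeta>" using W0_bmp[OF W0_diff[OF w u], of 1 0] unfolding \<phi>_def \<zeta>_def by simp
 have "(LINT x|M. pflux (p x) (\<gamma> x) \<bullet> \<zeta> x) <= (LINT x|M. pflux (p x) (g x) \<bullet> \<zeta> x)"
  by (rule le[OF W]) (auto simp: \<phi>_def bmp_nonneg bmp_le0)
 moreover have i: "integrable M (%x. pflux (p x) (\<gamma> x) \<bullet> \<zeta> x)" "integrable M (%x. pflux (p x) (g x) \<bullet> \<zeta> x)"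
  using W0_flux_integrable w u W by blast+
 ultimately have le0: "(LINT x|M. (pflux (p x) (\<gamma> x) - pflux (p x) (g x)) \<bullet> \<zeta> x) <= 0"
  by (simp add: inner_diff_left)
 have i0: "integrable M (%x. (pflux (p x) (\<gamma> x) - pflux (p x) (g x)) \<bullet> \<zeta> x)" using i by (simp add: inner_diff_left)
 have p1: "1 < p x" if "x \<in> \<Omega>" for x using p_lower[OF that] pm by simp
 have nn: "AE x in M. 0 <= (pflux (p x) (\<gamma> x) - pflux (p x) (g x)) \<bullet> \<zeta> x"
  using p1 by (intro AE_I2) (auto simp: \<zeta>_def intro!: mult_nonneg_nonneg bmp_nonneg pflux_mono)
 have "(LINT x|M. (pflux (p x) (\<gamma> x) - pflux (p x) (g x)) \<bullet> \<zeta> x) = 0"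
  using le0 integral_nonneg_AE[OF nn] by simp
 then have "AE x in M. (pflux (p x) (\<gamma> x) - pflux (p x) (g x)) \<bullet> \<zeta> x = 0"
  using integral_nonneg_eq_0_iff_AE[OF i0 nn] by simp
 then have "AE x in M. \<zeta> x = 0"
  using AE_space
 proof eventually_elim
  fix x assume *: "(pflux (p x) (\<gamma> x) - pflux (p x) (g x)) \<bullet> \<zeta> x = 0" and x: "x \<in> space M"
  show "\<zeta> x = 0"
  proof (cases "bmp 2 (w x - u x) = 0")
   case False
   then have "(pflux (p x) (\<gamma> x) - pflux (p x) (g x)) \<bullet> (\<gamma> x - g x) = 0" using * by (simp add: \<zeta>_def)
   then have "\<gamma> x = g x" using pflux_strict_mono[of "p x" "\<gamma> x" "g x"] p1 x by simp
   then show ?thesis by (simp add: \<zeta>_def)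
  qed (simp add: \<zeta>_def)
 qed
 then have "L1n \<zeta> = 0" using W0_M[OF W] by (subst nn_integral_0_iff_AE) auto
 then have "L1n \<phi> = 0" using W0_poincare[OF W] by simp
 then have "AE x in M. \<phi> x = 0" using W0_M[OF W] by (subst (asm) nn_integral_0_iff_AE) auto
 then show ?thesis
 proof eventually_elim
  case (elim x)
  then show ?case using bmp_pos[of "w x - u x" 0] by (force simp: \<phi>_def)
 qed
qed

lemma weak_sol_nonneg:
 assumes "weak_sol h u g" "source \<mu> h" shows "AE x in M. 0 <= u x"
proof (rule comparison[OF W0_zero])
 show u: "W0 u g" using assms by (simp add: weak_sol_def)
 fix \<phi> \<zeta> assume W: "W0 \<phi> \<zeta>" and ae: "AE x in M. 0 <= \<phi> x & (0 <= u x --> \<phi> x = 0)"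
 have "(LINT x|M. pflux (p x) (g x) \<bullet> \<zeta> x) = (LINT x|M. h x * \<phi> x)" using assms W by (simp add: weak_sol_def)
 also have "... >= 0"
 proof (rule integral_nonneg_AE)
  have "AE x in M. 0 <= h x & h x <= \<mu>" using assms by (simp add: source_def)
  with ae show "AE x in M. 0 <= h x * \<phi> x" by eventually_elim auto
 qed
 finally show "(LINT x|M. pflux (p x) 0 \<bullet> \<zeta> x) <= (LINT x|M. pflux (p x) (g x) \<bullet> \<zeta> x)" by (simp add: pflux_def)
qed

text \<open>The level of \<open>stampacchia_vanish\<close> for \<delta> = 1/N, V = vol + 1 and B = 4
  N e s, with the scale \<open>s\<close> factored out.\<close>

definition cInf :: real where
 "cInf = 2 * 2 powr (1 / (1 / real CARD('n))) * (4 * real CARD('n) * exp 1) * (vol + 1) powr (1 / real CARD('n))"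

lemma cInf_pos: "cInf > 0" using vol_nonneg by (simp add: cInf_def)

text \<open>The bound is linear in the scale \<open>s\<close>, which later allows the upper
  constants to be chosen. Testing with the truncation at level \<open>k\<close> bounds the energy
  above \<open>k\<close>; \<open>le_add_powr\<close> converts it into an L1 bound of the gradient,
  the Poincare inequality on the set u > k brings in its measure, and the smallness
  \<open>cP * \<mu> * \<sigma> <= 1 / 2\<close> absorbs what remains. The outcome is Stampacchia's
  recursion.\<close>

lemma weak_sol_bounded:
 assumes sol: "weak_sol h u g" and h: "source \<mu> h" and \<mu>: "0 <= \<mu>"
  and s: "0 < s" "\<And>x. x \<in> \<Omega> ==> s powr (1 - p x) <= \<sigma>" "cP * \<mu> * \<sigma> <= 1 / 2"
 shows "AE x in M. u x <= cInf * s"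
proof -
 let ?N = "real CARD('n)"
 have W: "W0 u g" using sol by (simp add: weak_sol_def)
 note [measurable] = W0_M[OF W] source_M[OF h]
 interpret finite_measure M by (rule finite_M)
 define A where "A k = measure M {x \<in> \<Omega>. u x > k}" for k
 have S[measurable]: "{x \<in> \<Omega>. u x > k} \<in> sets M" for k
  using measurable_sets[OF W0_M(1)[OF W], of "{k<..}"] by (simp add: vimage_def Int_def conj_commute)
 have SE[simp]: "{x \<in> \<Omega>. k < u x & x \<in> \<Omega>} = {x \<in> \<Omega>. k < u x}" for k by auto
 have p1: "1 < p x" if "x \<in> \<Omega>" for x using p_lower[OF that] pm by simp
 have bm[measurable]: "bmp 0 \<in> borel_measurable borel" "bmp 2 \<in> borel_measurable borel"
  by (auto intro!: borel_measurable_continuous_onI simp: continuous_on_eq_continuous_at intro: DERIV_isCont[OF bmp_deriv])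
 have step: "(l - k) * A l <= 4 * ?N * exp 1 * s * A k powr (1 + 1 / ?N)" if kl: "0 <= k" "k < l" for k l
 proof (cases "A k = 0")
  case True
  have "A l <= A k" unfolding A_def using kl by (intro finite_measure_mono) auto
  then have "A l = 0" using True unfolding A_def by (simp add: antisym)
  then show ?thesis using s by simp
 next
  case False
  then have Ak: "A k > 0" unfolding A_def by (simp add: less_le)
  define \<tau> where "\<tau> = l - k"
  have \<tau>: "\<tau> > 0" using kl by (simp add: \<tau>_def)
  define b where "b x = bmp 2 ((u x - k) / \<tau>)" for x
  define \<phi> where "\<phi> x = \<tau> * bmp 0 ((u x - k) / \<tau>)" for x
  have W\<phi>: "W0 \<phi> (%x. b x *\<^sub>R g x)" unfolding \<phi>_def b_def by (rule W0_bmp[OF W \<tau> kl(1)])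
  note [measurable] = W0_M[OF W\<phi>]
  have bM[measurable]: "meas b" unfolding b_def by measurable
  have b: "0 <= b x" "b x <= 1" "u x <= k ==> b x = 0" for x
   using \<tau> by (auto simp: b_def bmp_nonneg bmp2_le1 bmp_le0 field_simps)
  have \<phi>0: "0 <= \<phi> x" "u x <= k ==> \<phi> x = 0" for x
   using \<tau> by (auto simp: \<phi>_def bmp_nonneg bmp_le0 field_simps)
  have i\<phi>: "integrable M \<phi>" and ig: "integrable M (%x. b x *\<^sub>R g x)" using W0_integrable[OF W\<phi>] .
  have ip: "integrable M (%x. b x * norm (g x) powr p x)"
   by (rule Bochner_Integration.integrable_bound[OF pmod_integrable(1)[of g]])
     (use W0_pmod[OF W] b in \<open>auto intro!: mult_left_le_one_le\<close>)
  have e1: "(LINT x|M. b x * norm (g x) powr p x) = (LINT x|M. h x * \<phi> x)"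
  proof -
   have "(LINT x|M. b x * norm (g x) powr p x) = (LINT x|M. pflux (p x) (g x) \<bullet> (b x *\<^sub>R g x))"
    by (intro Bochner_Integration.integral_cong) (auto simp: pflux_inner_self p1)
   also have "... = (LINT x|M. h x * \<phi> x)" by (rule weak_solD(2)[OF sol W\<phi>])
   finally show ?thesis .
  qed
  also have "... <= (LINT x|M. \<mu> * \<phi> x)"
  proof (rule integral_mono_AE)
   have "AE x in M. 0 <= h x & h x <= \<mu>" using h by (simp add: source_def)
   then show "AE x in M. h x * \<phi> x <= \<mu> * \<phi> x" by eventually_elim (auto intro: mult_right_mono \<phi>0)
  qed (use source_integrable[OF h i\<phi>] i\<phi> in auto)
  finally have e1: "(LINT x|M. b x * norm (g x) powr p x) <= \<mu> * (LINT x|M. \<phi> x)" by simp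
  have \<sigma>0: "0 <= \<sigma>"
  proof -
   have "{x \<in> \<Omega>. u x > k} ~= {}" using Ak unfolding A_def by (metis measure_empty less_irrefl)
   then obtain x where "x \<in> \<Omega>" by auto
   from s(2)[OF this] show ?thesis by (smt (verit) powr_ge_zero)
  qed
  have e2: "(LINT x|M. norm (b x *\<^sub>R g x)) <= s * A k + \<sigma> * (\<mu> * (LINT x|M. \<phi> x))"
  proof -
   have "(LINT x|M. norm (b x *\<^sub>R g x)) <= (LINT x|M. s * indicator {x \<in> \<Omega>. u x > k} x + \<sigma> * (b x * norm (g x) powr p x))"
   proof (rule integral_mono)
    show "integrable M (%x. s * indicator {x \<in> \<Omega>. u x > k} x + \<sigma> * (b x * norm (g x) powr p x))"
     using ip by (intro Bochner_Integration.integrable_add integrable_mult_right integrable_real_indicator) (auto simp: emeasure_eq_measure)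
    fix x assume x: "x \<in> space M"
    show "norm (b x *\<^sub>R g x) <= s * indicator {x \<in> \<Omega>. u x > k} x + \<sigma> * (b x * norm (g x) powr p x)"
    proof (cases "u x > k")
     case True
     have "norm (g x) <= s + s powr (1 - p x) * norm (g x) powr p x"
      using p1 x s by (intro le_add_powr) auto
     also have "... <= s + \<sigma> * norm (g x) powr p x" using s(2) x by (intro add_left_mono mult_right_mono) auto
     finally have "b x * norm (g x) <= b x * (s + \<sigma> * norm (g x) powr p x)" using b by (intro mult_left_mono) auto
     also have "... <= s + \<sigma> * (b x * norm (g x) powr p x)"
      using mult_left_le_one_le[of s "b x"] b[of x] s by (simp add: algebra_simps)
     finally show ?thesis using True x b[of x] by simp
    next
     case False
     then show ?thesis using b(3)[of x] by simp
    qed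
   qed (use integrable_norm[OF ig] in simp)
   also have "... = s * A k + \<sigma> * (LINT x|M. b x * norm (g x) powr p x)"
    using ip by (subst Bochner_Integration.integral_add) (auto simp: A_def emeasure_eq_measure integrable_real_indicator Int_def)
   also have "... <= s * A k + \<sigma> * (\<mu> * (LINT x|M. \<phi> x))"
    using e1 \<sigma>0 by (intro add_left_mono mult_left_mono) auto
   finally show ?thesis .
  qed
  \<comment> \<open>The Poincare constant of the level set, used twice: its bound by
    \<open>cP\<close> permits the absorption, and its power of \<open>A k\<close> is the gain in the
    recursion.\<close>
  define c where "c = 2 * ?N * A k powr (1 / ?N)"
  have c: "0 <= c" "c <= cP"
  proof -
   have "A k <= measure M \<Omega>" unfolding A_def using finite_measure_mono[of _ \<Omega>] by (simp add: sets_restrict_space_iff)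
   also have "... = vol" using emeasure_M vol_nonneg by (simp add: measure_def)
   finally show "c <= cP" unfolding c_def cP_def using Ak by (intro mult_left_mono powr_mono2) auto
  qed (simp add: c_def)
  have P: "(LINT x|M. \<phi> x) <= c * (LINT x|M. norm (b x *\<^sub>R g x))"
  proof -
   have "L1n \<phi> <= ennreal c * L1n (%x. b x *\<^sub>R g x)"
    unfolding c_def by (rule W0_poincare_support[OF W\<phi> S[of k]]) (use \<phi>0 Ak in \<open>auto simp: A_def not_less\<close>)
   moreover have "L1n \<phi> = ennreal (LINT x|M. \<phi> x)"
    using i\<phi> \<phi>0(1) by (simp add: nn_integral_eq_integral)
   moreover have "L1n (%x. b x *\<^sub>R g x) = ennreal (LINT x|M. norm (b x *\<^sub>R g x))"
    using integrable_norm[OF ig] by (intro nn_integral_eq_integral) auto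
   ultimately have "ennreal (LINT x|M. \<phi> x) <= ennreal (c * (LINT x|M. norm (b x *\<^sub>R g x)))"
    using c by (simp add: ennreal_mult)
   then show ?thesis using c by (subst (asm) ennreal_le_iff) (auto intro!: mult_nonneg_nonneg integral_nonneg_AE)
  qed
  have "(LINT x|M. \<phi> x) <= c * (s * A k + \<sigma> * (\<mu> * (LINT x|M. \<phi> x)))"
   using P e2 c by (meson mult_left_mono order_trans)
  also have "... = c * s * A k + (c * \<mu> * \<sigma>) * (LINT x|M. \<phi> x)" by (simp add: algebra_simps)
  also have "... <= c * s * A k + 1 / 2 * (LINT x|M. \<phi> x)"
  proof -
   have "c * \<mu> * \<sigma> <= cP * \<mu> * \<sigma>" using c \<mu> \<sigma>0 by (intro mult_right_mono) auto
   then have "c * \<mu> * \<sigma> <= 1 / 2" using s(3) by linarith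
   then show ?thesis using \<phi>0(1) by (intro add_left_mono mult_right_mono integral_nonneg_AE) auto
  qed
  finally have I: "(LINT x|M. \<phi> x) <= 2 * c * s * A k" by simp
  \<comment> \<open>Above \<open>l\<close> the argument of \<open>bmp 0\<close> is at least 1, so
    the test function is at least \<tau>/e there.\<close>
  have "\<tau> * exp (-1) * A l = (LINT x|M. \<tau> * exp (-1) * indicator {x \<in> \<Omega>. u x > l} x)"
   by (simp add: A_def Int_def)
  also have "... <= (LINT x|M. \<phi> x)"
  proof (rule integral_mono)
   show "integrable M (%x. \<tau> * exp (-1) * indicator {x \<in> \<Omega>. u x > l} x)"
    by (intro integrable_mult_right integrable_real_indicator) (auto simp: emeasure_eq_measure)
   fix x
   show "\<tau> * exp (-1) * indicator {x \<in> \<Omega>. u x > l} x <= \<phi> x"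
   proof (cases "u x > l")
    case True
    then have ul: "(u x - k) / \<tau> >= 1" using \<tau> by (simp add: \<tau>_def)
    then have "1 / ((u x - k) / \<tau>) <= 1" by (subst divide_le_eq_1_pos) auto
    then have "exp (-1) <= bmp 0 ((u x - k) / \<tau>)" using ul unfolding bmp_def by simp
    then show ?thesis using \<tau> \<phi>0(1)[of x] by (auto simp: bmp_nonneg \<phi>_def split: split_indicator)
   qed (use \<phi>0 in auto)
  qed (rule i\<phi>)
  finally have "\<tau> * exp (-1) * A l <= 2 * c * s * A k" using I by linarith
  then have "exp 1 * (\<tau> * exp (-1) * A l) <= exp 1 * (2 * c * s * A k)" by (intro mult_left_mono) auto
  then have "\<tau> * A l <= exp 1 * (2 * c * s * A k)" by (simp add: exp_minus field_simps)
  also have "... = 4 * ?N * exp 1 * s * A k powr (1 + 1 / ?N)"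
   using Ak by (simp add: c_def powr_add)
  finally show ?thesis by (simp add: \<tau>_def)
 qed
 have "A (2 * 2 powr (1 / (1 / ?N)) * (4 * ?N * exp 1 * s) * (vol + 1) powr (1 / ?N)) = 0"
 proof (rule stampacchia_vanish)
  show "A l <= A k" if "k <= l" for k l unfolding A_def using that by (intro finite_measure_mono) auto
  have "A 0 <= measure M \<Omega>" unfolding A_def using finite_measure_mono[of _ \<Omega>] by (simp add: sets_restrict_space_iff)
  also have "... = vol" using emeasure_M vol_nonneg by (simp add: measure_def)
  finally show "A 0 <= vol + 1" by simp
 qed (use vol_nonneg s step in \<open>auto simp: A_def\<close>)
 then have "A (cInf * s) = 0" by (simp add: cInf_def mult_ac)
 then have "emeasure M {x \<in> \<Omega>. u x > cInf * s} = 0" unfolding A_def by (simp add: emeasure_eq_measure)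
 then have "AE x in M. x \<notin> {x \<in> \<Omega>. u x > cInf * s}" by (intro AE_not_in) (auto simp: null_sets_def)
 then show ?thesis using AE_space by eventually_elim (auto simp: not_less)
qed

end

section \<open>Continuity of the solution operator\<close>

context var_exponent
begin

text \<open>For s >= 1 the worst exponent is \<open>pm\<close>, and the chosen \<open>s\<close>
  makes s^(1 - pm) equal to 1/(2a + 1).\<close>

lemma scale_exists:
 assumes "0 <= a"
 shows "EX s \<sigma>. 0 < s & 0 <= \<sigma> & (ALL x:\<Omega>. s powr (1 - p x) <= \<sigma>) & a * \<sigma> <= 1 / 2"
proof -
 define s where "s = (2 * a + 1) powr (1 / (pm - 1))"
 have s1: "1 <= s" unfolding s_def using assms pm by (intro ge_one_powr_ge_zero) auto
 have le: "s powr (1 - p x) <= s powr (1 - pm)" if "x \<in> \<Omega>" for x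
  using p_lower[OF that] s1 by (intro powr_mono) auto
 have e: "s powr (1 - pm) = 1 / (2 * a + 1)"
 proof -
  have "s powr (1 - pm) = (2 * a + 1) powr (1 / (pm - 1) * (1 - pm))" by (simp add: s_def powr_powr)
  also have "1 / (pm - 1) * (1 - pm) = - 1" using pm by (simp add: field_simps)
  finally show ?thesis using assms by (simp add: powr_minus_divide)
 qed
 have "a * s powr (1 - pm) <= 1 / 2" unfolding e using assms by (simp add: field_simps)
 then show ?thesis using s1 le
  by (rule_tac exI[of _ s], rule_tac exI[of _ "s powr (1 - pm)"]) auto
qed

text \<open>Obtained by choice: for continuity and compactness it matters only that the bound
  depends on \<mu> alone.\<close>

definition ubound :: "real => real" where
 "ubound \<mu> = (SOME K. 0 <= K & (ALL h u g. weak_sol h u g --> source \<mu> h --> (AE x in M. 0 <= u x & u x <= K)))"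

lemma ubound:
 assumes "0 <= \<mu>"
 shows "0 <= ubound \<mu>" "weak_sol h u g ==> source \<mu> h ==> AE x in M. 0 <= u x & u x <= ubound \<mu>"
proof -
 have "0 <= cP * \<mu>" using assms cP_pos by simp
 from scale_exists[OF this] obtain s \<sigma> where s: "0 < s" "\<And>x. x \<in> \<Omega> ==> s powr (1 - p x) <= \<sigma>" "cP * \<mu> * \<sigma> <= 1 / 2" by blast
 have "EX K. 0 <= K & (ALL h u g. weak_sol h u g --> source \<mu> h --> (AE x in M. 0 <= u x & u x <= K))"
 proof (intro exI[of _ "cInf * s"] conjI allI impI)
  show "0 <= cInf * s" using cInf_pos s by simp
  fix h u g assume "weak_sol h u g" "source \<mu> h"
  then show "AE x in M. 0 <= u x & u x <= cInf * s"
   using weak_sol_bounded[OF _ _ assms s] weak_sol_nonneg by (intro AE_conjI) blast+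
 qed
 from someI_ex[OF this] have *: "0 <= ubound \<mu> & (ALL h u g. weak_sol h u g --> source \<mu> h --> (AE x in M. 0 <= u x & u x <= ubound \<mu>))"
  unfolding ubound_def .
 then show "0 <= ubound \<mu>" by blast
 show "weak_sol h u g ==> source \<mu> h ==> AE x in M. 0 <= u x & u x <= ubound \<mu>" using * by blast
qed

lemma integral_norm_grad_powr:
 assumes "weak_sol h u g"
 shows "(LINT x|M. norm (g x) powr p x) = (LINT x|M. h x * u x)"
proof -
 have p1: "1 < p x" if "x \<in> \<Omega>" for x using p_lower[OF that] pm by simp
 have "(LINT x|M. norm (g x) powr p x) = (LINT x|M. pflux (p x) (g x) \<bullet> g x)"
  by (intro Bochner_Integration.integral_cong) (auto simp: pflux_inner_self p1)
 also have "... = (LINT x|M. h x * u x)" by (rule weak_solD(2)[OF assms weak_solD(1)[OF assms]])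
 finally show ?thesis .
qed

lemma integral_bound_vol:
 assumes "integrable M f" "AE x in M. f x <= c"
 shows "(LINT x|M. f x) <= c * vol"
proof -
 interpret finite_measure M by (rule finite_M)
 have "(LINT x|M. f x) <= (LINT x|M. c)" using assms by (intro integral_mono_AE) auto
 also have "... = c * vol" using emeasure_M vol_nonneg by (simp add: measure_def)
 finally show ?thesis .
qed

lemma weak_sol_pmod:
 assumes sol: "weak_sol h u g" and h: "source \<mu> h" and \<mu>: "0 <= \<mu>"
 shows "pmod g <= ennreal (\<mu> * ubound \<mu> * vol)"
proof -
 have W: "W0 u g" using sol by (rule weak_solD)
 have "pmod g = ennreal (LINT x|M. h x * u x)"
  using pmod_integrable(2)[OF W0_M(2)[OF W] W0_pmod[OF W]] integral_norm_grad_powr[OF sol] by simp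
 also have "(LINT x|M. h x * u x) <= \<mu> * ubound \<mu> * vol"
 proof (rule integral_bound_vol[OF source_integrable[OF h W0_integrable(1)[OF W]]])
  have "AE x in M. 0 <= h x & h x <= \<mu>" using h by (simp add: source_def)
  with ubound(2)[OF \<mu> sol h] show "AE x in M. h x * u x <= \<mu> * ubound \<mu>"
   by eventually_elim (auto intro: mult_mono \<mu>)
 qed
 finally show ?thesis by (simp add: ennreal_leI)
qed

definition gbound :: "real => real" where
 "gbound \<mu> = (SOME K. 0 <= K & (ALL h u g. weak_sol h u g --> source \<mu> h --> L1n g <= ennreal K))"

lemma gbound:
 assumes "0 <= \<mu>"
 shows "0 <= gbound \<mu>" "weak_sol h u g ==> source \<mu> h ==> L1n g <= ennreal (gbound \<mu>)"
proof -
 have "(0::real) < 1" by simp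
 from L1n_le_pmod[OF this] obtain C where C: "C >= 0" "\<And>g :: real^'n => real^'n. meas g ==> L1n g <= ennreal 1 + ennreal C * pmod g" by blast
 define K where "K = 1 + C * (\<mu> * ubound \<mu> * vol)"
 have K0: "0 <= \<mu> * ubound \<mu> * vol" using assms ubound(1)[OF assms] vol_nonneg by simp
 have "EX K. 0 <= K & (ALL h u g. weak_sol h u g --> source \<mu> h --> L1n g <= ennreal K)"
 proof (intro exI[of _ K] conjI allI impI)
  show "0 <= K" using K0 C by (simp add: K_def)
  fix h u g assume s: "weak_sol h u g" "source \<mu> h"
  have "L1n g <= ennreal 1 + ennreal C * pmod g" by (rule C(2)[OF W0_M(2)[OF weak_solD(1)[OF s(1)]]])
  also have "... <= ennreal 1 + ennreal C * ennreal (\<mu> * ubound \<mu> * vol)"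
   by (intro add_left_mono mult_left_mono weak_sol_pmod[OF s assms]) auto
  also have "... = ennreal K" unfolding K_def using C K0 by (subst ennreal_plus) (auto simp: ennreal_mult)
  finally show "L1n g <= ennreal K" .
 qed
 from someI_ex[OF this] have *: "0 <= gbound \<mu> & (ALL h u g. weak_sol h u g --> source \<mu> h --> L1n g <= ennreal (gbound \<mu>))"
  unfolding gbound_def .
 then show "0 <= gbound \<mu>" by blast
 show "weak_sol h u g ==> source \<mu> h ==> L1n g <= ennreal (gbound \<mu>)" using * by blast
qed

lemma pmod_diff_le_gap:
 assumes "0 < \<epsilon>"
 shows "EX C>=0. ALL (f :: real^'n => 'b::euclidean_space) (g :: real^'n => 'b). meas f --> meas g -->
   pmod (%x. f x - g x) <= ennreal \<epsilon> * (pmod f + pmod g) + ennreal C * eint (%x. ennreal (cvx_gap (p x) (f x) (g x)))"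
proof -
 obtain C where C: "C >= 0" "\<And>q (a::'b) b. pm <= q ==> q <= pp ==> norm (a - b) powr q <= \<epsilon> * (norm a powr q + norm b powr q) + C * cvx_gap q a b"
  using powr_diff_le_gap[OF pm assms, of pp, where 'a='b] by blast
 show ?thesis
 proof (intro exI[of _ C] conjI allI impI C(1))
  fix f g :: "real^'n => 'b" assume [measurable]: "meas f" "meas g"
  have [measurable]: "meas (%x. cvx_gap (p x) (f x) (g x))" unfolding cvx_gap_def by measurable
  have "pmod (%x. f x - g x) <= eint (%x. ennreal \<epsilon> * (ennreal (norm (f x) powr p x) + ennreal (norm (g x) powr p x)) + ennreal C * ennreal (cvx_gap (p x) (f x) (g x)))"
   unfolding pmod_def
  proof (intro nn_integral_mono)
   fix x assume x: "x \<in> space M"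
   have g0: "0 <= cvx_gap (p x) (f x) (g x)" using p_lower[of x] x pm by (intro cvx_gap_nonneg) auto
   have "norm (f x - g x) powr p x <= \<epsilon> * (norm (f x) powr p x + norm (g x) powr p x) + C * cvx_gap (p x) (f x) (g x)"
    using p_lower[of x] p_upper[of x] x by (intro C(2)) auto
   then show "ennreal (norm (f x - g x) powr p x) <= ennreal \<epsilon> * (ennreal (norm (f x) powr p x) + ennreal (norm (g x) powr p x)) + ennreal C * ennreal (cvx_gap (p x) (f x) (g x))"
    using g0 C(1) assms by (simp flip: ennreal_mult ennreal_plus)
  qed
  also have "... = ennreal \<epsilon> * (pmod f + pmod g) + ennreal C * eint (%x. ennreal (cvx_gap (p x) (f x) (g x)))"
   unfolding pmod_def
   by (subst nn_integral_add, simp, simp, subst nn_integral_cmult, simp, subst nn_integral_add, simp, simp, subst nn_integral_cmult, simp) simp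
  finally show "pmod (%x. f x - g x) <= ennreal \<epsilon> * (pmod f + pmod g) + ennreal C * eint (%x. ennreal (cvx_gap (p x) (f x) (g x)))" .
 qed
qed

text \<open>Uniform convexity in modular form: bounded modulars and a vanishing gap force
  convergence. Two indices are kept so that the same lemma serves a Cauchy sequence and a sequence
  with a given limit.\<close>

lemma pmod_diff_tendsto:
 fixes f g :: "nat => nat => real^'n => 'b::euclidean_space"
 assumes m: "\<And>k l. meas (f k l)" "\<And>k l. meas (g k l)"
  and b: "\<And>k l. pmod (f k l) <= ennreal B" "\<And>k l. pmod (g k l) <= ennreal B"
  and gap: "\<And>e::real. 0 < e ==> EX N. ALL k>=N. ALL l>=N. eint (%x. ennreal (cvx_gap (p x) (f k l x) (g k l x))) <= ennreal e"
  and e: "0 < (e::real)"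
 shows "EX N. ALL k>=N. ALL l>=N. pmod (%x. f k l x - g k l x) <= ennreal e"
proof -
 define B' where "B' = \<bar>B\<bar> + 1"
 have B': "B' > 0" "ennreal B <= ennreal B'" unfolding B'_def by (simp, intro ennreal_leI) auto
 define \<epsilon> where "\<epsilon> = e / (4 * B')"
 have \<epsilon>: "\<epsilon> > 0" using e B' by (simp add: \<epsilon>_def)
 obtain C where C: "C >= 0" "\<And>(f :: real^'n => 'b) (g :: real^'n => 'b). meas f ==> meas g ==>
   pmod (%x. f x - g x) <= ennreal \<epsilon> * (pmod f + pmod g) + ennreal C * eint (%x. ennreal (cvx_gap (p x) (f x) (g x)))"
  using pmod_diff_le_gap[OF \<epsilon>, where 'b='b] by blast
 define d where "d = e / (2 * (C + 1))"
 have d: "d > 0" "C * d <= e / 2" using e C by (auto simp: d_def field_simps)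
 obtain N where N: "\<And>k l. k >= N ==> l >= N ==> eint (%x. ennreal (cvx_gap (p x) (f k l x) (g k l x))) <= ennreal d"
  using gap[OF d(1)] by blast
 have "pmod (%x. f k l x - g k l x) <= ennreal e" if "k >= N" "l >= N" for k l
 proof -
  have "pmod (%x. f k l x - g k l x) <= ennreal \<epsilon> * (pmod (f k l) + pmod (g k l)) + ennreal C * eint (%x. ennreal (cvx_gap (p x) (f k l x) (g k l x)))"
   by (rule C(2)[OF m])
  also have "... <= ennreal \<epsilon> * (ennreal B' + ennreal B') + ennreal C * ennreal d"
   using N[OF that] order_trans[OF b(1) B'(2)] order_trans[OF b(2) B'(2)] by (intro add_mono mult_left_mono) auto
  also have "ennreal \<epsilon> * (ennreal B' + ennreal B') = ennreal (e / 2)"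
   using B' \<epsilon> by (simp flip: ennreal_plus ennreal_mult'' add: \<epsilon>_def)
  also have "ennreal C * ennreal d <= ennreal (e / 2)" using d C by (simp flip: ennreal_mult'' add: ennreal_leI)
  also have "ennreal (e / 2) + ennreal (e / 2) = ennreal e" using e by (simp flip: ennreal_plus)
  finally show ?thesis by (simp add: add_left_mono)
 qed
 then show ?thesis by blast
qed

text \<open>The two equations are subtracted and tested with u_n - u0. The source side is at most
  twice the sup bound times the L1 distance of the sources, the flux side dominates the convexity
  gap; so the gradients converge in the modular and the functions in the mean.\<close>

lemma weak_sol_continuous:
 assumes sol: "\<And>n. weak_sol (h n) (u n) (g n)" "weak_sol h0 u0 g0"
  and src: "\<And>n. source \<mu> (h n)" "source \<mu> h0" and \<mu>: "0 <= \<mu>"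
  and lim: "AE x in M. (%n. h n x) \<longlonglongrightarrow> h0 x"
 shows "(%n. L1n (%x. u n x - u0 x)) \<longlonglongrightarrow> 0"
proof -
 note W = weak_solD(1)[OF sol(1)] weak_solD(1)[OF sol(2)]
 note [measurable] = W0_M[OF W(1)] W0_M[OF W(2)] source_M[OF src(1)] source_M[OF src(2)]
 have p1: "1 < p x" if "x \<in> \<Omega>" for x using p_lower[OF that] pm by simp
 let ?K = "ubound \<mu>"
 have K: "0 <= ?K" by (rule ubound(1)[OF \<mu>])
 have ae: "AE x in M. 0 <= h n x & h n x <= \<mu>" "AE x in M. 0 <= h0 x & h0 x <= \<mu>" for n
  using src by (auto simp: source_def)
 interpret finite_measure M by (rule finite_M)
 have hl: "(%n. \<integral>x. 2 * ?K * \<bar>h n x - h0 x\<bar> \<partial>M) \<longlonglongrightarrow> (LINT x|M. 0)"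
 proof (rule integral_dominated_convergence)
  show "integrable M (%x. 2 * ?K * \<mu>)" by simp
  show "AE x in M. (%n. 2 * ?K * \<bar>h n x - h0 x\<bar>) \<longlonglongrightarrow> 0"
   using lim
  proof eventually_elim
   case (elim x)
   then have "(%n. 2 * ?K * \<bar>h n x - h0 x\<bar>) \<longlonglongrightarrow> 2 * ?K * \<bar>h0 x - h0 x\<bar>" by (intro tendsto_intros)
   then show ?case by simp
  qed
  show "AE x in M. norm (2 * ?K * \<bar>h n x - h0 x\<bar>) <= 2 * ?K * \<mu>" for n
   using ae(1)[of n] ae(2)
  proof eventually_elim
   case (elim x)
   then have "\<bar>h n x - h0 x\<bar> <= \<mu>" by auto
   then show ?case using K by (auto simp: abs_mult intro!: mult_left_mono)
  qed
 qed auto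
 have gap: "eint (%x. ennreal (cvx_gap (p x) (g n x) (g0 x))) <= ennreal (pp / 4 * (LINT x|M. 2 * ?K * \<bar>h n x - h0 x\<bar>))" for n
 proof -
  have [measurable]: "meas (%x. cvx_gap (p x) (g n x) (g0 x))" unfolding cvx_gap_def by measurable
  have Wd: "W0 (%x. u n x - u0 x) (%x. g n x - g0 x)" by (rule W0_diff[OF W])
  have i: "integrable M (%x. pflux (p x) (g n x) \<bullet> (g n x - g0 x))" "integrable M (%x. pflux (p x) (g0 x) \<bullet> (g n x - g0 x))"
   using W0_flux_integrable W Wd by blast+
  have ih: "integrable M (%x. h n x * (u n x - u0 x))" "integrable M (%x. h0 x * (u n x - u0 x))"
   using source_integrable[OF src(1) W0_integrable(1)[OF Wd]] source_integrable[OF src(2) W0_integrable(1)[OF Wd]] .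
  let ?m = "%x. (pflux (p x) (g n x) - pflux (p x) (g0 x)) \<bullet> (g n x - g0 x)"
  have im: "integrable M ?m" using i by (simp add: inner_diff_left)
  have pp0: "0 <= pp / 4" if "\<Omega> ~= {}" using that p1 p_upper by fastforce
  have "eint (%x. ennreal (cvx_gap (p x) (g n x) (g0 x))) <= eint (%x. ennreal (pp / 4 * ?m x))"
  proof (intro nn_integral_mono ennreal_leI)
   fix x assume x: "x \<in> space M"
   have "4 / p x * cvx_gap (p x) (g n x) (g0 x) <= ?m x" using p1 x by (intro pflux_mono_gap) auto
   then have "cvx_gap (p x) (g n x) (g0 x) <= p x / 4 * ?m x" using p1[of x] x by (simp add: field_simps)
   also have "... <= pp / 4 * ?m x" using p1[of x] p_upper[of x] x by (intro mult_right_mono pflux_mono) auto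
   finally show "cvx_gap (p x) (g n x) (g0 x) <= pp / 4 * ?m x" .
  qed
  also have "... = ennreal (LINT x|M. pp / 4 * ?m x)"
  proof (intro nn_integral_eq_integral AE_I2)
   fix x assume "x \<in> space M"
   then show "0 <= pp / 4 * ?m x" using pp0 p1 by (intro mult_nonneg_nonneg pflux_mono) auto
  qed (use im in auto)
  also have "(LINT x|M. pp / 4 * ?m x) = pp / 4 * ((LINT x|M. pflux (p x) (g n x) \<bullet> (g n x - g0 x)) - (LINT x|M. pflux (p x) (g0 x) \<bullet> (g n x - g0 x)))"
   using i by (simp add: inner_diff_left)
  also have "... = pp / 4 * (LINT x|M. (h n x - h0 x) * (u n x - u0 x))"
   using ih by (simp only: weak_solD(2)[OF sol(1) Wd] weak_solD(2)[OF sol(2) Wd]) (simp add: left_diff_distrib)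
  also have "... <= pp / 4 * (LINT x|M. 2 * ?K * \<bar>h n x - h0 x\<bar>)"
  proof (cases "\<Omega> = {}")
   case False
   show ?thesis
   proof (intro mult_left_mono integral_mono_AE pp0 False)
    show "integrable M (%x. (h n x - h0 x) * (u n x - u0 x))" using ih by (simp add: left_diff_distrib)
    show "integrable M (%x. 2 * ?K * \<bar>h n x - h0 x\<bar>)"
    proof (rule Bochner_Integration.integrable_bound)
     show "integrable M (%x. 2 * ?K * \<mu>)" by simp
     show "AE x in M. norm (2 * ?K * \<bar>h n x - h0 x\<bar>) <= norm (2 * ?K * \<mu>)"
      using ae(1)[of n] ae(2)
     proof eventually_elim
      case (elim x)
      then have "\<bar>h n x - h0 x\<bar> <= \<mu>" by auto
      then show ?case using K \<mu> by (auto simp: abs_mult intro!: mult_left_mono)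
     qed
    qed simp
    show "AE x in M. (h n x - h0 x) * (u n x - u0 x) <= 2 * ?K * \<bar>h n x - h0 x\<bar>"
     using ubound(2)[OF \<mu> sol(1) src(1), of n] ubound(2)[OF \<mu> sol(2) src(2)]
    proof eventually_elim
     case (elim x)
     then have "\<bar>u n x - u0 x\<bar> <= 2 * ?K" by auto
     then have "\<bar>h n x - h0 x\<bar> * \<bar>u n x - u0 x\<bar> <= \<bar>h n x - h0 x\<bar> * (2 * ?K)" by (intro mult_left_mono) auto
     then show ?case
      using abs_ge_self[of "(h n x - h0 x) * (u n x - u0 x)"] by (simp add: abs_mult mult.commute)
    qed
   qed
  qed (simp add: Bochner_Integration.integral_empty)
  finally show ?thesis by (simp add: ennreal_leI)
 qed
 have "(%n. pmod (%x. g n x - g0 x)) \<longlonglongrightarrow> 0"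
 proof (rule tendsto_0_if_le)
  fix e :: real assume e: "0 < e"
  have "EX N. ALL k>=N. ALL l>=N. pmod (%x. g k x - g0 x) <= ennreal e"
  proof (rule pmod_diff_tendsto[where f="%k l. g k" and g="%k l. g0", OF _ _ _ _ _ e])
   show "pmod (g k) <= ennreal (\<mu> * ubound \<mu> * vol)" for k by (rule weak_sol_pmod[OF sol(1) src(1) \<mu>])
   show "pmod g0 <= ennreal (\<mu> * ubound \<mu> * vol)" by (rule weak_sol_pmod[OF sol(2) src(2) \<mu>])
   fix e :: real assume e: "0 < e"
   have "(%n. pp / 4 * (LINT x|M. 2 * ?K * \<bar>h n x - h0 x\<bar>)) \<longlonglongrightarrow> pp / 4 * 0"
    using hl by (intro tendsto_mult tendsto_const) simp
   then have "\<forall>\<^sub>F n in sequentially. pp / 4 * (LINT x|M. 2 * ?K * \<bar>h n x - h0 x\<bar>) < e" using e by (intro order_tendstoD) auto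
   then obtain N where "\<And>n. n >= N ==> pp / 4 * (LINT x|M. 2 * ?K * \<bar>h n x - h0 x\<bar>) < e" unfolding eventually_sequentially by blast
   then have "ALL k>=N. ALL l>=N. eint (%x. ennreal (cvx_gap (p x) (g k x) (g0 x))) <= ennreal e"
    by (intro allI impI order_trans[OF gap] ennreal_leI less_imp_le)
   then show "EX N. ALL k>=N. ALL l>=N. eint (%x. ennreal (cvx_gap (p x) (g k x) (g0 x))) <= ennreal e" by blast
  qed auto
  then show "\<forall>\<^sub>F k in sequentially. pmod (%x. g k x - g0 x) <= ennreal e"
   unfolding eventually_sequentially by blast
 qed
 then have "(%n. L1n (%x. g n x - g0 x)) \<longlonglongrightarrow> 0" by (intro L1n_tendsto) auto
 then have "(%n. ennreal cP * L1n (%x. g n x - g0 x)) \<longlonglongrightarrow> 0" by (rule tendsto_0_cmult)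
 then show ?thesis by (rule tendsto_0_bound) (rule W0_poincare[OF W0_diff[OF W]])
qed

end

section \<open>Existence by energy minimisation\<close>

context var_exponent
begin

text \<open>The limit is found in L1, where Cauchy sequences for the modular remain Cauchy, and
  Fatou's lemma lifts the convergence back to the modular.\<close>

lemma pmod_complete:
 fixes f :: "nat => real^'n => 'b::euclidean_space"
 assumes m[measurable]: "\<And>k. meas (f k)"
  and C: "\<And>e::real. 0 < e ==> EX N. ALL k>=N. ALL l>=N. pmod (%x. f k x - f l x) <= ennreal e"
 shows "EX g. meas g & (%k. pmod (%x. f k x - g x)) \<longlonglongrightarrow> 0"
  and "0 < (e::real) ==> EX N. ALL k>=N. ALL l>=N. L1n (%x. f k x - f l x) < ennreal e"
proof -
 have L1C: "EX N. ALL k>=N. ALL l>=N. L1n (%x. f k x - f l x) < ennreal e" if e: "0 < e" for e :: real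
 proof -
  have "e / 4 > 0" using e by simp
  from L1n_le_pmod[OF this] obtain D where D: "D >= 0" "\<And>g :: real^'n => 'b. meas g ==> L1n g <= ennreal (e/4) + ennreal D * pmod g"
   by blast
  define d where "d = e / (4 * (D + 1))"
  have d: "d > 0" "D * d <= e / 4" using e D by (auto simp: d_def field_simps)
  obtain N where N: "\<And>k l. k >= N ==> l >= N ==> pmod (%x. f k x - f l x) <= ennreal d" using C[OF d(1)] by blast
  have "L1n (%x. f k x - f l x) < ennreal e" if "k >= N" "l >= N" for k l
  proof -
   have "L1n (%x. f k x - f l x) <= ennreal (e/4) + ennreal D * pmod (%x. f k x - f l x)" by (rule D) simp
   also have "... <= ennreal (e/4) + ennreal D * ennreal d" using N[OF that] by (intro add_left_mono mult_left_mono) auto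
   also have "... <= ennreal (e/4) + ennreal (e/4)" using d D by (intro add_left_mono) (simp flip: ennreal_mult'' add: ennreal_leI)
   also have "... < ennreal e" using e by (simp flip: ennreal_plus add: ennreal_lessI)
   finally show ?thesis .
  qed
  then show ?thesis by blast
 qed
 then show "0 < e ==> EX N. ALL k>=N. ALL l>=N. L1n (%x. f k x - f l x) < ennreal e" .
 obtain g r where gr: "strict_mono (r::nat=>nat)" "meas g" "AE x in M. (%k. f (r k) x) \<longlonglongrightarrow> g x"
  by (rule L1_Cauchy_limit[of f M, OF m L1C]) (assumption, rule that)
 note [measurable] = gr(2)
 have "(%k. pmod (%x. f k x - g x)) \<longlonglongrightarrow> 0"
 proof (rule tendsto_0_if_le)
  fix e :: real assume "e > 0"
  then obtain N where N: "\<And>k l. N <= k ==> N <= l ==> pmod (%x. f k x - f l x) <= ennreal e"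
   using C by blast
  have "pmod (%x. f k x - g x) <= ennreal e" if k: "k >= N" for k
  proof -
   have "pmod (%x. f k x - g x) = eint (%x. liminf (%l. ennreal (norm (f k x - f (r l) x) powr p x)))"
    unfolding pmod_def
   proof (rule nn_integral_cong_AE)
    show "AE x in M. ennreal (norm (f k x - g x) powr p x) = liminf (%l. ennreal (norm (f k x - f (r l) x) powr p x))"
     using gr(3) AE_space
    proof eventually_elim
     case (elim x)
     note c = elim(1) and x = elim(2)
     have p0: "0 < p x" using p_lower[of x] x pm by simp
     have "(%l. norm (f k x - f (r l) x)) \<longlonglongrightarrow> norm (f k x - g x)" using c by (intro tendsto_intros)
     then have "(%l. norm (f k x - f (r l) x) powr p x) \<longlonglongrightarrow> norm (f k x - g x) powr p x"
      by (rule tendsto_powr'[OF _ tendsto_const]) (use p0 in auto)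
     then have "(%l. ennreal (norm (f k x - f (r l) x) powr p x)) \<longlonglongrightarrow> ennreal (norm (f k x - g x) powr p x)"
      by (rule tendsto_ennrealI)
     then show ?case
      by (intro lim_imp_Liminf[symmetric]) auto
    qed
   qed
   also have "... <= liminf (%l. pmod (%x. f k x - f (r l) x))"
    unfolding pmod_def by (rule nn_integral_liminf) auto
   also have "... <= ennreal e"
   proof (rule Liminf_le)
    have "\<forall>\<^sub>F l in sequentially. N <= l" by (rule eventually_ge_at_top)
    then show "\<forall>\<^sub>F l in sequentially. pmod (%x. f k x - f (r l) x) <= ennreal e"
    proof eventually_elim
     case (elim l)
     then have "N <= r l" using seq_suble[OF gr(1), of l] by simp
     then show ?case using N[OF k, of "r l"] by simp
    qed
   qed auto
   finally show ?thesis .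
  qed
  then show "\<forall>\<^sub>F k in sequentially. pmod (%x. f k x - g x) <= ennreal e"
   unfolding eventually_sequentially by blast
 qed
 with gr(2) show "EX g. meas g & (%k. pmod (%x. f k x - g x)) \<longlonglongrightarrow> 0" by blast
qed

definition energy :: "(real^'n => real^'n) => real" where
 "energy g = (LINT x|M. norm (g x) powr p x / p x)"

lemma energy_integrable:
 fixes g :: "real^'n => real^'n"
 assumes [measurable]: "meas g" and "pmod g < \<infinity>"
 shows "integrable M (%x. norm (g x) powr p x / p x)"
proof (rule Bochner_Integration.integrable_bound[OF pmod_integrable(1)[OF assms]])
 show "AE x in M. norm (norm (g x) powr p x / p x) <= norm (norm (g x) powr p x)"
 proof (intro AE_I2)
  fix x assume "x \<in> space M"
  then have "1 < p x" using p_gt1 by simp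
  then have "norm (g x) powr p x / p x <= norm (g x) powr p x / 1" by (intro divide_left_mono) auto
  then show "norm (norm (g x) powr p x / p x) <= norm (norm (g x) powr p x)" using \<open>1 < p x\<close> by simp
 qed
qed simp

lemma energy_nonneg: "0 <= energy g"
 unfolding energy_def by (intro integral_nonneg_AE AE_I2) (use p_gt1 in \<open>force intro!: divide_nonneg_pos\<close>)

lemma pmod_le_energy:
 fixes g :: "real^'n => real^'n"
 assumes [measurable]: "meas g" and fin: "pmod g < \<infinity>"
 shows "(LINT x|M. norm (g x) powr p x) <= pp * energy g"
proof -
 have "(LINT x|M. norm (g x) powr p x) <= (LINT x|M. pp * (norm (g x) powr p x / p x))"
 proof (rule integral_mono[OF pmod_integrable(1)[OF assms]])
  show "integrable M (%x. pp * (norm (g x) powr p x / p x))" using energy_integrable[OF assms] by (rule integrable_mult_right)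
  fix x assume x: "x \<in> space M"
  then have p: "1 < p x" "p x <= pp" using p_gt1 p_upper by auto
  have "norm (g x) powr p x = p x * (norm (g x) powr p x / p x)" using p by simp
  also have "... <= pp * (norm (g x) powr p x / p x)" using p by (intro mult_right_mono) auto
  finally show "norm (g x) powr p x <= pp * (norm (g x) powr p x / p x)" .
 qed
 then show ?thesis unfolding energy_def by (simp only: integral_mult_right_zero)
qed

lemma energy_tangent:
 fixes a b :: "real^'n => real^'n"
 assumes a: "meas a" "pmod a < \<infinity>" and b: "meas b" "pmod b < \<infinity>"
 shows "energy a + (LINT x|M. pflux (p x) (a x) \<bullet> (b x - a x)) <= energy b"
proof -
 note [measurable] = a(1) b(1)
 have "pmod (%x. b x - a x) < \<infinity>"
  by (rule le_less_trans[OF pmod_diff[OF b(1) a(1)]]) (use a(2) b(2) in \<open>simp add: ennreal_mult_less_top\<close>)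
 then have i: "integrable M (%x. pflux (p x) (a x) \<bullet> (b x - a x))" using a by (intro flux_integrable) auto
 have "(LINT x|M. norm (a x) powr p x / p x + pflux (p x) (a x) \<bullet> (b x - a x)) <= energy b"
  unfolding energy_def
 proof (rule integral_mono)
  fix x assume "x \<in> space M"
  then have p: "1 < p x" using p_gt1 by simp
  then show "norm (a x) powr p x / p x + pflux (p x) (a x) \<bullet> (b x - a x) <= norm (b x) powr p x / p x"
   using divide_right_mono[OF pflux_tangent[OF p, of "a x" "b x"], of "p x"] by (simp add: add_divide_distrib)
 qed (use i energy_integrable a b in auto)
 then show ?thesis using i energy_integrable[OF a] by (simp add: energy_def)
qed

lemma W0_closed:
 assumes W: "\<And>k. W0 (u k) (g k)" and m[measurable]: "meas u0" "meas g0"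
  and lim: "(%k. L1n (%x. u k x - u0 x)) \<longlonglongrightarrow> 0" "(%k. pmod (%x. g k x - g0 x)) \<longlonglongrightarrow> 0"
 shows "W0 u0 g0"
proof -
 note [measurable] = W0_M[OF W]
 let ?e = "%k. ennreal (1 / real (Suc k))"
 have "EX \<phi>. test_fun \<Omega> \<phi> & L1n (%x. \<phi> x - u k x) < ?e k & pmod (%x. grad \<phi> x - g k x) < ?e k" for k
 proof -
  obtain \<phi> where \<phi>: "W0_via \<phi> (u k) (g k)" using W unfolding W0_def by blast
  have "\<forall>\<^sub>F j in sequentially. L1n (%x. \<phi> j x - u k x) < ?e k & pmod (%x. grad (\<phi> j) x - g k x) < ?e k"
   using \<phi> unfolding W0_via_def by (intro eventually_conj order_tendstoD) auto
  then show ?thesis using \<phi> unfolding W0_via_def eventually_sequentially by blast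
 qed
 then have "EX \<phi>. ALL k. test_fun \<Omega> (\<phi> k) & L1n (%x. \<phi> k x - u k x) < ?e k & pmod (%x. grad (\<phi> k) x - g k x) < ?e k"
  by (intro choice allI)
 then obtain \<phi> where t: "\<And>k. test_fun \<Omega> (\<phi> k)" and L: "\<And>k. L1n (%x. \<phi> k x - u k x) < ?e k" and G: "\<And>k. pmod (%x. grad (\<phi> k) x - g k x) < ?e k"
  by blast
 note [measurable] = test_M[OF t] grad_M[OF t]
 have e0: "?e \<longlonglongrightarrow> 0" using tendsto_ennrealI[OF LIMSEQ_Suc[OF lim_1_over_n]] by simp
 have "(%k. L1n (%x. \<phi> k x - u0 x)) \<longlonglongrightarrow> 0"
 proof (rule tendsto_0_bound[OF tendsto_0_add[OF e0 lim(1)]])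
  show "L1n (%x. \<phi> k x - u0 x) <= ?e k + L1n (%x. u k x - u0 x)" for k
   using L[of k] by (intro order_trans[OF L1n_triangle[of _ "u k"]] add_mono) auto
 qed
 moreover have "(%k. pmod (%x. grad (\<phi> k) x - g0 x)) \<longlonglongrightarrow> 0"
 proof (rule tendsto_0_bound[OF tendsto_0_cmult[OF tendsto_0_add[OF e0 lim(2)], of "2 powr pp"]])
  fix k
  have "pmod (%x. grad (\<phi> k) x - g0 x) <= ennreal (2 powr pp) * (pmod (%x. grad (\<phi> k) x - g k x) + pmod (%x. g k x - g0 x))"
   using pmod_add[of "%x. grad (\<phi> k) x - g k x" "%x. g k x - g0 x"] by simp
  also have "... <= ennreal (2 powr pp) * (?e k + pmod (%x. g k x - g0 x))"
   by (intro mult_left_mono add_right_mono less_imp_le[OF G]) simp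
  finally show "pmod (%x. grad (\<phi> k) x - g0 x) <= ennreal (2 powr pp) * (?e k + pmod (%x. g k x - g0 x))" .
 qed
 ultimately show ?thesis unfolding W0_def W0_via_def using t m by blast
qed

text \<open>The direct method without weak compactness: the midpoint of two almost minimisers is a
  competitor, which bounds their convexity gap by the sum of their excesses. Hence a minimising
  sequence is Cauchy in the modular.\<close>

theorem weak_sol_exists:
 assumes h: "source \<mu> h" and \<mu>: "0 <= \<mu>"
 shows "EX u g. weak_sol h u g"
proof -
 note [measurable] = source_M[OF h]
 define J where "J u g = energy g - (LINT x|M. h x * u x)" for u g
 have ae: "AE x in M. 0 <= h x & h x <= \<mu>" using h by (simp add: source_def)
 \<comment> \<open>\<open>pp\<close> is known to be positive only when the domain has a point; the
   absolute value settles the sign in every case.\<close>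
 define pq where "pq = \<bar>pp\<bar>"
 have "0 <= cP * \<mu> * pq" using \<mu> cP_pos by (simp add: pq_def)
 \<comment> \<open>The scale is taken so that the linear term consumes at most half of the
   energy.\<close>
 from scale_exists[OF this] obtain s \<sigma> where s: "0 < s" "0 <= \<sigma>" "\<And>x. x \<in> \<Omega> ==> s powr (1 - p x) <= \<sigma>" "cP * \<mu> * pq * \<sigma> <= 1 / 2" by blast
 define c0 where "c0 = \<mu> * cP * s * vol"
 have lower: "energy g / 2 - c0 <= J u g" if W: "W0 u g" for u g
 proof -
  note [measurable] = W0_M[OF W]
  have iu: "integrable M u" and ig: "integrable M g" using W0_integrable[OF W] .
  have G: "(LINT x|M. norm (g x)) <= s * vol + \<sigma> * (pq * energy g)"
  proof -
   interpret finite_measure M by (rule finite_M)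
   have "(LINT x|M. norm (g x)) <= (LINT x|M. s + \<sigma> * norm (g x) powr p x)"
   proof (rule integral_mono)
    show "integrable M (%x. norm (g x))" using ig by simp
    show "integrable M (%x. s + \<sigma> * norm (g x) powr p x)" using pmod_integrable(1)[of g] W0_pmod[OF W] by simp
    fix x assume x: "x \<in> space M"
    have "norm (g x) <= s + s powr (1 - p x) * norm (g x) powr p x" using x s p_gt1 by (intro le_add_powr) auto
    also have "... <= s + \<sigma> * norm (g x) powr p x" using x s by (intro add_left_mono mult_right_mono) auto
    finally show "norm (g x) <= s + \<sigma> * norm (g x) powr p x" .
   qed
   also have "... = s * vol + \<sigma> * (LINT x|M. norm (g x) powr p x)"
    using pmod_integrable(1)[of g] W0_pmod[OF W] emeasure_M vol_nonneg
    by (subst Bochner_Integration.integral_add) (auto simp: measure_def)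
   also have "... <= s * vol + \<sigma> * (pq * energy g)"
   proof (intro add_left_mono mult_left_mono s)
    have "pp * energy g <= pq * energy g" by (intro mult_right_mono energy_nonneg) (simp add: pq_def)
    then show "(LINT x|M. norm (g x) powr p x) <= pq * energy g" using pmod_le_energy[of g] W0_pmod[OF W] by simp
   qed
   finally show ?thesis .
  qed
  have U: "(LINT x|M. norm (u x)) <= cP * (LINT x|M. norm (g x))"
  proof -
   have "ennreal (LINT x|M. norm (u x)) <= ennreal cP * ennreal (LINT x|M. norm (g x))"
    using W0_poincare[OF W] iu integrable_norm[OF ig] by (simp add: nn_integral_eq_integral)
   then have "ennreal (LINT x|M. norm (u x)) <= ennreal (cP * (LINT x|M. norm (g x)))" using cP_pos by (simp add: ennreal_mult)
   then show ?thesis using cP_pos by (subst (asm) ennreal_le_iff) auto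
  qed
  have "(LINT x|M. h x * u x) <= (LINT x|M. \<mu> * norm (u x))"
  proof (rule integral_mono_AE)
   show "integrable M (%x. h x * u x)" by (rule source_integrable[OF h iu])
   show "AE x in M. h x * u x <= \<mu> * norm (u x)" using ae
   proof eventually_elim
    case (elim x)
    then have "h x * u x <= h x * \<bar>u x\<bar>" "h x * \<bar>u x\<bar> <= \<mu> * \<bar>u x\<bar>" by (auto intro: mult_left_mono mult_right_mono)
    then show ?case by simp
   qed
  qed (use iu in auto)
  also have "... <= \<mu> * (cP * (s * vol + \<sigma> * (pq * energy g)))"
   using U G \<mu> cP_pos by (auto intro!: mult_left_mono intro: order_trans)
  also have "... = c0 + (cP * \<mu> * pq * \<sigma>) * energy g" by (simp add: c0_def algebra_simps)
  also have "... <= c0 + 1 / 2 * energy g" using s by (intro add_left_mono mult_right_mono energy_nonneg) auto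
  finally show ?thesis by (simp add: J_def)
 qed
 let ?S = "{J u g | u g. W0 u g}"
 define I where "I = Inf ?S"
 have bdd: "bdd_below ?S" using lower energy_nonneg by (intro bdd_belowI[of _ "- c0"]) (force intro: order_trans[rotated])
 have I_le: "I <= J u g" if "W0 u g" for u g unfolding I_def using that by (intro cInf_lower bdd) auto
 have "EX u g. W0 u g & J u g < I + 1 / real (Suc k)" for k
  using cInf_lessD[of ?S "I + 1 / real (Suc k)"] W0_zero by (auto simp: I_def)
 then have "EX v. ALL k. EX g. W0 (v k) g & J (v k) g < I + 1 / real (Suc k)" by (intro choice allI)
 then obtain v where "ALL k. EX g. W0 (v k) g & J (v k) g < I + 1 / real (Suc k)" ..
 from choice[OF this] obtain \<gamma> where W: "\<And>k. W0 (v k) (\<gamma> k)" and Jk: "\<And>k. J (v k) (\<gamma> k) < I + 1 / real (Suc k)" by blast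
 note [measurable] = W0_M[OF W]
 note Wp = W0_pmod[OF W]
 define B where "B = pq * (2 * (I + 1 + c0))"
 have pB: "pmod (\<gamma> k) <= ennreal B" for k
 proof -
  have "1 / real (Suc k) <= 1" by simp
  then have "energy (\<gamma> k) / 2 <= I + 1 + c0" using lower[OF W, of k] Jk[of k] by linarith
  then have "pq * energy (\<gamma> k) <= B" unfolding B_def by (intro mult_left_mono) (auto simp: pq_def)
  moreover have "pp * energy (\<gamma> k) <= pq * energy (\<gamma> k)" by (intro mult_right_mono energy_nonneg) (simp add: pq_def)
  ultimately have "(LINT x|M. norm (\<gamma> k x) powr p x) <= B" using pmod_le_energy[OF _ Wp, of k] by simp
  then show ?thesis using pmod_integrable(2)[OF _ Wp, of k] by (simp add: ennreal_leI)
 qed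
 have gap: "eint (%x. ennreal (cvx_gap (p x) (\<gamma> k x) (\<gamma> l x))) <= ennreal (pq / 2 * (1 / real (Suc k) + 1 / real (Suc l)))" for k l
 proof -
  let ?a = "\<gamma> k" and ?b = "\<gamma> l"
  let ?m = "%x. (1/2) * (v k x + v l x)" and ?c = "%x. (1/2) *\<^sub>R (?a x + ?b x)"
  have [measurable]: "meas (%x. cvx_gap (p x) (?a x) (?b x))" unfolding cvx_gap_def by measurable
  have Wm: "W0 ?m ?c" using W0_scale[OF W0_lincomb[OF W W, of k 1 l], of "1/2"] by simp
  note pc = W0_pmod[OF Wm]
  have [measurable]: "meas ?c" by measurable
  note iE = energy_integrable[OF _ Wp, of k] energy_integrable[OF _ Wp, of l] energy_integrable[OF _ pc]
  have ih: "integrable M (%x. h x * v k x)" "integrable M (%x. h x * v l x)"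
   using source_integrable[OF h W0_integrable(1)[OF W]] by blast+
  have hm: "(LINT x|M. h x * ?m x) = ((LINT x|M. h x * v k x) + (LINT x|M. h x * v l x)) / 2"
  proof -
   have "(LINT x|M. h x * ?m x) = (LINT x|M. (1/2) * (h x * v k x + h x * v l x))"
    by (intro Bochner_Integration.integral_cong) (auto simp: algebra_simps)
   then show ?thesis using ih by simp
  qed
  have ie: "integrable M (%x. norm (?a x) powr p x / p x + norm (?b x) powr p x / p x - 2 * (norm (?c x) powr p x / p x))"
   using iE by (intro Bochner_Integration.integrable_diff Bochner_Integration.integrable_add integrable_mult_right) auto
  have alg: "A / q + B / q - 2 * (C / q) = 2 / q * ((A + B) / 2 - C)" for A B C q :: real
   by (cases "q = 0") (simp_all add: field_simps)
  have rw: "norm (?a x) powr p x / p x + norm (?b x) powr p x / p x - 2 * (norm (?c x) powr p x / p x) = 2 / p x * cvx_gap (p x) (?a x) (?b x)" for x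
   by (simp only: cvx_gap_def alg)
  have intlin: "(LINT x|M. F1 x + F2 x - 2 * F3 x) = (LINT x|M. F1 x) + (LINT x|M. F2 x) - 2 * (LINT x|M. F3 x)"
   if "integrable M F1" "integrable M F2" "integrable M F3" for F1 F2 F3 :: "real^'n => real" using that by simp
  \<comment> \<open>The source term is linear, so it cancels at the midpoint and only energies are
    left.\<close>
  have lin: "Ea + Eb - 2 * Ec <= e1 + e2" if "I <= Ec - m" "Ea - a < I + e1" "Eb - b < I + e2" "m = (a + b) / 2" for Ea Eb Ec m a b e1 e2 :: real
   using that by (simp add: field_simps)
  have "energy ?a + energy ?b - 2 * energy ?c <= 1 / real (Suc k) + 1 / real (Suc l)"
   by (rule lin[OF I_le[OF Wm, unfolded J_def] Jk[unfolded J_def] Jk[unfolded J_def] hm])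
  moreover have "energy ?a + energy ?b - 2 * energy ?c = (LINT x|M. norm (?a x) powr p x / p x + norm (?b x) powr p x / p x - 2 * (norm (?c x) powr p x / p x))"
   unfolding energy_def by (rule intlin[symmetric]; rule iE; measurable)
  ultimately have ile: "(LINT x|M. 2 / p x * cvx_gap (p x) (?a x) (?b x)) <= 1 / real (Suc k) + 1 / real (Suc l)" unfolding rw by simp
  have ig: "integrable M (%x. 2 / p x * cvx_gap (p x) (?a x) (?b x))" using ie unfolding rw .
  have "eint (%x. ennreal (cvx_gap (p x) (?a x) (?b x))) <= eint (%x. ennreal (pq / 2) * ennreal (2 / p x * cvx_gap (p x) (?a x) (?b x)))"
  proof (intro nn_integral_mono)
   fix x assume x: "x \<in> space M"
   have px: "1 < p x" "p x <= pq" using p_gt1 p_upper[of x] x by (auto simp: pq_def)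
   have g0: "0 <= cvx_gap (p x) (?a x) (?b x)" using px by (intro cvx_gap_nonneg)
   have "cvx_gap (p x) (?a x) (?b x) = p x / 2 * (2 / p x * cvx_gap (p x) (?a x) (?b x))" using px by simp
   also have "... <= pq / 2 * (2 / p x * cvx_gap (p x) (?a x) (?b x))" using px g0 by (intro mult_right_mono) auto
   finally show "ennreal (cvx_gap (p x) (?a x) (?b x)) <= ennreal (pq / 2) * ennreal (2 / p x * cvx_gap (p x) (?a x) (?b x))"
    using px g0 by (subst ennreal_mult[symmetric]) (auto intro: ennreal_leI)
  qed
  also have "... = ennreal (pq / 2) * eint (%x. ennreal (2 / p x * cvx_gap (p x) (?a x) (?b x)))"
   by (rule nn_integral_cmult) simp
  also have "eint (%x. ennreal (2 / p x * cvx_gap (p x) (?a x) (?b x))) = ennreal (LINT x|M. 2 / p x * cvx_gap (p x) (?a x) (?b x))"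
  proof (rule nn_integral_eq_integral[OF ig], intro AE_I2)
   fix x assume x: "x \<in> space M"
   then show "0 <= 2 / p x * cvx_gap (p x) (?a x) (?b x)" using p_gt1[of x] by (intro mult_nonneg_nonneg cvx_gap_nonneg) auto
  qed
  also have "ennreal (pq / 2) * ... <= ennreal (pq / 2) * ennreal (1 / real (Suc k) + 1 / real (Suc l))"
   using ile by (intro mult_left_mono ennreal_leI) auto
  also have "... = ennreal (pq / 2 * (1 / real (Suc k) + 1 / real (Suc l)))" by (subst ennreal_mult) (auto simp: pq_def)
  finally show ?thesis .
 qed
 have Cau: "EX N. ALL k>=N. ALL l>=N. pmod (%x. \<gamma> k x - \<gamma> l x) <= ennreal e" if e: "0 < e" for e :: real
 proof (rule pmod_diff_tendsto[where f="%k l. \<gamma> k" and g="%k l. \<gamma> l", OF _ _ pB pB _ e])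
  fix e :: real assume e: "0 < e"
  have "(%k. pq / 2 * (2 * (1 / real (Suc k)))) \<longlonglongrightarrow> pq / 2 * (2 * 0)"
   by (intro tendsto_mult tendsto_const LIMSEQ_Suc lim_1_over_n)
  then have "\<forall>\<^sub>F k in sequentially. pq / 2 * (2 * (1 / real (Suc k))) < e" using e by (intro order_tendstoD) auto
  then obtain N where N: "pq / 2 * (2 * (1 / real (Suc N))) < e" unfolding eventually_sequentially by blast
  have "eint (%x. ennreal (cvx_gap (p x) (\<gamma> k x) (\<gamma> l x))) <= ennreal e" if "k >= N" "l >= N" for k l
  proof -
   have "1 / real (Suc k) <= 1 / real (Suc N)" "1 / real (Suc l) <= 1 / real (Suc N)" using that by (auto intro!: divide_left_mono)
   then have "pq / 2 * (1 / real (Suc k) + 1 / real (Suc l)) <= pq / 2 * (2 * (1 / real (Suc N)))"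
    by (intro mult_left_mono) (auto simp: pq_def)
   then have "pq / 2 * (1 / real (Suc k) + 1 / real (Suc l)) <= e" using N by linarith
   then show ?thesis by (intro order_trans[OF gap] ennreal_leI)
  qed
  then show "EX N. ALL k>=N. ALL l>=N. eint (%x. ennreal (cvx_gap (p x) (\<gamma> k x) (\<gamma> l x))) <= ennreal e" by blast
 qed auto
 obtain g where g[measurable]: "meas g" and glim: "(%k. pmod (%x. \<gamma> k x - g x)) \<longlonglongrightarrow> 0"
  using pmod_complete(1)[of "%k. \<gamma> k", OF _ Cau] by auto
 have uC: "EX N. ALL k>=N. ALL l>=N. L1n (%x. v k x - v l x) < ennreal e" if e: "0 < e" for e :: real
 proof -
  have "0 < e / (cP + 1)" using e cP_pos by simp
  from pmod_complete(2)[of \<gamma>, OF _ Cau this] obtain N where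
   N: "\<And>k l. k >= N ==> l >= N ==> L1n (%x. \<gamma> k x - \<gamma> l x) < ennreal (e / (cP + 1))" by auto
  have "L1n (%x. v k x - v l x) < ennreal e" if "k >= N" "l >= N" for k l
  proof -
   have "L1n (%x. v k x - v l x) <= ennreal cP * L1n (%x. \<gamma> k x - \<gamma> l x)" by (rule W0_poincare[OF W0_diff[OF W W]])
   also have "... <= ennreal cP * ennreal (e / (cP + 1))" using N[OF that] by (intro mult_left_mono) auto
   also have "... = ennreal (cP * (e / (cP + 1)))" using e cP_pos by (subst ennreal_mult) auto
   also have "... < ennreal e" using e cP_pos by (intro ennreal_lessI) (auto simp: field_simps)
   finally show ?thesis .
  qed
  then show ?thesis by blast
 qed
 obtain u where u: "meas u" "(%k. L1n (%x. v k x - u x)) \<longlonglongrightarrow> 0"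
  by (rule L1_Cauchy_limit[of v M, OF W0_M(1)[OF W] uC]) (assumption, rule that)
 have Wu: "W0 u g" by (rule W0_closed[OF W u(1) g u(2) glim])
 obtain r where r: "strict_mono (r::nat=>nat)" "AE x in M. (%k. \<gamma> (r k) x) \<longlonglongrightarrow> g x"
  using L1_null_AE_subseq[OF _ _ L1n_tendsto[OF _ glim]] by auto
 \<comment> \<open>Lower semicontinuity by Fatou's lemma along an almost everywhere convergent
   subsequence; the linear term converges because \<open>h\<close> is bounded.\<close>
 have JI: "J u g <= I"
 proof -
  let ?b = "%k. I + 1 / real (Suc (r k)) + (LINT x|M. h x * v (r k) x)" and ?L = "I + 0 + (LINT x|M. h x * u x)"
  have "AE x in M. norm (h x) <= \<mu>" using ae by eventually_elim simp
  from integral_inner_tendsto(2)[OF W0_integrable(1)[OF W] W0_integrable(1)[OF Wu] u(2) _ this]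
  have "(%k. \<integral>x. h x * v k x \<partial>M) \<longlonglongrightarrow> (LINT x|M. h x * u x)" by simp
  then have b: "?b \<longlonglongrightarrow> ?L"
   by (intro tendsto_add tendsto_const LIMSEQ_subseq_LIMSEQ[OF _ r(1), unfolded o_def] LIMSEQ_Suc lim_1_over_n)
  have eb: "energy (\<gamma> (r k)) <= ?b k" for k using Jk[of "r k"] by (simp add: J_def)
  then have b0: "0 <= ?L" using energy_nonneg by (intro LIMSEQ_le_const[OF b]) (meson order_trans)
  have en: "ennreal (energy f) = eint (%x. ennreal (norm (f x) powr p x / p x))" if "W0 w f" for w f
   unfolding energy_def using energy_integrable[OF W0_M(2)[OF that] W0_pmod[OF that]]
   by (intro nn_integral_eq_integral[symmetric] AE_I2) (use p_gt1 in \<open>force intro!: divide_nonneg_pos\<close>)+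
  have "ennreal (energy g) = eint (%x. liminf (%k. ennreal (norm (\<gamma> (r k) x) powr p x / p x)))"
   unfolding en[OF Wu]
  proof (rule nn_integral_cong_AE, use r(2) AE_space in eventually_elim)
   case (elim x)
   then have "(%k. ennreal (norm (\<gamma> (r k) x) powr p x / p x)) \<longlonglongrightarrow> ennreal (norm (g x) powr p x / p x)"
    using p_gt1[of x] by (intro tendsto_ennrealI tendsto_divide tendsto_powr' tendsto_norm tendsto_const) auto
   then show ?case by (intro lim_imp_Liminf[symmetric]) auto
  qed
  also have "... <= liminf (%k. \<integral>\<^sup>+x. ennreal (norm (\<gamma> (r k) x) powr p x / p x) \<partial>M)" by (rule nn_integral_liminf) simp
  also have "... <= liminf (%k. ennreal (?b k))"
   unfolding en[OF W, symmetric] by (intro Liminf_mono always_eventually allI ennreal_leI eb)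
  also have "... = ennreal ?L" by (intro lim_imp_Liminf tendsto_ennrealI b) simp
  finally have "energy g <= ?L" using b0 by (subst (asm) ennreal_le_iff)
  then show ?thesis by (simp add: J_def)
 qed
 have EL: "(LINT x|M. h x * \<psi> x) <= (LINT x|M. pflux (p x) (g x) \<bullet> \<zeta> x)" if W\<psi>: "W0 \<psi> \<zeta>" for \<psi> \<zeta>
 proof -
  note [measurable] = W0_M[OF W\<psi>] W0_M[OF Wu]
  define \<tau> where "\<tau> n = 1 / real (Suc n)" for n
  have \<tau>: "0 < \<tau> n" "\<tau> n <= 1" for n by (auto simp: \<tau>_def)
  have \<tau>0: "\<tau> \<longlonglongrightarrow> 0" unfolding \<tau>_def by (intro LIMSEQ_Suc lim_1_over_n)
  have Wn: "W0 (%x. u x + \<tau> n * \<psi> x) (%x. g x + \<tau> n *\<^sub>R \<zeta> x)" for n by (rule W0_lincomb[OF Wu W\<psi>])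
  have le: "(LINT x|M. h x * \<psi> x) <= (LINT x|M. pflux (p x) (g x + \<tau> n *\<^sub>R \<zeta> x) \<bullet> \<zeta> x)" for n
  proof -
   \<comment> \<open>Convexity is used at the perturbed gradient, so the Euler-Lagrange inequality
     holds before the limit and the energy is never differentiated.\<close>
   have "energy (%x. g x + \<tau> n *\<^sub>R \<zeta> x) + (LINT x|M. pflux (p x) (g x + \<tau> n *\<^sub>R \<zeta> x) \<bullet> (g x - (g x + \<tau> n *\<^sub>R \<zeta> x))) <= energy g"
    by (rule energy_tangent[OF W0_M(2)[OF Wn] W0_pmod[OF Wn] W0_M(2)[OF Wu] W0_pmod[OF Wu]])
   then have "energy (%x. g x + \<tau> n *\<^sub>R \<zeta> x) - \<tau> n * (LINT x|M. pflux (p x) (g x + \<tau> n *\<^sub>R \<zeta> x) \<bullet> \<zeta> x) <= energy g" by simp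
   moreover have "J u g <= J (%x. u x + \<tau> n * \<psi> x) (%x. g x + \<tau> n *\<^sub>R \<zeta> x)" using JI I_le[OF Wn, of n] by simp
   moreover have "(LINT x|M. h x * (u x + \<tau> n * \<psi> x)) = (LINT x|M. h x * u x) + \<tau> n * (LINT x|M. h x * \<psi> x)"
   proof -
    have "(LINT x|M. h x * (u x + \<tau> n * \<psi> x)) = (LINT x|M. h x * u x + \<tau> n * (h x * \<psi> x))" by (simp add: algebra_simps)
    then show ?thesis using source_integrable[OF h W0_integrable(1)[OF Wu]] source_integrable[OF h W0_integrable(1)[OF W\<psi>]] by simp
   qed
   ultimately have "\<tau> n * (LINT x|M. h x * \<psi> x) <= \<tau> n * (LINT x|M. pflux (p x) (g x + \<tau> n *\<^sub>R \<zeta> x) \<bullet> \<zeta> x)" unfolding J_def by linarith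
   then show ?thesis using \<tau>(1)[of n] by (simp add: mult_le_cancel_left_pos)
  qed
  have "(%n. \<integral>x. pflux (p x) (g x + \<tau> n *\<^sub>R \<zeta> x) \<bullet> \<zeta> x \<partial>M) \<longlonglongrightarrow> (LINT x|M. pflux (p x) (g x) \<bullet> \<zeta> x)"
  proof (rule integral_dominated_convergence)
   show "integrable M (%x. 2 powr pp * (norm (g x) powr p x + norm (\<zeta> x) powr p x))"
    using pmod_integrable(1)[OF _ W0_pmod[OF Wu]] pmod_integrable(1)[OF _ W0_pmod[OF W\<psi>]] by simp
   show "AE x in M. (%n. pflux (p x) (g x + \<tau> n *\<^sub>R \<zeta> x) \<bullet> \<zeta> x) \<longlonglongrightarrow> pflux (p x) (g x) \<bullet> \<zeta> x"
   proof (intro AE_I2)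
    fix x assume x: "x \<in> space M"
    have "(%n. g x + \<tau> n *\<^sub>R \<zeta> x) \<longlonglongrightarrow> g x + 0 *\<^sub>R \<zeta> x" by (intro tendsto_intros \<tau>0)
    then show "(%n. pflux (p x) (g x + \<tau> n *\<^sub>R \<zeta> x) \<bullet> \<zeta> x) \<longlonglongrightarrow> pflux (p x) (g x) \<bullet> \<zeta> x"
     using p_gt1[of x] x by (intro tendsto_inner tendsto_pflux tendsto_const) auto
   qed
   show "AE x in M. norm (pflux (p x) (g x + \<tau> n *\<^sub>R \<zeta> x) \<bullet> \<zeta> x) <= 2 powr pp * (norm (g x) powr p x + norm (\<zeta> x) powr p x)" for n
   proof (intro AE_I2)
    fix x assume x: "x \<in> space M"
    have p: "1 < p x" "p x <= pp" using p_gt1 p_upper x by auto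
    let ?S = "norm (g x) + norm (\<zeta> x)"
    have "norm (g x + \<tau> n *\<^sub>R \<zeta> x) <= ?S"
     using norm_triangle_ineq[of "g x" "\<tau> n *\<^sub>R \<zeta> x"] \<tau>[of n] mult_left_le_one_le[of "norm (\<zeta> x)" "\<tau> n"] by simp
    then have "norm (g x + \<tau> n *\<^sub>R \<zeta> x) powr (p x - 1) * norm (\<zeta> x) <= ?S powr (p x - 1) * ?S"
     using p by (intro mult_mono powr_mono2) auto
    also have "... = ?S powr p x" using powr_mult_base[of ?S "p x - 1"] by (simp add: mult.commute)
    also have "... <= 2 powr p x * (norm (g x) powr p x + norm (\<zeta> x) powr p x)" using p by (intro powr_add_le) auto
    also have "... <= 2 powr pp * (norm (g x) powr p x + norm (\<zeta> x) powr p x)" using p by (intro mult_right_mono powr_mono) auto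
    finally show "norm (pflux (p x) (g x + \<tau> n *\<^sub>R \<zeta> x) \<bullet> \<zeta> x) <= 2 powr pp * (norm (g x) powr p x + norm (\<zeta> x) powr p x)"
     by (rule order_trans[OF norm_pflux_inner_le])
   qed
  qed auto
  then show ?thesis by (rule LIMSEQ_le_const) (use le in blast)
 qed
 have "(LINT x|M. pflux (p x) (g x) \<bullet> \<zeta> x) = (LINT x|M. h x * \<psi> x)" if W\<psi>: "W0 \<psi> \<zeta>" for \<psi> \<zeta>
  using EL[OF W\<psi>] EL[OF W0_scale[OF W\<psi>, of "-1"]] by simp
 then have "weak_sol h u g" using Wu by (simp add: weak_sol_def)
 then show ?thesis by blast
qed

end

section \<open>Weak gradients and the variable exponent Sobolev space\<close>

text \<open>Boxes form an intersection-stable generator of the Borel sets. The positive and negative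
  parts of \<open>f\<close> are densities of two measures that agree on boxes, hence everywhere, so
  the parts coincide almost everywhere and both vanish.\<close>

lemma AE_zero_if_box_integrals_zero:
 fixes f :: "'a::euclidean_space => real"
 assumes f: "integrable lebesgue f" and z: "\<And>a b. (LINT x|lebesgue. indicator (box a b) x * f x) = 0"
 shows "AE x in lebesgue. f x = 0"
proof -
 obtain f' where f'[measurable]: "f' \<in> borel_measurable lborel" and ae: "AE x in lborel. f x = f' x"
  using completion_ex_borel_measurable_real[of f lborel] f by (auto simp: integrable_iff_bounded)
 have ae': "AE x in lebesgue. f x = f' x" using ae by (simp add: AE_completion)
 have if': "integrable lborel f'"
 proof -
  have "integrable lebesgue f'"
   by (rule integrable_cong_AE_imp[OF f _ ae']) (simp add: measurable_completion)
  then show ?thesis by (simp add: integrable_completion)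
 qed
 \<comment> \<open>\<open>ennreal\<close> sends negative reals to 0, so these are the densities of
   the positive and of the negative part.\<close>
 have eq: "density lborel (%x. ennreal (f' x)) = density lborel (%x. ennreal (- f' x))"
 proof (rule measure_eqI_generator_eq)
  let ?E = "range (%(a, b). box a b::'a set)"
  show "Int_stable ?E" by (auto simp: Int_stable_def box_Int_box)
  show "?E \<subseteq> Pow UNIV" "sets (density lborel (%x. ennreal (f' x))) = sigma_sets UNIV ?E" "sets (density lborel (%x. ennreal (- f' x))) = sigma_sets UNIV ?E"
   by (simp_all add: borel_eq_box)
  let ?A = "%n::nat. box (- (real n *\<^sub>R One)) (real n *\<^sub>R One) :: 'a set"
  show "range ?A \<subseteq> ?E" "(\<Union>i. ?A i) = UNIV" unfolding UN_box_eq_UNIV by auto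
  let ?I = "%g X. \<integral>\<^sup>+x. ennreal (g x) * indicator X x \<partial>lborel"
  have fin: "?I g X ~= \<infinity>" if "\<And>x. g x <= norm (f' x)" for g X
  proof -
   have "?I g X <= (\<integral>\<^sup>+x. ennreal (norm (f' x)) \<partial>lborel)"
    by (intro nn_integral_mono) (use that in \<open>auto split: split_indicator intro: ennreal_leI\<close>)
   then show ?thesis using if' by (auto simp: integrable_iff_bounded top_unique)
  qed
  show "emeasure (density lborel (%x. ennreal (f' x))) (?A i) ~= \<infinity>" for i
   using fin[of f' "?A i"] by (simp add: emeasure_density)
  fix X assume "X \<in> ?E"
  then obtain a b where X: "X = box a b" by auto
  have ib: "integrable lborel (%x. indicator X x * f' x)"
   using integrable_mult_indicator[OF _ if', of X] X by simp
  have "(LINT x|lborel. indicator X x * f' x) = (LINT x|lebesgue. indicator X x * f' x)"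
   using X by (simp add: integral_completion)
  also have "... = (LINT x|lebesgue. indicator X x * f x)"
  proof (rule integral_cong_AE)
   show "AE x in lebesgue. indicator X x * f' x = indicator X x * f x" using ae' by eventually_elim simp
   have Xl: "X \<in> sets lebesgue" using X by simp
   show "(%x. indicator X x * f' x) \<in> borel_measurable lebesgue" using X by (intro measurable_completion) simp
   show "(%x. indicator X x * f x) \<in> borel_measurable lebesgue" using Xl f by measurable
  qed
  also have "... = 0" using z X by simp
  finally have i0: "(LINT x|lborel. indicator X x * f' x) = 0" .
  have e: "(\<integral>\<^sup>+x. ennreal (indicator X x * f' x) \<partial>lborel) = ?I f' X" "(\<integral>\<^sup>+x. ennreal (- (indicator X x * f' x)) \<partial>lborel) = ?I (%x. - f' x) X"
   by (intro nn_integral_cong; auto split: split_indicator)+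
  have "ennreal (enn2real (?I f' X)) = ennreal (enn2real (?I (%x. - f' x) X))"
   using i0 real_lebesgue_integral_def[OF ib] unfolding e by simp
  then have "?I f' X = ?I (%x. - f' x) X"
   using fin[of f' X] fin[of "%x. - f' x" X] by (subst (asm) (1 2) ennreal_enn2real) (simp_all add: less_top)
  then show "emeasure (density lborel (%x. ennreal (f' x))) X = emeasure (density lborel (%x. ennreal (- f' x))) X"
   using X by (simp add: emeasure_density)
 qed
 have "AE x in lborel. ennreal (f' x) = ennreal (- f' x)"
  by (rule sigma_finite_measure.density_unique[OF lborel.sigma_finite_measure_axioms _ _ eq]) auto
 then have "AE x in lborel. f' x = 0"
 proof eventually_elim
  case (elim x)
  then have "ennreal (f' x) = 0 & ennreal (- f' x) = 0" by (cases "0 <= f' x") (auto simp: ennreal_neg)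
  then show ?case by (simp add: ennreal_eq_0_iff)
 qed
 then have "AE x in lebesgue. f' x = 0" by (simp add: AE_completion)
 with ae' show ?thesis by eventually_elim simp
qed

lemma smooth_on_prod:
 assumes "finite I" "\<And>i. i \<in> I ==> smooth_on UNIV (f i)"
 shows "smooth_on UNIV (%x::real^'n::finite. \<Prod>i\<in>I. f i x)"
 using assms by (induction I) (auto intro: smooth_on_const smooth_on_mult)

lemma smooth_on_sum:
 assumes "finite I" "\<And>i. i \<in> I ==> smooth_on UNIV (f i)"
 shows "smooth_on UNIV (%x::real^'n::finite. \<Sum>i\<in>I. f i x)"
 using assms by (induction I) (auto intro: smooth_on_const smooth_on_add)

lemma smooth_on_diff_fun: "smooth_on UNIV f ==> smooth_on UNIV g ==> smooth_on UNIV (%x::real^'n::finite. f x - g x)"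
 using smooth_on_add[OF _ smooth_on_mult[OF smooth_on_const[of "-1"]], of f g] by simp

lemma smooth_on_bmp:
 assumes "smooth_on UNIV f" shows "smooth_on UNIV (%x::real^'n::finite. bmp 0 (f x))"
 using smooth_on_compose[OF assms smooth1_bmp0[of 1 0 1]] by simp

text \<open>One factor per face of the box; since \<open>bmp 0\<close> tends to 1 at infinity,
  steepening its argument makes the product converge pointwise to the indicator.\<close>

lemma box_approx:
 fixes a b :: "real^'n::finite"
 shows "EX \<psi> :: nat => real^'n => real. (ALL j. smooth_on UNIV (\<psi> j)) & (ALL j x. x \<notin> box a b --> \<psi> j x = 0) &
  (ALL j x. 0 <= \<psi> j x & \<psi> j x <= 1) & (ALL x. (%j. \<psi> j x) \<longlonglongrightarrow> indicator (box a b) x)"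
proof -
 define \<psi> where "\<psi> j x = (\<Prod>i\<in>UNIV. bmp 0 (real (Suc j) * (x $ i - a $ i)) * bmp 0 (real (Suc j) * (b $ i - x $ i)))" for j and x :: "real^'n"
 have zero: "\<psi> j x = 0" if "x \<notin> box a b" for j x
 proof -
   have "~ (ALL i. a $ i < x $ i & x $ i < b $ i)" using that by (simp add: mem_box_cart)
   then obtain i where "x $ i <= a $ i \<or> b $ i <= x $ i" by (meson not_less)
   then have "bmp 0 (real (Suc j) * (x $ i - a $ i)) * bmp 0 (real (Suc j) * (b $ i - x $ i)) = 0"
    by (auto simp: bmp_le0 mult_le_0_iff)
   then show ?thesis unfolding \<psi>_def by (auto intro!: prod_zero)
 qed
 show ?thesis
 proof (intro exI[of _ \<psi>] conjI allI impI)
  show "smooth_on UNIV (\<psi> j)" for j unfolding \<psi>_def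
   by (intro smooth_on_prod smooth_on_mult smooth_on_bmp smooth_on_diff_fun smooth_on_coord smooth_on_const) auto
  have b01: "0 <= bmp 0 s * bmp 0 t" "bmp 0 s * bmp 0 t <= 1" for s t
   using bmp_nonneg[of 0] bmp0_le1 by (auto intro: mult_le_one)
  show "0 <= \<psi> j x" "\<psi> j x <= 1" for j x unfolding \<psi>_def using b01 by (auto intro!: prod_nonneg prod_le_1)
  show "\<psi> j x = 0" if "x \<notin> box a b" for j x using zero that .
  show "(%j. \<psi> j x) \<longlonglongrightarrow> indicator (box a b) x" for x
  proof (cases "x \<in> box a b")
   case True
   have one: "(%j. bmp 0 (real (Suc j) * s)) \<longlonglongrightarrow> 1" if s: "0 < s" for s :: real
   proof -
    have "(%j. exp (- (1 / s * (1 / real (Suc j))))) \<longlonglongrightarrow> exp (- (1 / s * 0))"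
     by (intro tendsto_intros LIMSEQ_Suc[OF lim_1_over_n])
    moreover have "bmp 0 (real (Suc j) * s) = exp (- (1 / s * (1 / real (Suc j))))" for j
     using s by (simp add: bmp_def)
    ultimately show ?thesis by simp
   qed
   have "(%j. \<psi> j x) \<longlonglongrightarrow> (\<Prod>i\<in>(UNIV::'n set). 1 * 1)" unfolding \<psi>_def
    using True by (intro tendsto_prod tendsto_mult one) (auto simp: mem_box_cart)
   then show ?thesis using True by simp
  qed (simp add: zero)
 qed
qed

lemma continuous_compact_support_integrable:
 fixes f :: "'a::euclidean_space => real"
 assumes "continuous_on UNIV f" "compact S" "\<And>x. x \<notin> S ==> f x = 0"
 shows "integrable lborel f"
proof -
 have "integrable lborel (%x. indicator S x *\<^sub>R f x)"
  using assms by (intro borel_integrable_compact) (auto intro: continuous_on_subset)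
 moreover have "(%x. indicator S x *\<^sub>R f x) = f" by (rule ext) (use assms(3) in \<open>auto simp: indicator_def\<close>)
 ultimately show ?thesis by simp
qed

lemma has_derivative_partial_bound:
 fixes f :: "real^'n::finite => real"
 assumes "\<And>x. f differentiable at x" "\<And>x. norm (grad f x) <= B"
 shows "\<bar>f x - f y\<bar> <= B * norm (x - y)"
proof -
 have "norm (f x - f y) <= B * norm (x - y)"
 proof (rule differentiable_bound[of UNIV f "%x h. grad f x \<bullet> h"])
  show "(f has_derivative (\<bullet>) (grad f x)) (at x within UNIV)" for x using has_derivative_grad[OF assms(1)] by simp
  show "onorm ((\<bullet>) (grad f x)) <= B" for x
  proof (rule onorm_bound)
   show "0 <= B" using assms(2)[of 0] norm_ge_zero[of "grad f 0"] by linarith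
   show "norm (grad f x \<bullet> h) <= B * norm h" for h
    using Cauchy_Schwarz_ineq2[of "grad f x" h] mult_right_mono[OF assms(2)[of x] norm_ge_zero[of h]] by simp
  qed
 qed auto
 then show ?thesis by simp
qed

text \<open>Difference quotients have integral zero by translation invariance. They converge
  dominatedly: they are bounded by the Lipschitz constant and, for steps at most 1, live in a ball
  one unit larger.\<close>

lemma integral_partial_zero:
 fixes f :: "real^'n::finite => real"
 assumes d: "\<And>x. f differentiable at x" and c: "continuous_on UNIV (grad f)"
  and K: "bounded K" "\<And>x. x \<notin> K ==> f x = 0"
 shows "(LINT x|lborel. grad f x $ i) = 0"
proof -
 obtain R where R: "R > 0" "\<And>x. x \<in> K ==> norm x <= R" using K(1) by (auto simp: bounded_pos)
 let ?C = "cball (0::real^'n) (R + 1)"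
 have fC: "emeasure lborel ?C < \<infinity>" using emeasure_bounded_finite[of ?C] by simp
 have fc: "continuous_on UNIV f" using d by (auto intro!: differentiable_imp_continuous_on simp: differentiable_on_def)
 have [measurable]: "f \<in> borel_measurable borel" "grad f \<in> borel_measurable borel" using fc c by (auto intro: borel_measurable_continuous_onI)
 have z: "f x = 0" if "norm x > R" for x using that K(2) R(2)[of x] by force
 have gz: "grad f x = 0" if "norm x > R" for x
 proof (rule grad_eqI)
  have "((%x. 0::real) has_derivative (%h. 0 \<bullet> h)) (at x)" by auto
  then show "(f has_derivative (%h. 0 \<bullet> h)) (at x)"
   by (rule has_derivative_transform_within_open[of _ _ _ _ "- cball 0 R"]) (use that z in auto)
 qed
 have "bounded (grad f ` ?C)" by (intro compact_imp_bounded compact_continuous_image continuous_on_subset[OF c]) auto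
 then obtain B where "0 < B" "\<And>x. x \<in> ?C ==> norm (grad f x) <= B" unfolding bounded_pos by auto
 then have B: "norm (grad f x) <= B" for x using gz[of x] by (cases "x \<in> ?C") auto
 have fint: "integrable lborel f" by (rule continuous_compact_support_integrable[OF fc compact_cball[of 0 R]]) (use z in auto)
 define \<tau> where "\<tau> n = 1 / real (Suc n)" for n
 have \<tau>: "0 < \<tau> n" "\<tau> n <= 1" for n by (auto simp: \<tau>_def)
 have \<tau>0: "\<tau> \<longlonglongrightarrow> 0" unfolding \<tau>_def by (intro LIMSEQ_Suc lim_1_over_n)
 let ?e = "axis i (1::real) :: real^'n"
 have tr: "integrable lborel (%x. f (x + c))" "(LINT x|lborel. f (x + c)) = (LINT x|lborel. f x)" for c
 proof -
  have "integrable (distr lborel borel ((+) c)) f" using fint by (simp add: lborel_distr_plus)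
  then show "integrable lborel (%x. f (x + c))" by (subst (asm) integrable_distr_eq) (auto simp: add.commute)
  have "(LINT x|lborel. f x) = (\<integral>x. f x \<partial>distr lborel borel ((+) c))" by (simp add: lborel_distr_plus)
  also have "... = (LINT x|lborel. f (c + x))" by (rule integral_distr) auto
  finally show "(LINT x|lborel. f (x + c)) = (LINT x|lborel. f x)" by (simp add: add.commute)
 qed
 have "(%n. \<integral>x. (f (x + \<tau> n *\<^sub>R ?e) - f x) / \<tau> n \<partial>lborel) \<longlonglongrightarrow> (LINT x|lborel. grad f x $ i)"
 proof (rule integral_dominated_convergence)
  show "integrable lborel (%x. indicator ?C x *\<^sub>R B)"
   by (intro integrable_scaleR_left integrable_real_indicator) (use fC in auto)
  show "AE x in lborel. (%n. (f (x + \<tau> n *\<^sub>R ?e) - f x) / \<tau> n) \<longlonglongrightarrow> grad f x $ i"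
  proof (intro AE_I2)
   fix x
   have "((%s. x + s *\<^sub>R ?e) has_derivative (%t. t *\<^sub>R ?e)) (at 0)" by (auto intro!: derivative_eq_intros)
   from has_derivative_compose[OF this, of f "%h. grad f x \<bullet> h"] has_derivative_grad[OF d, of x]
   have "((%s. f (x + s *\<^sub>R ?e)) has_real_derivative grad f x $ i) (at 0)"
    by (simp add: has_field_derivative_def mult_commute_abs inner_axis)
   then have "((%h. (f (x + h *\<^sub>R ?e) - f x) / h) \<longlongrightarrow> grad f x $ i) (at 0)"
    by (simp add: has_field_derivative_iff)
   moreover have "filterlim \<tau> (at 0) sequentially" using \<tau>0 \<tau>(1) by (auto simp: filterlim_at less_imp_neq[symmetric])
   ultimately show "(%n. (f (x + \<tau> n *\<^sub>R ?e) - f x) / \<tau> n) \<longlonglongrightarrow> grad f x $ i" by (rule filterlim_compose)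
  qed
  show "AE x in lborel. norm ((f (x + \<tau> n *\<^sub>R ?e) - f x) / \<tau> n) <= indicator ?C x *\<^sub>R B" for n
  proof (intro AE_I2)
   fix x
   have n1: "norm (\<tau> n *\<^sub>R ?e) = \<tau> n" using \<tau>[of n] by simp
   show "norm ((f (x + \<tau> n *\<^sub>R ?e) - f x) / \<tau> n) <= indicator ?C x *\<^sub>R B"
   proof (cases "x \<in> ?C")
    case True
    have "\<bar>f (x + \<tau> n *\<^sub>R ?e) - f x\<bar> <= B * \<tau> n" using has_derivative_partial_bound[OF d B, of "x + \<tau> n *\<^sub>R ?e" x] n1 by simp
    then show ?thesis using True \<tau>[of n] by (simp add: abs_divide pos_divide_le_eq)
   next
    case False
    then have "norm x > R + 1" by simp
    moreover have "norm x <= norm (x + \<tau> n *\<^sub>R ?e) + \<tau> n" using norm_triangle_ineq4[of "x + \<tau> n *\<^sub>R ?e" "\<tau> n *\<^sub>R ?e"] n1 by simp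
    ultimately have "f x = 0" "f (x + \<tau> n *\<^sub>R ?e) = 0" using \<tau>[of n] by (auto intro!: z)
    then show ?thesis using False by simp
   qed
  qed
  have [measurable]: "(%x. f (x + c)) \<in> borel_measurable borel" for c using tr(1) by auto
  show "(%x. (f (x + \<tau> n *\<^sub>R ?e) - f x) / \<tau> n) \<in> borel_measurable lborel" for n by simp
  show "(%x. grad f x $ i) \<in> borel_measurable lborel"
   using borel_measurable_continuous_onI[OF continuous_on_component[OF c, of i]] by simp
 qed
 moreover have "(LINT x|lborel. (f (x + c) - f x) / s) = 0" for c s
  using tr fint by simp
 ultimately have "(%n::nat. 0) \<longlonglongrightarrow> (LINT x|lborel. grad f x $ i)" by (simp only:)
 then show ?thesis by (simp add: LIMSEQ_const_iff)
qed

section \<open>Uniqueness and measurability of weak gradients\<close>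

context bounded_open
begin

lemma weak_gradD:
 assumes "weak_grad \<Omega> u g" "test_fun \<Omega> \<phi>"
 shows "(LINT x|M. u x * partial_deriv i \<phi> x) = - (LINT x|M. g x $ i * \<phi> x)"
 using assms unfolding weak_grad_def by simp

text \<open>Smooth approximations of boxes inside the closed box are admissible test functions, so
  the difference of the gradients integrates to zero over every such box; the boundary of the closed
  box is a null set.\<close>

lemma weak_grad_eq_on_cbox:
 assumes wg: "weak_grad \<Omega> u g" "weak_grad \<Omega> u g'" and K: "cbox c d \<subseteq> \<Omega>"
 shows "AE x in lebesgue. x \<in> cbox c d --> g x $ i = g' x $ i"
proof -
 let ?K = "cbox c d"
 let ?f = "%x. indicator ?K x *\<^sub>R (g x $ i - g' x $ i)"
 have si: "set_integrable lebesgue ?K (%x. g x $ i)" "set_integrable lebesgue ?K (%x. g' x $ i)"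
  using wg K unfolding weak_grad_def by (simp_all add: compact_cbox)
 have fi: "integrable lebesgue ?f"
  using set_integral_diff(1)[OF si] by (simp add: set_integrable_def)
 have "AE x in lebesgue. ?f x = 0"
 proof (rule AE_zero_if_box_integrals_zero[OF fi])
  fix a b :: "real^'n"
  have "EX a' b'. box a b \<inter> box c d = box a' b'" unfolding box_Int_box by blast
  then obtain a' b' where ab: "box a b \<inter> box c d = box a' b'" by blast
  have sub: "box a' b' \<subseteq> box c d" using ab by auto
  obtain \<psi> :: "nat => real^'n => real" where \<psi>: "\<And>j. smooth_on UNIV (\<psi> j)" "\<And>j x. x \<notin> box a' b' ==> \<psi> j x = 0"
   "\<And>j x. 0 <= \<psi> j x & \<psi> j x <= 1" "\<And>x. (%j. \<psi> j x) \<longlonglongrightarrow> indicator (box a' b') x"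
   using box_approx[of a' b'] by blast
  have \<psi>K: "\<psi> j x = 0" if "x \<notin> ?K" for j x using \<psi>(2)[of x j] that sub box_subset_cbox[of c d] by blast
  have t: "test_fun \<Omega> (\<psi> j)" for j by (rule test_funI[of _ ?K]) (use \<psi>(1) \<psi>K K in auto)
  have [measurable]: "\<psi> j \<in> borel_measurable lebesgue" for j
   using test_fun_cont[OF t] by (intro measurable_completion) (simp add: borel_measurable_continuous_onI)
  have ip: "integrable lebesgue (%x. \<psi> j x * (indicator ?K x *\<^sub>R h x))" if "set_integrable lebesgue ?K h" for h j
  proof (rule Bochner_Integration.integrable_bound)
   show "integrable lebesgue (%x. indicator ?K x *\<^sub>R h x)" using that by (simp add: set_integrable_def)
   then show "(%x. \<psi> j x * (indicator ?K x *\<^sub>R h x)) \<in> borel_measurable lebesgue"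
    by (intro borel_measurable_times) auto
   show "AE x in lebesgue. norm (\<psi> j x * (indicator ?K x *\<^sub>R h x)) <= norm (indicator ?K x *\<^sub>R h x)"
    using \<psi>(3)[of j] by (intro AE_I2) (auto simp: abs_mult intro: mult_left_le_one_le)
  qed
  have int: "(LINT x|M. h x * \<psi> j x) = (LINT x|lebesgue. \<psi> j x * (indicator ?K x *\<^sub>R h x))" for h j
  proof -
   have "(LINT x|M. h x * \<psi> j x) = (LINT x|lebesgue. indicator \<Omega> x *\<^sub>R (h x * \<psi> j x))"
    by (rule integral_restrict_space) simp
   also have "... = (LINT x|lebesgue. \<psi> j x * (indicator ?K x *\<^sub>R h x))"
    using \<psi>K K by (intro Bochner_Integration.integral_cong) (auto split: split_indicator)
   finally show ?thesis .
  qed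
  have z: "(LINT x|lebesgue. \<psi> j x * ?f x) = 0" for j
  proof -
   have "- (LINT x|M. g x $ i * \<psi> j x) = - (LINT x|M. g' x $ i * \<psi> j x)"
    using weak_gradD[OF wg(1) t[of j], of i] weak_gradD[OF wg(2) t[of j], of i] by simp
   then have "(LINT x|lebesgue. \<psi> j x * (indicator ?K x *\<^sub>R g x $ i)) - (LINT x|lebesgue. \<psi> j x * (indicator ?K x *\<^sub>R g' x $ i)) = 0"
    unfolding int by simp
   then show ?thesis using ip[OF si(1), of j] ip[OF si(2), of j]
    by (subst (asm) Bochner_Integration.integral_diff[symmetric]) (simp_all add: algebra_simps)
  qed
  have "(%j. \<integral>x. \<psi> j x * ?f x \<partial>lebesgue) \<longlonglongrightarrow> (LINT x|lebesgue. indicator (box a' b') x * ?f x)"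
  proof (rule integral_dominated_convergence)
   show "integrable lebesgue (%x. norm (?f x))" using fi by (rule integrable_norm)
   have fm: "?f \<in> borel_measurable lebesgue" using fi by auto
   then show "(%x. indicator (box a' b') x * ?f x) \<in> borel_measurable lebesgue"
    by (intro borel_measurable_times borel_measurable_indicator) auto
   show "(%x. \<psi> j x * ?f x) \<in> borel_measurable lebesgue" for j using fm by (intro borel_measurable_times) auto
   show "AE x in lebesgue. (%j. \<psi> j x * ?f x) \<longlonglongrightarrow> indicator (box a' b') x * ?f x"
    by (intro AE_I2 tendsto_mult tendsto_const \<psi>(4))
   show "AE x in lebesgue. norm (\<psi> j x * ?f x) <= norm (?f x)" for j
    using \<psi>(3)[of j] by (intro AE_I2) (auto simp: abs_mult intro: mult_left_le_one_le)
  qed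
  then have "(LINT x|lebesgue. indicator (box a' b') x * ?f x) = 0" unfolding z by (simp add: LIMSEQ_const_iff)
  moreover have "(LINT x|lebesgue. indicator (box a b) x * ?f x) = (LINT x|lebesgue. indicator (box a' b') x * ?f x)"
  proof (rule integral_cong_AE)
   have fm: "?f \<in> borel_measurable lebesgue" using fi by auto
   then show "(%x. indicator (box a b) x * ?f x) \<in> borel_measurable lebesgue" "(%x. indicator (box a' b') x * ?f x) \<in> borel_measurable lebesgue"
    by (auto intro!: borel_measurable_times borel_measurable_indicator)
   have "cbox c d - box c d \<in> null_sets lebesgue" using negligible_frontier_interval[of c d] by (simp add: negligible_iff_null_sets)
   then have "AE x in lebesgue. x \<notin> cbox c d - box c d" by (rule AE_not_in)
   then show "AE x in lebesgue. indicator (box a b) x * ?f x = indicator (box a' b') x * ?f x"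
   proof eventually_elim
    case x: (elim x)
    have "x \<in> box a' b' \<longleftrightarrow> x \<in> box a b & x \<in> box c d" using ab by blast
    then show ?case
     using x by (auto split: split_indicator)
   qed
  qed
  ultimately show "(LINT x|lebesgue. indicator (box a b) x * ?f x) = 0" by simp
 qed
 then show ?thesis by eventually_elim auto
qed

text \<open>Countably many closed boxes exhaust the open set. Uniqueness matters because
  \<open>weak_eq\<close> quantifies over arbitrary weak gradients of a test function.\<close>

lemma weak_grad_unique:
 assumes wg: "weak_grad \<Omega> u g" "weak_grad \<Omega> u g'"
 shows "AE x in M. g x = g' x"
proof -
 obtain D where D: "countable D" "D \<subseteq> Pow \<Omega>" "\<And>X. X \<in> D ==> EX a b. X = cbox a b" "\<Union>D = \<Omega>"
  by (rule open_countable_Union_open_cbox[OF open_\<Omega>]) (rule that)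
 have "AE x in lebesgue. ALL X:D. ALL i:UNIV. x \<in> X --> g x $ i = g' x $ i"
 proof (rule AE_ball_countable[OF D(1), THEN iffD2, rule_format])
  fix X assume X: "X \<in> D"
  then obtain c d where "X = cbox c d" using D by blast
  then show "AE x in lebesgue. ALL i:UNIV. x \<in> X --> g x $ i = g' x $ i"
   using weak_grad_eq_on_cbox[OF wg] X D(2) by (intro AE_finite_allI) auto
 qed
 then have "AE x in lebesgue. x \<in> \<Omega> --> g x = g' x"
 proof eventually_elim
  fix x assume *: "ALL X:D. ALL i:UNIV. x \<in> X --> g x $ i = g' x $ i"
  show "x \<in> \<Omega> --> g x = g' x"
  proof
   assume "x \<in> \<Omega>"
   then obtain X where "X \<in> D" "x \<in> X" using D(4) by blast
   then show "g x = g' x" using * by (auto simp: vec_eq_iff)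
  qed
 qed
 then show ?thesis by (simp add: AE_restrict_space_iff)
qed

text \<open>\<open>weak_grad\<close> provides integrability on compact subsets only; measurability
  on the domain is pieced together over countably many closed boxes.\<close>

lemma weak_grad_M:
 assumes wg: "weak_grad \<Omega> u g"
 shows "meas g"
proof -
 obtain D where D: "countable D" "D \<subseteq> Pow \<Omega>" "\<And>X. X \<in> D ==> EX a b. X = cbox a b" "\<Union>D = \<Omega>"
  by (rule open_countable_Union_open_cbox[OF open_\<Omega>]) (rule that)
 have gi: "meas (%x. g x $ i)" for i
 proof (rule measurable_piecewise_restrict[OF D(1)])
  show "space M \<subseteq> \<Union>D" using D(4) by simp
  fix X assume X: "X \<in> D"
  then obtain c d where cd: "X = cbox c d" using D by blast
  have sub: "X \<subseteq> \<Omega>" using X D(2) by blast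
  show "X \<inter> space M \<in> sets M" using cd sub by (auto simp: sets_restrict_space_iff Int_absorb2)
  have "set_integrable lebesgue X (%x. g x $ i)" using wg cd sub unfolding weak_grad_def by (simp add: compact_cbox)
  then have "integrable (lebesgue_on X) (%x. g x $ i)" using cd by (simp add: integrable_restrict_space set_integrable_def)
  then have "(%x. g x $ i) \<in> borel_measurable (lebesgue_on X)" by auto
  moreover have "restrict_space M X = lebesgue_on X" using sub cd by (simp add: restrict_restrict_space Int_absorb1)
  ultimately show "(%x. g x $ i) \<in> borel_measurable (restrict_space M X)" by simp
 qed
 have "meas (%x. g x \<bullet> b)" if b: "b \<in> Basis" for b
 proof -
  obtain i where "b = axis i 1" using axis_inverse[OF b] by blast
  then show ?thesis using gi[of i] by (simp add: inner_axis)
 qed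
 then show ?thesis using borel_measurable_euclidean_space[of g M] by blast
qed

lemma integral_M_lborel:
 fixes F :: "real^'n => real"
 assumes "F \<in> borel_measurable borel" "\<And>x. x \<notin> \<Omega> ==> F x = 0"
 shows "(LINT x|M. F x) = (LINT x|lborel. F x)"
proof -
 have "(LINT x|M. F x) = (LINT x|lebesgue. indicator \<Omega> x *\<^sub>R F x)" by (rule integral_restrict_space) simp
 also have "(%x. indicator \<Omega> x *\<^sub>R F x) = F" using assms(2) by (auto split: split_indicator)
 finally show ?thesis using assms(1) by (simp add: integral_completion)
qed

lemma test_parts:
 assumes \<phi>: "test_fun \<Omega> \<phi>" and \<psi>: "test_fun \<Omega> \<psi>"
 shows "(LINT x|M. \<phi> x * partial_deriv i \<psi> x) = - (LINT x|M. grad \<phi> x $ i * \<psi> x)"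
proof -
 interpret finite_measure M by (rule finite_M)
 obtain B1 where B1: "B1 >= 0" "\<And>x. \<bar>\<phi> x\<bar> <= B1" "\<And>x. norm (grad \<phi> x) <= B1" by (rule test_bounded[OF \<phi>]) (rule that, auto)
 obtain B2 where B2: "B2 >= 0" "\<And>x. \<bar>\<psi> x\<bar> <= B2" "\<And>x. norm (grad \<psi> x) <= B2" by (rule test_bounded[OF \<psi>]) (rule that, auto)
 have pd: "partial_deriv i \<psi> x = grad \<psi> x $ i" for x by (simp add: grad_def)
 have [measurable]: "\<phi> \<in> borel_measurable borel" "\<psi> \<in> borel_measurable borel" "grad \<phi> \<in> borel_measurable borel" "grad \<psi> \<in> borel_measurable borel"
  using \<phi> \<psi> by (auto intro!: borel_measurable_continuous_onI test_fun_cont test_fun_grad_cont)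
 have [measurable]: "(%x. grad \<phi> x $ i) \<in> borel_measurable borel" "(%x. grad \<psi> x $ i) \<in> borel_measurable borel"
  using test_fun_grad_cont[OF \<phi>] test_fun_grad_cont[OF \<psi>] by (auto intro!: borel_measurable_continuous_onI continuous_on_component)
 let ?f = "%x. \<phi> x * \<psi> x"
 have t: "test_fun \<Omega> ?f" by (rule test_fun_mult_smooth[OF test_fun_smooth[OF \<phi>] \<psi>])
 obtain K where K: "compact K" "\<And>x. x \<notin> K ==> ?f x = 0" using test_funE[OF t] by metis
 have "(LINT x|lborel. grad ?f x $ i) = 0"
  by (rule integral_partial_zero[OF test_fun_diff[OF t] test_fun_grad_cont[OF t] compact_imp_bounded[OF K(1)] K(2)])
 moreover have "grad ?f x $ i = \<phi> x * grad \<psi> x $ i + grad \<phi> x $ i * \<psi> x" for x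
  using partial_deriv_mult[OF test_fun_diff[OF \<phi>, of x] test_fun_diff[OF \<psi>, of x], of i] by (simp add: grad_def)
 ultimately have "(LINT x|lborel. \<phi> x * grad \<psi> x $ i + grad \<phi> x $ i * \<psi> x) = 0" by simp
 then have "(LINT x|M. \<phi> x * grad \<psi> x $ i + grad \<phi> x $ i * \<psi> x) = 0"
  by (subst integral_M_lborel) (use test_fun_outside[OF \<phi>] test_fun_outside[OF \<psi>] in auto)
 moreover have "integrable M (%x. \<phi> x * grad \<psi> x $ i)"
 proof (rule integrable_const_bound[of _ "B1 * B2"])
  show "AE x in M. norm (\<phi> x * grad \<psi> x $ i) <= B1 * B2"
   using B1 B2 component_le_norm_cart order_trans by (intro AE_I2) (auto simp: abs_mult intro!: mult_mono; blast)
  show "meas (%x. \<phi> x * grad \<psi> x $ i)" by (rule borel_M) simp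
 qed
 moreover have "integrable M (%x. grad \<phi> x $ i * \<psi> x)"
 proof (rule integrable_const_bound[of _ "B1 * B2"])
  show "AE x in M. norm (grad \<phi> x $ i * \<psi> x) <= B1 * B2"
   using B1 B2 component_le_norm_cart order_trans by (intro AE_I2) (auto simp: abs_mult intro!: mult_mono; blast)
  show "meas (%x. grad \<phi> x $ i * \<psi> x)" by (rule borel_M) simp
 qed
 ultimately show ?thesis unfolding pd by simp
qed

end

context var_exponent
begin

lemma W0_weak_grad:
 assumes W: "W0 u g" shows "weak_grad \<Omega> u g"
proof -
 obtain \<phi> where \<phi>: "W0_via \<phi> u g" using W unfolding W0_def by blast
 note [measurable] = W0_M[OF W]
 have t: "test_fun \<Omega> (\<phi> k)" for k using \<phi> unfolding W0_via_def by auto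
 have [measurable]: "meas (grad (\<phi> k))" for k using t by auto
 have iu: "integrable M u" and ig: "integrable M g" using W0_integrable[OF W] .
 have igi: "integrable M (%x. h x $ i)" if "integrable M h" for h :: "real^'n => real^'n" and i
 proof -
  have "integrable M (%x. h x \<bullet> axis i 1)" using that by (rule integrable_inner_left)
  then show ?thesis by (simp add: inner_axis)
 qed
 have si: "set_integrable lebesgue K h" if h: "integrable M h" and K: "compact K" "K \<subseteq> \<Omega>" for h :: "real^'n => real" and K
 proof -
  have i\<Omega>: "integrable lebesgue (%x. indicator \<Omega> x *\<^sub>R h x)" using h by (simp add: integrable_restrict_space)
  have "K \<in> sets lebesgue" using K by (simp add: compact_imp_closed borel_closed)
  from integrable_mult_indicator[OF this i\<Omega>]
  have "integrable lebesgue (%x. indicator K x *\<^sub>R (indicator \<Omega> x *\<^sub>R h x))" .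
  moreover have "(%x. indicator K x *\<^sub>R (indicator \<Omega> x *\<^sub>R h x)) = (%x. indicator K x *\<^sub>R h x)"
   by (rule ext) (use K in \<open>auto simp: indicator_def\<close>)
  ultimately show ?thesis by (simp add: set_integrable_def)
 qed
 have l1: "(%k. L1n (%x. \<phi> k x - u x)) \<longlonglongrightarrow> 0" and l2: "(%k. L1n (%x. grad (\<phi> k) x - g x)) \<longlonglongrightarrow> 0"
  using \<phi> unfolding W0_via_def by (auto intro!: L1n_tendsto)
 have eq: "(LINT x|M. u x * partial_deriv i \<psi> x) = - (LINT x|M. g x $ i * \<psi> x)" if \<psi>: "test_fun \<Omega> \<psi>" for \<psi> i
 proof -
  obtain B where B: "\<And>x. \<bar>\<psi> x\<bar> <= B" "\<And>x. norm (grad \<psi> x) <= B" by (rule test_bounded[OF \<psi>]) (rule that, auto)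
  have "(%k. \<integral>x. partial_deriv i \<psi> x \<bullet> \<phi> k x \<partial>M) \<longlonglongrightarrow> (LINT x|M. partial_deriv i \<psi> x \<bullet> u x)"
  proof (rule integral_inner_tendsto(2)[OF W0_integrable(1)[OF W0_test[OF t]] iu l1])
   show "meas (partial_deriv i \<psi>)" by (intro cont_M smooth_on_cont smooth_on_partial test_fun_smooth[OF \<psi>])
   have "\<bar>partial_deriv i \<psi> x\<bar> <= B" for x
    using component_le_norm_cart[of "grad \<psi> x" i] B(2)[of x] by (simp add: grad_def)
   then show "AE x in M. norm (partial_deriv i \<psi> x) <= B" by simp
  qed
  then have "(%k. \<integral>x. \<phi> k x * partial_deriv i \<psi> x \<partial>M) \<longlonglongrightarrow> (LINT x|M. u x * partial_deriv i \<psi> x)" by (simp add: mult.commute)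
  moreover have "(%k. \<integral>x. (\<psi> x *\<^sub>R axis i 1) \<bullet> grad (\<phi> k) x \<partial>M) \<longlonglongrightarrow> (LINT x|M. (\<psi> x *\<^sub>R axis i 1) \<bullet> g x)"
  proof (rule integral_inner_tendsto(2)[OF W0_integrable(2)[OF W0_test[OF t]] ig l2])
   show "meas (%x. \<psi> x *\<^sub>R axis i 1 :: real^'n)" by (rule borel_measurable_scaleR[OF test_M[OF \<psi>] borel_measurable_const])
  qed (use B in auto)
  then have "(%k. \<integral>x. grad (\<phi> k) x $ i * \<psi> x \<partial>M) \<longlonglongrightarrow> (LINT x|M. g x $ i * \<psi> x)" by (simp add: inner_axis' mult.commute)
  ultimately have "(%k. - (LINT x|M. grad (\<phi> k) x $ i * \<psi> x)) \<longlonglongrightarrow> (LINT x|M. u x * partial_deriv i \<psi> x)"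
   "(%k. - (LINT x|M. grad (\<phi> k) x $ i * \<psi> x)) \<longlonglongrightarrow> - (LINT x|M. g x $ i * \<psi> x)"
   using test_parts[OF t \<psi>, of _ i] by (auto intro: tendsto_minus)
  then show ?thesis by (rule LIMSEQ_unique)
 qed
 show ?thesis unfolding weak_grad_def using si[OF iu] si[OF igi[OF ig]] eq by blast
qed

section \<open>Luxemburg norm and modular\<close>

lemma modular_pmod: "modular \<Omega> p (%x. norm (f x) / l) = pmod (%x. (1 / l) *\<^sub>R f x)" if "0 < l"
 unfolding modular_def pmod_def using that by (simp add: abs_divide)

lemma pmod_scale_le:
 fixes f :: "real^'n => 'b::euclidean_space"
 assumes [measurable]: "meas f" and l: "1 <= l"
 shows "pmod (%x. (1 / l) *\<^sub>R f x) <= ennreal (1 / l) * pmod f"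
proof -
 have "pmod (%x. (1 / l) *\<^sub>R f x) <= eint (%x. ennreal (1 / l) * ennreal (norm (f x) powr p x))"
  unfolding pmod_def
 proof (intro nn_integral_mono)
  fix x assume x: "x \<in> space M"
  have "norm ((1 / l) *\<^sub>R f x) powr p x = (1 / l) powr p x * norm (f x) powr p x" using l by (simp add: powr_divide)
  also have "(1 / l) powr p x <= (1 / l) powr 1" using p_gt1[of x] x l by (intro powr_mono') auto
  finally show "ennreal (norm ((1 / l) *\<^sub>R f x) powr p x) <= ennreal (1 / l) * ennreal (norm (f x) powr p x)"
   using l by (simp add: ennreal_mult[symmetric] ennreal_leI mult_right_mono)
 qed
 then show ?thesis by (subst (asm) nn_integral_cmult) (auto simp: pmod_def)
qed

definition luxset :: "(real^'n => 'b::euclidean_space) => real set" where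
 "luxset f = {l. l > 0 & pmod (%x. (1 / l) *\<^sub>R f x) <= 1}"

lemma lux_norm_eq: "lux_norm \<Omega> p (%x. norm (f x)) = Inf (luxset f)"
 unfolding lux_norm_def luxset_def by (intro arg_cong[where f=Inf] Collect_cong conj_cong refl) (simp add: modular_pmod)

lemma lux_norm_eq_real: "lux_norm \<Omega> p f = Inf (luxset f)"
 unfolding lux_norm_def luxset_def modular_def pmod_def
 by (intro arg_cong[where f=Inf] Collect_cong conj_cong refl) (simp add: abs_divide)

lemma luxset_nonempty:
 fixes f :: "real^'n => 'b::euclidean_space"
 assumes "meas f" "pmod f < \<infinity>" shows "luxset f ~= {}"
proof -
 obtain X where X: "pmod f = ennreal X" "X >= 0" using assms(2) by (cases "pmod f") auto
 have "pmod (%x. (1 / (X + 1)) *\<^sub>R f x) <= ennreal (1 / (X + 1)) * ennreal X"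
  using pmod_scale_le[OF assms(1), of "X + 1"] X by simp
 also have "... = ennreal (1 / (X + 1) * X)" using X by (subst ennreal_mult) auto
 also have "... <= 1" using X by (simp add: field_simps)
 finally show ?thesis using X unfolding luxset_def by (auto intro!: exI[of _ "X + 1"])
qed

text \<open>An admissible scale l <= 1 bounds the modular by l, by convexity. Conversely a dilation
  by 2/e multiplies the modular by at most a fixed factor, the exponent being bounded by
  \<open>pp\<close>, so a small modular forces the norm below e.\<close>

lemma luxset_tendsto_0:
 fixes f :: "nat => real^'n => 'b::euclidean_space"
 assumes m: "\<And>k. meas (f k)" and fin: "\<And>k. pmod (f k) < \<infinity>"
 shows "(%k. Inf (luxset (f k))) \<longlonglongrightarrow> 0 \<longleftrightarrow> (%k. pmod (f k)) \<longlonglongrightarrow> 0"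
proof -
 have bdd: "bdd_below (luxset (f k))" for k by (rule bdd_belowI[of _ 0]) (auto simp: luxset_def)
 have nn: "0 <= Inf (luxset (f k))" for k
  by (rule cInf_greatest[OF luxset_nonempty[OF m fin]]) (auto simp: luxset_def)
 show ?thesis
 proof
  assume L: "(%k. Inf (luxset (f k))) \<longlonglongrightarrow> 0"
  show "(%k. pmod (f k)) \<longlonglongrightarrow> 0"
  proof (rule tendsto_0_if_le)
   fix e :: real assume e: "0 < e"
   define e' where "e' = min e 1"
   have e': "0 < e'" "e' <= e" "e' <= 1" using e by (auto simp: e'_def)
   have "\<forall>\<^sub>F k in sequentially. Inf (luxset (f k)) < e'" using L e' by (intro order_tendstoD) auto
   then show "\<forall>\<^sub>F k in sequentially. pmod (f k) <= ennreal e"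
   proof eventually_elim
    case (elim k)
    then obtain l where l: "l \<in> luxset (f k)" "l < e'" using cInf_lessD[OF luxset_nonempty[OF m fin]] by blast
    then have l0: "0 < l" "l <= 1" "pmod (%x. (1 / l) *\<^sub>R f k x) <= 1" using e' by (auto simp: luxset_def)
    have [measurable]: "meas (f k)" by (rule m)
    have "pmod (f k) = pmod (%x. (1 / (1 / l)) *\<^sub>R ((1 / l) *\<^sub>R f k x))" using l0 by simp
    also have "... <= ennreal (1 / (1 / l)) * pmod (%x. (1 / l) *\<^sub>R f k x)" using l0 by (intro pmod_scale_le) auto
    also have "... <= ennreal l * 1" using l0 by (intro mult_mono) auto
    also have "... <= ennreal e" using l(2) e' by (simp add: ennreal_leI)
    finally show ?case .
   qed
  qed
 next
  assume L: "(%k. pmod (f k)) \<longlonglongrightarrow> 0"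
  show "(%k. Inf (luxset (f k))) \<longlonglongrightarrow> 0"
  proof (rule tendstoI)
   fix e :: real assume e: "0 < e"
   define B where "B = max 1 (2 / e) powr pp"
   have "(%k. ennreal B * pmod (f k)) \<longlonglongrightarrow> 0" by (rule tendsto_0_cmult[OF L])
   then have "\<forall>\<^sub>F k in sequentially. ennreal B * pmod (f k) < 1" by (intro order_tendstoD) auto
   then show "\<forall>\<^sub>F k in sequentially. dist (Inf (luxset (f k))) 0 < e"
   proof eventually_elim
    case k: (elim k)
    have "pmod (%x. (1 / (e / 2)) *\<^sub>R f k x) <= ennreal B * pmod (f k)"
     unfolding B_def using e by (intro pmod_mult_le m) auto
    then have "e / 2 \<in> luxset (f k)" using k e unfolding luxset_def by (auto intro: order_trans less_imp_le)
    then have "Inf (luxset (f k)) <= e / 2" by (rule cInf_lower[OF _ bdd])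
    then show ?case using nn[of k] e by simp
   qed
  qed
 qed
qed

lemma Lvar_pmod:
 fixes f :: "real^'n => 'b::euclidean_space"
 assumes [measurable]: "meas f"
 shows "Lvar \<Omega> p (%x. norm (f x)) \<longleftrightarrow> pmod f < \<infinity>"
proof
 assume "Lvar \<Omega> p (%x. norm (f x))"
 then obtain l where l: "0 < l" "pmod (%x. (1 / l) *\<^sub>R f x) < \<infinity>" unfolding Lvar_def by (auto simp: modular_pmod)
 have "pmod f = pmod (%x. l *\<^sub>R ((1 / l) *\<^sub>R f x))" using l by simp
 also have "... <= ennreal (max 1 l powr pp) * pmod (%x. (1 / l) *\<^sub>R f x)" using l by (intro pmod_mult_le) auto
 also have "... < \<infinity>" using l by (simp add: ennreal_mult_less_top)
 finally show "pmod f < \<infinity>" .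
next
 assume "pmod f < \<infinity>"
 then have "modular \<Omega> p (%x. norm (f x) / 1) < \<infinity>" by (subst modular_pmod) auto
 then show "Lvar \<Omega> p (%x. norm (f x))" unfolding Lvar_def by (auto intro!: exI[of _ 1])
qed

lemma Lvar_pmod_real:
 assumes [measurable]: "meas (f :: real^'n => real)"
 shows "Lvar \<Omega> p f \<longleftrightarrow> pmod f < \<infinity>"
proof -
 have "Lvar \<Omega> p f \<longleftrightarrow> Lvar \<Omega> p (%x. norm (f x))" unfolding Lvar_def modular_def by (simp add: abs_divide)
 then show ?thesis using Lvar_pmod[of f] by simp
qed

lemma pmod_diff_finite:
 fixes f g :: "real^'n => 'b::euclidean_space"
 assumes "meas f" "meas g" "pmod f < \<infinity>" "pmod g < \<infinity>"
 shows "pmod (%x. f x - g x) < \<infinity>"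
 by (rule le_less_trans[OF pmod_diff[OF assms(1,2)]]) (use assms in \<open>simp add: ennreal_mult_less_top\<close>)

lemma pmod_test_fun: "test_fun \<Omega> \<phi> ==> pmod \<phi> < \<infinity>"
 by (metis pmod_bounded_finite test_bounded real_norm_def)

lemma W01p_iff:
 assumes m: "meas u" "meas g" and fin: "pmod u < \<infinity>" "pmod g < \<infinity>" and t: "\<And>k. test_fun \<Omega> (\<phi> k)"
 shows "(%k. W1p_norm \<Omega> p (%x. \<phi> k x - u x) (%x. grad (\<phi> k) x - g x)) \<longlonglongrightarrow> 0 \<longleftrightarrow>
  (%k. pmod (%x. \<phi> k x - u x)) \<longlonglongrightarrow> 0 & (%k. pmod (%x. grad (\<phi> k) x - g x)) \<longlonglongrightarrow> 0"
proof -
 note [measurable] = m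
 have [measurable]: "meas (\<phi> k)" "meas (grad (\<phi> k))" for k using t by auto
 have f1: "pmod (%x. \<phi> k x - u x) < \<infinity>" for k by (intro pmod_diff_finite pmod_test_fun t fin) auto
 have f2: "pmod (%x. grad (\<phi> k) x - g x) < \<infinity>" for k by (intro pmod_diff_finite pmod_test t fin) auto
 let ?a = "%k. Inf (luxset (%x. \<phi> k x - u x))" and ?b = "%k. Inf (luxset (%x. grad (\<phi> k) x - g x))"
 have nn: "0 <= ?a k" "0 <= ?b k" for k
  by (rule cInf_greatest[OF luxset_nonempty[OF _ f1]]; auto simp: luxset_def)
    (rule cInf_greatest[OF luxset_nonempty[OF _ f2]]; auto simp: luxset_def)
 have "(%k. ?a k + ?b k) \<longlonglongrightarrow> 0 \<longleftrightarrow> ?a \<longlonglongrightarrow> 0 & ?b \<longlonglongrightarrow> 0"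
 proof (intro iffI conjI)
  assume s: "(%k. ?a k + ?b k) \<longlonglongrightarrow> 0"
  show "?a \<longlonglongrightarrow> 0" by (rule tendsto_sandwich[OF _ _ tendsto_const s]) (use nn in auto)
  show "?b \<longlonglongrightarrow> 0" by (rule tendsto_sandwich[OF _ _ tendsto_const s]) (use nn in auto)
 next
  assume "?a \<longlonglongrightarrow> 0 & ?b \<longlonglongrightarrow> 0"
  then have "(%k. ?a k + ?b k) \<longlonglongrightarrow> 0 + 0" by (intro tendsto_add) auto
  then show "(%k. ?a k + ?b k) \<longlonglongrightarrow> 0" by simp
 qed
 then show ?thesis
  unfolding W1p_norm_def lux_norm_eq lux_norm_eq_real
  using luxset_tendsto_0[of "%k x. \<phi> k x - u x", OF _ f1] luxset_tendsto_0[of "%k x. grad (\<phi> k) x - g x", OF _ f2] by simp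
qed

text \<open>Modular convergence of the values implies convergence in the mean, and uniqueness of
  weak gradients replaces the gradient hidden in \<open>W01p\<close> by the given one.\<close>

lemma W01p_imp_W0:
 assumes "W01p \<Omega> p u" "weak_grad \<Omega> u g" shows "W0 u g"
proof -
 obtain h \<phi> where h: "W1p_grad \<Omega> p u h" and t: "\<And>k. test_fun \<Omega> (\<phi> k)"
  and l: "(%k. W1p_norm \<Omega> p (%x. \<phi> k x - u x) (%x. grad (\<phi> k) x - h x)) \<longlonglongrightarrow> 0"
  using assms(1) unfolding W01p_def by blast
 have wh: "weak_grad \<Omega> u h" using h by (simp add: W1p_grad_def)
 have m: "meas u" "meas h"
  using h weak_grad_M[OF wh] by (auto simp: W1p_grad_def Lvar_def)
 note [measurable] = m
 have [measurable]: "meas (\<phi> k)" "meas (grad (\<phi> k))" for k using t by auto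
 have fin: "pmod u < \<infinity>" "pmod h < \<infinity>" using h Lvar_pmod_real[OF m(1)] Lvar_pmod[OF m(2)] by (auto simp: W1p_grad_def)
 have lims: "(%k. pmod (%x. \<phi> k x - u x)) \<longlonglongrightarrow> 0" "(%k. pmod (%x. grad (\<phi> k) x - h x)) \<longlonglongrightarrow> 0"
  using W01p_iff[OF m fin t] l by auto
 have "(%k. L1n (%x. \<phi> k x - u x)) \<longlonglongrightarrow> 0" by (rule L1n_tendsto[OF _ lims(1)]) simp
 then have "W0_via \<phi> u h" unfolding W0_via_def using m t lims by auto
 then have "W0 u h" unfolding W0_def by blast
 from W0_cong[OF this _ weak_grad_unique[OF wh assms(2)] m(1) weak_grad_M[OF assms(2)]] show ?thesis by simp
qed

end

lemma scaled_sin_tendsto: "(%j. real (Suc j) * sin (t / real (Suc j))) \<longlonglongrightarrow> t"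
proof (cases "t = 0")
 case False
 have z: "(%j. t / real (Suc j)) \<longlonglongrightarrow> 0"
  using tendsto_mult[OF tendsto_const[of t] LIMSEQ_Suc[OF lim_1_over_n]] by simp
 have "((%h::real. sin h / h) \<longlongrightarrow> 1) (at 0)"
  using DERIV_sin[of 0] by (simp add: has_field_derivative_iff)
 moreover have "filterlim (%j. t / real (Suc j)) (at 0) sequentially"
  using z False by (auto simp: filterlim_at)
 ultimately have "(%j. sin (t / real (Suc j)) / (t / real (Suc j))) \<longlonglongrightarrow> 1" by (rule filterlim_compose)
 from tendsto_mult[OF tendsto_const[of t] this]
 have "(%j. t * (sin (t / real (Suc j)) / (t / real (Suc j)))) \<longlonglongrightarrow> t" by (simp only: mult_1_right)
 moreover have "t * (sin (t / real (Suc j)) / (t / real (Suc j))) = real (Suc j) * sin (t / real (Suc j))" for j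
  using False by simp
 ultimately show ?thesis by (simp only:)
qed simp

context var_exponent
begin

lemma pmod_le_L1:
 assumes [measurable]: "meas (f :: real^'n => real)" and B: "\<And>x. x \<in> \<Omega> ==> \<bar>f x\<bar> <= B"
 shows "pmod f <= ennreal (max 1 B powr pp) * L1n f"
proof -
 have "pmod f <= eint (%x. ennreal (max 1 B powr pp) * ennreal (norm (f x)))"
  unfolding pmod_def
 proof (intro nn_integral_mono)
  fix x assume x: "x \<in> space M"
  have p: "1 < p x" "p x <= pp" using p_gt1 p_upper x by auto
  have "norm (f x) powr p x = \<bar>f x\<bar> powr (p x - 1) * \<bar>f x\<bar>"
   using powr_mult_base[of "\<bar>f x\<bar>" "p x - 1"] by (simp add: mult.commute)
  also have "\<bar>f x\<bar> powr (p x - 1) <= max 1 B powr (p x - 1)" using p B[of x] x by (intro powr_mono2) auto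
  also have "... <= max 1 B powr pp" using p by (intro powr_mono) auto
  finally show "ennreal (norm (f x) powr p x) <= ennreal (max 1 B powr pp) * ennreal (norm (f x))"
   by (simp add: ennreal_mult[symmetric] ennreal_leI mult_right_mono)
 qed
 then show ?thesis by (subst (asm) nn_integral_cmult) auto
qed

text \<open>Truncating by the bounded smooth functions t \<open>\<mapsto>\<close> m sin (t / m) turns the L1-approximation of u
 into an approximation in the variable exponent space, without a Poincare inequality for the Luxemburg norm.\<close>

lemma W0_bounded_imp_W01p:
 assumes W: "W0 u g" and B: "AE x in M. \<bar>u x\<bar> <= B"
 shows "W01p \<Omega> p u"
proof -
 note [measurable] = W0_M[OF W]
 obtain \<phi> where \<phi>: "W0_via \<phi> u g" using W unfolding W0_def by blast
 define m where "m j = real (Suc j)" for j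
 have m0: "0 < m j" "m j ~= 0" for j by (auto simp: m_def)
 define G where "G j t = m j * sin (t / m j)" for j t
 have Gm[measurable]: "meas (%x. G j (u x))" "meas (%x. cos (u x / m j))" for j unfolding G_def by measurable
 have Gd: "(G j has_real_derivative cos (t / m j)) (at t)" for j t
  unfolding G_def by (rule derivative_eq_intros | use m0 in simp)+
 have Gb: "\<bar>G j t\<bar> <= m j" for j t
  unfolding G_def using m0[of j] abs_sin_le_one[of "t / m j"] by (simp add: abs_mult mult_left_le)
 have Gt: "\<bar>G j t\<bar> <= \<bar>t\<bar>" for j t
 proof -
  have "\<bar>sin (t / m j)\<bar> <= \<bar>t / m j\<bar>" by (rule abs_sin_x_le_abs_x)
  then have "m j * \<bar>sin (t / m j)\<bar> <= m j * \<bar>t / m j\<bar>" using m0[of j] by (intro mult_left_mono) auto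
  then show ?thesis unfolding G_def using m0[of j] by (simp add: abs_mult abs_divide)
 qed
 have ex: "EX \<psi>. test_fun \<Omega> \<psi> & pmod (%x. \<psi> x - G j (u x)) < ennreal (1 / real (Suc j)) &
   pmod (%x. grad \<psi> x - cos (u x / m j) *\<^sub>R g x) < ennreal (1 / real (Suc j))" for j
 proof -
  obtain r where r: "W0_via (%k x. G j (\<phi> (r k) x)) (%x. G j (u x)) (%x. cos (u x / m j) *\<^sub>R g x)"
   using W0_via_compose[OF \<phi>, of "G j" "%t. cos (t / m j)" 1] smooth1_sin[OF m0(2)[of j]] Gd
   unfolding G_def by (auto simp: abs_cos_le_one)
  have t: "test_fun \<Omega> (%x. G j (\<phi> (r k) x))" for k using r unfolding W0_via_def by blast
  note [measurable] = test_M[OF t]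
  have "(%k. pmod (%x. G j (\<phi> (r k) x) - G j (u x))) \<longlonglongrightarrow> 0"
  proof (rule tendsto_0_bound)
   show "(%k. ennreal (max 1 (2 * m j) powr pp) * L1n (%x. G j (\<phi> (r k) x) - G j (u x))) \<longlonglongrightarrow> 0"
    using r unfolding W0_via_def by (intro tendsto_0_cmult) auto
   show "pmod (%x. G j (\<phi> (r k) x) - G j (u x)) <= ennreal (max 1 (2 * m j) powr pp) * L1n (%x. G j (\<phi> (r k) x) - G j (u x))" for k
   proof (rule pmod_le_L1)
    fix x show "\<bar>G j (\<phi> (r k) x) - G j (u x)\<bar> <= 2 * m j"
     using Gb[of j "\<phi> (r k) x"] Gb[of j "u x"] by linarith
   qed simp
  qed
  then have "\<forall>\<^sub>F k in sequentially. pmod (%x. G j (\<phi> (r k) x) - G j (u x)) < ennreal (1 / real (Suc j))"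
   by (intro order_tendstoD) auto
  moreover have "\<forall>\<^sub>F k in sequentially. pmod (%x. grad (%x. G j (\<phi> (r k) x)) x - cos (u x / m j) *\<^sub>R g x) < ennreal (1 / real (Suc j))"
   using r unfolding W0_via_def by (intro order_tendstoD) auto
  ultimately have "\<forall>\<^sub>F k in sequentially. pmod (%x. G j (\<phi> (r k) x) - G j (u x)) < ennreal (1 / real (Suc j)) &
    pmod (%x. grad (%x. G j (\<phi> (r k) x)) x - cos (u x / m j) *\<^sub>R g x) < ennreal (1 / real (Suc j))"
   by (rule eventually_conj)
  then obtain k where "pmod (%x. G j (\<phi> (r k) x) - G j (u x)) < ennreal (1 / real (Suc j)) &
    pmod (%x. grad (%x. G j (\<phi> (r k) x)) x - cos (u x / m j) *\<^sub>R g x) < ennreal (1 / real (Suc j))"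
   unfolding eventually_sequentially by blast
  with t show ?thesis by blast
 qed
 define \<psi> where "\<psi> j = (SOME \<psi>. test_fun \<Omega> \<psi> & pmod (%x. \<psi> x - G j (u x)) < ennreal (1 / real (Suc j)) &
   pmod (%x. grad \<psi> x - cos (u x / m j) *\<^sub>R g x) < ennreal (1 / real (Suc j)))" for j
 have \<psi>: "test_fun \<Omega> (\<psi> j) & pmod (%x. \<psi> j x - G j (u x)) < ennreal (1 / real (Suc j)) &
   pmod (%x. grad (\<psi> j) x - cos (u x / m j) *\<^sub>R g x) < ennreal (1 / real (Suc j))" for j
  unfolding \<psi>_def by (rule someI_ex[OF ex])
 then have t: "\<And>j. test_fun \<Omega> (\<psi> j)" and \<psi>1: "\<And>j. pmod (%x. \<psi> j x - G j (u x)) < ennreal (1 / real (Suc j))"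
   and \<psi>2: "\<And>j. pmod (%x. grad (\<psi> j) x - cos (u x / m j) *\<^sub>R g x) < ennreal (1 / real (Suc j))"
  by blast+
 note [measurable] = test_M[OF t] grad_M[OF t]
 have "(%j. ennreal (1 / real (Suc j))) \<longlonglongrightarrow> ennreal 0" by (intro tendsto_ennrealI LIMSEQ_Suc lim_1_over_n)
 then have e0: "(%j. ennreal (1 / real (Suc j))) \<longlonglongrightarrow> 0" by simp
 have pB: "pmod (%x. 2 * B :: real) < \<infinity>" by (rule pmod_bounded_finite[of _ "\<bar>2 * B\<bar>"]) simp
 have fin: "pmod u < \<infinity>"
 proof -
  have "pmod u <= pmod (%x. 2 * B :: real)" unfolding pmod_def
  proof (rule nn_integral_mono_AE)
   show "AE x in M. ennreal (norm (u x) powr p x) <= ennreal (norm (2 * B) powr p x)" using B AE_space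
   proof eventually_elim
    case (elim x)
    then show ?case
     using p_gt1[of x] by (intro ennreal_leI powr_mono2) auto
   qed
  qed
  then show ?thesis using pB by (rule le_less_trans)
 qed
 have l1: "(%j. pmod (%x. G j (u x) - u x)) \<longlonglongrightarrow> 0"
 proof (rule pmod_dominated[OF _ _ _ pB])
  show "AE x in M. norm (G j (u x) - u x) <= norm (2 * B)" for j
   using B
  proof eventually_elim
   case (elim x)
   then show ?case using Gt[of j "u x"] by simp
  qed
  show "AE x in M. (%j. G j (u x) - u x) \<longlonglongrightarrow> 0"
   using scaled_sin_tendsto by (intro AE_I2) (simp add: G_def m_def LIM_zero)
 qed auto
 have l2: "(%j. pmod (%x. cos (u x / m j) *\<^sub>R g x - g x)) \<longlonglongrightarrow> 0"
 proof (rule pmod_dominated[of _ "%x. 2 * norm (g x)"])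
  have "pmod (%x. 2 * norm (g x)) <= ennreal (max 1 2 powr pp) * pmod (%x. norm (g x))"
   using pmod_mult_le[of "%x. norm (g x)" "%x. 2" 2] by simp
  also have "... < \<infinity>" using W0_pmod[OF W] by (simp add: pmod_def ennreal_mult_less_top)
  finally show "pmod (%x. 2 * norm (g x)) < \<infinity>" .
  show "AE x in M. norm (cos (u x / m j) *\<^sub>R g x - g x) <= norm (2 * norm (g x))" for j
  proof (intro AE_I2)
   fix x
   have "cos (u x / m j) *\<^sub>R g x - g x = (cos (u x / m j) - 1) *\<^sub>R g x" by (simp add: scaleR_left_diff_distrib)
   then have "norm (cos (u x / m j) *\<^sub>R g x - g x) = \<bar>cos (u x / m j) - 1\<bar> * norm (g x)"
    by (simp only: norm_scaleR)
   also have "... <= 2 * norm (g x)" using abs_cos_le_one[of "u x / m j"] by (intro mult_right_mono) (linarith | simp)+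
   finally show "norm (cos (u x / m j) *\<^sub>R g x - g x) <= norm (2 * norm (g x))" by simp
  qed
  show "AE x in M. (%j. cos (u x / m j) *\<^sub>R g x - g x) \<longlonglongrightarrow> 0"
  proof (intro AE_I2)
   fix x
   have "(%j. cos (u x * (1 / real (Suc j))) *\<^sub>R g x - g x) \<longlonglongrightarrow> cos (u x * 0) *\<^sub>R g x - g x"
    by (intro tendsto_intros LIMSEQ_Suc[OF lim_1_over_n])
   then show "(%j. cos (u x / m j) *\<^sub>R g x - g x) \<longlonglongrightarrow> 0" by (simp add: m_def)
  qed
 qed auto
 have c1: "(%j. pmod (%x. \<psi> j x - u x)) \<longlonglongrightarrow> 0"
 proof (rule tendsto_0_bound)
  show "(%j. ennreal (2 powr pp) * (ennreal (1 / real (Suc j)) + pmod (%x. G j (u x) - u x))) \<longlonglongrightarrow> 0"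
   by (intro tendsto_0_cmult tendsto_0_add e0 l1)
  fix j
  have "pmod (%x. \<psi> j x - u x) = pmod (%x. (\<psi> j x - G j (u x)) + (G j (u x) - u x))" by simp
  also have "... <= ennreal (2 powr pp) * (pmod (%x. \<psi> j x - G j (u x)) + pmod (%x. G j (u x) - u x))" by (rule pmod_add) auto
  also have "... <= ennreal (2 powr pp) * (ennreal (1 / real (Suc j)) + pmod (%x. G j (u x) - u x))"
   using \<psi>1[of j] by (intro mult_left_mono add_right_mono) auto
  finally show "pmod (%x. \<psi> j x - u x) <= ennreal (2 powr pp) * (ennreal (1 / real (Suc j)) + pmod (%x. G j (u x) - u x))" .
 qed
 have c2: "(%j. pmod (%x. grad (\<psi> j) x - g x)) \<longlonglongrightarrow> 0"
 proof (rule tendsto_0_bound)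
  show "(%j. ennreal (2 powr pp) * (ennreal (1 / real (Suc j)) + pmod (%x. cos (u x / m j) *\<^sub>R g x - g x))) \<longlonglongrightarrow> 0"
   by (intro tendsto_0_cmult tendsto_0_add e0 l2)
  fix j
  have "pmod (%x. grad (\<psi> j) x - g x) = pmod (%x. (grad (\<psi> j) x - cos (u x / m j) *\<^sub>R g x) + (cos (u x / m j) *\<^sub>R g x - g x))" by simp
  also have "... <= ennreal (2 powr pp) * (pmod (%x. grad (\<psi> j) x - cos (u x / m j) *\<^sub>R g x) + pmod (%x. cos (u x / m j) *\<^sub>R g x - g x))" by (rule pmod_add) auto
  also have "... <= ennreal (2 powr pp) * (ennreal (1 / real (Suc j)) + pmod (%x. cos (u x / m j) *\<^sub>R g x - g x))"
   using \<psi>2[of j] by (intro mult_left_mono add_right_mono) auto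
  finally show "pmod (%x. grad (\<psi> j) x - g x) <= ennreal (2 powr pp) * (ennreal (1 / real (Suc j)) + pmod (%x. cos (u x / m j) *\<^sub>R g x - g x))" .
 qed
 have "(%k. W1p_norm \<Omega> p (%x. \<psi> k x - u x) (%x. grad (\<psi> k) x - g x)) \<longlonglongrightarrow> 0"
  using W01p_iff[where \<phi>=\<psi>, OF W0_M(1)[OF W] W0_M(2)[OF W] fin W0_pmod[OF W] t] c1 c2 by simp
 moreover have "W1p_grad \<Omega> p u g"
  unfolding W1p_grad_def using W0_weak_grad[OF W] Lvar_pmod_real[of u] Lvar_pmod[of g] fin W0_pmod[OF W] by simp
 ultimately show ?thesis unfolding W01p_def using t by blast
qed

text \<open>The bridge to the notions of the theorem: boundedness puts the solution into
  \<open>W01p\<close>, and every test function with any of its weak gradients is a \<open>W0\<close>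
  pair.\<close>

lemma weak_sol_weak_eq:
 assumes sol: "weak_sol F u g" and F: "source \<mu> F" and \<mu>: "0 <= \<mu>"
 shows "W01p \<Omega> p u" "weak_grad \<Omega> u g" "Linfty \<Omega> u" "weak_eq \<Omega> p g F"
proof -
 have W: "W0 u g" using sol by (rule weak_solD)
 have B: "AE x in M. \<bar>u x\<bar> <= ubound \<mu>" using ubound(2)[OF \<mu> sol F] by eventually_elim simp
 show "W01p \<Omega> p u" by (rule W0_bounded_imp_W01p[OF W B])
 show "weak_grad \<Omega> u g" by (rule W0_weak_grad[OF W])
 show "Linfty \<Omega> u" unfolding Linfty_def using W0_M(1)[OF W] B by blast
 show "weak_eq \<Omega> p g F"
  unfolding weak_eq_def
 proof (intro allI impI)
  fix \<phi> \<zeta> assume a: "W01p \<Omega> p \<phi> & weak_grad \<Omega> \<phi> \<zeta>"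
  then have V: "W0 \<phi> \<zeta>" using W01p_imp_W0 by blast
  have e: "pflux (p x) (g x) \<bullet> \<zeta> x = norm (g x) powr (p x - 2) * (g x \<bullet> \<zeta> x)" for x by (simp add: pflux_def)
  show "integrable M (%x. norm (g x) powr (p x - 2) * (g x \<bullet> \<zeta> x)) & integrable M (%x. F x * \<phi> x) &
   (LINT x|M. norm (g x) powr (p x - 2) * (g x \<bullet> \<zeta> x)) = (LINT x|M. F x * \<phi> x)"
   using W0_flux_integrable[OF W V] source_integrable[OF F W0_integrable(1)[OF V]] weak_solD(2)[OF sol V]
   unfolding e by blast
 qed
qed

end

section \<open>Lower barriers\<close>

lemma smooth1_bmp: "smooth1 (bmp n)"
proof (rule smooth1_fun_alg)
 let ?B = "range bmp \<union> range (%c t. c)"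
 show "bmp n \<in> fun_alg ?B" by (intro fun_alg.base) auto
 fix f assume "f \<in> ?B"
 then consider n where "f = bmp n" | c where "f = (%t. c)" by auto
 then show "EX f':fun_alg ?B. ALL t. (f has_real_derivative f' t) (at t)"
 proof cases
  case 1
  show ?thesis
  proof (intro bexI allI)
   show "(%t. bmp (n+2) t + (- real n) * bmp (n+1) t) \<in> fun_alg ?B"
    by (intro fun_alg.add fun_alg.mult fun_alg.base) auto
   show "(f has_real_derivative bmp (n+2) t + (- real n) * bmp (n+1) t) (at t)" for t
    using bmp_deriv[of n t] 1 by simp
  qed
 next
  case 2
  then show ?thesis by (intro bexI[of _ "%t. 0"]) (auto intro!: fun_alg.base)
 qed
qed

lemma smooth_on_power: "smooth_on UNIV f ==> smooth_on UNIV (%x::real^'n::finite. f x ^ k)"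
 by (induction k) (auto intro: smooth_on_const smooth_on_mult)

text \<open>The logarithm will arise from differentiating a power with variable exponent. For y <= 1
  it is absorbed by the slack pm - \<kappa>; for y between 1 and \<open>Y\<close> everything is
  bounded.\<close>

lemma powr_log_bound:
 fixes Y A B \<kappa> pm pp :: real
 assumes \<kappa>: "0 < \<kappa>" "\<kappa> < pm" and AB: "0 <= A" "0 <= B" and Y: "1 <= Y"
 shows "EX C>=0. ALL q y. pm <= q --> q <= pp --> 0 < y --> y <= Y --> y powr q * (A + B * \<bar>ln y\<bar>) <= C * y powr \<kappa>"
proof -
 define \<nu> where "\<nu> = pm - \<kappa>"
 have \<nu>: "\<nu> > 0" using \<kappa> by (simp add: \<nu>_def)
 define C where "C = (A + B / \<nu>) + Y powr \<bar>pp\<bar> * (A + B * Y)"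
 have C1: "0 <= A + B / \<nu>" "0 <= Y powr \<bar>pp\<bar> * (A + B * Y)" using AB \<nu> Y by auto
 show ?thesis
 proof (intro exI[of _ C] conjI allI impI)
  show "0 <= C" using C1 by (simp add: C_def)
  fix q y assume q: "pm <= q" "q <= pp" and y: "0 < y" "y <= Y"
  have "y powr (q - \<kappa>) * (A + B * \<bar>ln y\<bar>) <= C"
  proof (cases "y <= 1")
   case True
   have l: "\<bar>ln y\<bar> = - ln y" using True y by (simp add: abs_if)
   have "ln (y powr (- \<nu>)) <= y powr (- \<nu>) - 1" using y by (intro ln_le_minus_one) auto
   then have "\<nu> * \<bar>ln y\<bar> <= y powr (- \<nu>)" using y l by (simp add: ln_powr)
   then have "\<bar>ln y\<bar> <= y powr (- \<nu>) / \<nu>" using \<nu> by (simp add: field_simps)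
   then have "y powr \<nu> * \<bar>ln y\<bar> <= y powr \<nu> * (y powr (- \<nu>) / \<nu>)" by (intro mult_left_mono) auto
   also have "... = 1 / \<nu>" using y by (simp add: powr_add[symmetric])
   finally have 1: "y powr \<nu> * \<bar>ln y\<bar> <= 1 / \<nu>" .
   have 2: "y powr \<nu> <= 1" using y True \<nu> by (simp add: powr_le1)
   have "y powr (q - \<kappa>) * (A + B * \<bar>ln y\<bar>) <= y powr \<nu> * (A + B * \<bar>ln y\<bar>)"
    using AB by (intro mult_right_mono[OF powr_mono' add_nonneg_nonneg]) (use y True q in \<open>auto simp: \<nu>_def mult_nonneg_nonpos\<close>)
   also have "... = y powr \<nu> * A + B * (y powr \<nu> * \<bar>ln y\<bar>)" by (simp add: algebra_simps)
   also have "... <= 1 * A + B * (1 / \<nu>)" using 1 2 AB by (intro add_mono mult_right_mono mult_left_mono) auto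
   also have "... <= C" using C1 by (simp add: C_def)
   finally show ?thesis .
  next
   case False
   have "\<bar>ln y\<bar> <= y" using False ln_le_minus_one[of y] by simp
   then have l: "\<bar>ln y\<bar> <= Y" using y by simp
   have "y powr (q - \<kappa>) <= y powr \<bar>pp\<bar>" using False q \<kappa> by (intro powr_mono) auto
   also have "... <= Y powr \<bar>pp\<bar>" using y by (intro powr_mono2) auto
   finally have "y powr (q - \<kappa>) * (A + B * \<bar>ln y\<bar>) <= Y powr \<bar>pp\<bar> * (A + B * Y)"
    using l AB by (intro mult_mono add_mono mult_left_mono) auto
   also have "... <= C" using C1 by (simp add: C_def)
   finally show ?thesis .
  qed
  then have "y powr \<kappa> * (y powr (q - \<kappa>) * (A + B * \<bar>ln y\<bar>)) <= y powr \<kappa> * C" by (intro mult_left_mono) auto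
  moreover have "y powr \<kappa> * y powr (q - \<kappa>) = y powr q" by (simp add: powr_add[symmetric])
  ultimately show "y powr q * (A + B * \<bar>ln y\<bar>) <= C * y powr \<kappa>" by (simp add: mult.assoc[symmetric] mult.commute)
 qed
qed

text \<open>In terms of s = 1/d the profile is exp(-s) and its derivative s^2 exp(-s), so the
  derivative to the power \<kappa>2 is bounded by the profile to any smaller power. The chosen
  \<tau> makes the exponential loss exactly (\<kappa>2 - \<kappa>) s.\<close>

lemma bmp2_powr_le:
 assumes "0 < \<kappa>" "\<kappa> < \<kappa>2"
 shows "EX C>=0. ALL d>0. bmp 2 d powr \<kappa>2 <= C * bmp 0 d powr \<kappa>"
proof -
 define \<tau> where "\<tau> = (\<kappa>2 - \<kappa>) / (2 * \<kappa>2)"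
 have \<tau>: "\<tau> > 0" using assms by (simp add: \<tau>_def)
 show ?thesis
 proof (intro exI[of _ "(1 / \<tau>) powr (2 * \<kappa>2)"] conjI allI impI)
  fix d :: real assume d: "0 < d"
  define s where "s = 1 / d"
  have s: "s > 0" using d by (simp add: s_def)
  have "\<tau> * s <= exp (\<tau> * s)" using exp_ge_add_one_self[of "\<tau> * s"] by linarith
  then have "s <= (1 / \<tau>) * exp (\<tau> * s)" using \<tau> by (simp add: field_simps)
  then have "s powr (2 * \<kappa>2) <= ((1 / \<tau>) * exp (\<tau> * s)) powr (2 * \<kappa>2)" using s assms by (intro powr_mono2) auto
  also have "... = (1 / \<tau>) powr (2 * \<kappa>2) * exp (\<tau> * s * (2 * \<kappa>2))" using \<tau> by (subst powr_mult) (simp_all add: exp_powr_real)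
  also have "\<tau> * s * (2 * \<kappa>2) = (\<kappa>2 - \<kappa>) * s" using assms by (simp add: \<tau>_def)
  finally have *: "s powr (2 * \<kappa>2) <= (1 / \<tau>) powr (2 * \<kappa>2) * exp ((\<kappa>2 - \<kappa>) * s)" .
  have "bmp 2 d powr \<kappa>2 = (s\<^sup>2 * exp (- s)) powr \<kappa>2" using d by (simp add: bmp_def s_def)
  also have "... = s powr (2 * \<kappa>2) * exp (- s * \<kappa>2)"     proof -
   have "s\<^sup>2 = s powr 2" using s by simp
   then show ?thesis by (simp only: powr_mult powr_powr exp_powr_real powr_ge_zero exp_ge_zero)
  qed
  also have "... <= (1 / \<tau>) powr (2 * \<kappa>2) * exp ((\<kappa>2 - \<kappa>) * s) * exp (- s * \<kappa>2)" using * by (intro mult_right_mono) auto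
  also have "... = (1 / \<tau>) powr (2 * \<kappa>2) * exp (- s * \<kappa>)" by (simp add: mult.assoc mult_exp_exp algebra_simps)
  also have "exp (- s * \<kappa>) = bmp 0 d powr \<kappa>" using d by (simp add: bmp_def s_def exp_powr_real)
  finally show "bmp 2 d powr \<kappa>2 <= (1 / \<tau>) powr (2 * \<kappa>2) * bmp 0 d powr \<kappa>" .
 qed auto
qed

text \<open>A smooth approximation of the identity on the half line that vanishes below \<delta>,
  has slope between 0 and 1, and is off by at most \<delta> + \<delta>^2. Applied to the amplitude
  of a flux it produces compact support inside the region where that amplitude is
  differentiated.\<close>

definition kcut :: "real => real => real" where
 "kcut \<delta> s = (s - \<delta>) * bmp 0 ((s - \<delta>) / \<delta>\<^sup>2)"

definition kcut' :: "real => real => real" where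
 "kcut' \<delta> s = bmp 0 ((s - \<delta>) / \<delta>\<^sup>2) + ((s - \<delta>) / \<delta>\<^sup>2) * bmp 2 ((s - \<delta>) / \<delta>\<^sup>2)"

lemma kcut_deriv:
 assumes "0 < \<delta>" shows "(kcut \<delta> has_real_derivative kcut' \<delta> s) (at s)"
proof -
 have "((%s. (s - \<delta>) / \<delta>\<^sup>2) has_real_derivative 1 / \<delta>\<^sup>2) (at s)" using assms by (auto intro!: derivative_eq_intros simp: divide_inverse)
 from DERIV_chain2[OF bmp0_deriv this]
 have "((%s. bmp 0 ((s - \<delta>) / \<delta>\<^sup>2)) has_real_derivative bmp 2 ((s - \<delta>) / \<delta>\<^sup>2) * (1 / \<delta>\<^sup>2)) (at s)" .
 moreover have "((%s. s - \<delta>) has_real_derivative 1) (at s)" by (auto intro!: derivative_eq_intros)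
 ultimately have "((%s. (s - \<delta>) * bmp 0 ((s - \<delta>) / \<delta>\<^sup>2)) has_real_derivative 1 * bmp 0 ((s - \<delta>) / \<delta>\<^sup>2) + bmp 2 ((s - \<delta>) / \<delta>\<^sup>2) * (1 / \<delta>\<^sup>2) * (s - \<delta>)) (at s)"
  by (rule DERIV_mult[rotated])
 then show ?thesis unfolding kcut_def[abs_def] kcut'_def by (simp add: algebra_simps)
qed

lemma bmp_cont: "continuous_on UNIV (bmp n)"
 by (auto simp: continuous_on_eq_continuous_at intro!: DERIV_isCont[OF bmp_deriv])

lemma kcut'_cont: "continuous_on UNIV (kcut' \<delta>)"
 unfolding kcut'_def divide_inverse
 by (intro continuous_intros continuous_on_compose2[OF bmp_cont]) auto

lemma kcut_props:
 assumes \<delta>: "0 < \<delta>"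
 shows "s <= \<delta> ==> kcut \<delta> s = 0" "0 <= kcut \<delta> s" "0 <= s ==> kcut \<delta> s <= s" "0 <= kcut' \<delta> s" "kcut' \<delta> s <= 1"
  "0 <= s ==> \<bar>kcut \<delta> s - s\<bar> <= \<delta> + \<delta>\<^sup>2"
proof -
 let ?q = "(s - \<delta>) / \<delta>\<^sup>2"
 have q0: "?q <= 0" if "s <= \<delta>" using that \<delta> by (simp add: divide_nonpos_pos)
 then show z: "s <= \<delta> ==> kcut \<delta> s = 0" by (simp add: kcut_def bmp_le0)
 show nn: "0 <= kcut \<delta> s"
  using z bmp_nonneg[of 0 ?q] by (cases "s <= \<delta>") (auto simp: kcut_def)
 show le: "kcut \<delta> s <= s" if "0 <= s"
 proof (cases "s <= \<delta>")
  case False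
  then have "kcut \<delta> s <= (s - \<delta>) * 1" unfolding kcut_def by (intro mult_left_mono bmp0_le1) auto
  then show ?thesis using \<delta> by simp
 qed (use that z in auto)
 have k': "0 <= kcut' \<delta> s & kcut' \<delta> s <= 1"
 proof (cases "s <= \<delta>")
  case True
  then show ?thesis using q0 by (simp add: kcut'_def bmp_le0)
 next
  case False
  then have q: "?q > 0" using \<delta> by simp
  \<comment> \<open>With z = 1/q the slope is (1 + z) exp(-z), which lies between 0 and 1.\<close>
  have "kcut' \<delta> s = (1 + 1 / ?q) * exp (- (1 / ?q))" using q unfolding kcut'_def bmp_def by (simp add: power2_eq_square distrib_right)
  moreover have "(1 + 1 / ?q) * exp (- (1 / ?q)) <= exp (1 / ?q) * exp (- (1 / ?q))"
   using exp_ge_add_one_self[of "1 / ?q"] by (intro mult_right_mono) auto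
  moreover have "exp (1 / ?q) * exp (- (1 / ?q)) = 1" by (simp add: mult_exp_exp)
  moreover have "0 <= (1 + 1 / ?q) * exp (- (1 / ?q))"
   by (intro mult_nonneg_nonneg add_nonneg_nonneg divide_nonneg_nonneg less_imp_le[OF q]) auto
  ultimately show ?thesis by linarith
 qed
 then show "0 <= kcut' \<delta> s" "kcut' \<delta> s <= 1" by auto
 show "\<bar>kcut \<delta> s - s\<bar> <= \<delta> + \<delta>\<^sup>2" if "0 <= s"
 proof (cases "s <= \<delta>")
  case False
  then have q: "?q > 0" using \<delta> by simp
  have "1 - 1 / ?q <= exp (- (1 / ?q))" using exp_ge_add_one_self[of "- (1 / ?q)"] by simp
  then have "(s - \<delta>) * (1 - 1 / ?q) <= (s - \<delta>) * bmp 0 ?q" using q False unfolding bmp_def by (intro mult_left_mono) auto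
  then have "s - \<delta> - (s - \<delta>) * (1 / ?q) <= kcut \<delta> s" unfolding kcut_def by (simp add: right_diff_distrib)
  moreover have "(s - \<delta>) * (1 / ?q) = \<delta>\<^sup>2" using False by simp
  ultimately show ?thesis using le[OF that] by (simp add: abs_le_iff)
 qed (use that z in \<open>auto intro: order_trans\<close>)
qed

text \<open>The bump is exp(-1/d) with d = 1 - t^(m+2) and t the squared relative distance from the
  centre. The power makes its gradient vanish to high order at the centre, the flat function does so
  at the sphere. \<open>bar_c\<close> is the factor of the radial field x - x0 in the negative
  gradient.\<close>

definition bar_t :: "real^'n::finite => real => real^'n => real" where
 "bar_t x0 \<rho> x = ((x - x0) \<bullet> (x - x0)) / \<rho>\<^sup>2"
definition bar_d :: "real^'n::finite => real => nat => real^'n => real" where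
 "bar_d x0 \<rho> m x = 1 - bar_t x0 \<rho> x ^ (m + 2)"
definition bar_f :: "real^'n::finite => real => nat => real^'n => real" where
 "bar_f x0 \<rho> m x = bmp 0 (bar_d x0 \<rho> m x)"
definition bar_c :: "real^'n::finite => real => nat => real^'n => real" where
 "bar_c x0 \<rho> m x = 2 * real (m + 2) / \<rho>\<^sup>2 * (bmp 2 (bar_d x0 \<rho> m x) * bar_t x0 \<rho> x ^ (m + 1))"

lemma bar_t_smooth: "smooth_on UNIV (bar_t x0 \<rho>)"
proof -
 have eq: "bar_t x0 \<rho> = (%x. 1 / \<rho>\<^sup>2 * (\<Sum>i\<in>UNIV. (x $ i - x0 $ i) * (x $ i - x0 $ i)))"
  by (auto simp: bar_t_def inner_vec_def)
 show ?thesis unfolding eq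
  by (intro smooth_on_mult smooth_on_const smooth_on_sum smooth_on_diff_fun smooth_on_coord) auto
qed

lemma bar_d_smooth: "smooth_on UNIV (bar_d x0 \<rho> m)"
 unfolding bar_d_def[abs_def] by (intro smooth_on_diff_fun smooth_on_const smooth_on_power bar_t_smooth)

lemma bar_f_smooth: "smooth_on UNIV (bar_f x0 \<rho> m)"
 unfolding bar_f_def[abs_def] by (intro smooth_on_bmp bar_d_smooth)

lemma bar_c_smooth: "smooth_on UNIV (bar_c x0 \<rho> m)"
 unfolding bar_c_def[abs_def]
 by (intro smooth_on_mult smooth_on_const smooth_on_compose[OF bar_d_smooth smooth1_bmp] smooth_on_power bar_t_smooth)

lemma bar_t_deriv: "(bar_t x0 \<rho> has_derivative (%h. 2 / \<rho>\<^sup>2 * ((x - x0) \<bullet> h))) (at x)"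
proof -
 have "((%x. (x - x0) \<bullet> (x - x0)) has_derivative (%h. 2 * ((x - x0) \<bullet> h))) (at x)"
  by (auto intro!: derivative_eq_intros simp: inner_commute)
 from has_derivative_mult_right[OF this, of "1 / \<rho>\<^sup>2"] show ?thesis
  unfolding bar_t_def[abs_def] by simp
qed

lemma bar_d_deriv: "(bar_d x0 \<rho> m has_derivative (%h. - (real (m + 2) * bar_t x0 \<rho> x ^ (m + 1) * (2 / \<rho>\<^sup>2 * ((x - x0) \<bullet> h))))) (at x)"
proof -
 have "((%x. bar_t x0 \<rho> x ^ (m + 2)) has_derivative (%h. real (m + 2) * (2 / \<rho>\<^sup>2 * ((x - x0) \<bullet> h)) * bar_t x0 \<rho> x ^ (m + 2 - 1))) (at x)"
  by (rule has_derivative_power[OF bar_t_deriv])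
 from has_derivative_diff[OF has_derivative_const[of 1] this] show ?thesis
  unfolding bar_d_def[abs_def] by (simp add: mult_ac)
qed

lemma bar_f_grad: "grad (bar_f x0 \<rho> m) x = - (bar_c x0 \<rho> m x *\<^sub>R (x - x0))"
proof (rule grad_eqI)
 have "((%x. bmp 0 (bar_d x0 \<rho> m x)) has_derivative (%h. bmp 2 (bar_d x0 \<rho> m x) * (- (real (m + 2) * bar_t x0 \<rho> x ^ (m + 1) * (2 / \<rho>\<^sup>2 * ((x - x0) \<bullet> h)))))) (at x)"
  by (rule has_derivative_compose[OF bar_d_deriv bmp0_deriv[unfolded has_field_derivative_def]])
 then show "(bar_f x0 \<rho> m has_derivative (\<bullet>) (- (bar_c x0 \<rho> m x *\<^sub>R (x - x0)))) (at x)"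
  unfolding bar_f_def[abs_def] by (rule has_derivative_eq_rhs) (auto simp: bar_c_def mult_ac)
qed

lemma bar_annulus:
 assumes "0 < \<rho>" "x ~= x0" "norm (x - x0) < \<rho>"
 shows "0 < bar_t x0 \<rho> x" "bar_t x0 \<rho> x < 1" "0 < bar_d x0 \<rho> m x" "bar_d x0 \<rho> m x <= 1" "0 < bar_c x0 \<rho> m x"
  "bar_t x0 \<rho> x = (norm (x - x0) / \<rho>)\<^sup>2"
proof -
 show t: "bar_t x0 \<rho> x = (norm (x - x0) / \<rho>)\<^sup>2" by (simp add: bar_t_def power2_norm_eq_inner power_divide)
 have r: "0 < norm (x - x0) / \<rho>" "norm (x - x0) / \<rho> < 1" using assms by auto
 have sq: "0 < q\<^sup>2 & q\<^sup>2 < 1" if "0 < q" "q < 1" for q :: real using that by (simp add: power_less_one_iff)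
 show t0: "0 < bar_t x0 \<rho> x" using sq[OF r] unfolding t by (rule conjunct1)
 show t1: "bar_t x0 \<rho> x < 1" using sq[OF r] unfolding t by (rule conjunct2)
 have "bar_t x0 \<rho> x ^ (m + 2) < 1" using power_Suc_less_one[OF t0 t1, of "Suc m"] by simp
 then show d: "0 < bar_d x0 \<rho> m x" "bar_d x0 \<rho> m x <= 1" using t0 by (auto simp: bar_d_def)
 show "0 < bar_c x0 \<rho> m x" unfolding bar_c_def using assms t0 bmp_pos[OF d(1), of 2] by simp
qed

text \<open>Only a one-sided bound can hold: near the sphere the second derivative of the flat
  profile contributes t^(m+2) (2/d - 1/d^2), which is unbounded below but at most 1, by completing
  the square. This is the sign a subsolution needs.\<close>

lemma bar_c_radial:
 assumes \<rho>: "0 < \<rho>" "x ~= x0" "norm (x - x0) < \<rho>"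
 shows "grad (bar_c x0 \<rho> m) x \<bullet> (x - x0) <= 4 * real (m + 2) * bar_c x0 \<rho> m x"
proof -
 let ?t = "bar_t x0 \<rho> x" and ?d = "bar_d x0 \<rho> m x" and ?z = "x - x0" and ?a = "real (m + 2)"
 note b = bar_annulus[OF assms]
 have zz: "2 / \<rho>\<^sup>2 * (?z \<bullet> ?z) = 2 * ?t" by (simp add: bar_t_def)
 have 1: "((%x. bmp 2 (bar_d x0 \<rho> m x)) has_derivative (%h. (bmp 4 ?d - 2 * bmp 3 ?d) * (- (?a * ?t ^ (m + 1) * (2 / \<rho>\<^sup>2 * (?z \<bullet> h)))))) (at x)"
 proof (rule has_derivative_compose[OF bar_d_deriv])
  show "(bmp 2 has_derivative (*) (bmp 4 ?d - 2 * bmp 3 ?d)) (at ?d)"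
   using bmp_deriv[of 2 ?d] by (simp add: has_field_derivative_def)
 qed
 have 2: "((%x. bar_t x0 \<rho> x ^ (m + 1)) has_derivative (%h. real (m + 1) * (2 / \<rho>\<^sup>2 * (?z \<bullet> h)) * ?t ^ m)) (at x)"
  using has_derivative_power[OF bar_t_deriv[of x0 \<rho> x], where n="m + 1"] by simp
 have H1: "(bar_c x0 \<rho> m has_derivative (%h. 2 * ?a / \<rho>\<^sup>2 * (bmp 2 ?d * (real (m + 1) * (2 / \<rho>\<^sup>2 * (?z \<bullet> h)) * ?t ^ m)
   + (bmp 4 ?d - 2 * bmp 3 ?d) * (- (?a * ?t ^ (m + 1) * (2 / \<rho>\<^sup>2 * (?z \<bullet> h)))) * ?t ^ (m + 1)))) (at x)"
  unfolding bar_c_def[abs_def] by (rule has_derivative_mult_right[OF has_derivative_mult[OF 1 2]])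
 have alg: "K * (b * (M * (2 * t) * T) + (b * D2 - 2 * (b * D1)) * (- (a * (t * T) * (2 * t))) * (t * T))
   = K * (b * (t * T)) * (2 * M + 2 * a * (t * (t * T) * (2 * D1 - D2)))" for K b M t T D2 D1 a :: real
  by (simp add: algebra_simps)
 have H2: "(bar_c x0 \<rho> m has_derivative (%h. grad (bar_c x0 \<rho> m) x \<bullet> h)) (at x)"
  by (rule has_derivative_grad[OF smooth_on_diff[OF bar_c_smooth]])
 have "grad (bar_c x0 \<rho> m) x \<bullet> ?z = 2 * ?a / \<rho>\<^sup>2 * (bmp 2 ?d * (real (m + 1) * (2 * ?t) * ?t ^ m)
   + (bmp 4 ?d - 2 * bmp 3 ?d) * (- (?a * ?t ^ (m + 1) * (2 * ?t))) * ?t ^ (m + 1))"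
  using has_derivative_unique[OF H2 H1, THEN fun_cong, of ?z] unfolding zz .
 also have "bmp 4 ?d = bmp 2 ?d / ?d\<^sup>2" using b by (simp add: bmp_def power2_eq_square eval_nat_numeral)
 also have "bmp 3 ?d = bmp 2 ?d / ?d" using b by (simp add: bmp_def power2_eq_square eval_nat_numeral)
 also have "2 * ?a / \<rho>\<^sup>2 * (bmp 2 ?d * (real (m + 1) * (2 * ?t) * ?t ^ m)
   + (bmp 2 ?d / ?d\<^sup>2 - 2 * (bmp 2 ?d / ?d)) * (- (?a * ?t ^ (m + 1) * (2 * ?t))) * ?t ^ (m + 1))
   = bar_c x0 \<rho> m x * (2 * real (m + 1) + 2 * ?a * (?t ^ (m + 2) * (2 / ?d - 1 / ?d\<^sup>2)))"
  using alg[of "2 * ?a / \<rho>\<^sup>2" "bmp 2 ?d" "real (m + 1)" ?t "?t ^ m" "1 / ?d\<^sup>2" "1 / ?d" ?a] by (simp add: bar_c_def)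
 also have "... <= bar_c x0 \<rho> m x * (2 * ?a + 2 * ?a * 1)"
 proof (intro mult_left_mono add_mono)
  have "2 / ?d - 1 / ?d\<^sup>2 = 1 - (1 - 1 / ?d)\<^sup>2" by (simp add: power2_eq_square algebra_simps)
  then have "2 / ?d - 1 / ?d\<^sup>2 <= 1" by simp
  then have "?t ^ (m + 2) * (2 / ?d - 1 / ?d\<^sup>2) <= ?t ^ (m + 2) * 1" using b by (intro mult_left_mono) auto
  also have "... <= 1" unfolding mult_1_right by (rule power_le_one) (use b(1,2) in linarith)+
  finally show "?t ^ (m + 2) * (2 / ?d - 1 / ?d\<^sup>2) <= 1" .
 qed (use b(5)[of m] in \<open>auto simp: less_imp_le\<close>)
 also have "... = 4 * ?a * bar_c x0 \<rho> m x" by simp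
 finally show ?thesis .
qed

section \<open>The divergence theorem for radial fields\<close>

lemma continuous_on_If_const:
 "continuous_on S f ==> continuous_on S g ==> continuous_on S (%x. if b then f x else g x)"
 by (cases b) auto

text \<open>The integrand is the divergence of h (x - x0); coordinate by coordinate, each summand is
  a partial derivative of a compactly supported function.\<close>

lemma integral_divergence_radial:
 fixes h :: "real^'n::finite => real"
 assumes d: "\<And>x. h differentiable at x" and c: "continuous_on UNIV (grad h)"
  and K: "compact K" "\<And>x. x \<notin> K ==> h x = 0" "\<And>x. x \<notin> K ==> grad h x = 0"
 shows "(LINT x|lborel. real CARD('n) * h x + grad h x \<bullet> (x - x0)) = 0"
proof -
 have hc: "continuous_on UNIV h" using d by (auto intro!: differentiable_imp_continuous_on simp: differentiable_on_def)
 let ?F = "%i x. h x + grad h x $ i * (x - x0) $ i"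
 have z: "(LINT x|lborel. ?F i x) = 0" and int: "integrable lborel (?F i)" for i
 proof -
  let ?f = "%x. (x $ i - x0 $ i) * h x"
  have d1: "(%x. x $ i - x0 $ i) differentiable at x" for x :: "real^'n"
   by (rule smooth_on_diff[OF smooth_on_diff_fun[OF smooth_on_coord smooth_on_const]])
  have pd1: "partial_deriv j (%x. x $ i - x0 $ i) x = (if i = j then 1 else 0)" for j and x :: "real^'n"
  proof -
   have "((%x::real^'n. x $ i - x0 $ i) has_derivative (%h. h $ i - 0)) (at x)"
    by (rule has_derivative_diff[OF bounded_linear_imp_has_derivative[OF bounded_linear_vec_nth] has_derivative_const])
   from partial_deriv_eqI[OF this] show ?thesis by (simp add: axis_def)
  qed
  have g: "grad ?f x $ j = (x $ i - x0 $ i) * grad h x $ j + (if i = j then h x else 0)" for x j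
   using partial_deriv_mult[OF d1 d] pd1 by (simp add: grad_def)
  have g': "grad ?f x = (x $ i - x0 $ i) *\<^sub>R grad h x + axis i (h x)" for x
   unfolding vec_eq_iff g by (simp add: axis_def)
  have "(LINT x|lborel. grad ?f x $ i) = 0"
  proof (rule integral_partial_zero)
   show "?f differentiable at x" for x using d1 d by (intro differentiable_mult) auto
   have "continuous_on UNIV (%x. axis i (h x) :: real^'n)"
    unfolding axis_def by (intro continuous_on_vec_lambda continuous_on_If_const hc continuous_on_const)
   then show "continuous_on UNIV (grad ?f)" unfolding g'[abs_def] by (intro continuous_intros c)
   show "bounded K" using K by (simp add: compact_imp_bounded)
  qed (use K in auto)
  from this[unfolded g] show "(LINT x|lborel. ?F i x) = 0" by (simp add: algebra_simps)
  show "integrable lborel (?F i)"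
   by (rule continuous_compact_support_integrable[OF _ K(1)]) (use K in \<open>auto intro!: continuous_intros c hc\<close>)
 qed
 have "(LINT x|lborel. (\<Sum>i\<in>UNIV. ?F i x)) = (\<Sum>i\<in>UNIV. (LINT x|lborel. ?F i x))"
  by (rule Bochner_Integration.integral_sum) (rule int)
 also have "... = 0" using z by simp
 also have "(%x. \<Sum>i\<in>UNIV. ?F i x) = (%x. real CARD('n) * h x + grad h x \<bullet> (x - x0))"
  by (auto simp: sum.distrib inner_vec_def)
 finally show ?thesis .
qed

context var_exponent
begin

lemma radial_parts:
 assumes d: "\<And>x. k differentiable at x" and c: "continuous_on UNIV (grad k)"
  and S: "compact S" "S \<subseteq> \<Omega>" "\<And>x. x \<notin> S ==> k x = 0" "\<And>x. x \<notin> S ==> grad k x = 0"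
  and W: "W0 \<phi> \<zeta>"
 shows "integrable M (%x. (k x *\<^sub>R (x - x0)) \<bullet> \<zeta> x)"
  and "integrable M (%x. (real CARD('n) * k x + grad k x \<bullet> (x - x0)) * \<phi> x)"
  and "(LINT x|M. (k x *\<^sub>R (x - x0)) \<bullet> \<zeta> x) = - (LINT x|M. (real CARD('n) * k x + grad k x \<bullet> (x - x0)) * \<phi> x)"
proof -
 obtain \<psi> where V: "W0_via \<psi> \<phi> \<zeta>" using W unfolding W0_def by blast
 have t: "test_fun \<Omega> (\<psi> j)" for j using V unfolding W0_via_def by blast
 note [measurable] = W0_M[OF W] test_M[OF t] grad_M[OF t]
 have kc: "continuous_on UNIV k" using d by (auto intro!: differentiable_imp_continuous_on simp: differentiable_on_def)
 let ?w = "%x. k x *\<^sub>R (x - x0)" and ?D = "%x. real CARD('n) * k x + grad k x \<bullet> (x - x0)"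
 have wc: "continuous_on UNIV ?w" "continuous_on UNIV ?D" by (intro continuous_intros kc c)+
 have "bounded (?w ` S)" "bounded (?D ` S)"
  by (intro compact_imp_bounded compact_continuous_image continuous_on_subset[OF wc(1)] continuous_on_subset[OF wc(2)] S(1); simp)+
 then obtain B1 B2 where B: "\<And>x. x \<in> S ==> norm (?w x) <= B1" "\<And>x. x \<in> S ==> norm (?D x) <= B2"
  unfolding bounded_iff by auto
 have Bw: "norm (?w x) <= \<bar>B1\<bar>" for x using B(1)[of x] S(3)[of x] by (cases "x \<in> S") auto
 have BD: "\<bar>?D x\<bar> <= \<bar>B2\<bar>" for x using B(2)[of x] S(3,4)[of x] by (cases "x \<in> S") auto
 have wM: "meas ?w" "meas ?D" using wc by (auto intro: cont_M)
 have l1: "(%j. L1n (%x. \<psi> j x - \<phi> x)) \<longlonglongrightarrow> 0" and l2: "(%j. L1n (%x. grad (\<psi> j) x - \<zeta> x)) \<longlonglongrightarrow> 0"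
  using V unfolding W0_via_def by (auto intro!: L1n_tendsto)
 note I1 = integral_inner_tendsto[OF W0_integrable(2)[OF W0_test[OF t]] W0_integrable(2)[OF W] l2 wM(1) AE_I2[OF Bw]]
 note I2 = integral_inner_tendsto[OF W0_integrable(1)[OF W0_test[OF t]] W0_integrable(1)[OF W] l1 wM(2) AE_I2[OF BD[folded real_norm_def]], unfolded inner_real_def]
 show "integrable M (%x. ?w x \<bullet> \<zeta> x)" by (rule I1(1))
 show "integrable M (%x. ?D x * \<phi> x)" by (rule I2(1))
 have out: "x \<notin> S" if "x \<notin> \<Omega>" for x using that S(2) by blast
 have eq: "(LINT x|M. ?w x \<bullet> grad (\<psi> j) x) = - (LINT x|M. \<psi> j x * ?D x)" for j
 proof -
  let ?h = "%x. k x * \<psi> j x"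
  have pc: "continuous_on UNIV (\<psi> j)" "continuous_on UNIV (grad (\<psi> j))" using test_fun_cont[OF t] test_fun_grad_cont[OF t] by auto
  have gh: "grad ?h x = k x *\<^sub>R grad (\<psi> j) x + \<psi> j x *\<^sub>R grad k x" for x
   using partial_deriv_mult[OF d test_fun_diff[OF t]] by (simp add: grad_def vec_eq_iff mult.commute)
  have "(LINT x|lborel. real CARD('n) * ?h x + grad ?h x \<bullet> (x - x0)) = 0"
  proof (rule integral_divergence_radial[OF _ _ S(1)])
   show "?h differentiable at x" for x using d test_fun_diff[OF t] by (intro differentiable_mult) auto
   show "continuous_on UNIV (grad ?h)" unfolding gh[abs_def] by (intro continuous_intros kc c pc)
  qed (use S gh in auto)
  then have "(LINT x|lborel. ?w x \<bullet> grad (\<psi> j) x + \<psi> j x * ?D x) = 0"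
   unfolding gh by (simp add: algebra_simps inner_simps inner_commute)
  then have "(LINT x|lborel. ?w x \<bullet> grad (\<psi> j) x) + (LINT x|lborel. \<psi> j x * ?D x) = 0"
  proof (subst (asm) Bochner_Integration.integral_add)
   show "integrable lborel (%x. ?w x \<bullet> grad (\<psi> j) x)"
    by (rule continuous_compact_support_integrable[OF _ S(1)]) (use S in \<open>auto intro!: continuous_intros kc pc\<close>)
   show "integrable lborel (%x. \<psi> j x * ?D x)"
    by (rule continuous_compact_support_integrable[OF _ S(1)]) (use S in \<open>auto intro!: continuous_intros kc pc c\<close>)
  qed
  moreover have "(LINT x|M. ?w x \<bullet> grad (\<psi> j) x) = (LINT x|lborel. ?w x \<bullet> grad (\<psi> j) x)"
   by (intro integral_M_lborel borel_measurable_continuous_onI continuous_intros kc pc) (use out S in auto)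
  moreover have "(LINT x|M. \<psi> j x * ?D x) = (LINT x|lborel. \<psi> j x * ?D x)"
   by (intro integral_M_lborel borel_measurable_continuous_onI continuous_intros kc pc c) (use out S in auto)
  ultimately show ?thesis by linarith
 qed
 have "(%j. \<integral>x. ?w x \<bullet> grad (\<psi> j) x \<partial>M) \<longlonglongrightarrow> - (LINT x|M. \<phi> x * ?D x)"
  unfolding eq using tendsto_minus[OF I2(2)] by (simp add: mult.commute)
 from LIMSEQ_unique[OF I1(2) this] show "(LINT x|M. ?w x \<bullet> \<zeta> x) = - (LINT x|M. ?D x * \<phi> x)"
  by (simp add: mult.commute)
qed

text \<open>For \<epsilon> f the flux is radial, minus an amplitude \<open>E0\<close> times x - x0,
  and its negative divergence is N E0 plus the radial derivative of E0, to be bounded by a multiple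
  of (\<epsilon> f)^\<kappa>. The amplitude is differentiated only in the punctured open ball, so
  the divergence theorem is applied to \<open>kcut \<delta>\<close> of it, and \<delta> tends to 0
  afterwards. The constant does not depend on \<epsilon>.\<close>

lemma barrier:
 assumes ball: "0 < \<rho>" "cball x0 \<rho> \<subseteq> \<Omega>" and \<kappa>: "0 < \<kappa>" "\<kappa> < pm - 1"
  and P: "\<And>x. x \<in> \<Omega> ==> (p has_derivative (%h. P x \<bullet> h)) (at x)" "continuous_on \<Omega> P"
 shows "EX f C. test_fun \<Omega> f & (ALL x. 0 <= f x & f x <= 1) & (ALL x:ball x0 \<rho>. 0 < f x) & 0 <= C &
  (ALL \<epsilon> \<phi> \<zeta>. 0 < \<epsilon> --> \<epsilon> <= 1 --> W0 \<phi> \<zeta> --> (AE x in M. 0 <= \<phi> x) -->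
   (LINT x|M. pflux (p x) (\<epsilon> *\<^sub>R grad f x) \<bullet> \<zeta> x) <= (LINT x|M. C * (\<epsilon> * f x) powr \<kappa> * \<phi> x))"
proof -
 \<comment> \<open>Half of the slack up to pm - 1 pays for the logarithm, the other half for
   comparing \<open>bmp 2\<close> with \<open>bmp 0\<close>.\<close>
 define \<kappa>2 where "\<kappa>2 = (\<kappa> + (pm - 1)) / 2"
 have \<kappa>2: "0 < \<kappa>2" "\<kappa> < \<kappa>2" "\<kappa>2 < pm - 1" using \<kappa> by (auto simp: \<kappa>2_def)
 \<comment> \<open>This size of \<open>m\<close> yields \<open>m2\<close>: after taking the power
   \<kappa>2 the gradient still leaves two powers of the radius, one of which makes the majorant
   \<open>g\<close> below vanish at the centre.\<close>
 obtain m :: nat where m: "1 / \<kappa>2 <= real m" using real_arch_simple by blast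
 then have "1 <= real m * \<kappa>2" using \<kappa>2 by (simp add: field_simps)
 then have m2: "2 <= real (2 * m + 3) * \<kappa>2" using \<kappa>2 by (simp add: algebra_simps)
 let ?a = "real (m + 2)" and ?N = "real CARD('n)"
 define f where "f = bar_f x0 \<rho> m"
 define c where "c = bar_c x0 \<rho> m"
 define r where "r x = norm (x - x0)" for x
 define Ann where "Ann = ball x0 \<rho> - {x0}"
 have AnnO: "open Ann" by (auto simp: Ann_def)
 have Ann\<Omega>: "Ann \<subseteq> \<Omega>" using order_trans[OF ball_subset_cball ball(2)] unfolding Ann_def by blast
 have Ann: "x \<in> Ann \<longleftrightarrow> x ~= x0 & r x < \<rho>" for x by (auto simp: Ann_def r_def dist_norm norm_minus_commute)
 have b: "0 < bar_t x0 \<rho> x" "bar_t x0 \<rho> x < 1" "0 < bar_d x0 \<rho> m x" "bar_d x0 \<rho> m x <= 1" "0 < c x" "bar_t x0 \<rho> x = (r x / \<rho>)\<^sup>2" "0 < r x"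
  if "x \<in> Ann" for x using bar_annulus[OF ball(1), of x x0] that unfolding Ann c_def r_def by auto
 have f01: "0 <= f x & f x <= 1" for x unfolding f_def bar_f_def using bmp_nonneg bmp0_le1 by auto
 have dneg: "bar_d x0 \<rho> m x <= 0" if "\<rho> <= r x" for x
 proof -
  have "1 <= r x / \<rho>" using that ball by simp
  then have "1 <= (r x / \<rho>)\<^sup>2" by simp
  moreover have "bar_t x0 \<rho> x = (r x / \<rho>)\<^sup>2" by (simp add: bar_t_def r_def power2_norm_eq_inner power_divide)
  ultimately have "1 <= bar_t x0 \<rho> x ^ (m + 2)" by (intro one_le_power) simp
  then show ?thesis by (simp add: bar_d_def)
 qed
 have fz: "f x = 0" "c x = 0" if "\<rho> <= r x" for x using dneg[OF that] by (auto simp: f_def bar_f_def c_def bar_c_def bmp_le0)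
 have fpos: "0 < f x" if "x \<in> ball x0 \<rho>" for x
 proof (cases "x = x0")
  case True then show ?thesis by (simp add: f_def bar_f_def bar_d_def bar_t_def bmp_def)
 next
  case False
  then have "x \<in> Ann" using that by (simp add: Ann_def)
  then show ?thesis using b(3)[of x] by (simp add: f_def bar_f_def bmp_pos)
 qed
 have gf: "grad f x = - (c x *\<^sub>R (x - x0))" for x unfolding f_def c_def by (rule bar_f_grad)
 have tf: "test_fun \<Omega> f"
 proof (rule test_funI[of _ "cball x0 \<rho>"])
  show "smooth_on UNIV f" unfolding f_def by (rule bar_f_smooth)
  show "f x = 0" if "x \<notin> cball x0 \<rho>" for x using that fz[of x] by (auto simp: r_def dist_norm norm_minus_commute)
 qed (use ball in auto)
 have cs: "smooth_on UNIV c" unfolding c_def by (rule bar_c_smooth)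
 have cc: "continuous_on UNIV c" "continuous_on UNIV (grad c)" "c differentiable at x" for x
  using cs by (auto intro: smooth_on_cont smooth_on_diff simp: grad_def[abs_def] intro!: continuous_on_vec_lambda smooth_on_partial)
 have fc: "continuous_on UNIV f" using tf by (rule test_fun_cont)
 have "bounded ((%x. P x \<bullet> (x - x0)) ` cball x0 \<rho>)"
  using P(2) ball by (intro compact_imp_bounded compact_continuous_image continuous_intros) (auto intro: continuous_on_subset)
 then obtain B0 where "\<And>x. x \<in> cball x0 \<rho> ==> norm (P x \<bullet> (x - x0)) <= B0" unfolding bounded_iff by blast
 note PB = this
 have B: "\<bar>P x \<bullet> (x - x0)\<bar> <= \<bar>B0\<bar>" if "x \<in> Ann" for x
 proof -
  have "x \<in> cball x0 \<rho>" using that by (auto simp: Ann_def)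
  from PB[OF this] show ?thesis by simp
 qed
 \<comment> \<open>Collects N from the divergence, 4 (m + 2) \<bar>pp\<bar> from the radial growth
   of \<open>c\<close>, and \<bar>pp\<bar> from the power of the radius.\<close>
 define A where "A = ?N + (4 * ?a * \<bar>pp\<bar> + \<bar>pp\<bar>)"
 have A: "1 <= A" by (simp add: A_def add_increasing2 Suc_leI)
 \<comment> \<open>An upper bound for \<epsilon> c r, the norm of the gradient of the scaled
   bump.\<close>
 define Y where "Y = max 1 (2 * ?a / \<rho>)"
 obtain C3 where C3: "0 <= C3" "\<And>q y. pm - 1 <= q ==> q <= pp - 1 ==> 0 < y ==> y <= Y ==> y powr q * (A + \<bar>B0\<bar> * \<bar>ln y\<bar>) <= C3 * y powr \<kappa>2"
  using powr_log_bound[OF \<kappa>2(1,3), of A "\<bar>B0\<bar>" Y "pp - 1"] A by (auto simp: Y_def)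
 obtain C5 where C5: "0 <= C5" "\<And>d. d > 0 ==> bmp 2 d powr \<kappa>2 <= C5 * bmp 0 d powr \<kappa>" using bmp2_powr_le[OF \<kappa>(1) \<kappa>2(2)] by blast
 define C6 where "C6 = (2 * ?a / \<rho>\<^sup>2) powr \<kappa>2 * C5 * (\<rho> powr \<kappa>2 / \<rho>\<^sup>2)"
 define C where "C = C3 * C6 + 1"
 have C6: "0 <= C6" using C5(1) by (simp add: C6_def)
 have C: "0 < C" using C3 C6 by (simp add: C_def add_nonneg_pos)
 define E where "E \<epsilon> x = (\<epsilon> * c x) powr (p x - 1) * r x powr (p x - 2)" for \<epsilon> x
 have key: "E \<epsilon> x * (A + \<bar>B0\<bar> * \<bar>ln (\<epsilon> * c x * r x)\<bar>) <= C * r x * (\<epsilon> * f x) powr \<kappa>" if \<epsilon>: "0 < \<epsilon>" "\<epsilon> <= 1" and x: "x \<in> Ann" for \<epsilon> x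
 proof -
  let ?y = "\<epsilon> * c x * r x" and ?d = "bar_d x0 \<rho> m x" and ?s = "r x / \<rho>"
  note bx = b[OF x]
  have s: "0 < ?s" "?s < 1" using bx x ball by (auto simp: Ann)
  have px: "pm - 1 <= p x - 1" "p x - 1 <= pp - 1" using p_lower p_upper x Ann\<Omega> by (auto simp: subset_iff)
  have y0: "0 < ?y" using \<epsilon> bx by simp
  have pw: "(w\<^sup>2) ^ (m + 1) * (\<rho> * w) = \<rho> * w ^ (2 * (m + 1) + 1)" for w :: real
   by (simp only: power_mult power_add power_one_right) (simp only: mult_ac)
  have tm: "bar_t x0 \<rho> x ^ (m + 1) * r x = \<rho> * ?s ^ (2 * m + 3)"
  proof -
   have "r x = \<rho> * ?s" using ball by simp
   then have "bar_t x0 \<rho> x ^ (m + 1) * r x = (?s\<^sup>2) ^ (m + 1) * (\<rho> * ?s)" using bx(6) by (simp only:)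
   also have "... = \<rho> * ?s ^ (2 * (m + 1) + 1)" by (rule pw)
   also have "2 * (m + 1) + 1 = 2 * m + 3" by simp
   finally show ?thesis .
  qed
  have cr: "c x * r x = 2 * ?a / \<rho>\<^sup>2 * (bmp 2 ?d * (\<rho> * ?s ^ (2 * m + 3)))"
   unfolding c_def bar_c_def tm[symmetric] by simp
  have "?y <= Y"
  proof -
   have "?y <= 1 * (c x * r x)" using \<epsilon> bx by (simp add: mult_le_cancel_right1 mult.assoc)
   also have "... <= 2 * ?a / \<rho>\<^sup>2 * (1 * (\<rho> * 1))" unfolding cr mult_1_left
    using s ball bmp2_le1[of ?d] bmp_nonneg[of 2 ?d] by (intro mult_left_mono mult_mono[of "bmp 2 ?d" 1, simplified]) (auto simp: power_le_one)
   also have "... = 2 * ?a / \<rho>" using ball by (simp add: power2_eq_square)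
   finally show ?thesis by (simp add: Y_def)
  qed
  \<comment> \<open>First the logarithm is traded for the exponent \<kappa>2, then, in the next
    estimate, \<kappa>2 for \<kappa> together with a factor r^2.\<close>
  with y0 px have 1: "?y powr (p x - 1) * (A + \<bar>B0\<bar> * \<bar>ln ?y\<bar>) <= C3 * ?y powr \<kappa>2" by (intro C3(2)) auto
  have 2: "?y powr \<kappa>2 <= C6 * ((r x)\<^sup>2 * (\<epsilon> * f x) powr \<kappa>)"
  proof -
   have e: "\<epsilon> powr \<kappa>2 <= \<epsilon> powr \<kappa>" using \<epsilon> \<kappa>2 by (intro powr_mono') auto
   have ss: "(?s ^ (2 * m + 3)) powr \<kappa>2 <= ?s\<^sup>2"
   proof -
    have "(?s ^ (2 * m + 3)) powr \<kappa>2 = ?s powr (real (2 * m + 3) * \<kappa>2)" using s by (simp only: powr_realpow[symmetric] powr_powr)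
    also have "... <= ?s powr 2" using s m2 by (intro powr_mono') auto
    also have "... = ?s\<^sup>2" using s by simp
    finally show ?thesis .
   qed
   have pm: "(w1 * (w2 * (w3 * (w4 * w5)))) powr k = w1 powr k * (w2 powr k * (w3 powr k * (w4 powr k * w5 powr k)))"
    if "0 <= w1" "0 <= w2" "0 <= w3" "0 <= w4" "0 <= w5" for w1 w2 w3 w4 w5 k :: real
    using that by (simp add: powr_mult)
   have "?y powr \<kappa>2 = \<epsilon> powr \<kappa>2 * ((2 * ?a / \<rho>\<^sup>2) powr \<kappa>2 * (bmp 2 ?d powr \<kappa>2 * (\<rho> powr \<kappa>2 * (?s ^ (2 * m + 3)) powr \<kappa>2)))"
    unfolding mult.assoc cr
    by (rule pm) (use \<epsilon> ball s bmp_nonneg[of 2 ?d] in auto)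
   also have "... <= \<epsilon> powr \<kappa> * ((2 * ?a / \<rho>\<^sup>2) powr \<kappa>2 * ((C5 * bmp 0 ?d powr \<kappa>) * (\<rho> powr \<kappa>2 * ?s\<^sup>2)))"
    using e ss C5 bx(3) by (intro mult_mono mult_nonneg_nonneg) auto
   also have "... = C6 * ((r x)\<^sup>2 * (\<epsilon> powr \<kappa> * f x powr \<kappa>))"
    using ball by (simp add: C6_def f_def bar_f_def power_divide mult_ac)
   also have "\<epsilon> powr \<kappa> * f x powr \<kappa> = (\<epsilon> * f x) powr \<kappa>" using \<epsilon> f01[of x] by (simp add: powr_mult)
   finally show ?thesis .
  qed
  have Er: "E \<epsilon> x * r x = ?y powr (p x - 1)"
  proof -
   have "r x powr (p x - 2) * r x = r x powr (p x - 1)" using powr_mult_base[of "r x" "p x - 2"] bx by (simp add: mult.commute)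
   then show ?thesis unfolding E_def using \<epsilon> bx by (simp add: powr_mult mult.assoc)
  qed
  have "E \<epsilon> x * (A + \<bar>B0\<bar> * \<bar>ln ?y\<bar>) * r x = ?y powr (p x - 1) * (A + \<bar>B0\<bar> * \<bar>ln ?y\<bar>)"
   unfolding Er[symmetric] by (simp only: mult_ac)
  also have "... <= C3 * ?y powr \<kappa>2" by (rule 1)
  also have "... <= C3 * (C6 * ((r x)\<^sup>2 * (\<epsilon> * f x) powr \<kappa>))" by (rule mult_left_mono[OF 2 C3(1)])
  also have "... <= C * ((r x)\<^sup>2 * (\<epsilon> * f x) powr \<kappa>)" unfolding C_def by (simp add: algebra_simps)
  also have "... = C * r x * (\<epsilon> * f x) powr \<kappa> * r x" by (simp add: power2_eq_square mult_ac)
  finally show ?thesis using bx(7) by (simp add: mult_le_cancel_right)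
 qed
 have flux: "pflux (p x) (\<epsilon> *\<^sub>R grad f x) = - ((if x \<in> Ann then E \<epsilon> x else 0) *\<^sub>R (x - x0))" if \<epsilon>: "0 < \<epsilon>" for \<epsilon> x
 proof (cases "x \<in> Ann")
  case True
  note bx = b[OF True]
  have n: "norm (\<epsilon> *\<^sub>R grad f x) = \<epsilon> * c x * r x" unfolding gf using \<epsilon> bx by (simp add: r_def)
  have "(\<epsilon> * c x) powr (p x - 2) * (\<epsilon> * c x) = (\<epsilon> * c x) powr (p x - 1)" using powr_mult_base[of "\<epsilon> * c x" "p x - 2"] \<epsilon> bx by (simp add: mult.commute)
  then have e: "(\<epsilon> * c x * r x) powr (p x - 2) * (\<epsilon> * c x) = E \<epsilon> x" unfolding E_def using \<epsilon> bx by (subst powr_mult) (auto simp: mult_ac)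
  have "pflux (p x) (\<epsilon> *\<^sub>R grad f x) = (\<epsilon> * c x * r x) powr (p x - 2) *\<^sub>R (\<epsilon> *\<^sub>R grad f x)" unfolding pflux_def n ..
  also have "... = - (((\<epsilon> * c x * r x) powr (p x - 2) * (\<epsilon> * c x)) *\<^sub>R (x - x0))" unfolding gf by simp
  finally show ?thesis unfolding e using True by simp
 next
  case False
  then have "x = x0 \<or> \<rho> <= r x" by (auto simp: Ann)
  then have "grad f x = 0" unfolding gf using fz(2)[of x] by auto
  then show ?thesis using False by (simp add: pflux_def)
 qed
 show ?thesis
 proof (intro exI[of _ f] exI[of _ "C * \<rho>"] conjI allI impI ballI tf)
  show "0 <= f x" "f x <= 1" for x using f01 by auto
  show "0 < f x" if "x \<in> ball x0 \<rho>" for x by (rule fpos[OF that])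
  show "0 <= C * \<rho>" using C ball by simp
  fix \<epsilon> :: real and \<phi> \<zeta> assume \<epsilon>: "0 < \<epsilon>" "\<epsilon> <= 1" and W: "W0 \<phi> \<zeta>" and \<phi>0: "AE x in M. 0 <= \<phi> x"
  note [measurable] = W0_M[OF W]
  define E0 where "E0 x = (if x \<in> Ann then E \<epsilon> x else 0)" for x
  have E0nn: "0 <= E0 x" for x by (simp add: E0_def E_def)
  define H where "H x = C * \<rho> * (\<epsilon> * f x) powr \<kappa>" for x
  \<comment> \<open>A continuous majorant of the amplitude that vanishes off the punctured ball: its
    superlevel set at \<delta> is compact and contains every point where the cut amplitude is
    nonzero.\<close>
  define g where "g x = C * r x * (\<epsilon> * f x) powr \<kappa>" for x
  have gc: "continuous_on UNIV g" unfolding g_def r_def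
   by (intro continuous_intros continuous_on_powr' fc) (use \<epsilon> f01 \<kappa> in \<open>auto simp: mult_nonneg_nonneg\<close>)
  have gz: "g x = 0" if "x \<notin> Ann" for x using that fz(1)[of x] \<kappa> by (auto simp: Ann g_def r_def)
  have E0g: "E0 x <= g x" for x
  proof (cases "x \<in> Ann")
   case True
   have "E \<epsilon> x * 1 <= E \<epsilon> x * (A + \<bar>B0\<bar> * \<bar>ln (\<epsilon> * c x * r x)\<bar>)" using A by (intro mult_left_mono) (auto simp: E_def add_increasing2)
   then show ?thesis using key[OF \<epsilon> True] True by (simp add: E0_def g_def)
  next
   case False then show ?thesis using gz[of x] by (simp add: E0_def)
  qed
  \<comment> \<open>The logarithmic gradient of the amplitude; its first term stems from
    differentiating the exponent. The logarithm of the radius is written as half the logarithm of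
    the squared radius, so that no norm has to be differentiated.\<close>
  define Gp where "Gp x = (ln (\<epsilon> * c x) + ln ((x - x0) \<bullet> (x - x0)) / 2) *\<^sub>R P x + ((p x - 1) / c x) *\<^sub>R grad c x + ((p x - 2) / ((x - x0) \<bullet> (x - x0))) *\<^sub>R (x - x0)" for x
  have lr: "ln ((x - x0) \<bullet> (x - x0)) / 2 = ln (r x)" if "x \<in> Ann" for x
  proof -
   have "(x - x0) \<bullet> (x - x0) = (r x)\<^sup>2" by (simp add: r_def power2_norm_eq_inner)
   then show ?thesis using b(7)[OF that] by (simp add: ln_realpow)
  qed
  have E_exp: "E \<epsilon> x = exp ((p x - 1) * ln (\<epsilon> * c x) + (p x - 2) * (ln ((x - x0) \<bullet> (x - x0)) / 2))" if "x \<in> Ann" for x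
   unfolding lr[OF that] E_def using b[OF that] \<epsilon> by (simp add: powr_def exp_add)
  have Ed: "(E0 has_derivative (%h. (E0 x *\<^sub>R Gp x) \<bullet> h)) (at x)" if x: "x \<in> Ann" for x
  proof -
   note bx = b[OF x]
   have zz: "0 < (x - x0) \<bullet> (x - x0)" using x by (simp add: Ann)
   have L1: "((%x. ln (\<epsilon> * c x)) has_derivative (%h. grad c x \<bullet> h / c x)) (at x)"
    by (rule has_derivative_eq_rhs[OF has_derivative_ln[OF _ has_derivative_mult_right[OF has_derivative_grad[OF cc(3)]]]])
      (use bx \<epsilon> in \<open>auto simp: divide_inverse\<close>)
   have alg: "(a * (g \<bullet> h / c') + q \<bullet> h * l + (b' * (z \<bullet> h / d') + q \<bullet> h * w)) * e =
     (e *\<^sub>R ((l + w) *\<^sub>R q + (a / c') *\<^sub>R g + (b' / d') *\<^sub>R z)) \<bullet> h" for a b' c' d' e l w :: real and g h q z :: "real^'n"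
    by (simp add: inner_add_left algebra_simps)
   have z1: "((%x. x - x0) has_derivative (%h. h)) (at x)" by (auto intro!: derivative_eq_intros)
   have L2: "((%x. ln ((x - x0) \<bullet> (x - x0)) / 2) has_derivative (%h. (x - x0) \<bullet> h / ((x - x0) \<bullet> (x - x0)))) (at x)"
    by (rule has_derivative_eq_rhs[OF bounded_linear.has_derivative[OF bounded_linear_divide has_derivative_ln[OF zz has_derivative_inner[OF z1 z1]]]])
      (auto simp: inner_commute field_simps)
   have p1: "((%x. p x - k) has_derivative (%h. P x \<bullet> h)) (at x)" for k
    using has_derivative_diff[OF P(1) has_derivative_const, of x k] Ann\<Omega> x by auto
   have "((%x. exp ((p x - 1) * ln (\<epsilon> * c x) + (p x - 2) * (ln ((x - x0) \<bullet> (x - x0)) / 2))) has_derivative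
     (%h. (E0 x *\<^sub>R Gp x) \<bullet> h)) (at x)"
   proof (rule has_derivative_eq_rhs[OF has_derivative_exp[OF has_derivative_add[OF has_derivative_mult[OF p1 L1] has_derivative_mult[OF p1 L2]]]])
    show "(%h. ((p x - 1) * (grad c x \<bullet> h / c x) + P x \<bullet> h * ln (\<epsilon> * c x) + ((p x - 2) * ((x - x0) \<bullet> h / ((x - x0) \<bullet> (x - x0))) + P x \<bullet> h * (ln ((x - x0) \<bullet> (x - x0)) / 2))) *
      exp ((p x - 1) * ln (\<epsilon> * c x) + (p x - 2) * (ln ((x - x0) \<bullet> (x - x0)) / 2))) = (%h. (E0 x *\<^sub>R Gp x) \<bullet> h)"
     unfolding E_exp[OF x, symmetric] Gp_def E0_def using x by (simp only: if_True alg)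
   qed
   then show ?thesis
    by (rule has_derivative_transform_within_open[OF _ AnnO x]) (simp add: E0_def E_exp)
  qed
  have Gc: "continuous_on Ann (%x. E0 x *\<^sub>R Gp x)" "continuous_on Ann E0"
  proof -
   have pc: "continuous_on Ann p" "continuous_on Ann P" using continuous_on_subset[OF p_cont Ann\<Omega>] continuous_on_subset[OF P(2) Ann\<Omega>] .
   have nz: "c x ~= 0" "x ~= x0" "\<epsilon> * c x ~= 0" "0 < \<epsilon> * c x" if "x \<in> Ann" for x using b[OF that] that \<epsilon> by (auto simp: Ann)
   show E0c: "continuous_on Ann E0" using Ed by (intro differentiable_imp_continuous_on) (auto simp: differentiable_on_def intro: differentiableI differentiable_at_withinI)
   show "continuous_on Ann (%x. E0 x *\<^sub>R Gp x)" unfolding Gp_def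
    by (intro continuous_intros E0c pc continuous_on_subset[OF cc(1)] continuous_on_subset[OF cc(2)]) (use nz \<epsilon> in auto)
  qed
  have rad: "Gp x \<bullet> (x - x0) <= \<bar>B0\<bar> * \<bar>ln (\<epsilon> * c x * r x)\<bar> + (4 * ?a * \<bar>pp\<bar> + \<bar>pp\<bar>)" if x: "x \<in> Ann" for x
  proof -
   note bx = b[OF x]
   have px: "1 < p x" "p x <= pp" using p_gt1 p_upper x Ann\<Omega> by auto
   have zz: "0 < (x - x0) \<bullet> (x - x0)" using x by (simp add: Ann)
   have 1: "ln (\<epsilon> * c x) + ln ((x - x0) \<bullet> (x - x0)) / 2 = ln (\<epsilon> * c x * r x)" unfolding lr[OF x] using bx \<epsilon> by (simp add: ln_mult)
   have "Gp x \<bullet> (x - x0) = ln (\<epsilon> * c x * r x) * (P x \<bullet> (x - x0)) + (p x - 1) / c x * (grad c x \<bullet> (x - x0)) + (p x - 2)"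
    unfolding Gp_def 1 using zz by (simp add: inner_add_left)
   also have "... <= \<bar>B0\<bar> * \<bar>ln (\<epsilon> * c x * r x)\<bar> + 4 * ?a * \<bar>pp\<bar> + \<bar>pp\<bar>"
   proof (intro add_mono)
    have "ln (\<epsilon> * c x * r x) * (P x \<bullet> (x - x0)) <= \<bar>ln (\<epsilon> * c x * r x)\<bar> * \<bar>P x \<bullet> (x - x0)\<bar>" by (simp flip: abs_mult)
    also have "... <= \<bar>ln (\<epsilon> * c x * r x)\<bar> * \<bar>B0\<bar>" using B[OF x] by (intro mult_left_mono) auto
    finally show "ln (\<epsilon> * c x * r x) * (P x \<bullet> (x - x0)) <= \<bar>B0\<bar> * \<bar>ln (\<epsilon> * c x * r x)\<bar>" by (simp add: mult.commute)
    have "grad c x \<bullet> (x - x0) <= 4 * ?a * c x" unfolding c_def by (rule bar_c_radial) (use ball x in \<open>auto simp: Ann r_def\<close>)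
    then have "(p x - 1) / c x * (grad c x \<bullet> (x - x0)) <= (p x - 1) / c x * (4 * ?a * c x)" using px bx by (intro mult_left_mono) auto
    also have "... = 4 * ?a * (p x - 1)" using bx by simp
    also have "... <= 4 * ?a * \<bar>pp\<bar>" using px by (intro mult_left_mono) auto
    finally show "(p x - 1) / c x * (grad c x \<bullet> (x - x0)) <= 4 * ?a * \<bar>pp\<bar>" .
   qed (use px in auto)
   finally show ?thesis by simp
  qed
  have iV: "integrable M (%x. pflux (p x) (\<epsilon> *\<^sub>R grad f x) \<bullet> \<zeta> x)"
   by (rule W0_flux_integrable[OF W0_scale[OF W0_test[OF tf]] W])
  have iH: "integrable M (%x. H x * \<phi> x)"
  proof (rule Bochner_Integration.integrable_bound)
   show "integrable M (%x. (C * \<rho>) * \<phi> x)" using W0_integrable(1)[OF W] by simp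
   have "meas (%x. f x)" using tf by measurable
   then show "meas (%x. H x * \<phi> x)" unfolding H_def by measurable
   show "AE x in M. norm (H x * \<phi> x) <= norm (C * \<rho> * \<phi> x)"
   proof (intro AE_I2)
    fix x
    have "(\<epsilon> * f x) powr \<kappa> <= 1" using \<epsilon> f01[of x] \<kappa> by (intro powr_le1) (auto intro: mult_le_one)
    then have "C * \<rho> * (\<epsilon> * f x) powr \<kappa> <= C * \<rho> * 1" using C ball by (intro mult_left_mono) auto
    then show "norm (H x * \<phi> x) <= norm (C * \<rho> * \<phi> x)" unfolding H_def using C ball by (simp add: abs_mult mult_left_le_one_le)
   qed
  qed
  \<comment> \<open>Cutting the amplitude changes the pairing by at most (\<delta> + \<delta>^2)
    \<rho> times the L1 norm of the test gradient.\<close>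
  have step: "(LINT x|M. pflux (p x) (\<epsilon> *\<^sub>R grad f x) \<bullet> \<zeta> x) <= (LINT x|M. H x * \<phi> x) + (\<delta> + \<delta>\<^sup>2) * \<rho> * (LINT x|M. norm (\<zeta> x))" if \<delta>: "0 < \<delta>" for \<delta>
  proof -
   define k where "k x = kcut \<delta> (E0 x)" for x
   define S where "S = {x. \<delta> <= g x}"
   have SA: "S \<subseteq> Ann" using gz \<delta> by (auto simp: S_def) (metis not_le)
   have Scl: "closed S" unfolding S_def by (intro closed_Collect_le gc continuous_on_const)
   have "bounded S" using SA by (rule bounded_subset[rotated]) (auto simp: Ann_def intro: bounded_subset[OF bounded_ball])
   then have Sc: "compact S" using Scl by (simp add: compact_eq_bounded_closed)
   have kz: "k x = 0" if "x \<notin> S" for x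
    unfolding k_def using that E0g[of x] by (intro kcut_props(1)[OF \<delta>]) (auto simp: S_def)
   have kd1: "(k has_derivative (%h. ((kcut' \<delta> (E0 x) * E0 x) *\<^sub>R Gp x) \<bullet> h)) (at x)" if "x \<in> Ann" for x
    using has_derivative_compose[OF Ed[OF that] kcut_deriv[OF \<delta>, unfolded has_field_derivative_def]]
    unfolding k_def[abs_def] by (simp add: mult.assoc)
   have kd2: "(k has_derivative (%h. 0 \<bullet> h)) (at x)" if "x \<notin> S" for x
   proof -
    have "((%x. 0::real) has_derivative (%h. 0 \<bullet> h)) (at x)" by auto
    then show ?thesis by (rule has_derivative_transform_within_open[of _ _ _ _ "- S"]) (use that kz Scl in auto)
   qed
   have kg1: "grad k x = (kcut' \<delta> (E0 x) * E0 x) *\<^sub>R Gp x" if "x \<in> Ann" for x by (rule grad_eqI[OF kd1[OF that]])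
   have kg2: "grad k x = 0" if "x \<notin> S" for x by (rule grad_eqI[OF kd2[OF that]])
   have kd: "k differentiable at x" for x
    using kd1[of x] kd2[of x] SA by (cases "x \<in> S") (auto intro: differentiableI)
   have "continuous_on (Ann \<union> - S) (grad k)"
   proof (rule continuous_on_open_Un[OF AnnO])
    show "open (- S)" using Scl by auto
    have "continuous_on Ann (%x. kcut' \<delta> (E0 x) *\<^sub>R (E0 x *\<^sub>R Gp x))"
     by (intro continuous_intros Gc continuous_on_compose2[OF kcut'_cont Gc(2)]) auto
    then show "continuous_on Ann (grad k)" by (rule continuous_on_eq) (simp add: kg1)
    show "continuous_on (- S) (grad k)" by (rule continuous_on_eq[OF continuous_on_const[of _ 0]]) (simp add: kg2)
   qed
   moreover have "Ann \<union> - S = UNIV" using SA by auto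
   ultimately have kgc: "continuous_on UNIV (grad k)" by simp
   note R = radial_parts[OF kd kgc Sc _ kz kg2 W, of x0]
   have S\<Omega>: "S \<subseteq> \<Omega>" using SA Ann\<Omega> by auto
   let ?D = "%x. ?N * k x + grad k x \<bullet> (x - x0)"
   have DH: "?D x <= H x" for x
   proof (cases "x \<in> Ann")
    case True
    let ?R = "\<bar>B0\<bar> * \<bar>ln (\<epsilon> * c x * r x)\<bar> + (4 * ?a * \<bar>pp\<bar> + \<bar>pp\<bar>)"
    have R0: "0 <= ?R" by simp
    have "kcut' \<delta> (E0 x) * E0 x * (Gp x \<bullet> (x - x0)) <= kcut' \<delta> (E0 x) * E0 x * ?R"
     using rad[OF True] kcut_props(4)[OF \<delta>] E0nn by (intro mult_left_mono) auto
    also have "... <= 1 * E0 x * ?R" using kcut_props(5)[OF \<delta>, of "E0 x"] E0nn[of x] R0 by (intro mult_right_mono) auto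
    finally have "grad k x \<bullet> (x - x0) <= E0 x * ?R" unfolding kg1[OF True] by simp
    moreover have "?N * k x <= ?N * E0 x" unfolding k_def using kcut_props(3)[OF \<delta> E0nn] by (intro mult_left_mono) auto
    ultimately have "?D x <= ?N * E0 x + E0 x * ?R" by (intro add_mono)
    also have "... = E0 x * (?N + ?R)" by (simp only: distrib_left mult.commute)
    also have "... = E \<epsilon> x * (A + \<bar>B0\<bar> * \<bar>ln (\<epsilon> * c x * r x)\<bar>)" using True by (simp add: E0_def A_def)
    also have "... <= C * r x * (\<epsilon> * f x) powr \<kappa>" by (rule key[OF \<epsilon> True])
    also have "... <= H x" unfolding H_def using True C by (intro mult_right_mono mult_left_mono) (auto simp: Ann)
    finally show ?thesis .
   next
    case False
    then have "x \<notin> S" using SA by auto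
    then show ?thesis using kz kg2 C ball by (simp add: H_def)
   qed
   have "(LINT x|M. (k x *\<^sub>R (x - x0)) \<bullet> \<zeta> x) = - (LINT x|M. ?D x * \<phi> x)" by (rule R(3)[OF S\<Omega>])
   moreover have "(LINT x|M. ?D x * \<phi> x) <= (LINT x|M. H x * \<phi> x)"
   proof (rule integral_mono_AE[OF R(2)[OF S\<Omega>] iH])
    show "AE x in M. ?D x * \<phi> x <= H x * \<phi> x" using \<phi>0 by eventually_elim (rule mult_right_mono[OF DH])
   qed
   moreover have "(LINT x|M. pflux (p x) (\<epsilon> *\<^sub>R grad f x) \<bullet> \<zeta> x) + (LINT x|M. (k x *\<^sub>R (x - x0)) \<bullet> \<zeta> x) <= (\<delta> + \<delta>\<^sup>2) * \<rho> * (LINT x|M. norm (\<zeta> x))"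
   proof -
    have "(LINT x|M. pflux (p x) (\<epsilon> *\<^sub>R grad f x) \<bullet> \<zeta> x) + (LINT x|M. (k x *\<^sub>R (x - x0)) \<bullet> \<zeta> x)
      = (LINT x|M. pflux (p x) (\<epsilon> *\<^sub>R grad f x) \<bullet> \<zeta> x + (k x *\<^sub>R (x - x0)) \<bullet> \<zeta> x)"
     using iV R(1)[OF S\<Omega>] by simp
    also have "... <= (LINT x|M. (\<delta> + \<delta>\<^sup>2) * \<rho> * norm (\<zeta> x))"
    proof (rule integral_mono)
     show "integrable M (%x. pflux (p x) (\<epsilon> *\<^sub>R grad f x) \<bullet> \<zeta> x + (k x *\<^sub>R (x - x0)) \<bullet> \<zeta> x)" using iV R(1)[OF S\<Omega>] by simp
     show "integrable M (%x. (\<delta> + \<delta>\<^sup>2) * \<rho> * norm (\<zeta> x))" using integrable_norm[OF W0_integrable(2)[OF W]] by simp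
     fix x
     have "pflux (p x) (\<epsilon> *\<^sub>R grad f x) \<bullet> \<zeta> x + (k x *\<^sub>R (x - x0)) \<bullet> \<zeta> x = (k x - E0 x) * ((x - x0) \<bullet> \<zeta> x)"
      unfolding flux[OF \<epsilon>(1)] E0_def[symmetric] by (simp add: algebra_simps)
     also have "... <= (\<delta> + \<delta>\<^sup>2) * \<rho> * norm (\<zeta> x)"
     proof (cases "x \<in> Ann")
      case True
      have "(k x - E0 x) * ((x - x0) \<bullet> \<zeta> x) <= \<bar>k x - E0 x\<bar> * \<bar>(x - x0) \<bullet> \<zeta> x\<bar>" by (simp flip: abs_mult)
      also have "... <= (\<delta> + \<delta>\<^sup>2) * (\<rho> * norm (\<zeta> x))"
      proof (intro mult_mono)
       show "\<bar>k x - E0 x\<bar> <= \<delta> + \<delta>\<^sup>2" unfolding k_def by (rule kcut_props(6)[OF \<delta> E0nn])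
       have "\<bar>(x - x0) \<bullet> \<zeta> x\<bar> <= norm (x - x0) * norm (\<zeta> x)" by (rule Cauchy_Schwarz_ineq2)
       also have "... <= \<rho> * norm (\<zeta> x)" using True by (intro mult_right_mono) (auto simp: Ann r_def)
       finally show "\<bar>(x - x0) \<bullet> \<zeta> x\<bar> <= \<rho> * norm (\<zeta> x)" .
      qed (use \<delta> in auto)
      finally show ?thesis by (simp add: mult.assoc)
     next
      case False
      then have "k x = 0" "E0 x = 0" using kz[of x] SA by (auto simp: E0_def)
      then show ?thesis using \<delta> ball by simp
     qed
     finally show "pflux (p x) (\<epsilon> *\<^sub>R grad f x) \<bullet> \<zeta> x + (k x *\<^sub>R (x - x0)) \<bullet> \<zeta> x <= (\<delta> + \<delta>\<^sup>2) * \<rho> * norm (\<zeta> x)" .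
    qed
    finally show ?thesis by simp
   qed
   ultimately show ?thesis by linarith
  qed
  have "(LINT x|M. pflux (p x) (\<epsilon> *\<^sub>R grad f x) \<bullet> \<zeta> x) <= (LINT x|M. H x * \<phi> x) + (0 + 0\<^sup>2) * \<rho> * (LINT x|M. norm (\<zeta> x))"
  proof (rule LIMSEQ_le_const)
   have "(%n. 1 / real (Suc n)) \<longlonglongrightarrow> 0" by (intro LIMSEQ_Suc lim_1_over_n)
   then show "(%n. (LINT x|M. H x * \<phi> x) + (1 / real (Suc n) + (1 / real (Suc n))\<^sup>2) * \<rho> * (LINT x|M. norm (\<zeta> x))) \<longlonglongrightarrow>
     (LINT x|M. H x * \<phi> x) + (0 + 0\<^sup>2) * \<rho> * (LINT x|M. norm (\<zeta> x))" by (intro tendsto_intros)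
  qed (use step in auto)
  then show "(LINT x|M. pflux (p x) (\<epsilon> *\<^sub>R grad f x) \<bullet> \<zeta> x) <= (LINT x|M. C * \<rho> * (\<epsilon> * f x) powr \<kappa> * \<phi> x)"
   by (simp add: H_def)
 qed
qed

end

section \<open>Compactness and fixed points\<close>

text \<open>Bolzano-Weierstrass for one coordinate at a time and a diagonal sequence through the
  countable index type.\<close>

lemma pointwise_subseq:
 fixes X :: "nat => 'i::countable => real"
 assumes "\<And>k i. \<bar>X k i\<bar> <= B"
 shows "EX r l. strict_mono (r::nat=>nat) & (ALL i. (%k. X (r k) i) \<longlonglongrightarrow> l i)"
proof -
 let ?P = "%n s. convergent (%k. X (s k) (from_nat n))"
 interpret subseqs ?P
 proof
  fix n and s :: "nat => nat"
  have "bounded (range (%k. X (s k) (from_nat n)))" using assms by (auto simp: bounded_iff)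
  from bounded_imp_convergent_subsequence[OF this]
  show "EX r'. strict_mono r' & ?P n (s \<circ> r')" by (auto simp: o_def convergent_def)
 qed
 have D: "convergent (%k. X ((diagseq \<circ> (+) (Suc n)) k) (from_nat n))" for n
 proof (rule diagseq_holds)
  fix r s :: "nat => nat" and n assume "strict_mono r" "?P n s"
  then show "?P n (s \<circ> r)" using LIMSEQ_subseq_LIMSEQ[of "%k. X (s k) (from_nat n)" _ r] by (auto simp: convergent_def o_def)
 qed
 have "EX l. (%k. X (diagseq (k + Suc n)) (from_nat n)) \<longlonglongrightarrow> l" for n
  using D[of n] unfolding convergent_def o_def add.commute[of "Suc n"] .
 then have "EX l. (%k. X (diagseq k) (from_nat n)) \<longlonglongrightarrow> l" for n
  using LIMSEQ_offset[of "%k. X (diagseq k) (from_nat n)" "Suc n"] by blast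
 note E = this
 have "EX l. (%k. X (diagseq k) i) \<longlonglongrightarrow> l" for i using E[of "to_nat i"] by simp
 then have "EX l. ALL i. (%k. X (diagseq k) i) \<longlonglongrightarrow> l i" by (intro choice allI)
 then show ?thesis using subseq_diagseq by blast
qed

text \<open>The dimension will depend on the mesh of the grid and so cannot be a type; the statement
  works with functions on an index type of which finitely many coordinates matter, and is derived
  from Kuhn's labelling lemma. Continuity is sequential, as it will be available for the solution
  map.\<close>

lemma brouwer_coordinates:
 fixes F :: "('i => real) => 'i => real"
 assumes I: "finite I"
  and F: "\<And>x i. (\<And>j. 0 <= x j & x j <= 1) ==> i \<in> I ==> 0 <= F x i & F x i <= 1"
  and cont: "\<And>X x i. (\<And>k j. 0 <= X k j & X k j <= 1) ==> (\<And>j. 0 <= x j & x j <= 1) ==> (\<And>j. j \<in> I ==> (%k. X k j) \<longlonglongrightarrow> x j) ==>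
   i \<in> I ==> (%k. F (X k) i) \<longlonglongrightarrow> F x i"
 shows "EX x. (ALL j. 0 <= x j & x j <= 1) & (ALL i:I. F x i = x i)"
proof -
 define n where "n = card I"
 obtain e where e: "bij_betw e {0..<n} I" using ex_bij_betw_nat_finite[OF I] unfolding n_def by blast
 have "ALL i:I. EX k. k < n & e k = i" using e by (auto simp: bij_betw_def)
 then obtain d where "ALL i:I. d i < n & e (d i) = i" by (rule bchoice[THEN exE])
 then have ed: "d i < n" "e (d i) = i" if "i \<in> I" for i using that by auto
 have eI: "e i \<in> I" if "i < n" for i using e that by (auto simp: bij_betw_def)
 have de: "d (e i) = i" if "i < n" for i
  using inj_onD[OF bij_betw_imp_inj_on[OF e] ed(2)[OF eI[OF that]]] ed(1)[OF eI[OF that]] that by simp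
 \<comment> \<open>Coordinates outside \<open>I\<close> are pinned to 0, and \<open>min\<close>
   keeps every grid point inside the unit cube whatever its integer labels.\<close>
 define P where "P k y i = (if i \<in> I then min 1 (real (y (d i)) / real (Suc k)) else 0)" for k :: nat and y :: "nat => nat" and i
 have P01: "0 <= P k y j & P k y j <= 1" for k y j by (simp add: P_def)
 \<comment> \<open>Label 0 means that the map does not decrease the coordinate, label 1 that it does
   not increase it; the two faces are labelled as Kuhn's lemma demands.\<close>
 define lab where "lab k y i = (if y i = 0 \<or> (y i < Suc k & P k y (e i) <= F (P k y) (e i)) then 0 else 1 :: nat)" for k y i
 define nb where "nb q c \<longleftrightarrow> (ALL j<n. q j <= c j & c j <= q j + 1)" for q c :: "nat => nat"
 have "EX q. ALL i<n. EX a b. nb q a & nb q b & lab k a i = 0 & lab k b i = 1" for k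
 proof -
  have l: "lab k x i = 0 \<or> lab k x i = 1" "x i = 0 ==> lab k x i = 0" "x i = Suc k ==> lab k x i = 1" for x i
   by (auto simp: lab_def)
  have "EX q. ALL i<n. EX r s. nb q r & nb q s & lab k r i ~= lab k s i"
  proof (rule kuhn_lemma[of "Suc k" n "lab k"])
   show "ALL x. (ALL i<n. x i <= Suc k) --> (ALL i<n. lab k x i = 0 \<or> lab k x i = 1)" using l(1) by blast
   show "ALL x. (ALL i<n. x i <= Suc k) --> (ALL i<n. x i = 0 --> lab k x i = 0)" using l(2) by blast
   show "ALL x. (ALL i<n. x i <= Suc k) --> (ALL i<n. x i = Suc k --> lab k x i = 1)" using l(3) by blast
  qed (auto simp: nb_def)
  then obtain q where q: "ALL i<n. EX r s. nb q r & nb q s & lab k r i ~= lab k s i" by blast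
  have "EX a b. nb q a & nb q b & lab k a i = 0 & lab k b i = 1" if i: "i < n" for i
  proof -
   obtain r s where rs: "nb q r" "nb q s" "lab k r i ~= lab k s i" using q i by blast
   then consider "lab k r i = 0" "lab k s i = 1" | "lab k s i = 0" "lab k r i = 1" using l(1)[of r i] l(1)[of s i] by linarith
   then show ?thesis using rs by cases blast+
  qed
  then show ?thesis by blast
 qed
 then obtain q where q: "ALL k. ALL i<n. EX a b. nb (q k) a & nb (q k) b & lab k a i = 0 & lab k b i = 1" by (rule choice[OF allI, THEN exE])
 define a b where "a k i = (SOME a. nb (q k) a & lab k a i = 0)" and "b k i = (SOME b. nb (q k) b & lab k b i = 1)" for k i
 have a: "nb (q k) (a k i)" "lab k (a k i) i = 0" and b: "nb (q k) (b k i)" "lab k (b k i) i = 1" if i: "i < n" for k i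
 proof -
  have "EX a. nb (q k) a & lab k a i = 0" "EX b. nb (q k) b & lab k b i = 1" using q i by blast+
  from someI_ex[OF this(1)] someI_ex[OF this(2)]
  show "nb (q k) (a k i)" "lab k (a k i) i = 0" "nb (q k) (b k i)" "lab k (b k i) i = 1" unfolding a_def b_def by blast+
 qed
 obtain r x where r: "strict_mono (r::nat=>nat)" and x: "\<And>j. (%k. P (r k) (q (r k)) (e j)) \<longlonglongrightarrow> x j"
  using pointwise_subseq[of "%k j. P k (q k) (e j)" 1] P01 by fastforce
 define X where "X i = (if i \<in> I then x (d i) else 0)" for i
 have X: "(%k. P (r k) (q (r k)) i) \<longlonglongrightarrow> X i" for i
  using x[of "d i"] ed[of i] by (cases "i \<in> I") (auto simp: X_def P_def)
 have X01: "0 <= X j & X j <= 1" for j using LIMSEQ_le_const[OF X] LIMSEQ_le_const2[OF X] P01 by blast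
 \<comment> \<open>All vertices of Kuhn's small cubes stay within one mesh width of the base point,
   so along the subsequence they share its limit.\<close>
 have near: "(%k. P (r k) (c k) j) \<longlonglongrightarrow> X j" if c: "\<And>k. nb (q (r k)) (c k)" for c j
 proof (rule Lim_transform2[OF X[of j]])
  have d1: "\<bar>P (r k) (q (r k)) j - P (r k) (c k) j\<bar> <= 1 / real (Suc (r k))" for k
  proof (cases "j \<in> I")
   case True
   have "\<bar>real (q (r k) (d j)) / real (Suc (r k)) - real (c k (d j)) / real (Suc (r k))\<bar> <= 1 / real (Suc (r k))"

   proof -
    have "q (r k) (d j) <= c k (d j)" "c k (d j) <= q (r k) (d j) + 1" using c[of k] ed(1)[OF True] by (auto simp: nb_def)
    then have "\<bar>real (q (r k) (d j)) - real (c k (d j))\<bar> <= 1" by linarith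
    then show ?thesis by (simp add: abs_divide divide_right_mono flip: diff_divide_distrib)
   qed
   moreover have "\<bar>min 1 v - min 1 w\<bar> <= \<bar>v - w\<bar>" for v w :: real by (simp add: min_def abs_if)
   ultimately show ?thesis using True unfolding P_def by (simp only: if_True)
  qed (simp add: P_def)
  have d2: "(%k. 1 / real (Suc (r k))) \<longlonglongrightarrow> 0"
   using LIMSEQ_subseq_LIMSEQ[OF LIMSEQ_Suc[OF lim_1_over_n] r] by (simp add: o_def)
  show "(%k. P (r k) (q (r k)) j - P (r k) (c k) j) \<longlonglongrightarrow> 0"
   by (rule Lim_null_comparison[OF always_eventually[OF allI] d2]) (simp only: real_norm_def d1)
 qed
 have "F X i = X i" if i: "i \<in> I" for i
 proof (rule antisym)
  have la: "P k (a k (d i)) i <= F (P k (a k (d i))) i" for k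
   using a(2)[OF ed(1)[OF i], of k] F[of "P k (a k (d i))", OF P01 i] ed[OF i] i by (auto simp: lab_def P_def split: if_splits)
  have one: "1 <= real y / (1 + real k)" if "Suc k <= y" for y k using that by (simp add: le_divide_eq)
  have lb: "F (P k (b k (d i))) i <= P k (b k (d i)) i" for k
   using b(2)[OF ed(1)[OF i], of k] F[of "P k (b k (d i))", OF P01 i] ed[OF i] i one
   by (auto simp: lab_def P_def not_less split: if_splits intro: order_trans)
  have n1: "(%k. P (r k) (a (r k) (d i)) j) \<longlonglongrightarrow> X j" "(%k. P (r k) (b (r k) (d i)) j) \<longlonglongrightarrow> X j" for j
   by (rule near, rule a(1)[OF ed(1)[OF i]] b(1)[OF ed(1)[OF i]])+
  show "X i <= F X i" by (rule LIMSEQ_le[OF n1(1) cont[OF P01 X01 n1(1) i]]) (use la in auto)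
  show "F X i <= X i" by (rule LIMSEQ_le[OF cont[OF P01 X01 n1(2) i] n1(2)]) (use lb in auto)
 qed
 then show ?thesis using X01 by blast
qed

context bounded_open
begin

lemma finite_cells:
 assumes l: "0 < l" shows "finite (cellof l ` \<Omega>)"
proof -
 obtain R where R: "\<And>x. x \<in> \<Omega> ==> norm x <= R" using bounded_\<Omega> unfolding bounded_iff by blast
 have "cellof l ` \<Omega> \<subseteq> PiE UNIV (%_. {- \<lceil>R / l\<rceil> - 1..\<lceil>R / l\<rceil>})"
 proof (intro image_subsetI PiE_I)
  fix x i assume "x \<in> \<Omega>"
  then have "\<bar>x $ i\<bar> <= R" using R[of x] component_le_norm_cart[of x i] by linarith
  then have "\<bar>x $ i / l\<bar> <= R / l" using l by (simp add: abs_divide divide_right_mono)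
  then show "cellof l x i \<in> {- \<lceil>R / l\<rceil> - 1..\<lceil>R / l\<rceil>}" unfolding cellof_def by (simp, linarith)
 qed simp
 then show ?thesis by (rule finite_subset) (intro finite_PiE, auto)
qed

lemma bounded_integrable:
 assumes "meas u" "AE x in M. 0 <= u x & u x <= (B::real)" shows "integrable M u"
 by (rule finite_measure.integrable_const_bound[OF finite_M _ assms(1), of B], use assms(2) in eventually_elim) auto

lemma L1n_bounded_tendsto:
 fixes f :: "nat => real^'n => real"
 assumes [measurable]: "\<And>k. meas (f k)" "meas f0"
  and b: "\<And>k. AE x in M. \<bar>f k x\<bar> <= B" and lim: "AE x in M. (%k. f k x) \<longlonglongrightarrow> f0 x"
 shows "(%k. L1n (%x. f k x - f0 x)) \<longlonglongrightarrow> 0"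
proof -
 have "(%k. L1n (%x. f k x - f0 x)) \<longlonglongrightarrow> eint (%x. 0)"
 proof (rule nn_integral_dominated_convergence[where w="%x. ennreal (2 * B)"])
  show "eint (%x. ennreal (2 * B)) < \<infinity>" by (simp add: emeasure_M ennreal_mult_less_top)
  have all: "AE x in M. ALL k. \<bar>f k x\<bar> <= B" using b by (simp add: AE_all_countable)
  show "AE x in M. ennreal (norm (f k x - f0 x)) <= ennreal (2 * B)" for k
   using all lim
  proof eventually_elim
   case (elim x)
   note 1 = elim(1) and 2 = elim(2)
   have "\<bar>f0 x\<bar> <= B" by (rule LIMSEQ_le_const2[OF tendsto_rabs[OF 2]]) (use 1 in auto)
   then show ?case using spec[OF 1, of k] by (intro ennreal_leI) simp
  qed
  show "AE x in M. (%k. ennreal (norm (f k x - f0 x))) \<longlonglongrightarrow> 0"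
   using lim
  proof eventually_elim
   fix x assume "(%k. f k x) \<longlonglongrightarrow> f0 x"
   then have "(%k. norm (f k x - f0 x)) \<longlonglongrightarrow> 0" by (intro tendsto_norm_zero) (simp add: LIM_zero)
   from tendsto_ennrealI[OF this] show "(%k. ennreal (norm (f k x - f0 x))) \<longlonglongrightarrow> 0" by simp
  qed
 qed auto
 then show ?thesis by simp
qed

text \<open>Rellich's theorem, from approximation by cell averages.\<close>

lemma L1_compact:
 fixes u :: "nat => 'j::finite => real^'n => real"
 assumes m: "\<And>k j. meas (u k j)" and B: "\<And>k j. AE x in M. 0 <= u k j x & u k j x <= B"
  and osc: "\<And>k j l. 0 < l ==> eint (%x. ennreal \<bar>u k j x - cavg l (u k j) (cellof l x)\<bar>) <= ennreal (K * l)"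
 shows "EX r U. strict_mono (r::nat=>nat) & (ALL j. meas (U j) & (%k. L1n (%x. u (r k) j x - U j x)) \<longlonglongrightarrow> 0)"
proof -
 note [measurable] = m
 have int: "integrable M (u k j)" for k j
  by (rule bounded_integrable[OF m B])
 have ca: "\<bar>cavg (1 / real (Suc i)) (u k j) z\<bar> <= \<bar>B\<bar>" for i k j z
 proof -
  have "AE x in M. 0 <= u k j x & u k j x <= \<bar>B\<bar>" using B[of k j] by eventually_elim auto
  from cavg_bounds[OF int this, of "1 / real (Suc i)" z] show ?thesis by simp
 qed
 obtain r l where r: "strict_mono (r::nat=>nat)" and l: "\<And>i j z. (%k. cavg (1 / real (Suc i)) (u (r k) j) z) \<longlonglongrightarrow> l (i, j, z)"
  using pointwise_subseq[of "%k (i, j, z). cavg (1 / real (Suc i)) (u k j) z" "\<bar>B\<bar>"] ca by (auto simp: split_beta)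
 have C: "EX N. ALL a>=N. ALL b>=N. L1n (%x. u (r a) j x - u (r b) j x) < ennreal e" if e: "0 < e" for e j
 proof -
  obtain i :: nat where i: "6 * (\<bar>K\<bar> + 1) / e < real (Suc i)" using reals_Archimedean2 less_Suc_eq by (metis of_nat_less_iff order.strict_trans lessI)
  let ?l = "1 / real (Suc i)"
  have Kl: "K * ?l < e / 6" using i e by (simp add: field_simps)
  let ?A = "%k x. cavg ?l (u (r k) j) (cellof ?l x)" and ?L = "%x. l (i, j, cellof ?l x)"
  have [measurable]: "meas ?L" by (rule step_M)
  have "(%k. L1n (%x. ?A k x - ?L x)) \<longlonglongrightarrow> 0"
   by (rule L1n_bounded_tendsto[where B="\<bar>B\<bar>"]) (use ca l in \<open>auto simp del: of_nat_Suc\<close>)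
  then have "\<forall>\<^sub>F k in sequentially. L1n (%x. ?A k x - ?L x) < ennreal (e / 6)" using e by (intro order_tendstoD) auto
  then obtain N where N: "\<And>k. N <= k ==> L1n (%x. ?A k x - ?L x) < ennreal (e / 6)" unfolding eventually_sequentially by blast
  have one: "L1n (%x. u (r k) j x - ?L x) <= ennreal (e / 3)" if "N <= k" for k
  proof -
   have "L1n (%x. u (r k) j x - ?L x) <= L1n (%x. u (r k) j x - ?A k x) + L1n (%x. ?A k x - ?L x)" by (intro L1n_triangle) measurable
   also have "... <= ennreal (e / 6) + ennreal (e / 6)"
   proof (rule add_mono)
    have "K * ?l <= e / 6" using Kl by simp
    then show "L1n (%x. u (r k) j x - ?A k x) <= ennreal (e / 6)"
     unfolding real_norm_def by (intro order_trans[OF osc ennreal_leI]) auto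
    show "L1n (%x. ?A k x - ?L x) <= ennreal (e / 6)" using N[OF that] by simp
   qed
   finally show ?thesis using e by (simp flip: ennreal_plus)
  qed
  have "L1n (%x. u (r a) j x - u (r b) j x) < ennreal e" if "N <= a" "N <= b" for a b
  proof -
   have "L1n (%x. u (r a) j x - u (r b) j x) <= L1n (%x. u (r a) j x - ?L x) + L1n (%x. ?L x - u (r b) j x)" by (intro L1n_triangle) measurable
   also have "... <= ennreal (e / 3) + ennreal (e / 3)"
    using one[OF that(1)] one[OF that(2)] by (subst (2) L1n_minus_commute) (intro add_mono)
   also have "... < ennreal e" using e by (simp flip: ennreal_plus add: ennreal_less_iff)
   finally show ?thesis .
  qed
  then show ?thesis by blast
 qed
 have "EX g. meas g & (%k. L1n (%x. u (r k) j x - g x)) \<longlonglongrightarrow> 0" for j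
 proof -
  obtain g s where "meas g" "(%k. L1n (%x. u (r k) j x - g x)) \<longlonglongrightarrow> 0"
   by (rule L1_Cauchy_limit[of "%k. u (r k) j" M, OF m C]) (assumption, rule that)
  then show ?thesis by blast
 qed
 then have "EX U. ALL j. meas (U j) & (%k. L1n (%x. u (r k) j x - U j x)) \<longlonglongrightarrow> 0"
  by (intro choice allI)
 then show ?thesis using r by blast
qed

text \<open>Step functions on the grid with values in [0, B] form a finite-dimensional cube;
  averaging \<open>T\<close> over cells maps it to itself, and a Brouwer fixed point of that map
  satisfies T U = U up to K l in the mean. The range of \<open>T\<close> is relatively compact in L1
  by \<open>L1_compact\<close>, so some sequence of these approximate fixed points converges as l
  tends to 0.\<close>

lemma schauder_cells:
 fixes T :: "('j::finite => real^'n => real) => 'j => real^'n => real"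
 assumes B0: "0 < B" and m: "\<And>U j. (\<And>i. meas (U i)) ==> meas (T U j)"
  and B: "\<And>U j. (\<And>i. meas (U i)) ==> AE x in M. 0 <= T U j x & T U j x <= B"
  and osc: "\<And>U j l. (\<And>i. meas (U i)) ==> 0 < l ==>
    eint (%x. ennreal \<bar>T U j x - cavg l (T U j) (cellof l x)\<bar>) <= ennreal (K * l)"
  and cont: "\<And>U U0 j. (\<And>k i. meas (U k i)) ==> (\<And>i. meas (U0 i)) ==>
    (\<And>i. AE x in M. (%k. U k i x) \<longlonglongrightarrow> U0 i x) ==> (%k. L1n (%x. T (U k) j x - T U0 j x)) \<longlonglongrightarrow> 0"
 shows "EX U. ALL j. meas (U j) & (AE x in M. T U j x = U j x)"
proof -
 have int: "integrable M (T U j)" if "\<And>i. meas (U i)" for U j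
  by (rule bounded_integrable[OF m B]) (rule that)+
 have fp: "EX U. ALL j. meas (U j) & eint (%x. ennreal \<bar>T U j x - U j x\<bar>) <= ennreal (K * l)" if l: "0 < l" for l
 proof -
  let ?I = "UNIV \<times> cellof l ` \<Omega> :: ('j \<times> ('n => int)) set"
  define S where "S x j y = B * x (j, cellof l y)" for x and j :: 'j and y
  have Sm: "meas (S x j)" for x j unfolding S_def by (rule step_M)
  have "EX x. (ALL j. 0 <= x j & x j <= 1) & (ALL i:?I. (%(j, z). cavg l (T (S x) j) z / B) i = x i)"
  proof (rule brouwer_coordinates)
   show "finite ?I" using finite_cells[OF l] by auto
   fix x i show "0 <= (%(j, z). cavg l (T (S x) j) z / B) i & (%(j, z). cavg l (T (S x) j) z / B) i <= 1"
    using cavg_bounds[OF int B l, of "S x"] Sm B0 by (auto split: prod.split)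
  next
   fix X :: "nat => 'j \<times> ('n => int) => real" and x and i :: "'j \<times> ('n => int)" assume lim: "\<And>j. j \<in> ?I ==> (%k. X k j) \<longlonglongrightarrow> x j"
   obtain j z where i: "i = (j, z)" by (cases i)
   have L: "(%k. L1n (%y. T (S (X k)) j y - T (S x) j y)) \<longlonglongrightarrow> 0"
    by (rule cont[OF Sm Sm]) (auto simp: S_def intro!: AE_I2 tendsto_mult lim)
   have "(%k. ennreal \<bar>cavg l (T (S (X k)) j) z - cavg l (T (S x) j) z\<bar>) \<longlonglongrightarrow> 0"
    by (rule tendsto_0_bound[OF tendsto_0_cmult[OF L] cavg_diff_le[OF int[OF Sm] int[OF Sm] l]])
   then have "(%k. cavg l (T (S (X k)) j) z - cavg l (T (S x) j) z) \<longlonglongrightarrow> 0"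
    by (subst (asm) ennreal_0[symmetric], subst (asm) tendsto_ennreal_iff) (auto simp: tendsto_rabs_zero_iff)
   then show "(%k. (%(j, z). cavg l (T (S (X k)) j) z / B) i) \<longlonglongrightarrow> (%(j, z). cavg l (T (S x) j) z / B) i"
    unfolding i prod.case by (rule tendsto_divide[OF LIM_zero_cancel tendsto_const]) (use B0 in auto)
  qed
  then obtain x where x': "ALL i:?I. (%(j, z). cavg l (T (S x) j) z / B) i = x i" by blast
  have x: "cavg l (T (S x) j) z = B * x (j, z)" if "z \<in> cellof l ` \<Omega>" for j z
   using bspec[OF x', of "(j, z)"] that B0 by (simp add: field_simps)
  \<comment> \<open>At the fixed point the step function consists of the cell averages of its own
    image, so \<open>osc\<close> measures how far it is from being fixed by
    \<open>T\<close>.\<close>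
  have "eint (%y. ennreal \<bar>T (S x) j y - S x j y\<bar>) = eint (%y. ennreal \<bar>T (S x) j y - cavg l (T (S x) j) (cellof l y)\<bar>)" for j
   by (rule nn_integral_cong) (simp add: x S_def)
  then show ?thesis using osc[OF Sm l] Sm by (intro exI[of _ "S x"]) auto
 qed
 have "EX U. ALL j. meas (U j) & eint (%x. ennreal \<bar>T U j x - U j x\<bar>) <= ennreal (K * (1 / real (Suc k)))" for k
  by (rule fp) simp
 then have "EX U. ALL k. ALL j. meas (U k j) & eint (%x. ennreal \<bar>T (U k) j x - U k j x\<bar>) <= ennreal (K * (1 / real (Suc k)))"
  by (intro choice allI)
 then obtain U where U: "\<And>k j. meas (U k j)" "\<And>k j. eint (%x. ennreal \<bar>T (U k) j x - U k j x\<bar>) <= ennreal (K * (1 / real (Suc k)))"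
  by blast
 note UT = m[of "U _", OF U(1)] B[of "U _", OF U(1)] osc[of "U _", OF U(1)]
 note [measurable] = U(1) UT(1)
 obtain r V where r: "strict_mono (r::nat=>nat)" and V[measurable]: "\<And>j. meas (V j)"
  and V2: "\<And>j. (%k. L1n (%x. T (U (r k)) j x - V j x)) \<longlonglongrightarrow> 0"
  using L1_compact[of "%k. T (U k)" B K, OF UT] by blast
 have UV: "(%k. L1n (%x. U (r k) j x - V j x)) \<longlonglongrightarrow> 0" for j
 proof (rule tendsto_0_bound[OF tendsto_0_add[OF _ V2[of j]]])
  have "(%k. ennreal (K * (1 / real (Suc (r k))))) \<longlonglongrightarrow> ennreal (K * 0)"
   by (intro tendsto_ennrealI tendsto_mult tendsto_const LIMSEQ_subseq_LIMSEQ[OF LIMSEQ_Suc[OF lim_1_over_n] r, unfolded o_def])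
  then show "(%k. ennreal (K * (1 / real (Suc (r k))))) \<longlonglongrightarrow> 0" by simp
  fix k
  have "L1n (%x. U (r k) j x - V j x) <= L1n (%x. U (r k) j x - T (U (r k)) j x) + L1n (%x. T (U (r k)) j x - V j x)"
   by (intro L1n_triangle) measurable
  also have "L1n (%x. U (r k) j x - T (U (r k)) j x) <= ennreal (K * (1 / real (Suc (r k))))"
   by (subst L1n_minus_commute) (use U(2)[of "r k" j] in simp)
  finally show "L1n (%x. U (r k) j x - V j x) <= ennreal (K * (1 / real (Suc (r k)))) + L1n (%x. T (U (r k)) j x - V j x)" by (simp add: add_right_mono)
 qed
 \<comment> \<open>Summing over the finitely many components gives one almost everywhere convergent
   subsequence for all of them.\<close>
 have "(%k. \<Sum>j\<in>UNIV. L1n (%x. U (r k) j x - V j x)) \<longlonglongrightarrow> (\<Sum>j\<in>(UNIV::'j set). 0)" by (intro tendsto_sum UV)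
 then have "(%k. L1n (%x. (\<Sum>j\<in>UNIV. \<bar>U (r k) j x - V j x\<bar>) - 0)) \<longlonglongrightarrow> 0"
  by (simp add: nn_integral_sum[symmetric] sum_nonneg)
 then obtain s where s: "strict_mono (s::nat=>nat)" and ae: "AE x in M. (%k. \<Sum>j\<in>UNIV. \<bar>U (r (s k)) j x - V j x\<bar>) \<longlonglongrightarrow> 0"
  by (rule L1_null_AE_subseq[rotated 2]) measurable
 have ae': "AE x in M. (%k. U (r (s k)) i x) \<longlonglongrightarrow> V i x" for i
  using ae
 proof eventually_elim
  case (elim x)
  then have "(%k. U (r (s k)) i x - V i x) \<longlonglongrightarrow> 0"
   by (rule Lim_null_comparison[rotated]) (auto intro!: always_eventually member_le_sum[of i UNIV "%j. \<bar>U (r (s _)) j x - V j x\<bar>"])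
  then show ?case by (rule LIM_zero_cancel)
 qed
 have "AE x in M. T V j x = V j x" for j
 proof -
  note [measurable] = m[OF V]
  have 1: "(%k. L1n (%x. T (U (r (s k))) j x - T V j x)) \<longlonglongrightarrow> 0" by (rule cont[OF U(1) V ae'])
  have 2: "(%k. L1n (%x. T (U (r (s k))) j x - V j x)) \<longlonglongrightarrow> 0" using LIMSEQ_subseq_LIMSEQ[OF V2[of j] s] by (simp add: o_def)
  have "L1n (%x. T V j x - V j x) <= L1n (%x. T (U (r (s k))) j x - T V j x) + L1n (%x. T (U (r (s k))) j x - V j x)" for k
   by (subst (2) L1n_minus_commute) (intro L1n_triangle, measurable)
  then have "L1n (%x. T V j x - V j x) <= 0" by (intro LIMSEQ_le_const[OF tendsto_0_add[OF 1 2]]) auto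
  then show ?thesis by (subst (asm) le_zero_eq, subst (asm) nn_integral_0_iff_AE) (auto elim!: eventually_mono)
 qed
 then show ?thesis using V by blast
qed

end

section \<open>Luxemburg norms and subsolutions\<close>

text \<open>Essential boundedness rules out the value \<infinity>, which
  \<open>real_of_ereal\<close> would turn into 0.\<close>

lemma ess_sup_AE:
 assumes "Linfty \<Omega> m" shows "AE x in lebesgue_on \<Omega>. m x <= ess_sup \<Omega> m"
proof -
 obtain C where m: "m \<in> borel_measurable (lebesgue_on \<Omega>)" and C: "AE x in lebesgue_on \<Omega>. \<bar>m x\<bar> <= C"
  using assms unfolding Linfty_def by blast
 have "AE x in lebesgue_on \<Omega>. ereal (m x) <= ereal C" using C by eventually_elim simp
 then have "esssup (lebesgue_on \<Omega>) (%x. ereal (m x)) <= ereal C" using m by (intro esssup_I) auto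
 with esssup_AE[where M="lebesgue_on \<Omega>" and f="%x. ereal (m x)"] show ?thesis
  unfolding ess_sup_def by (cases "esssup (lebesgue_on \<Omega>) (%x. ereal (m x))") auto
qed

lemma ess_inf_AE:
 assumes "Linfty \<Omega> m" shows "AE x in lebesgue_on \<Omega>. ess_inf \<Omega> m <= m x"
proof -
 have "Linfty \<Omega> (%x. - m x)" using assms by (simp add: Linfty_def)
 from ess_sup_AE[OF this] show ?thesis by eventually_elim (simp add: ess_inf_def)
qed

lemma small_powr:
 fixes C d D :: real
 assumes "0 <= C" "0 < d" "0 < D"
 shows "EX e>0. ALL \<epsilon>. 0 < \<epsilon> --> \<epsilon> <= e --> C * \<epsilon> powr d <= D"
proof (intro exI[of _ "(D / (C + 1)) powr (1 / d)"] conjI allI impI)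
 show "0 < (D / (C + 1)) powr (1 / d)" using assms by simp
 fix \<epsilon> :: real assume \<epsilon>: "0 < \<epsilon>" "\<epsilon> <= (D / (C + 1)) powr (1 / d)"
 have "\<epsilon> powr d <= ((D / (C + 1)) powr (1 / d)) powr d" using \<epsilon> assms by (intro powr_mono2) auto
 also have "... = D / (C + 1)" using assms by (simp add: powr_powr)
 finally have "C * \<epsilon> powr d <= C * (D / (C + 1))" using assms by (intro mult_left_mono) auto
 also have "... <= D" using assms by (simp add: field_simps)
 finally show "C * \<epsilon> powr d <= D" .
qed

text \<open>The excess \<kappa> - b of the exponent, evaluated at \<epsilon> t <= \<epsilon> <= 1,
  is traded for the small factor \<epsilon>^(\<kappa> - bp).\<close>

lemma powr_barrier_le:
 fixes t \<epsilon> b bp \<kappa> C D :: real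
 assumes "0 <= C" "0 < \<epsilon>" "\<epsilon> <= 1" "0 <= t" "t <= 1" "b <= bp" "bp < \<kappa>" "C * \<epsilon> powr (\<kappa> - bp) <= D"
 shows "C * (\<epsilon> * t) powr \<kappa> <= D * (\<epsilon> * t) powr b"
proof (cases "t = 0")
 case False
 have "(\<epsilon> * t) powr (\<kappa> - b) <= \<epsilon> powr (\<kappa> - b)" using assms by (intro powr_mono2) (auto simp: mult_le_cancel_left1)
 also have "... <= \<epsilon> powr (\<kappa> - bp)" using assms by (intro powr_mono') auto
 finally have "C * (\<epsilon> * t) powr (\<kappa> - b) <= C * \<epsilon> powr (\<kappa> - bp)" using assms by (intro mult_left_mono) auto
 also have "... <= D" by fact
 finally have "C * (\<epsilon> * t) powr (\<kappa> - b) * (\<epsilon> * t) powr b <= D * (\<epsilon> * t) powr b" by (intro mult_right_mono) auto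
 then show ?thesis by (simp add: mult.assoc flip: powr_add)
qed simp

context bounded_open
begin

text \<open>Nonempty open sets are not negligible, so an essential bound of a continuous function
  holds at every point.\<close>

lemma AE_le_open:
 assumes "continuous_on \<Omega> f" "AE x in M. f x <= (c::real)" "x \<in> \<Omega>"
 shows "f x <= c"
proof (rule ccontr)
 let ?S = "{x \<in> \<Omega>. c < f x}"
 assume "~ f x <= c"
 then have "?S ~= {}" using assms by auto
 moreover have "open ?S"
  using continuous_open_preimage[OF assms(1) open_\<Omega>, of "{c<..}"] by (simp add: vimage_def Int_def conj_commute)
 ultimately have "~ negligible ?S" by (intro open_not_negligible)
 moreover have "AE x in lebesgue. x \<notin> ?S"
  using assms(2) by (subst (asm) AE_restrict_space_iff) (auto elim!: eventually_mono)
 then have "negligible ?S" using \<open>open ?S\<close> by (subst negligible_iff_null_sets) (auto simp: AE_iff_null_sets borel_open)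
 ultimately show False by simp
qed

definition vexp :: "(real^'n => real) => bool" where
 "vexp q \<longleftrightarrow> meas q & (EX Q. AE x in M. 1 <= q x & q x <= Q)"

lemma vexp_M: "vexp q ==> meas q" by (simp add: vexp_def)
lemma vexp_ge: "vexp q ==> AE x in M. 1 <= q x" by (auto simp: vexp_def)

lemma modular_scale_le:
 assumes q: "vexp q" and [measurable]: "meas u" and k: "0 < k" "k <= l"
 shows "modular \<Omega> q (%x. u x / l) <= ennreal (k / l) * modular \<Omega> q (%x. u x / k)"
proof -
 note [measurable] = vexp_M[OF q]
 have "modular \<Omega> q (%x. u x / l) <= eint (%x. ennreal (k / l) * ennreal (\<bar>u x / k\<bar> powr q x))"
  unfolding modular_def
 proof (rule nn_integral_mono_AE, use vexp_ge[OF q] in eventually_elim)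
  case x: (elim x)
  have "\<bar>u x / l\<bar> powr q x = (k / l * \<bar>u x / k\<bar>) powr q x" using k by (simp add: abs_divide)
  also have "... = (k / l) powr q x * \<bar>u x / k\<bar> powr q x" using k by (subst powr_mult) auto
  also have "... <= (k / l) powr 1 * \<bar>u x / k\<bar> powr q x" using k x by (intro mult_right_mono powr_mono') auto
  finally show ?case
   using k by (simp flip: ennreal_mult add: ennreal_leI)
 qed
 then show ?thesis unfolding modular_def by (subst (asm) nn_integral_cmult) auto
qed

definition lset :: "(real^'n => real) => (real^'n => real) => real set" where
 "lset q u = {l. l > 0 & modular \<Omega> q (%x. u x / l) <= 1}"

lemma lux_lset: "lux_norm \<Omega> q u = Inf (lset q u)" by (simp add: lux_norm_def lset_def)

lemma lset_bdd[simp]: "bdd_below (lset q u)" by (rule bdd_belowI[of _ 0]) (simp add: lset_def)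

text \<open>The quotient is at most 1 / max 1 vol; as exponents are at least 1, so are its powers,
  and these integrate to at most 1.\<close>

lemma lset_member:
 assumes q: "vexp q" and B: "0 < B" "AE x in M. \<bar>u x\<bar> <= B"
 shows "max 1 vol * B \<in> lset q u"
proof -
 let ?V = "max 1 vol"
 have "modular \<Omega> q (%x. u x / (?V * B)) <= eint (%x. ennreal (1 / ?V))"
  unfolding modular_def
 proof (rule nn_integral_mono_AE, use vexp_ge[OF q] B(2) in eventually_elim)
  case x: (elim x)
  have "\<bar>u x / (?V * B)\<bar> powr q x <= (1 / ?V) powr q x"
   using x B(1) by (intro powr_mono2) (auto simp: abs_mult abs_divide field_simps)
  also have "... <= (1 / ?V) powr 1" using x by (intro powr_mono') auto
  finally show ?case by (intro ennreal_leI) simp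
 qed
 also have "... = ennreal (1 / ?V * vol)" unfolding nn_integral_const space_M emeasure_M
  by (rule ennreal_mult[symmetric]) (auto simp: vol_nonneg)
 also have "... <= ennreal 1" by (intro ennreal_leI) (simp add: field_simps)
 finally show ?thesis using B by (simp add: lset_def)
qed

lemma lux_le: "vexp q ==> 0 < B ==> AE x in M. \<bar>u x\<bar> <= B ==> lux_norm \<Omega> q u <= max 1 vol * B"
 unfolding lux_lset by (intro cInf_lower lset_member) auto

text \<open>A scale l < \<delta> makes the quotient exceed 1 on \<open>E\<close>, so with exponents
  at least 1 the modular is at least \<delta>/l times the measure of \<open>E\<close>.\<close>

lemma lux_ge:
 assumes q: "vexp q" and u[measurable]: "meas u" and B: "0 < B" "AE x in M. \<bar>u x\<bar> <= B"
  and E[measurable]: "E \<in> sets M" and \<delta>: "0 < \<delta>" "AE x in M. x \<in> E --> \<delta> <= \<bar>u x\<bar>"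
 shows "\<delta> * min 1 (measure M E) <= lux_norm \<Omega> q u"
 unfolding lux_lset
proof (rule cInf_greatest)
 show "lset q u ~= {}" using lset_member[OF q B] by blast
 fix l assume "l \<in> lset q u"
 then have l: "0 < l" "modular \<Omega> q (%x. u x / l) <= 1" by (auto simp: lset_def)
 interpret finite_measure M by (rule finite_M)
 show "\<delta> * min 1 (measure M E) <= l"
 proof (cases "\<delta> <= l")
  case True
  have "\<delta> * min 1 (measure M E) <= \<delta> * 1" using \<delta> by (intro mult_left_mono) auto
  then show ?thesis using True by simp
 next
  case False
  have "ennreal (\<delta> / l * measure M E) = eint (%x. ennreal (\<delta> / l) * indicator E x)"
   using \<delta> l by (simp add: nn_integral_cmult_indicator emeasure_eq_measure flip: ennreal_mult)
  also have "... <= modular \<Omega> q (%x. u x / l)" unfolding modular_def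
  proof (rule nn_integral_mono_AE, use vexp_ge[OF q] \<delta>(2) in eventually_elim)
   case x: (elim x)
   show ?case
   proof (cases "x \<in> E")
    case True
    have "\<delta> / l = (\<delta> / l) powr 1" using \<delta> l by simp
    also have "... <= (\<delta> / l) powr q x" using x False l by (intro powr_mono) auto
    also have "... <= \<bar>u x / l\<bar> powr q x" using x True \<delta> l by (intro powr_mono2) (auto simp: abs_divide divide_right_mono)
    finally show ?thesis using True by (simp add: ennreal_leI)
   qed simp
  qed
  also have "... <= ennreal 1" using l by simp
  finally have "\<delta> / l * measure M E <= 1" by (subst (asm) ennreal_le_iff) auto
  then have "\<delta> * measure M E <= l" using l by (simp add: field_simps)
  moreover have "\<delta> * min 1 (measure M E) <= \<delta> * measure M E" using \<delta> by (intro mult_left_mono) auto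
  ultimately show ?thesis by simp
 qed
qed

text \<open>At each fixed scale the modular converges by dominated convergence. By
  \<open>modular_scale_le\<close> it falls strictly below 1 past any admissible scale, so the
  infimum of the admissible scales cannot jump.\<close>

lemma lux_tendsto:
 assumes q: "vexp q" and [measurable]: "\<And>k. meas (u k)" "meas u0"
  and B: "0 < B" "\<And>k. AE x in M. \<bar>u k x\<bar> <= B" "AE x in M. \<bar>u0 x\<bar> <= B" and lim: "AE x in M. (%k. u k x) \<longlonglongrightarrow> u0 x"
 shows "(%k. lux_norm \<Omega> q (u k)) \<longlonglongrightarrow> lux_norm \<Omega> q u0"
proof -
 obtain Q where Q: "AE x in M. 1 <= q x & q x <= Q" using q by (auto simp: vexp_def)
 note [measurable] = vexp_M[OF q]
 have conv: "(%k. modular \<Omega> q (%x. u k x / l)) \<longlonglongrightarrow> modular \<Omega> q (%x. u0 x / l)" if l: "0 < l" for l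
  unfolding modular_def
 proof (rule nn_integral_dominated_convergence[where w="%x. ennreal (max 1 (B / l) powr Q)"])
  show "eint (%x. ennreal (max 1 (B / l) powr Q)) < \<infinity>" by (simp add: emeasure_M ennreal_mult_less_top)
  show "AE x in M. ennreal (\<bar>u k x / l\<bar> powr q x) <= ennreal (max 1 (B / l) powr Q)" for k
   using Q B(2)[of k]
  proof eventually_elim
   case x: (elim x)
   have "\<bar>u k x / l\<bar> powr q x <= max 1 (B / l) powr q x" using x l by (intro powr_mono2) (auto simp: abs_divide divide_right_mono le_max_iff_disj)
   also have "... <= max 1 (B / l) powr Q" using x by (intro powr_mono) auto
   finally show ?case by (rule ennreal_leI)
  qed
  show "AE x in M. (%k. ennreal (\<bar>u k x / l\<bar> powr q x)) \<longlonglongrightarrow> ennreal (\<bar>u0 x / l\<bar> powr q x)"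
   using Q lim by eventually_elim (use l in \<open>intro tendsto_ennrealI tendsto_powr' tendsto_rabs tendsto_divide tendsto_const; auto\<close>)
 qed auto
 have ne: "lset q (u k) ~= {}" "lset q u0 ~= {}" for k using lset_member[OF q B(1)] B by blast+
 show ?thesis
 proof (rule order_tendstoI)
  fix a assume a: "a < lux_norm \<Omega> q u0"
  show "\<forall>\<^sub>F k in sequentially. a < lux_norm \<Omega> q (u k)"
  proof (cases "a < 0")
   case True
   have "0 <= lux_norm \<Omega> q (u k)" for k unfolding lux_lset by (rule cInf_greatest[OF ne(1)]) (simp add: lset_def)
   then show ?thesis using True by (intro always_eventually allI) (rule less_le_trans)
  next
   case False
   obtain l where l: "a < l" "l < lux_norm \<Omega> q u0" using dense[OF a] by blast
   have "~ modular \<Omega> q (%x. u0 x / l) <= 1" using cInf_lower[OF _ lset_bdd, of l q u0] l False unfolding lux_lset by (auto simp: lset_def)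
   then have "\<forall>\<^sub>F k in sequentially. 1 < modular \<Omega> q (%x. u k x / l)" using l False by (intro order_tendstoD[OF conv]) auto
   then show ?thesis
   proof eventually_elim
    case k: (elim k)
    have "l <= lux_norm \<Omega> q (u k)" unfolding lux_lset
    proof (rule cInf_greatest[OF ne(1)], rule ccontr)
     fix l' assume l': "l' \<in> lset q (u k)" "~ l <= l'"
     then have "modular \<Omega> q (%x. u k x / l) <= ennreal (l' / l) * modular \<Omega> q (%x. u k x / l')" by (intro modular_scale_le q) (auto simp: lset_def)
     also have "... <= ennreal 1 * 1" using l' by (intro mult_mono ennreal_leI) (auto simp: lset_def)
     finally show False using k by simp
    qed
    then show ?case using l by simp
   qed
  qed
 next
  fix a assume "lux_norm \<Omega> q u0 < a"
  then obtain l0 where l0: "l0 \<in> lset q u0" "l0 < a" unfolding lux_lset using cInf_lessD[OF ne(2)] by blast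
  obtain l where l: "l0 < l" "l < a" using dense[OF l0(2)] by blast
  have l0p: "0 < l0" "modular \<Omega> q (%x. u0 x / l0) <= 1" using l0 by (auto simp: lset_def)
  have "modular \<Omega> q (%x. u0 x / l) <= ennreal (l0 / l) * modular \<Omega> q (%x. u0 x / l0)" using l l0p by (intro modular_scale_le q) auto
  also have "... <= ennreal (l0 / l) * 1" using l0p by (intro mult_left_mono) auto
  also have "... < 1" using l l0p by (simp add: ennreal_less_one_iff)
  finally have "\<forall>\<^sub>F k in sequentially. modular \<Omega> q (%x. u k x / l) < 1" using l l0p by (intro order_tendstoD[OF conv]) auto
  then show "\<forall>\<^sub>F k in sequentially. lux_norm \<Omega> q (u k) < a"
  proof eventually_elim
   case (elim k)
   then have "l \<in> lset q (u k)" using l l0p by (simp add: lset_def)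
   then have "lux_norm \<Omega> q (u k) <= l" unfolding lux_lset by (intro cInf_lower) auto
   then show ?case using l by simp
  qed
 qed
qed

lemma lux_cong:
 assumes "AE x in M. u x = v x" shows "lux_norm \<Omega> q u = lux_norm \<Omega> q v"
proof -
 have "modular \<Omega> q (%x. u x / l) = modular \<Omega> q (%x. v x / l)" for l
  unfolding modular_def by (rule nn_integral_cong_AE, use assms in eventually_elim) simp
 then show ?thesis by (simp add: lux_norm_def)
qed

end

context var_exponent
begin

lemma weak_sol_cong:
 assumes "weak_sol h u g" "AE x in M. h x = h' x" "meas h" "meas h'"
  "AE x in M. u x = u' x" "meas u'"
 shows "weak_sol h' u' g"
 unfolding weak_sol_def
proof (intro conjI allI impI)
 note W = weak_solD(1)[OF assms(1)]
 show "W0 u' g" using assms(5,6) W0_M[OF W] by (intro W0_cong[OF W]) auto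
 fix \<phi> \<zeta> assume F: "W0 \<phi> \<zeta>"
 have "(LINT x|M. h x * \<phi> x) = (LINT x|M. h' x * \<phi> x)"
  by (rule integral_cong_AE) (use assms(2) in \<open>auto elim!: eventually_mono intro!: borel_measurable_times assms(3,4) W0_M(1)[OF F]\<close>)
 then show "(LINT x|M. pflux (p x) (g x) \<bullet> \<zeta> x) = (LINT x|M. h' x * \<phi> x)" using weak_solD(2)[OF assms(1) F] by simp
qed

text \<open>One constant \<open>C\<close> serves every \<epsilon> in (0, 1], so that \<epsilon> can
  be chosen after \<open>C\<close> is known.\<close>

definition subsol :: "real => (real^'n => real) => real => bool" where
 "subsol \<kappa> f C \<longleftrightarrow> test_fun \<Omega> f & (ALL x. 0 <= f x & f x <= 1) & 0 <= C &
  (ALL \<epsilon> \<phi> \<zeta>. 0 < \<epsilon> --> \<epsilon> <= 1 --> W0 \<phi> \<zeta> --> (AE x in M. 0 <= \<phi> x) -->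
   (LINT x|M. pflux (p x) (\<epsilon> *\<^sub>R grad f x) \<bullet> \<zeta> x) <= (LINT x|M. C * (\<epsilon> * f x) powr \<kappa> * \<phi> x))"

lemma subsol_le:
 assumes S: "subsol \<kappa> f C" and \<epsilon>: "0 < \<epsilon>" "\<epsilon> <= 1" "0 <= \<kappa>" and sol: "weak_sol h u g" and h: "source \<mu> h"
  and le: "AE x in M. C * (\<epsilon> * f x) powr \<kappa> <= h x"
 shows "AE x in M. \<epsilon> * f x <= u x"
proof (rule comparison)
 have t: "test_fun \<Omega> f" and f01: "\<And>x. 0 <= f x" "\<And>x. f x <= 1" and C: "0 <= C" using S by (auto simp: subsol_def)
 show "W0 (%x. \<epsilon> * f x) (%x. \<epsilon> *\<^sub>R grad f x)" by (rule W0_scale[OF W0_test[OF t]])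
 show "W0 u g" by (rule weak_solD(1)[OF sol])
 fix \<phi> \<zeta> assume W: "W0 \<phi> \<zeta>" and "AE x in M. 0 <= \<phi> x & (\<epsilon> * f x <= u x --> \<phi> x = 0)"
 then have \<phi>: "AE x in M. 0 <= \<phi> x" by auto
 have "(LINT x|M. pflux (p x) (\<epsilon> *\<^sub>R grad f x) \<bullet> \<zeta> x) <= (LINT x|M. C * (\<epsilon> * f x) powr \<kappa> * \<phi> x)" using S \<epsilon> W \<phi> by (simp add: subsol_def)
 also have "... <= (LINT x|M. h x * \<phi> x)"
 proof (rule integral_mono_AE[OF source_integrable source_integrable[OF h W0_integrable(1)[OF W]]])
  note [measurable] = test_M[OF t]
  have "C * (\<epsilon> * f x) powr \<kappa> <= C * 1" for x using C \<epsilon> f01[of x] by (intro mult_left_mono powr_le1) (auto intro: mult_le_one)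
  then show "source C (%x. C * (\<epsilon> * f x) powr \<kappa>)" unfolding source_def using C by simp
  show "AE x in M. C * (\<epsilon> * f x) powr \<kappa> * \<phi> x <= h x * \<phi> x" using le \<phi> by eventually_elim (rule mult_right_mono)
 qed (rule W0_integrable(1)[OF W])
 also have "... = (LINT x|M. pflux (p x) (g x) \<bullet> \<zeta> x)" using weak_solD(2)[OF sol W] by simp
 finally show "(LINT x|M. pflux (p x) (\<epsilon> *\<^sub>R grad f x) \<bullet> \<zeta> x) <= (LINT x|M. pflux (p x) (g x) \<bullet> \<zeta> x)" .
qed

text \<open>The sets where the bumps are positive cover the domain, and Lindelof's theorem leaves
  countably many; countability keeps their supremum measurable and the almost everywhere comparison
  valid.\<close>

lemma subsol_cover:
 assumes \<kappa>: "0 < \<kappa>" "\<kappa> < pm - 1"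
  and P: "\<And>x. x \<in> \<Omega> ==> (p has_derivative (%h. P x \<bullet> h)) (at x)" "continuous_on \<Omega> P" and ne: "\<Omega> ~= {}"
 shows "EX f C. (ALL n::nat. subsol \<kappa> (f n) (C n)) & (ALL x:\<Omega>. EX n. 0 < f n x)"
proof -
 let ?F = "{{x. 0 < f x} | f. EX C. subsol \<kappa> f C}"
 have op: "open S" if "S \<in> ?F" for S
  using that test_fun_cont by (auto simp: subsol_def intro!: open_Collect_less continuous_on_const)
 obtain F' where F': "F' \<subseteq> ?F" "countable F'" "\<Union>F' = \<Union>?F" by (rule Lindelof[OF op])
 have cov: "x \<in> \<Union>F'" if x: "x \<in> \<Omega>" for x
 proof -
  obtain \<rho> where \<rho>: "0 < \<rho>" "cball x \<rho> \<subseteq> \<Omega>" using open_contains_cball[of \<Omega>] open_\<Omega> x by blast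
  obtain f C where f: "subsol \<kappa> f C" "ALL y:ball x \<rho>. 0 < f y" using barrier[OF \<rho> \<kappa> P] unfolding subsol_def by auto
  then have "{x. 0 < f x} \<in> ?F" by blast
  moreover have "x \<in> {x. 0 < f x}" using f(2) \<rho> by simp
  ultimately show ?thesis unfolding F'(3) by blast
 qed
 have F'ne: "F' ~= {}" using cov ne by blast
 have "EX f C. subsol \<kappa> f C & from_nat_into F' n = {x. 0 < f x}" for n
  using subsetD[OF F'(1) from_nat_into[OF F'ne]] by blast
 then have "EX f. ALL n. EX C. subsol \<kappa> (f n) C & from_nat_into F' n = {x. 0 < f n x}" by (intro choice allI)
 then obtain f where "ALL n. EX C. subsol \<kappa> (f n) C & from_nat_into F' n = {x. 0 < f n x}" by blast
 from choice[OF this] obtain C where fC: "\<And>n. subsol \<kappa> (f n) (C n)" "\<And>n. from_nat_into F' n = {x. 0 < f n x}" by blast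
 have "EX n. 0 < f n x" if x: "x \<in> \<Omega>" for x
 proof -
  obtain S where S: "S \<in> F'" "x \<in> S" using cov[OF x] by blast
  then obtain n where "S = from_nat_into F' n" using from_nat_into_surj[OF F'(2)] by metis
  then show ?thesis using S(2) fC(2)[of n] by auto
 qed
 then show ?thesis using fC(1) by blast
qed

end

section \<open>The coupled system\<close>

lemma abs_powr_times: "0 < (u::real) ==> \<bar>u\<bar> powr (b - 1) * u = u powr b"
 using powr_mult_base[of u "b - 1"] by (simp add: mult.commute)

text \<open>The Boolean index stands for the equation, \<open>True\<close> for the first, and
  negation exchanges the two unknowns, so that every estimate is proved once. \<open>ap\<close> and
  \<open>bp\<close> bound \<alpha> and \<beta> from above; \<sigma> and \<open>E\<close> bound
  \<eta> + \<gamma> from below and above.\<close>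

locale kirchhoff = bounded_open \<Omega> for \<Omega> :: "(real^'n::finite) set" +
 fixes p q r s \<alpha> \<beta> \<gamma> \<eta> :: "bool => real^'n => real" and P :: "bool => real^'n => real^'n"
  and pm pp ap bp \<sigma> E :: "bool => real" and A :: "real^'n => real => real"
 assumes V: "\<And>j. var_exponent \<Omega> (p j) (pm j) (pp j)" and \<Omega>_ne: "\<Omega> ~= {}"
  and P: "\<And>j x. x \<in> \<Omega> ==> (p j has_derivative (%h. P j x \<bullet> h)) (at x)" "\<And>j. continuous_on \<Omega> (P j)"
  and vexps: "\<And>j. vexp (q j)" "\<And>j. vexp (r j)" "\<And>j. vexp (s j)"
  and coeff_M: "\<And>j. meas (\<alpha> j)" "\<And>j. meas (\<beta> j)" "\<And>j. meas (\<gamma> j)" "\<And>j. meas (\<eta> j)"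
  and \<alpha>b: "\<And>j. AE x in M. 0 <= \<alpha> j x & \<alpha> j x <= ap j" and \<beta>b: "\<And>j. AE x in M. 0 <= \<beta> j x & \<beta> j x <= bp j"
  and \<gamma>\<eta>b: "\<And>j. AE x in M. 0 <= \<gamma> j x & 0 <= \<eta> j x & \<sigma> j <= \<eta> j x + \<gamma> j x & \<eta> j x + \<gamma> j x <= E j"
  and ab: "\<And>j. 0 <= ap j" "\<And>j. 0 <= bp j" "\<And>j. ap j + bp j < pm j - 1"
  and A_cont: "continuous_on (closure \<Omega> \<times> {0..}) (%(x, t). A x t)"
begin

abbreviation ws :: "bool => (real^'n => real) => (real^'n => real) => (real^'n => real^'n) => bool"
 where "ws j == var_exponent.weak_sol \<Omega> (p j)"

text \<open>Packages what is needed of the barriers: everything above \<open>w j\<close> has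
  Luxemburg norm at least \<open>c0\<close>, whatever the exponent, and a solution whose source
  dominates the least possible \<lambda>-term lies above \<open>w j\<close>. \<open>D\<close> will
  be \<lambda> divided by an upper bound for \<open>A\<close>.\<close>

definition lower_pair :: "real => real => (bool => real^'n => real) => real => bool" where
 "lower_pair D m0 w c0 \<longleftrightarrow> 0 < c0 & (ALL j. meas (w j) & (ALL x. w j x <= m0) & (ALL x:\<Omega>. 0 < w j x) &
   (ALL Q v B. vexp Q --> meas v --> 0 < B --> (AE x in M. w j x <= v x & v x <= B) --> c0 <= lux_norm \<Omega> Q v) &
   (ALL h u g \<mu>. ws j h u g --> source \<mu> h --> (AE x in M. D * (w j x powr \<beta> j x * c0 powr \<alpha> j x) <= h x) --> (AE x in M. w j x <= u x)))"

text \<open>One distinguished bump with scale \<epsilon>0 fixes \<open>c0\<close>, which is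
  proportional to \<epsilon>0, and must itself satisfy the barrier condition with that c0; this
  works since \<kappa> > ap + bp. All other scales are chosen afterwards, with c0 known, and capped
  by \<epsilon>0.\<close>

lemma lower_functions:
 assumes D: "0 < D" and m0: "0 < m0" "m0 <= (1::real)"
 shows "EX w c0. lower_pair D m0 w c0"
proof -
 define \<kappa> where "\<kappa> j = (ap j + bp j + (pm j - 1)) / 2" for j
 have \<kappa>: "ap j + bp j < \<kappa> j" "\<kappa> j < pm j - 1" for j using ab(3)[of j] by (auto simp: \<kappa>_def field_simps)
 have \<kappa>0: "0 < \<kappa> j" "bp j < \<kappa> j" for j using \<kappa>(1)[of j] ab(1,2)[of j] by linarith+
 have "ALL j. EX f. EX C. (ALL n::nat. var_exponent.subsol \<Omega> (p j) (\<kappa> j) (f n) (C n)) & (ALL x:\<Omega>. EX n. 0 < f n x)"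
  by (intro allI var_exponent.subsol_cover[OF V \<kappa>0(1) \<kappa>(2) P \<Omega>_ne])
 from choice[OF this] obtain f where "ALL j. EX C. (ALL n::nat. var_exponent.subsol \<Omega> (p j) (\<kappa> j) (f j n) (C n)) & (ALL x:\<Omega>. EX n. 0 < f j n x)" ..
 from choice[OF this] obtain C where sub: "\<And>j n. var_exponent.subsol \<Omega> (p j) (\<kappa> j) (f j n) (C j n)" and cov: "\<And>j x. x \<in> \<Omega> ==> EX n. 0 < f j n x"
  by blast
 have t: "test_fun \<Omega> (f j n)" and f01: "0 <= f j n x" "f j n x <= 1" and C0: "0 <= C j n" for j n x
  using sub[of j n] unfolding var_exponent.subsol_def[OF V] by auto
 note [measurable] = test_M[OF t]
 obtain x0 where x0: "x0 \<in> \<Omega>" using \<Omega>_ne by blast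
 define n0 where "n0 j = (SOME n. 0 < f j n x0)" for j
 have f0: "0 < f j (n0 j) x0" for j unfolding n0_def by (rule someI_ex[OF cov[OF x0]])
 define \<delta> where "\<delta> j = f j (n0 j) x0 / 2" for j
 have \<delta>: "0 < \<delta> j" "\<delta> j <= 1" "\<delta> j < f j (n0 j) x0" for j using f0[of j] f01(2)[of j "n0 j" x0] by (auto simp: \<delta>_def)
 define S where "S j = {x \<in> \<Omega>. \<delta> j < f j (n0 j) x}" for j
 have So: "open (S j)" for j unfolding S_def Collect_conj_eq Collect_mem_eq
  by (intro open_Int open_\<Omega> open_Collect_less continuous_on_const test_fun_cont[OF t])
 have SM[measurable]: "S j \<in> sets M" for j using So[of j] by (auto simp: sets_restrict_space_iff S_def borel_open)
 have Sp: "0 < measure M (S j)" for j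
 proof -
  have "x0 \<in> S j" using x0 \<delta> by (simp add: S_def)
  then have "~ negligible (S j)" using So[of j] by (intro open_not_negligible) auto
  then have "emeasure lebesgue (S j) ~= 0" using So[of j] by (simp add: negligible_iff_null_sets null_sets_def borel_open)
  then have "emeasure M (S j) ~= 0" by (subst emeasure_restrict_space) (auto simp: S_def)
  then show ?thesis using finite_measure.emeasure_eq_measure[OF finite_M, of "S j"] by (simp add: zero_less_measure_iff)
 qed
 \<comment> \<open>A lower bound for the Luxemburg norms of the unscaled distinguished bumps, from
   their superlevel sets, valid for both components and all exponents.\<close>
 define c where "c = min (\<delta> True * min 1 (measure M (S True))) (\<delta> False * min 1 (measure M (S False)))"
 have c: "0 < c" "c <= \<delta> j * min 1 (measure M (S j))" for j using \<delta> Sp by (auto simp: c_def, cases j, auto)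
 have "EX e>0. ALL \<epsilon>. 0 < \<epsilon> --> \<epsilon> <= e --> C j (n0 j) * \<epsilon> powr (\<kappa> j - bp j - ap j) <= D * c powr ap j" for j
  using C0 \<kappa>(1)[of j] D c by (intro small_powr) auto
 then obtain e where e: "\<And>j. 0 < e j" "\<And>j \<epsilon>. 0 < \<epsilon> ==> \<epsilon> <= e j ==> C j (n0 j) * \<epsilon> powr (\<kappa> j - bp j - ap j) <= D * c powr ap j" by metis
 define \<epsilon>0 where "\<epsilon>0 = min m0 (min (e True) (e False))"
 have \<epsilon>0: "0 < \<epsilon>0" "\<epsilon>0 <= m0" "\<epsilon>0 <= e j" "\<epsilon>0 <= 1" for j using m0 e(1) by (auto simp: \<epsilon>0_def, cases j, auto)
 define c0 where "c0 = \<epsilon>0 * c"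
 \<comment> \<open>\<open>c0 <= 1\<close> is wanted because then c0^ap is a lower bound for every
   c0^\<alpha>, and a constant exponent suffices.\<close>
 have "c <= 1" using c(2)[of True] \<delta>(1,2)[of True] mult_mono[of "\<delta> True" 1 "min 1 (measure M (S True))" 1] by simp
 then have c0: "0 < c0" "c0 <= 1" using c \<epsilon>0 by (auto simp: c0_def mult_le_one)
 have "EX \<epsilon>. 0 < \<epsilon> & \<epsilon> <= \<epsilon>0 & C j n * \<epsilon> powr (\<kappa> j - bp j) <= D * c0 powr ap j & (n = n0 j --> \<epsilon> = \<epsilon>0)" for j n
 proof (cases "n = n0 j")
  case True
  have "C j n * \<epsilon>0 powr (\<kappa> j - bp j) = C j n * \<epsilon>0 powr (\<kappa> j - bp j - ap j) * \<epsilon>0 powr ap j" by (simp add: mult.assoc flip: powr_add)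
  also have "... <= D * c powr ap j * \<epsilon>0 powr ap j" using e(2)[OF \<epsilon>0(1,3)] True by (intro mult_right_mono) auto
  also have "... = D * c0 powr ap j" using \<epsilon>0 c by (simp add: c0_def powr_mult)
  finally show ?thesis using \<epsilon>0 by blast
 next
  case False
  obtain e' where e': "0 < e'" "\<And>\<epsilon>. 0 < \<epsilon> ==> \<epsilon> <= e' ==> C j n * \<epsilon> powr (\<kappa> j - bp j) <= D * c0 powr ap j"
   using small_powr[OF C0, of "\<kappa> j - bp j" "D * c0 powr ap j" j n] \<kappa>0(2)[of j] D c0 by auto
  then show ?thesis using False \<epsilon>0 by (intro exI[of _ "min e' \<epsilon>0"]) auto
 qed
 then have "EX \<epsilon>. ALL j n. 0 < \<epsilon> j n & \<epsilon> j n <= \<epsilon>0 & C j n * \<epsilon> j n powr (\<kappa> j - bp j) <= D * c0 powr ap j & (n = n0 j --> \<epsilon> j n = \<epsilon>0)"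
  by (intro choice allI)
 then obtain \<epsilon> where \<epsilon>: "\<And>j n. 0 < \<epsilon> j n" "\<And>j n. \<epsilon> j n <= \<epsilon>0" "\<And>j n. C j n * \<epsilon> j n powr (\<kappa> j - bp j) <= D * c0 powr ap j" "\<And>j. \<epsilon> j (n0 j) = \<epsilon>0" by blast
 define w where "w j x = (SUP n. \<epsilon> j n * f j n x)" for j x
 have ub: "\<epsilon> j n * f j n x <= \<epsilon>0" for j n x
  using mult_mono[OF \<epsilon>(2)[of j n] f01(2)[of j n x]] \<epsilon>0(1) f01(1)[of j n x] by simp
 have bdd: "bdd_above (range (%n. \<epsilon> j n * f j n x))" for j x using ub by (intro bdd_aboveI) auto
 have le_w: "\<epsilon> j n * f j n x <= w j x" for j n x unfolding w_def by (rule cSUP_upper[OF _ bdd]) simp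
 have w0: "0 <= w j x" for j x using le_w[of j 0 x] \<epsilon>(1)[of j 0] f01(1)[of j 0 x] by (meson less_imp_le mult_nonneg_nonneg order_trans)
 have wm: "w j x <= \<epsilon>0" for j x unfolding w_def using ub by (intro cSUP_least) auto
 have wM: "meas (w j)" for j unfolding w_def[abs_def] by (rule borel_measurable_cSUP) (use bdd in auto)
 have wpos: "0 < w j x" if x: "x \<in> \<Omega>" for j x
 proof -
  obtain n where "0 < f j n x" using cov[OF x] by blast
  then have "0 < \<epsilon> j n * f j n x" using \<epsilon>(1) by simp
  then show ?thesis using le_w[of j n x] by linarith
 qed
 have norm: "c0 <= lux_norm \<Omega> Q v" if Q: "vexp Q" and v: "meas v" "0 < B" "AE x in M. w j x <= v x & v x <= B" for j Q v B
 proof -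
  have "\<epsilon>0 * \<delta> j * min 1 (measure M (S j)) <= lux_norm \<Omega> Q v"
  proof (rule lux_ge[OF Q v(1,2) _ SM])
   show "AE x in M. \<bar>v x\<bar> <= B" using v(3) by eventually_elim (use w0 in \<open>smt (verit)\<close>)
   show "AE x in M. x \<in> S j --> \<epsilon>0 * \<delta> j <= \<bar>v x\<bar>" using v(3)
   proof eventually_elim
    case vx: (elim x)
    show ?case
    proof
     assume "x \<in> S j"
     then have "\<epsilon>0 * \<delta> j <= \<epsilon>0 * f j (n0 j) x" using \<epsilon>0(1) by (intro mult_left_mono) (auto simp: S_def)
     then show "\<epsilon>0 * \<delta> j <= \<bar>v x\<bar>" using le_w[of j "n0 j" x] vx unfolding \<epsilon>(4) by linarith
    qed
   qed
  qed (use \<epsilon>0 \<delta> in simp)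
  moreover have "c0 <= \<epsilon>0 * (\<delta> j * min 1 (measure M (S j)))" unfolding c0_def using c(2) \<epsilon>0(1) by (intro mult_left_mono) auto
  ultimately show ?thesis by (simp add: mult.assoc)
 qed
 have low: "AE x in M. w j x <= u x" if sol: "ws j h u g" and h: "source \<mu> h" and le: "AE x in M. D * (w j x powr \<beta> j x * c0 powr \<alpha> j x) <= h x" for j h u g \<mu>
 proof -
  \<comment> \<open>Each scaled bump is compared separately; since \<open>w\<close> lies above it
    and \<beta> is nonnegative, having the whole supremum in the lower bound for the source only
    helps.\<close>
  have "AE x in M. \<epsilon> j n * f j n x <= u x" for n
  proof (rule var_exponent.subsol_le[OF V sub \<epsilon>(1) _ _ sol h])
   show "\<epsilon> j n <= 1" "0 <= \<kappa> j" using \<epsilon>(2)[of j n] \<epsilon>0(4) \<kappa>0(1)[of j] by linarith+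
   show "AE x in M. C j n * (\<epsilon> j n * f j n x) powr \<kappa> j <= h x"
    using le \<alpha>b[of j] \<beta>b[of j]
   proof eventually_elim
    case (elim x)
    note hx = elim(1) and ax = elim(2) and bx = elim(3)
    have "C j n * (\<epsilon> j n * f j n x) powr \<kappa> j <= D * c0 powr ap j * (\<epsilon> j n * f j n x) powr \<beta> j x"
     using \<epsilon>(2)[of j n] \<epsilon>0(4) bx by (intro powr_barrier_le[OF C0 \<epsilon>(1) _ f01 _ \<kappa>0(2) \<epsilon>(3)]) auto
    also have "... <= D * c0 powr \<alpha> j x * w j x powr \<beta> j x"
     using D c0 ax bx le_w[of j n x] \<epsilon>(1)[of j n] f01(1)[of j n x]
     by (intro mult_mono mult_left_mono powr_mono' powr_mono2) (auto simp: less_imp_le)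
    also have "... <= h x" using hx by (simp add: mult_ac)
    finally show ?case .
   qed
  qed
  then have "AE x in M. ALL n. \<epsilon> j n * f j n x <= u x" by (simp add: AE_all_countable)
  then show ?thesis by eventually_elim (auto simp: w_def intro!: cSUP_least)
 qed
 show ?thesis
  unfolding lower_pair_def
 proof (intro exI[of _ w] exI[of _ c0] conjI allI impI ballI)
  show "w j x <= m0" for j x using wm[of j x] \<epsilon>0(2) by simp
 qed (use c0 wM wpos norm low in blast)+
qed

definition G :: "real => real => bool => (real^'n => real) => (real^'n => real) => real^'n => real" where
 "G lam th j U W x = rhs \<Omega> lam th (\<alpha> j) (\<beta> j) (\<gamma> j) (\<eta> j) (q j) (s j) U W x / A x (lux_norm \<Omega> (r j) W)"

lemma G_M:
 assumes "meas U" "meas W" "0 <= lux_norm \<Omega> (r j) W"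
 shows "meas (G lam th j U W)"
proof -
 have c: "continuous_on \<Omega> (%x. (x, lux_norm \<Omega> (r j) W))" by (intro continuous_intros)
 have "continuous_on \<Omega> (%x. A x (lux_norm \<Omega> (r j) W))"
  using continuous_on_compose2[OF A_cont c] assms(3) closure_subset[of \<Omega>] by force
 then have [measurable]: "meas (%x. A x (lux_norm \<Omega> (r j) W))" by (rule continuous_imp_measurable_on_sets_lebesgue) simp
 note [measurable] = assms(1,2) coeff_M
 show ?thesis unfolding G_def rhs_def by measurable
qed

lemma A_tendsto:
 assumes "x \<in> \<Omega>" "\<And>k. 0 <= t k" "0 <= t0" "t \<longlonglongrightarrow> t0"
 shows "(%k. A x (t k)) \<longlonglongrightarrow> A x t0"
proof -
 have c: "continuous_on {0..} (%t::real. (x, t))" by (intro continuous_intros)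
 have "continuous_on {0..} (%t. A x t)"
  using continuous_on_compose2[OF A_cont c] assms(1) closure_subset[of \<Omega>] by force
 from continuous_on_tendsto_compose[OF this assms(4)] show ?thesis using assms(2,3) by auto
qed

text \<open>\<open>X1\<close> and \<open>X2\<close> bound the \<lambda>- and \<theta>-terms for
  unknowns below \<open>Mx\<close>. The parameter \<tau> measures the source: \<open>small\<close>
  makes cP times the source bound at most \<tau>/2, and with S^(1 - p) <= 1/\<tau> the sup bound
  returns U <= cInf S <= Mx.\<close>

lemma system_solution:
 fixes w :: "bool => real^'n => real" and X1 X2 S Mx :: "bool => real"
 assumes pos': "0 < lam" "0 < th" "0 < alo" "0 < \<tau>"
  and pair: "lower_pair (lam / ahi) m0 w c0" and m0: "\<And>j. m0 <= Mx j"
  and A: "\<And>x j t. x \<in> \<Omega> ==> c0 <= t ==> t <= max 1 vol * Mx j ==> alo <= A x t & A x t <= ahi"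
  and X: "\<And>j. 0 <= X1 j" "\<And>j. AE x in M. Mx j powr \<beta> j x * (max 1 vol * Mx (~ j)) powr \<alpha> j x <= X1 j"
   "\<And>j. 0 <= X2 j" "\<And>j. AE x in M. Mx (~ j) powr \<eta> j x * (max 1 vol * Mx (~ j)) powr \<gamma> j x <= X2 j"
  and small: "\<And>j. var_exponent.cP \<Omega> * (lam * X1 j) <= alo * \<tau> / 4" "\<And>j. var_exponent.cP \<Omega> * (th * X2 j) <= alo * \<tau> / 4"
  and S: "\<And>j. 0 < S j" "\<And>j x. x \<in> \<Omega> ==> S j powr (1 - p j x) <= 1 / \<tau>" "\<And>j. var_exponent.cInf \<Omega> * S j <= Mx j"
 shows "EX U. ALL j. (AE x in M. 0 < U j x) & W01p \<Omega> (p j) (U j) & Linfty \<Omega> (U j) &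
   (EX g. weak_grad \<Omega> (U j) g & weak_eq \<Omega> (p j) g (G lam th j (U j) (U (~ j))))"
proof -
 let ?V = "max 1 vol"
 note pair' = pair[unfolded lower_pair_def]
 note pj = spec[OF conjunct2[OF pair']]
 have pos: "0 < lam" "0 < th" "0 < alo" "0 < c0" "0 < \<tau>" using pos' conjunct1[OF pair'] by auto
 have w: "meas (w j)" "w j x <= Mx j" "x \<in> \<Omega> ==> 0 < w j x" for j x
  using pj[of j] order_trans[OF _ m0[of j], of "w j x"] by blast+
 have Mx: "0 < Mx j" for j using \<Omega>_ne w(2)[of j] w(3)[of _ j] by (force intro: less_le_trans)
 have norm: "c0 <= lux_norm \<Omega> Q v" if "vexp Q" "meas v" "AE x in M. w j x <= v x & v x <= Mx j" for j Q v
  by (rule pj[THEN conjunct2, THEN conjunct2, THEN conjunct2, THEN conjunct1, rule_format, OF that(1,2) Mx that(3)])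
 have low: "AE x in M. w j x <= u x" if "ws j h u g" "source \<mu> h" "AE x in M. lam / ahi * (w j x powr \<beta> j x * c0 powr \<alpha> j x) <= h x" for j h u g \<mu>
  by (rule pj[THEN conjunct2, THEN conjunct2, THEN conjunct2, THEN conjunct2, rule_format, OF that])
 define adm where "adm j u \<longleftrightarrow> meas u & (AE x in M. 0 < u x & w j x <= u x & u x <= Mx j)" for j u
 define tr where "tr U j x = max (w j x) (min (Mx j) (U j x))" for U :: "bool => real^'n => real" and j x
 have tr: "adm j (tr U j)" if [measurable]: "meas (U j)" for U j
 proof -
  note [measurable] = w(1)
  have "AE x in M. 0 < tr U j x & w j x <= tr U j x & tr U j x <= Mx j"
   by (intro AE_I2) (use w(2,3) in \<open>auto simp: tr_def less_max_iff_disj\<close>)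
  moreover have "meas (tr U j)" unfolding tr_def[abs_def] by measurable
  ultimately show ?thesis by (simp add: adm_def)
 qed
 have adm_abs: "AE x in M. \<bar>u x\<bar> <= Mx j" if "adm j u" for j u
  using that[unfolded adm_def, THEN conjunct2] by eventually_elim auto
 have lux: "c0 <= lux_norm \<Omega> Q u" "lux_norm \<Omega> Q u <= ?V * Mx j" if "vexp Q" "adm j u" for Q j u
  using norm[OF that(1), of u j] lux_le[OF that(1) Mx adm_abs[OF that(2)]] that(2) by (auto simp: adm_def)
 \<comment> \<open>Read off from the two-sided bound on \<open>A\<close> at t = \<open>c0\<close>,
   which is in range because some admissible function exists.\<close>
 have ahi: "0 < ahi"
 proof -
  obtain x where "x \<in> \<Omega>" using \<Omega>_ne by blast
  moreover have "c0 <= ?V * Mx True" by (rule order_trans[OF lux[OF vexps(1) tr, of "%j x. 0"]]) auto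
  ultimately show ?thesis using A[of x c0 True] pos by auto
 qed
 have Gb: "source ((lam * X1 j + th * X2 j) / alo) (G lam th j U W)" "AE x in M. lam / ahi * (w j x powr \<beta> j x * c0 powr \<alpha> j x) <= G lam th j U W x"
  if U: "adm j U" and W: "adm (~ j) W" for j U W
 proof -
  note l = lux[OF vexps(1) W, of j] lux[OF vexps(2) W, of j] lux[OF vexps(3) W, of j]
  have "AE x in M. (lam / ahi * (w j x powr \<beta> j x * c0 powr \<alpha> j x) <= G lam th j U W x) & (0 <= G lam th j U W x & G lam th j U W x <= (lam * X1 j + th * X2 j) / alo)"
   using U[unfolded adm_def, THEN conjunct2] W[unfolded adm_def, THEN conjunct2] \<alpha>b[of j] \<beta>b[of j] \<gamma>\<eta>b[of j] X(2)[of j] X(4)[of j] AE_space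
  proof eventually_elim
   case (elim x)
   note u = elim(1) and v = elim(2) and a = elim(3) and b = elim(4) and ge = elim(5) and x1 = elim(6) and x2 = elim(7)
   have x: "x \<in> \<Omega>" using elim(8) by simp
   let ?n1 = "lux_norm \<Omega> (q j) W" and ?n2 = "lux_norm \<Omega> (s j) W" and ?a = "A x (lux_norm \<Omega> (r j) W)"
   have A': "alo <= ?a" "?a <= ahi" using A[OF x l(3,4)] by auto
   have Geq: "G lam th j U W x = (lam * (U x powr \<beta> j x * ?n1 powr \<alpha> j x) + th * (W x powr \<eta> j x * ?n2 powr \<gamma> j x)) / ?a"
    unfolding G_def rhs_def using abs_powr_times[of "U x"] abs_powr_times[of "W x"] u v by (simp add: mult.assoc)
   let ?N1 = "U x powr \<beta> j x * ?n1 powr \<alpha> j x" and ?N2 = "W x powr \<eta> j x * ?n2 powr \<gamma> j x"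
   have n: "?N1 <= X1 j" "?N2 <= X2 j"
    using u v a b ge l pos by (auto intro!: order_trans[OF _ x1] order_trans[OF _ x2] mult_mono powr_mono2)
   \<comment> \<open>Only the \<lambda>-term is kept: its factors are least at the barrier, and
     \<open>A\<close> is replaced by its largest value.\<close>
   have "lam / ahi * (w j x powr \<beta> j x * c0 powr \<alpha> j x) <= lam / ?a * ?N1"
    using w(3)[OF x, of j] u a b pos A' l ahi by (intro mult_mono divide_left_mono powr_mono2) (auto intro!: mult_pos_pos)
   also have "... <= G lam th j U W x" unfolding Geq using pos A' by (simp add: add_divide_distrib)
   finally have 1: "lam / ahi * (w j x powr \<beta> j x * c0 powr \<alpha> j x) <= G lam th j U W x" .
   have "lam * ?N1 + th * ?N2 <= lam * X1 j + th * X2 j" using n pos by (intro add_mono mult_left_mono) auto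
   then have 2: "G lam th j U W x <= (lam * X1 j + th * X2 j) / alo" unfolding Geq using pos A' X(1,3) by (intro frac_le) auto
   have "0 <= G lam th j U W x" unfolding Geq using pos A' by (intro divide_nonneg_nonneg add_nonneg_nonneg) auto
   then show ?case using 1 2 by blast
  qed
  moreover have "meas (G lam th j U W)" using U W l(3) pos by (intro G_M) (auto simp: adm_def)
  ultimately show "source ((lam * X1 j + th * X2 j) / alo) (G lam th j U W)" "AE x in M. lam / ahi * (w j x powr \<beta> j x * c0 powr \<alpha> j x) <= G lam th j U W x"
   by (auto simp: source_def)
 qed
 define \<mu> where "\<mu> j = (lam * X1 j + th * X2 j) / alo" for j
 have \<mu>0: "0 <= \<mu> j" for j using pos X by (simp add: \<mu>_def)
 define GG where "GG U j = G lam th j (tr U j) (tr U (~ j))" for U j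
 have GGs: "source (\<mu> j) (GG U j)" if "\<And>i. meas (U i)" for U j
  unfolding GG_def \<mu>_def by (intro Gb(1) tr that)
 have GGc: "AE x in M. (%k. GG (U k) j x) \<longlonglongrightarrow> GG U0 j x"
  if m: "\<And>k i. meas (U k i)" "\<And>i. meas (U0 i)" and lim: "\<And>i. AE x in M. (%k. U k i x) \<longlonglongrightarrow> U0 i x" for U U0 j
 proof -
  have lt: "AE x in M. (%k. tr (U k) i x) \<longlonglongrightarrow> tr U0 i x" for i
   using lim[of i] by eventually_elim (auto simp: tr_def intro!: tendsto_max tendsto_min)
  have ad1: "adm i (tr (U k) i)" and ad2: "adm i (tr U0 i)" for i k by (rule tr, rule m)+
  have lx: "(%k. lux_norm \<Omega> Q (tr (U k) i)) \<longlonglongrightarrow> lux_norm \<Omega> Q (tr U0 i)" if "vexp Q" for Q i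
   by (rule lux_tendsto[OF that _ _ Mx[of i] adm_abs[OF ad1] adm_abs[OF ad2] lt]) (use ad1 ad2 in \<open>auto simp: adm_def\<close>)
  note c = lux(1)[OF vexps(1) ad2] lux(1)[OF vexps(3) ad2] lux[OF vexps(2) ad2] lux(1)[OF vexps(2) ad1]
  show ?thesis
   using lt[of j] lt[of "~ j"] ad2[of j, unfolded adm_def, THEN conjunct2] ad2[of "~ j", unfolded adm_def, THEN conjunct2] AE_space
  proof eventually_elim
   case (elim x)
   note 1 = elim(1-2) and 2 = elim(3-4)
   have x: "x \<in> \<Omega>" using elim(5) by simp
   have At: "(%k. A x (lux_norm \<Omega> (r j) (tr (U k) (~ j)))) \<longlonglongrightarrow> A x (lux_norm \<Omega> (r j) (tr U0 (~ j)))"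
    by (intro A_tendsto x lx vexps) (use c pos in \<open>auto intro: order_trans[of 0 c0]\<close>)
   have nz: "A x (lux_norm \<Omega> (r j) (tr U0 (~ j))) ~= 0"
    by (rule less_imp_neq[THEN not_sym], rule less_le_trans[OF pos(3)], rule conjunct1[OF A[OF x c(3,4)]])
   have nq: "lux_norm \<Omega> (q j) (tr U0 (~ j)) ~= 0" "lux_norm \<Omega> (s j) (tr U0 (~ j)) ~= 0"
    by (rule less_imp_neq[THEN not_sym], rule less_le_trans[OF pos(4)], rule c)+
   show ?case
    unfolding GG_def G_def rhs_def using 2
    by (intro tendsto_divide tendsto_add tendsto_mult tendsto_powr tendsto_rabs tendsto_const 1 At nz lx vexps nq) auto
  qed
 qed
 \<comment> \<open>Any selection will do, because \<open>weak_sol_continuous\<close> compares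
   arbitrary solutions of the equations involved.\<close>
 define T where "T U j = (SOME u. EX g. ws j (GG U j) u g)" for U j
 have T: "EX g. ws j (GG U j) (T U j) g" if "\<And>i. meas (U i)" for U j
  unfolding T_def by (rule someI_ex[OF var_exponent.weak_sol_exists[OF V GGs[OF that] \<mu>0]])
 define ub where "ub j = var_exponent.ubound \<Omega> (p j) (\<mu> j)" for j
 define gb where "gb j = var_exponent.gbound \<Omega> (p j) (\<mu> j)" for j
 have ub0: "0 <= ub j" and gb0: "0 <= gb j" for j unfolding ub_def gb_def by (rule var_exponent.ubound(1)[OF V \<mu>0] var_exponent.gbound(1)[OF V \<mu>0])+
 let ?B = "1 + ub True + ub False" and ?K = "2 ^ CARD('n) * real CARD('n) * (gb True + gb False)"
 have ubB: "ub j <= ?B" and gbB: "gb j <= gb True + gb False" for j using ub0 gb0 by (cases j; simp add: add_increasing add_increasing2)+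
 have "EX U. ALL j. meas (U j) & (AE x in M. T U j x = U j x)"
 proof (rule schauder_cells[of ?B T ?K])
  show "0 < ?B" using ub0[of True] ub0[of False] by linarith
  fix U :: "bool => real^'n => real" and j assume m: "\<And>i. meas (U i)"
  obtain g where g: "ws j (GG U j) (T U j) g" using T[of U, OF m] by blast
  note W = var_exponent.weak_solD(1)[OF V g]
  show "meas (T U j)" by (rule var_exponent.W0_M(1)[OF V W])
  show "AE x in M. 0 <= T U j x & T U j x <= ?B"
   using var_exponent.ubound(2)[OF V \<mu>0 g GGs[of U, OF m], folded ub_def] by eventually_elim (use ubB[of j] in linarith)
  fix l :: real assume l: "0 < l"
  have "eint (%x. ennreal \<bar>T U j x - cavg l (T U j) (cellof l x)\<bar>) <= ennreal (2 ^ CARD('n) * real CARD('n) * l) * L1n (%x. g x)"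
   by (rule var_exponent.W0_cavg[OF V W l])
  also have "... <= ennreal (2 ^ CARD('n) * real CARD('n) * l) * ennreal (gb True + gb False)"
   using gbB[of j] unfolding gb_def by (intro mult_left_mono order_trans[OF var_exponent.gbound(2)[OF V \<mu>0 g GGs[of U, OF m]]] ennreal_leI) auto
  also have "... = ennreal (?K * l)" by (subst ennreal_mult[symmetric]) (use gb0 l in \<open>auto simp: mult_ac\<close>)
  finally show "eint (%x. ennreal \<bar>T U j x - cavg l (T U j) (cellof l x)\<bar>) <= ennreal (?K * l)" .
 next
  fix U :: "nat => bool => real^'n => real" and U0 j assume m: "\<And>k i. meas (U k i)" "\<And>i. meas (U0 i)"
   and lim: "\<And>i. AE x in M. (%k. U k i x) \<longlonglongrightarrow> U0 i x"
  have "ALL k. EX g. ws j (GG (U k) j) (T (U k) j) g" using T[of "U _", OF m(1)] by blast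
  from choice[OF this] obtain g where g: "\<And>k. ws j (GG (U k) j) (T (U k) j) (g k)" by blast
  obtain g0 where g0: "ws j (GG U0 j) (T U0 j) g0" using T[of U0, OF m(2)] by blast
  show "(%k. \<integral>\<^sup>+x. ennreal (norm (T (U k) j x - T U0 j x)) \<partial>M) \<longlonglongrightarrow> 0"
   by (rule var_exponent.weak_sol_continuous[OF V g g0 GGs[of "U _", OF m(1)] GGs[of U0, OF m(2)] \<mu>0 GGc[of U U0, OF m lim]])
 qed
 then obtain U where U: "\<And>j. meas (U j)" "\<And>j. AE x in M. T U j x = U j x" by blast
 have sol: "EX g. ws j (GG U j) (U j) g" for j
 proof -
  obtain g where g: "ws j (GG U j) (T U j) g" using T[of U, OF U(1)] by blast
  have m: "meas (GG U j)" using GGs[of U, OF U(1)] by (simp add: source_def)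
  show ?thesis using var_exponent.weak_sol_cong[OF V g _ m m U(2) U(1)] by auto
 qed
 have bounds: "AE x in M. w j x <= U j x" "AE x in M. U j x <= Mx j" for j
 proof -
  obtain g where g: "ws j (GG U j) (U j) g" using sol by blast
  show "AE x in M. w j x <= U j x" by (rule low[OF g GGs[of U, OF U(1)]]) (unfold GG_def, intro Gb(2) tr U(1))
  have "var_exponent.cP \<Omega> * (lam * X1 j) + var_exponent.cP \<Omega> * (th * X2 j) <= alo * \<tau> / 2" using small[of j] by linarith
  then have "var_exponent.cP \<Omega> * \<mu> j * (1 / \<tau>) <= 1 / 2" using pos by (simp add: \<mu>_def field_simps)
  then have "AE x in M. U j x <= var_exponent.cInf \<Omega> * S j"
   by (rule var_exponent.weak_sol_bounded[OF V g GGs[of U, OF U(1)] \<mu>0 S(1), rotated]) (rule S(2))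
  then show "AE x in M. U j x <= Mx j" by eventually_elim (use S(3)[of j] in linarith)
 qed
 have ad: "adm j (U j)" for j
 proof -
  have "AE x in M. 0 < U j x & w j x <= U j x & U j x <= Mx j" using bounds[of j] AE_space
  proof eventually_elim
   case (elim x)
   then show ?case using w(3)[of x j] by simp
  qed
  then show ?thesis using U(1) by (simp add: adm_def)
 qed
 have trU: "AE x in M. tr U j x = U j x" for j using bounds[of j] by eventually_elim (simp add: tr_def)
 show ?thesis
 proof (intro exI[of _ U] allI)
  fix j
  obtain g where g: "ws j (GG U j) (U j) g" using sol by blast
  have eq: "AE x in M. GG U j x = G lam th j (U j) (U (~ j)) x"
   using trU[of j] trU[of "~ j"] by eventually_elim (simp add: GG_def G_def rhs_def lux_cong[OF trU])
  note src = Gb(1)[OF ad[of j] ad[of "~ j"], folded \<mu>_def]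
  have m: "meas (GG U j)" "meas (G lam th j (U j) (U (~ j)))" using GGs[of U, OF U(1)] src by (simp_all add: source_def)
  have "ws j (G lam th j (U j) (U (~ j))) (U j) g" by (rule var_exponent.weak_sol_cong[OF V g eq m _ U(1)]) simp
  note R = var_exponent.weak_sol_weak_eq[OF V this src \<mu>0]
  have "AE x in M. 0 < U j x" using ad[of j] by (auto simp: adm_def)
  then show "(AE x in M. 0 < U j x) & W01p \<Omega> (p j) (U j) & Linfty \<Omega> (U j) &
   (EX g. weak_grad \<Omega> (U j) g & weak_eq \<Omega> (p j) g (G lam th j (U j) (U (~ j))))" using R by blast
 qed
qed

end

section \<open>Choice of the parameters\<close>

lemma eventually_small_powr:
 fixes C d D :: real
 assumes "0 <= C" "0 < d" "0 < D" shows "\<forall>\<^sub>F \<epsilon> in at_right 0. C * \<epsilon> powr d <= D"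
proof -
 obtain e where "0 < e" "\<And>\<epsilon>. 0 < \<epsilon> ==> \<epsilon> <= e ==> C * \<epsilon> powr d <= D" using small_powr[OF assms] by blast
 then show ?thesis unfolding eventually_at_right_field by (intro exI[of _ e]) auto
qed

context kirchhoff
begin

abbreviation is_solution :: "real => real => (bool => real^'n => real) => bool" where
 "is_solution lam th U == ALL j. (AE x in M. 0 < U j x) & W01p \<Omega> (p j) (U j) & Linfty \<Omega> (U j) &
   (EX g. weak_grad \<Omega> (U j) g & weak_eq \<Omega> (p j) g (G lam th j (U j) (U (~ j))))"

lemma pm_gt1: "1 < pm j" and pm_pp: "pm j <= pp j"
proof -
 interpret var_exponent \<Omega> "p j" "pm j" "pp j" by (rule V)
 show "1 < pm j" by (rule pm)
 show "pm j <= pp j" using \<Omega>_ne p_lower p_upper by (meson equals0I order_trans)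
qed

lemma p_bounds: "x \<in> \<Omega> ==> pm j <= p j x & p j x <= pp j"
 using var_exponent.p_lower[OF V] var_exponent.p_upper[OF V] by blast

lemma compact_closure: "compact (closure \<Omega>)" using bounded_\<Omega> by (simp add: compact_closure)

lemma A_upper: "EX ahi>0. ALL x:\<Omega>. ALL t:{0..b}. A x t <= ahi"
proof -
 have "bounded ((%(x, t). A x t) ` (closure \<Omega> \<times> {0..b}))"
  by (intro compact_imp_bounded compact_continuous_image continuous_on_subset[OF A_cont] compact_Times compact_closure) auto
 then obtain B where B: "\<And>x t. x \<in> closure \<Omega> ==> t \<in> {0..b} ==> \<bar>A x t\<bar> <= B" unfolding bounded_iff by force
 show ?thesis using B closure_subset[of \<Omega>] by (intro exI[of _ "\<bar>B\<bar> + 1"]) (force simp: abs_le_iff)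
qed

text \<open>Beyond some T the uniform limit keeps \<open>A\<close> above b0/2; between
  \<open>c0\<close> and T compactness gives a positive minimum. The bound starts at
  \<open>c0\<close> because \<open>A\<close> may tend to 0 with t.\<close>

lemma A_lower:
 assumes pos: "\<And>x t. x \<in> closure \<Omega> ==> 0 < t ==> 0 < A x t" and b0: "0 < b0" and c0: "0 < c0"
  and lim: "uniform_limit (closure \<Omega>) (%t x. A x t) (%x. b0) at_top"
 shows "EX alo>0. ALL x:\<Omega>. ALL t>=c0. alo <= A x t"
proof -
 have "\<forall>\<^sub>F t in at_top. ALL x:closure \<Omega>. dist (A x t) b0 < b0 / 2" using lim half_gt_zero[OF b0] unfolding uniform_limit_iff by blast
 then obtain T where T: "\<And>t x. T <= t ==> x \<in> closure \<Omega> ==> dist (A x t) b0 < b0 / 2" unfolding eventually_at_top_linorder by blast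
 let ?K = "closure \<Omega> \<times> {c0..max c0 T}"
 have "EX z:?K. ALL y:?K. (case z of (x, t) => A x t) <= (case y of (x, t) => A x t)"
  using \<Omega>_ne c0 by (intro continuous_attains_inf compact_Times compact_closure continuous_on_subset[OF A_cont]) auto
 then obtain x0 t0 where z: "x0 \<in> closure \<Omega>" "c0 <= t0" "\<And>x t. x \<in> closure \<Omega> ==> c0 <= t ==> t <= max c0 T ==> A x0 t0 <= A x t" by auto
 have "min (A x0 t0) (b0 / 2) <= A x t" if x: "x \<in> \<Omega>" "c0 <= t" for x t
 proof (cases "t <= max c0 T")
  case True then show ?thesis using z(3)[of x t] x closure_subset by (auto simp: min_le_iff_disj)
 next
  case False
  then have "dist (A x t) b0 < b0 / 2" using T[of t x] subsetD[OF closure_subset x(1)] by auto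
  then have "b0 / 2 <= A x t" unfolding dist_real_def by linarith
  then show ?thesis by simp
 qed
 moreover have "0 < min (A x0 t0) (b0 / 2)" using pos[OF z(1)] z(2) c0 b0 by simp
 ultimately show ?thesis by blast
qed

text \<open>With S = \<tau>^(1/(pp - 1)) and \<tau> <= 1 the largest exponent is the worst, so S^(1
  - p) <= 1/\<tau>. The \<theta>-term, of size S^\<sigma> with S of the other component, is then
  \<tau>^(1 + e) with e > 0 by superlinearity, which for small \<tau> stays within the allowance
  proportional to \<tau>. The parameter \<lambda> is chosen last.\<close>

lemma small_lambda:
 assumes a0: "0 < a0" and b0: "0 < b0" and th: "0 < th" and super: "\<And>j. pp (~ j) - 1 < \<sigma> j"
  and Age: "\<And>x t. x \<in> closure \<Omega> ==> 0 <= t ==> t <= b0 ==> a0 <= A x t"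
 shows "EX lam0>0. ALL lam. 0 < lam & lam < lam0 --> (EX U. is_solution lam th U)"
proof -
 let ?V = "max 1 vol" and ?cP = "var_exponent.cP \<Omega>"
 have cP: "0 < ?cP" by (rule var_exponent.cP_pos[OF V])
 define K where "K = max 1 (var_exponent.cInf \<Omega>)"
 define L where "L = ?V * K"
 have K: "1 <= K" "var_exponent.cInf \<Omega> <= K" by (auto simp: K_def)
 have L: "1 <= L" "K <= L" using mult_mono[of 1 ?V 1 K] mult_right_mono[of 1 ?V K] K by (auto simp: L_def)
 have pp1: "0 < pp j - 1" for j using pm_gt1[of j] pm_pp[of j] by linarith
 define e where "e j = \<sigma> j / (pp (~ j) - 1) - 1" for j
 have e: "0 < e j" for j using super[of j] pp1[of "~ j"] by (simp add: e_def)
 have "\<forall>\<^sub>F \<tau> in at_right 0. (ALL j. L * \<tau> powr (1 / (pp j - 1)) <= b0) & (ALL j. (?cP * (th * L powr E j)) * \<tau> powr e j <= a0 / 4) & \<tau> \<in> {0<..<1}"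
  using L pp1 b0 e a0 cP th
  by (intro eventually_conj eventually_all_finite eventually_small_powr eventually_at_right_real) auto
 from eventually_happens'[OF trivial_limit_at_right_real this] obtain \<tau> where
  \<tau>: "0 < \<tau>" "\<tau> <= 1" "\<And>j. L * \<tau> powr (1 / (pp j - 1)) <= b0" "\<And>j. (?cP * (th * L powr E j)) * \<tau> powr e j <= a0 / 4" by auto
 define S where "S j = \<tau> powr (1 / (pp j - 1))" for j
 have S: "0 < S j" "S j <= 1" for j using \<tau> pp1[of j] by (auto simp: S_def intro!: powr_le1)
 define Mx where "Mx j = K * S j" for j
 have Mx: "0 < Mx j" "?V * Mx j <= b0" "Mx j <= L * S j" "?V * Mx j = L * S j" for j
  using K S L \<tau>(3)[of j] by (auto simp: Mx_def L_def S_def mult_ac)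
 have LS: "L * S j <= L" for j using L S[of j] by (simp add: mult_left_le)
 define X1 where "X1 j = L powr (ap j + bp j)" for j
 define X2 where "X2 j = L powr E j * (\<tau> * \<tau> powr e j)" for j
 have X1p: "0 < X1 j" for j using L by (simp add: X1_def)
 have X1: "AE x in M. Mx j powr \<beta> j x * (?V * Mx (~ j)) powr \<alpha> j x <= X1 j" for j
  using \<alpha>b[of j] \<beta>b[of j]
 proof eventually_elim
  case (elim x)
  note a = elim(1) and b = elim(2)
  have "Mx j powr \<beta> j x * (?V * Mx (~ j)) powr \<alpha> j x <= L powr \<beta> j x * L powr \<alpha> j x"
   using a b Mx(1)[of j] Mx(1,4)[of "~ j"] order_trans[OF Mx(3) LS] LS L S[of "~ j"] by (intro mult_mono powr_mono2) auto
  also have "... <= L powr (ap j + bp j)" unfolding powr_add[symmetric] using a b L by (intro powr_mono) auto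
  finally show ?case by (simp add: X1_def)
 qed
 have X2: "AE x in M. Mx (~ j) powr \<eta> j x * (?V * Mx (~ j)) powr \<gamma> j x <= X2 j" for j
  using \<gamma>\<eta>b[of j]
 proof eventually_elim
  case g: (elim x)
  let ?S = "S (~ j)"
  have "Mx (~ j) powr \<eta> j x * (?V * Mx (~ j)) powr \<gamma> j x <= (L * ?S) powr \<eta> j x * (L * ?S) powr \<gamma> j x"
   unfolding Mx(4) using g Mx[of "~ j"] by (intro mult_right_mono powr_mono2) auto
  also have "... = L powr (\<eta> j x + \<gamma> j x) * ?S powr (\<eta> j x + \<gamma> j x)" using L S by (simp add: powr_mult powr_add less_imp_le)
  also have "... <= L powr E j * ?S powr \<sigma> j" using g L S[of "~ j"] by (intro mult_mono powr_mono powr_mono') auto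
  also have "?S powr \<sigma> j = \<tau> powr (1 + e j)" by (simp add: S_def powr_powr e_def)
  also have "... = \<tau> * \<tau> powr e j" using \<tau> by (simp add: powr_add)
  finally show ?case by (simp add: X2_def)
 qed
 have small2: "?cP * (th * X2 j) <= a0 * \<tau> / 4" for j
  using mult_right_mono[OF \<tau>(4)[of j] less_imp_le[OF \<tau>(1)]] by (simp add: X2_def mult_ac)
 have Sp: "S j powr (1 - p j x) <= 1 / \<tau>" if "x \<in> \<Omega>" for j x
 proof -
  have "S j powr (1 - p j x) = \<tau> powr ((1 - p j x) / (pp j - 1))" by (simp add: S_def powr_powr)
  also have "... <= \<tau> powr (- 1)" using \<tau> p_bounds[OF that, of j] pp1[of j] by (intro powr_mono') (auto simp: field_simps)
  finally show ?thesis using \<tau> by (simp add: powr_minus_divide)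
 qed
 obtain ahi where ahi: "0 < ahi" "\<And>x t. x \<in> \<Omega> ==> 0 <= t ==> t <= b0 ==> A x t <= ahi" using A_upper[of b0] by auto
 define l0 where "l0 = min (a0 * \<tau> / (4 * ?cP * X1 True)) (a0 * \<tau> / (4 * ?cP * X1 False))"
 have l0: "0 < l0" "l0 <= a0 * \<tau> / (4 * ?cP * X1 j)" for j using a0 \<tau> cP X1p by (auto simp: l0_def, cases j, auto)
 have "EX U. is_solution lam th U" if lam: "0 < lam" "lam < l0" for lam
 proof -
  \<comment> \<open>The upper constants are already fixed, independently of \<lambda>; the barrier,
    which depends on \<lambda>, is placed below both of them.\<close>
  define m0 where "m0 = min 1 (min (Mx True) (Mx False))"
  have m0: "0 < m0" "m0 <= 1" "m0 <= Mx j" for j using Mx(1) by (auto simp: m0_def, cases j, auto)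
  have "0 < lam / ahi" using lam ahi by simp
  from lower_functions[OF this m0(1,2)] obtain w c0 where w: "lower_pair (lam / ahi) m0 w c0" by blast
  then have c0: "0 < c0" by (simp add: lower_pair_def)
  show ?thesis
  proof (rule system_solution[OF lam(1) th a0 \<tau>(1) w m0(3)])
   show "a0 <= A x t & A x t <= ahi" if "x \<in> \<Omega>" "c0 <= t" "t <= ?V * Mx j" for x j t
    using Age[of x t] ahi(2)[of x t] that c0 Mx(2)[of j] closure_subset by auto
   show "?cP * (lam * X1 j) <= a0 * \<tau> / 4" for j
    using less_le_trans[OF lam(2) l0(2)[of j]] cP X1p[of j] by (simp add: field_simps)
   show "var_exponent.cInf \<Omega> * S j <= Mx j" for j unfolding Mx_def using K S(1)[of j] by (intro mult_right_mono) auto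
   show "0 <= X2 j" for j using \<tau> by (simp add: X2_def)
  qed (use X1p X1 X2 small2 S Sp in \<open>auto simp: less_imp_le\<close>)
 qed
 then show ?thesis using l0(1) by blast
qed

text \<open>Now \<tau> >= 1 and S = \<tau>^(1/(pm - 1)), the smallest exponent being the worst. The
  \<lambda>-term grows like \<tau>^\<rho> with \<rho> < 1 by \<open>sub\<close>, hence stays within
  the allowance proportional to \<tau> for large \<tau>; \<theta> is chosen last.\<close>

lemma small_theta:
 assumes b0: "0 < b0" and lam: "0 < lam" and sub: "\<And>j. bp j / (pm j - 1) + ap j / (pm (~ j) - 1) < 1"
  and Apos: "\<And>x t. x \<in> closure \<Omega> ==> 0 < t ==> 0 < A x t & A x t <= a0"
  and lim: "uniform_limit (closure \<Omega>) (%t x. A x t) (%x. b0) at_top"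
 shows "EX th0>0. ALL th. 0 < th & th < th0 --> (EX U. is_solution lam th U)"
proof -
 let ?V = "max 1 vol" and ?cP = "var_exponent.cP \<Omega>"
 have cP: "0 < ?cP" by (rule var_exponent.cP_pos[OF V])
 define K where "K = max 1 (var_exponent.cInf \<Omega>)"
 define L where "L = ?V * K"
 have K: "1 <= K" "var_exponent.cInf \<Omega> <= K" by (auto simp: K_def)
 have L: "1 <= L" "K <= L" using mult_mono[of 1 ?V 1 K] mult_right_mono[of 1 ?V K] K by (auto simp: L_def)
 have pm1: "0 < pm j - 1" for j using pm_gt1[of j] by linarith
 obtain x1 where x1: "x1 \<in> \<Omega>" using \<Omega>_ne by blast
 have a0: "0 < a0" using Apos[of x1 1] x1 closure_subset by force
 have "0 < lam / a0" using lam a0 by simp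
 \<comment> \<open>The barrier comes first and does not involve \<theta>: its \<open>c0\<close>
   determines the lower bound for \<open>A\<close>, and that in turn the size of the upper
   constants.\<close>
 from lower_functions[OF this zero_less_one order_refl] obtain w c0 where w: "lower_pair (lam / a0) 1 w c0" by blast
 then have c0: "0 < c0" by (simp add: lower_pair_def)
 obtain alo where alo: "0 < alo" "\<And>x t. x \<in> \<Omega> ==> c0 <= t ==> alo <= A x t" using A_lower[OF _ b0 c0 lim] Apos by blast
 define \<rho> where "\<rho> j = bp j / (pm j - 1) + ap j / (pm (~ j) - 1)" for j
 have \<rho>: "0 < 1 - \<rho> j" for j using sub[of j] by (simp add: \<rho>_def)
 have "\<forall>\<^sub>F \<epsilon> in at_right 0. (ALL j. (?cP * (lam * L powr (bp j + ap j))) * \<epsilon> powr (1 - \<rho> j) <= alo / 4) & \<epsilon> \<in> {0<..<1}"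
  using L \<rho> alo cP lam by (intro eventually_conj eventually_all_finite eventually_small_powr eventually_at_right_real) auto
 from eventually_happens'[OF trivial_limit_at_right_real this] obtain \<epsilon> where
  \<epsilon>: "0 < \<epsilon>" "\<epsilon> <= 1" "\<And>j. (?cP * (lam * L powr (bp j + ap j))) * \<epsilon> powr (1 - \<rho> j) <= alo / 4" by auto
 \<comment> \<open>A large \<tau> is sought as the reciprocal of a small \<epsilon>, so that
   \<open>eventually_small_powr\<close> serves both parts of the theorem.\<close>
 define \<tau> where "\<tau> = 1 / \<epsilon>"
 have \<tau>: "0 < \<tau>" "1 <= \<tau>" using \<epsilon> by (auto simp: \<tau>_def)
 define S where "S j = \<tau> powr (1 / (pm j - 1))" for j
 have S: "0 < S j" "1 <= S j" for j using \<tau> pm1[of j] by (auto simp: S_def intro!: ge_one_powr_ge_zero)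
 define Mx where "Mx j = K * S j" for j
 have Mx: "1 <= Mx j" "?V * Mx j = L * S j" "Mx j <= L * S j" "1 <= L * S j" for j
  using mult_mono[of 1 K 1 "S j"] mult_mono[of 1 L 1 "S j"] K S[of j] L by (auto simp: Mx_def L_def mult_ac)
 have Mx0: "0 < Mx j" for j using Mx(1)[of j] by linarith
 define X1 where "X1 j = L powr (bp j + ap j) * (\<tau> * \<epsilon> powr (1 - \<rho> j))" for j
 define X2 where "X2 j = (L * S (~ j)) powr E j" for j
 have X1: "AE x in M. Mx j powr \<beta> j x * (?V * Mx (~ j)) powr \<alpha> j x <= X1 j" for j
  using \<alpha>b[of j] \<beta>b[of j]
 proof eventually_elim
  case (elim x)
  note a = elim(1) and b = elim(2)
  have "Mx j powr \<beta> j x * (?V * Mx (~ j)) powr \<alpha> j x <= (L * S j) powr \<beta> j x * (L * S (~ j)) powr \<alpha> j x"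
   unfolding Mx(2) using a b Mx[of j] by (intro mult_right_mono powr_mono2) auto
  also have "... <= (L * S j) powr bp j * (L * S (~ j)) powr ap j" using a b Mx(4) by (intro mult_mono powr_mono) auto
  also have "... = L powr (bp j + ap j) * (S j powr bp j * S (~ j) powr ap j)" using L S[of j] S[of "~ j"] by (simp add: powr_mult powr_add)
  also have "S j powr bp j * S (~ j) powr ap j = \<tau> powr \<rho> j" by (simp add: S_def powr_powr \<rho>_def powr_add)
  also have "... = \<tau> * \<epsilon> powr (1 - \<rho> j)"
  proof -
   have "\<epsilon> powr (1 - \<rho> j) = \<tau> powr (\<rho> j - 1)" using \<epsilon> powr_minus_divide[of \<epsilon> "\<rho> j - 1"] by (simp add: \<tau>_def powr_divide)
   then show ?thesis using powr_mult_base[of \<tau> "\<rho> j - 1"] \<tau> by simp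
  qed
  finally show ?case by (simp add: X1_def)
 qed
 have X2: "AE x in M. Mx (~ j) powr \<eta> j x * (?V * Mx (~ j)) powr \<gamma> j x <= X2 j" for j
  using \<gamma>\<eta>b[of j]
 proof eventually_elim
  case g: (elim x)
  have "Mx (~ j) powr \<eta> j x * (?V * Mx (~ j)) powr \<gamma> j x <= (L * S (~ j)) powr \<eta> j x * (L * S (~ j)) powr \<gamma> j x"
   unfolding Mx(2) using g Mx[of "~ j"] by (intro mult_right_mono powr_mono2) auto
  also have "... <= X2 j" unfolding X2_def powr_add[symmetric] using g Mx(4) by (intro powr_mono) auto
  finally show ?case .
 qed
 have X2p: "0 < X2 j" for j using Mx(4)[of "~ j"] unfolding X2_def by (subst powr_gt_zero) linarith
 have small1: "?cP * (lam * X1 j) <= alo * \<tau> / 4" for j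
  using mult_right_mono[OF \<epsilon>(3)[of j] less_imp_le[OF \<tau>(1)]] by (simp add: X1_def mult_ac)
 have Sp: "S j powr (1 - p j x) <= 1 / \<tau>" if "x \<in> \<Omega>" for j x
 proof -
  have "S j powr (1 - p j x) = \<tau> powr ((1 - p j x) / (pm j - 1))" by (simp add: S_def powr_powr)
  also have "... <= \<tau> powr (- 1)" using \<tau> p_bounds[OF that, of j] pm1[of j] by (intro powr_mono) (auto simp: field_simps)
  finally show ?thesis using \<tau> by (simp add: powr_minus_divide)
 qed
 define t0 where "t0 = min (alo * \<tau> / (4 * ?cP * X2 True)) (alo * \<tau> / (4 * ?cP * X2 False))"
 have t0: "0 < t0" "t0 <= alo * \<tau> / (4 * ?cP * X2 j)" for j using alo \<tau> cP X2p by (auto simp: t0_def, cases j, auto)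
 have "EX U. is_solution lam th U" if th: "0 < th" "th < t0" for th
 proof (rule system_solution[OF lam th(1) alo(1) \<tau>(1) w Mx(1)])
  show "alo <= A x t & A x t <= a0" if "x \<in> \<Omega>" "c0 <= t" "t <= ?V * Mx j" for x j t
   using alo(2)[of x t] Apos[of x t] that c0 closure_subset by auto
  show "?cP * (th * X2 j) <= alo * \<tau> / 4" for j
   using less_le_trans[OF th(2) t0(2)[of j]] cP X2p[of j] by (simp add: field_simps)
  show "var_exponent.cInf \<Omega> * S j <= Mx j" for j unfolding Mx_def using K S(1)[of j] by (intro mult_right_mono) auto
  show "0 <= X1 j" for j using \<tau> by (simp add: X1_def)
 qed (use X2p X1 X2 small1 S Sp in \<open>auto simp: less_imp_le\<close>)
 then show ?thesis using t0(1) by blast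
qed

end

theorem theorem4p2:
  fixes \<Omega> :: "(real^'n::finite) set"
    and p1 p2 r1 r2 q1 q2 s1 s2 \<alpha>1 \<alpha>2 \<beta>1 \<beta>2 \<gamma>1 \<gamma>2 \<eta>1 \<eta>2 :: "real^'n \<Rightarrow> real"
    and A :: "real^'n \<Rightarrow> real \<Rightarrow> real"
    and a0 b0 :: real
  assumes dim: "CARD('n) > 1"
    and dom: "bounded_domain \<Omega>" and bdry: "C2_boundary \<Omega>"
    and p1C1: "C1_closure \<Omega> p1" and p2C1: "C1_closure \<Omega> p2"
    and p1b: "1 < ess_inf \<Omega> p1" "ess_sup \<Omega> p1 < real CARD('n)"
    and p2b: "1 < ess_inf \<Omega> p2" "ess_sup \<Omega> p2 < real CARD('n)"
    and rqs: "Linfty \<Omega> r1" "Linfty \<Omega> r2" "Linfty \<Omega> q1" "Linfty \<Omega> q2" "Linfty \<Omega> s1" "Linfty \<Omega> s2"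
    and rqs_ge1: "ess_inf \<Omega> r1 \<ge> 1" "ess_inf \<Omega> r2 \<ge> 1" "ess_inf \<Omega> q1 \<ge> 1"
       "ess_inf \<Omega> q2 \<ge> 1" "ess_inf \<Omega> s1 \<ge> 1" "ess_inf \<Omega> s2 \<ge> 1"
    and agh: "Linfty \<Omega> \<alpha>1" "Linfty \<Omega> \<alpha>2" "Linfty \<Omega> \<gamma>1" "Linfty \<Omega> \<gamma>2" "Linfty \<Omega> \<eta>1" "Linfty \<Omega> \<eta>2"
    and agh_nn: "AE x in lebesgue_on \<Omega>. \<alpha>1 x \<ge> 0" "AE x in lebesgue_on \<Omega>. \<alpha>2 x \<ge> 0"
       "AE x in lebesgue_on \<Omega>. \<gamma>1 x \<ge> 0" "AE x in lebesgue_on \<Omega>. \<gamma>2 x \<ge> 0"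
       "AE x in lebesgue_on \<Omega>. \<eta>1 x \<ge> 0" "AE x in lebesgue_on \<Omega>. \<eta>2 x \<ge> 0"
    and bet: "Linfty \<Omega> \<beta>1" "Linfty \<Omega> \<beta>2"
       "AE x in lebesgue_on \<Omega>. \<beta>1 x \<ge> 0" "AE x in lebesgue_on \<Omega>. \<beta>2 x \<ge> 0"
    and ab1: "0 < ess_inf \<Omega> \<alpha>1 + ess_inf \<Omega> \<beta>1"
       "ess_inf \<Omega> \<alpha>1 + ess_inf \<Omega> \<beta>1 \<le> ess_sup \<Omega> \<alpha>1 + ess_sup \<Omega> \<beta>1"
       "ess_sup \<Omega> \<alpha>1 + ess_sup \<Omega> \<beta>1 < ess_inf \<Omega> p1 - 1"
    and ab2: "0 < ess_inf \<Omega> \<alpha>2 + ess_inf \<Omega> \<beta>2"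
       "ess_inf \<Omega> \<alpha>2 + ess_inf \<Omega> \<beta>2 \<le> ess_sup \<Omega> \<alpha>2 + ess_sup \<Omega> \<beta>2"
       "ess_sup \<Omega> \<alpha>2 + ess_sup \<Omega> \<beta>2 < ess_inf \<Omega> p2 - 1"
    and Acont: "continuous_on (closure \<Omega> \<times> {0..}) (\<lambda>(x, t). A x t)"
    and a0: "a0 > 0" and b0: "b0 > 0"
  shows
    "(ess_sup \<Omega> p2 - 1 < ess_inf \<Omega> \<eta>1 + ess_inf \<Omega> \<gamma>1 \<and>
      ess_sup \<Omega> p1 - 1 < ess_inf \<Omega> \<eta>2 + ess_inf \<Omega> \<gamma>2 \<and>
      (\<forall>x\<in>closure \<Omega>. \<forall>t\<in>{0..b0}. A x t \<ge> a0)
      \<longrightarrow> (\<forall>th>0. \<exists>lam0>0. \<forall>lam. 0 < lam \<and> lam < lam0 \<longrightarrow>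
            (\<exists>u v. pos_weak_solution \<Omega> A lam th p1 p2 r1 r2 q1 q2 s1 s2
                     \<alpha>1 \<alpha>2 \<beta>1 \<beta>2 \<gamma>1 \<gamma>2 \<eta>1 \<eta>2 u v)))
   \<and>
    (ess_sup \<Omega> p2 - 1 < ess_inf \<Omega> \<eta>1 + ess_inf \<Omega> \<gamma>1 \<and>
      ess_sup \<Omega> p1 - 1 < ess_inf \<Omega> \<eta>2 + ess_inf \<Omega> \<gamma>2 \<and>
      ess_sup \<Omega> \<beta>1 / (ess_inf \<Omega> p1 - 1) + ess_sup \<Omega> \<alpha>1 / (ess_inf \<Omega> p2 - 1) < 1 \<and>
      ess_sup \<Omega> \<beta>2 / (ess_inf \<Omega> p2 - 1) + ess_sup \<Omega> \<alpha>2 / (ess_inf \<Omega> p1 - 1) < 1 \<and>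
      (\<forall>x\<in>closure \<Omega>. \<forall>t>0. 0 < A x t \<and> A x t \<le> a0) \<and>
      uniform_limit (closure \<Omega>) (\<lambda>t x. A x t) (\<lambda>x. b0) at_top
      \<longrightarrow> (\<forall>lam>0. \<exists>th0>0. \<forall>th. 0 < th \<and> th < th0 \<longrightarrow>
            (\<exists>u v. pos_weak_solution \<Omega> A lam th p1 p2 r1 r2 q1 q2 s1 s2
                     \<alpha>1 \<alpha>2 \<beta>1 \<beta>2 \<gamma>1 \<gamma>2 \<eta>1 \<eta>2 u v)))"
proof -
 interpret bounded_open \<Omega> using dom by unfold_locales (auto simp: bounded_domain_def)
 have ne: "\<Omega> ~= {}" using dom by (simp add: bounded_domain_def)
 \<comment> \<open>A nonempty open set has positive measure, so two almost everywhere bounds of one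
   function are comparable.\<close>
 have nontriv: "c <= d" if "AE x in M. c <= f x" "AE x in M. f x <= d" for c d :: real and f
 proof -
  have "AE x in M. c <= d" using that by eventually_elim simp
  then have "ALL x:\<Omega>. - d <= - c" using AE_le_open[OF continuous_on_const, of "- d" "- c"] by simp
  then show ?thesis using ne by auto
 qed
 have le_sup: "0 <= ess_sup \<Omega> f" if "Linfty \<Omega> f" "AE x in M. 0 <= f x" for f
  by (rule nontriv[OF that(2) ess_sup_AE[OF that(1)]])
 have vx: "vexp f" if "Linfty \<Omega> f" "1 <= ess_inf \<Omega> f" for f
 proof -
  have "AE x in M. 1 <= f x & f x <= ess_sup \<Omega> f"
   using ess_inf_AE[OF that(1)] ess_sup_AE[OF that(1)] by eventually_elim (use that(2) in auto)
  then show ?thesis using that(1) by (auto simp: vexp_def Linfty_def)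
 qed
 have var: "var_exponent \<Omega> f (ess_inf \<Omega> f) (ess_sup \<Omega> f)" "x \<in> \<Omega> ==> (f has_derivative (%h. grad f x \<bullet> h)) (at x)" "continuous_on \<Omega> (grad f)"
  if f: "C1_closure \<Omega> f" "1 < ess_inf \<Omega> f" for f x
 proof -
  obtain Df where c: "continuous_on (closure \<Omega>) f" and D: "\<And>x. x \<in> \<Omega> ==> (f has_derivative blinfun_apply (Df x)) (at x)" "continuous_on (closure \<Omega>) Df"
   using f(1) unfolding C1_closure_def by blast
  have c\<Omega>: "continuous_on \<Omega> f" by (rule continuous_on_subset[OF c closure_subset])
  have "compact (closure \<Omega>)" using bounded_\<Omega> by (simp add: compact_closure)
  then have "bounded (f ` closure \<Omega>)" by (intro compact_imp_bounded compact_continuous_image c)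
  then obtain B where B: "\<And>x. x \<in> closure \<Omega> ==> \<bar>f x\<bar> <= B" unfolding bounded_iff by auto
  have Li: "Linfty \<Omega> f" unfolding Linfty_def
   by (intro conjI exI[of _ B] AE_I2 B continuous_imp_measurable_on_sets_lebesgue[OF c\<Omega>]) (auto intro: subsetD[OF closure_subset])
  show "var_exponent \<Omega> f (ess_inf \<Omega> f) (ess_sup \<Omega> f)"
  proof
   \<comment> \<open>Continuity upgrades the essential bounds to the pointwise ones that
     \<open>var_exponent\<close> demands.\<close>
   show "f x <= ess_sup \<Omega> f" if "x \<in> \<Omega>" for x by (rule AE_le_open[OF c\<Omega> ess_sup_AE[OF Li] that])
   have "- f x <= - ess_inf \<Omega> f" if "x \<in> \<Omega>" for x
    by (rule AE_le_open[OF continuous_on_minus[OF c\<Omega>] _ that]) (use ess_inf_AE[OF Li] in eventually_elim, simp)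
   then show "ess_inf \<Omega> f <= f x" if "x \<in> \<Omega>" for x using that by force
  qed (use c\<Omega> f in auto)
  show "x \<in> \<Omega> ==> (f has_derivative (%h. grad f x \<bullet> h)) (at x)" using D(1) by (intro has_derivative_grad) (auto intro: differentiableI)
  have "grad f x = (\<chi> i. blinfun_apply (Df x) (axis i 1))" if "x \<in> \<Omega>" for x
   unfolding grad_def using partial_deriv_eqI[OF D(1)[OF that]] by simp
  moreover have "continuous_on \<Omega> (%x. \<chi> i. blinfun_apply (Df x) (axis i 1))"
   by (intro continuous_on_vec_lambda continuous_intros continuous_on_subset[OF D(2) closure_subset])
  ultimately show "continuous_on \<Omega> (grad f)" by (simp cong: continuous_on_cong)
 qed
 define sel where "sel f g j = (if j then f else g)" for f g :: "real^'n => real" and j :: bool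
 have sel: "sel f g True = f" "sel f g False = g" for f g by (simp_all add: sel_def)
 define lo where "lo f g j = ess_inf \<Omega> (sel f g j)" for f g j
 define hi where "hi f g j = ess_sup \<Omega> (sel f g j)" for f g j
 note lh = lo_def hi_def sel
 interpret K: kirchhoff \<Omega> "sel p1 p2" "sel q1 q2" "sel r1 r2" "sel s1 s2" "sel \<alpha>1 \<alpha>2" "sel \<beta>1 \<beta>2" "sel \<gamma>1 \<gamma>2" "sel \<eta>1 \<eta>2"
  "%j. grad (sel p1 p2 j)" "lo p1 p2" "hi p1 p2" "hi \<alpha>1 \<alpha>2" "hi \<beta>1 \<beta>2" "%j. lo \<eta>1 \<eta>2 j + lo \<gamma>1 \<gamma>2 j" "%j. hi \<eta>1 \<eta>2 j + hi \<gamma>1 \<gamma>2 j" A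
 proof (intro kirchhoff.intro kirchhoff_axioms.intro)
  fix j and x :: "real^'n"
  have C1: "C1_closure \<Omega> (sel p1 p2 j)" "1 < ess_inf \<Omega> (sel p1 p2 j)" using p1C1 p2C1 p1b p2b by (cases j; simp add: sel)+
  show "var_exponent \<Omega> (sel p1 p2 j) (lo p1 p2 j) (hi p1 p2 j)" "continuous_on \<Omega> (grad (sel p1 p2 j))"
   unfolding lh by (rule var[OF C1])+
  show "(sel p1 p2 j has_derivative (%h. grad (sel p1 p2 j) x \<bullet> h)) (at x)" if "x \<in> \<Omega>" by (rule var(2)[OF C1 that])
  show "vexp (sel q1 q2 j)" "vexp (sel r1 r2 j)" "vexp (sel s1 s2 j)" using rqs rqs_ge1 by (cases j; simp add: sel vx)+
  have Li: "Linfty \<Omega> (sel \<alpha>1 \<alpha>2 j)" "Linfty \<Omega> (sel \<beta>1 \<beta>2 j)" "Linfty \<Omega> (sel \<gamma>1 \<gamma>2 j)" "Linfty \<Omega> (sel \<eta>1 \<eta>2 j)"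
   using agh bet by (cases j; simp add: sel)+
  show "sel \<alpha>1 \<alpha>2 j \<in> borel_measurable M" "sel \<beta>1 \<beta>2 j \<in> borel_measurable M" "sel \<gamma>1 \<gamma>2 j \<in> borel_measurable M" "sel \<eta>1 \<eta>2 j \<in> borel_measurable M"
   using Li by (simp_all add: Linfty_def)
  have nn: "AE x in M. 0 <= sel \<alpha>1 \<alpha>2 j x" "AE x in M. 0 <= sel \<beta>1 \<beta>2 j x" "AE x in M. 0 <= sel \<gamma>1 \<gamma>2 j x" "AE x in M. 0 <= sel \<eta>1 \<eta>2 j x"
   using agh_nn bet by (cases j; simp add: sel)+
  show "0 <= hi \<alpha>1 \<alpha>2 j" "0 <= hi \<beta>1 \<beta>2 j" unfolding lh using Li nn by (auto intro: le_sup)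
  show "AE x in M. 0 <= sel \<alpha>1 \<alpha>2 j x & sel \<alpha>1 \<alpha>2 j x <= hi \<alpha>1 \<alpha>2 j" "AE x in M. 0 <= sel \<beta>1 \<beta>2 j x & sel \<beta>1 \<beta>2 j x <= hi \<beta>1 \<beta>2 j"
   unfolding lh using ess_sup_AE[OF Li(1)] ess_sup_AE[OF Li(2)] nn by auto
  show "AE x in M. 0 <= sel \<gamma>1 \<gamma>2 j x & 0 <= sel \<eta>1 \<eta>2 j x & lo \<eta>1 \<eta>2 j + lo \<gamma>1 \<gamma>2 j <= sel \<eta>1 \<eta>2 j x + sel \<gamma>1 \<gamma>2 j x &
    sel \<eta>1 \<eta>2 j x + sel \<gamma>1 \<gamma>2 j x <= hi \<eta>1 \<eta>2 j + hi \<gamma>1 \<gamma>2 j"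
   using ess_sup_AE[OF Li(3)] ess_sup_AE[OF Li(4)] ess_inf_AE[OF Li(3)] ess_inf_AE[OF Li(4)] nn(3,4) unfolding lh by eventually_elim auto
  show "hi \<alpha>1 \<alpha>2 j + hi \<beta>1 \<beta>2 j < lo p1 p2 j - 1" using ab1 ab2 by (cases j; simp add: lh)
 qed (use ne Acont bounded_open_axioms in auto)
 \<comment> \<open>At \<open>False\<close> the family reads off the second equation with the
   unknowns exchanged, exactly as in \<open>pos_weak_solution\<close>.\<close>
 have sol: "EX u v. pos_weak_solution \<Omega> A lam th p1 p2 r1 r2 q1 q2 s1 s2 \<alpha>1 \<alpha>2 \<beta>1 \<beta>2 \<gamma>1 \<gamma>2 \<eta>1 \<eta>2 u v" if "K.is_solution lam th U" for lam th U
  using that[rule_format, of True] that[rule_format, of False] unfolding K.G_def[abs_def] sel pos_weak_solution_def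
  by (intro exI[of _ "U True"] exI[of _ "U False"]) auto
 show ?thesis
 proof (intro conjI impI allI; elim conjE)
  fix th :: real
  assume h: "ess_sup \<Omega> p2 - 1 < ess_inf \<Omega> \<eta>1 + ess_inf \<Omega> \<gamma>1" "ess_sup \<Omega> p1 - 1 < ess_inf \<Omega> \<eta>2 + ess_inf \<Omega> \<gamma>2"
   "ALL x:closure \<Omega>. ALL t:{0..b0}. a0 <= A x t" "0 < th"
  have "hi p1 p2 (~ j) - 1 < lo \<eta>1 \<eta>2 j + lo \<gamma>1 \<gamma>2 j" for j using h(1,2) by (cases j; simp add: lh)
  from K.small_lambda[OF a0 b0 h(4) this] obtain l0 where "0 < l0" "\<And>lam. 0 < lam ==> lam < l0 ==> EX U. K.is_solution lam th U"
   using h(3) by auto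
  then show "EX lam0>0. ALL lam. 0 < lam & lam < lam0 -->
    (EX u v. pos_weak_solution \<Omega> A lam th p1 p2 r1 r2 q1 q2 s1 s2 \<alpha>1 \<alpha>2 \<beta>1 \<beta>2 \<gamma>1 \<gamma>2 \<eta>1 \<eta>2 u v)" using sol by blast
 next
  fix lam :: real
  assume h: "ess_sup \<Omega> \<beta>1 / (ess_inf \<Omega> p1 - 1) + ess_sup \<Omega> \<alpha>1 / (ess_inf \<Omega> p2 - 1) < 1"
   "ess_sup \<Omega> \<beta>2 / (ess_inf \<Omega> p2 - 1) + ess_sup \<Omega> \<alpha>2 / (ess_inf \<Omega> p1 - 1) < 1"
   "ALL x:closure \<Omega>. ALL t>0. 0 < A x t & A x t <= a0" "uniform_limit (closure \<Omega>) (%t x. A x t) (%x. b0) at_top" "0 < lam"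
  have "hi \<beta>1 \<beta>2 j / (lo p1 p2 j - 1) + hi \<alpha>1 \<alpha>2 j / (lo p1 p2 (~ j) - 1) < 1" for j using h(1,2) by (cases j; simp add: lh)
  from K.small_theta[OF b0 h(5) this h(3)[rule_format] h(4)] obtain t0 where "0 < t0" "\<And>th. 0 < th ==> th < t0 ==> EX U. K.is_solution lam th U"
   by blast
  then show "EX th0>0. ALL th. 0 < th & th < th0 -->
    (EX u v. pos_weak_solution \<Omega> A lam th p1 p2 r1 r2 q1 q2 s1 s2 \<alpha>1 \<alpha>2 \<beta>1 \<beta>2 \<gamma>1 \<gamma>2 \<eta>1 \<eta>2 u v)" using sol by blast
 qed
qed

end
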